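(* Let $H=\prod_{i=1}^M SL(n_i)$ and let $X$ be a nondegenerate representation of $H$. Let $\mathbb{C}_a$ denote the 1-dimensional representation of $\mathbb{G}_m$ of weight $a$. Then the self-dual representation $$V:=(X\otimes\mathbb{C}_a)\oplus(X^\vee\otimes\mathbb{C}_{-a})$$ of $H\times\mathbb{G}_m$ is Weyl-generic.
   Context: All groups and representations are over $\mathbb{C}$ and representations are finite-dimensional. $X^\vee$ is the dual representation of $X$. $\chi(K)$ is the group of characters $K\to\mathbb{G}_m$ and $\chi(K)_{\mathbb Q}=\chi(K)\otimes\mathbb{Q}$. Nondegenerate: let $T_H\subseteq H$ be a maximal torus of a semisimple group $H$. For a positive-dimensional representation $X$ of $H$, the degeneracy $\mathrm{degen}(X)$ is the smallest integer $n$ such that there exist $T_H$-weights $\xi_1,\dots,\xi_{n+1}$ of $X$ and $a_i\in\mathbb{Q}_{\ge0}$ with $\sum a_i=1$ and $\sum a_i\xi_i=0$. It always satisfies $\mathrm{degen}(X)\le\mathrm{rank}(H)$; $X$ is nondegenerate if $\mathrm{degen}(X)=\mathrm{rank}(H)$. Weyl-generic: for a character $\theta$ and 1-parameter subgroup $\lambda$ of a torus $T$, $\langle\theta,\lambda\rangle$ is the integer $c$ with $\theta(\lambda(t))=t^c$, extended linearly to $\theta\in\chi(T)_{\mathbb Q}$. For a $T$-representation $V$ and $\theta\in\chi(T)_{\mathbb Q}$, $V^{ss}_\theta(T)$ is the set of $x\in V$ such that whenever $\lim_{t\to0}\lambda(t)x$ exists for a 1-parameter subgroup $\lambda$ of $T$,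 one has $\langle\theta,\lambda\rangle\ge0$. Put $\Sigma(V,T)=\{\theta\mid V^{ss}_\theta(T)\ne\emptyset\}$ and $\omega(V,T)=\{\theta\in\Sigma(V,T)\mid\text{some }x\in V^{ss}_\theta(T)\text{ has positive-dimensional stabilizer in }T\}$. If $G$ is a connected complex reductive group with maximal torus $T$ and Weyl group $W$, a representation $(V,G)$ is Weyl-generic if the set $\Sigma(V,T)^W$ of $W$-invariant elements of $\Sigma(V,T)$ is not contained in $\omega(V,T)$.
   Formalization: The weight a is assumed to be nonzero; for a = 0 the factor G_m acts trivially on V, every stabilizer is positive-dimensional, and V is never Weyl-generic, so the claim as written fails there. *)

theory Defs
  imports
    Complex_Main
    "HOL-Library.Extended_Nat"
    "HOL-Algebra.Group_Action"
    "HOL-Algebra.Product_Groups"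
    "Jordan_Normal_Form.Determinant"
begin

section \<open>Affine algebraic groups over the complex numbers\<close>

text \<open>
  An affine algebraic group is given by its group of complex points together with its algebra of
  regular functions. Only the values of regular functions on the carrier matter, so a closed
  subgroup \<open>K\<close> of \<open>G\<close> is the record \<open>G\<lparr>carrier := K\<rparr>\<close>, with the regular functions of \<open>G\<close>
  (implicitly restricted to \<open>K\<close>).
\<close>

record 'a alg_group = "'a monoid" +
  regular :: "('a \<Rightarrow> complex) set"

inductive_set generated_algebra :: "('a \<Rightarrow> complex) set \<Rightarrow> ('a \<Rightarrow> complex) set"
  for S :: "('a \<Rightarrow> complex) set" where
  gen: "f \<in> S \<Longrightarrow> f \<in> generated_algebra S"
| const: "(\<lambda>_. c) \<in> generated_algebra S"
| add: "f \<in> generated_algebra S \<Longrightarrow> g \<in> generated_algebra S \<Longrightarrow> (\<lambda>x. f x + g x) \<in> generated_algebra S"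
| mult: "f \<in> generated_algebra S \<Longrightarrow> g \<in> generated_algebra S \<Longrightarrow> (\<lambda>x. f x * g x) \<in> generated_algebra S"

definition Gm :: "complex alg_group" where
  "Gm = \<lparr>carrier = - {0}, monoid.mult = (*), one = 1,
         regular = generated_algebra {\<lambda>z. z, inverse}\<rparr>"

definition GL :: "nat \<Rightarrow> complex mat alg_group" where
  "GL n = \<lparr>carrier = {A \<in> carrier_mat n n. det A \<noteq> 0}, monoid.mult = (*), one = 1\<^sub>m n,
           regular = generated_algebra
             (insert (\<lambda>A. inverse (det A)) {\<lambda>A. A $$ (i, j) | i j. i < n \<and> j < n})\<rparr>"

definition SL :: "nat \<Rightarrow> complex mat alg_group" where
  "SL n = \<lparr>carrier = {A \<in> carrier_mat n n. det A = 1}, monoid.mult = (*), one = 1\<^sub>m n,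
           regular = generated_algebra {\<lambda>A. A $$ (i, j) | i j. i < n \<and> j < n}\<rparr>"

definition alg_prod :: "'i set \<Rightarrow> ('i \<Rightarrow> 'a alg_group) \<Rightarrow> ('i \<Rightarrow> 'a) alg_group" where
  "alg_prod I G = monoid.extend (product_group I G)
     \<lparr>regular = generated_algebra {\<lambda>x. \<phi> (x i) | i \<phi>. i \<in> I \<and> \<phi> \<in> regular (G i)}\<rparr>"

definition alg_dirprod :: "'a alg_group \<Rightarrow> 'b alg_group \<Rightarrow> ('a \<times> 'b) alg_group" where
  "alg_dirprod G H = monoid.extend (G \<times>\<times> H)
     \<lparr>regular = generated_algebra ({\<lambda>x. \<phi> (fst x) | \<phi>. \<phi> \<in> regular G} \<union>
                                   {\<lambda>x. \<psi> (snd x) | \<psi>. \<psi> \<in> regular H})\<rparr>"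

definition alg_hom :: "'a alg_group \<Rightarrow> 'b alg_group \<Rightarrow> ('a \<Rightarrow> 'b) set" where
  "alg_hom G H = {f \<in> hom G H.
     \<forall>\<phi>\<in>regular H. \<exists>\<psi>\<in>regular G. \<forall>x\<in>carrier G. \<psi> x = \<phi> (f x)}"

definition alg_iso :: "'a alg_group \<Rightarrow> 'b alg_group \<Rightarrow> bool" where
  "alg_iso G H \<longleftrightarrow> (\<exists>f\<in>alg_hom G H. \<exists>g\<in>alg_hom H G.
     (\<forall>x\<in>carrier G. g (f x) = x) \<and> (\<forall>y\<in>carrier H. f (g y) = y))"


section \<open>Zariski topology and dimension\<close>

definition zariski_closed :: "'a alg_group \<Rightarrow> 'a set \<Rightarrow> bool" where
  "zariski_closed G Z \<longleftrightarrow> (\<exists>S\<subseteq>regular G. Z = {x \<in> carrier G. \<forall>\<phi>\<in>S. \<phi> x = 0})"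

definition irreducible_closed :: "'a alg_group \<Rightarrow> 'a set \<Rightarrow> bool" where
  "irreducible_closed G Z \<longleftrightarrow> zariski_closed G Z \<and> Z \<noteq> {} \<and>
     (\<forall>Z1 Z2. zariski_closed G Z1 \<and> zariski_closed G Z2 \<and> Z \<subseteq> Z1 \<union> Z2 \<longrightarrow> Z \<subseteq> Z1 \<or> Z \<subseteq> Z2)"

text \<open>Krull dimension of a closed subset \<open>Z\<close> of \<open>G\<close>.\<close>

definition alg_dim :: "'a alg_group \<Rightarrow> 'a set \<Rightarrow> enat" where
  "alg_dim G Z = Sup {enat m | m. \<exists>C :: nat \<Rightarrow> 'a set.
     (\<forall>i\<le>m. irreducible_closed G (C i) \<and> C i \<subseteq> Z) \<and> (\<forall>i<m. C i \<subset> C (Suc i))}"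


section \<open>Maximal tori\<close>

definition split_torus :: "nat \<Rightarrow> (nat \<Rightarrow> complex) alg_group" where
  "split_torus r = alg_prod {..<r} (\<lambda>_. Gm)"

definition torus :: "'a alg_group \<Rightarrow> bool" where
  "torus K \<longleftrightarrow> (\<exists>r. alg_iso (split_torus r) K)"

definition torus_rank :: "'a alg_group \<Rightarrow> nat" where
  "torus_rank K = (THE r. alg_iso (split_torus r) K)"

definition subtorus :: "'a alg_group \<Rightarrow> 'a set \<Rightarrow> bool" where
  "subtorus G T \<longleftrightarrow> subgroup T G \<and> zariski_closed G T \<and> torus (G\<lparr>carrier := T\<rparr>)"

definition maximal_torus :: "'a alg_group \<Rightarrow> 'a set \<Rightarrow> bool" where
  "maximal_torus G T \<longleftrightarrow> subtorus G T \<and> (\<forall>T'. subtorus G T' \<and> T \<subseteq> T' \<longrightarrow> T' = T)"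


section \<open>Rational representations\<close>

definition rational_rep :: "'a alg_group \<Rightarrow> nat \<Rightarrow> ('a \<Rightarrow> complex mat) \<Rightarrow> bool" where
  "rational_rep G d \<rho> \<longleftrightarrow> \<rho> \<in> alg_hom G (GL d)"

definition dual_rep :: "'a alg_group \<Rightarrow> ('a \<Rightarrow> complex mat) \<Rightarrow> 'a \<Rightarrow> complex mat" where
  "dual_rep G \<rho> = (\<lambda>g. transpose_mat (\<rho> (inv\<^bsub>G\<^esub> g)))"

definition sum_rep ::
  "nat \<Rightarrow> ('a \<Rightarrow> complex mat) \<Rightarrow> nat \<Rightarrow> ('a \<Rightarrow> complex mat) \<Rightarrow> 'a \<Rightarrow> complex mat" where
  "sum_rep d \<rho> e \<sigma> = (\<lambda>g. four_block_mat (\<rho> g) (0\<^sub>m d e) (0\<^sub>m e d) (\<sigma> g))"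

text \<open>
  For a representation \<open>\<rho>\<close> of \<open>H\<close>, the external tensor product with the one-dimensional
  representation of weight \<open>a\<close> of the multiplicative group, as a representation of the product of
  \<open>H\<close> and the multiplicative group.
\<close>

definition tensor_weight :: "('a \<Rightarrow> complex mat) \<Rightarrow> int \<Rightarrow> 'a \<times> complex \<Rightarrow> complex mat" where
  "tensor_weight \<rho> a = (\<lambda>(h, t). (t powi a) \<cdot>\<^sub>m \<rho> h)"

definition rep_iso :: "'a alg_group \<Rightarrow> nat \<Rightarrow> ('a \<Rightarrow> complex mat) \<Rightarrow> ('a \<Rightarrow> complex mat) \<Rightarrow> bool" where
  "rep_iso G d \<rho> \<sigma> \<longleftrightarrow> (\<exists>P\<in>carrier (GL d). \<forall>g\<in>carrier G. P * \<rho> g = \<sigma> g * P)"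

definition self_dual_rep :: "'a alg_group \<Rightarrow> nat \<Rightarrow> ('a \<Rightarrow> complex mat) \<Rightarrow> bool" where
  "self_dual_rep G d \<rho> \<longleftrightarrow> rational_rep G d \<rho> \<and> rep_iso G d \<rho> (dual_rep G \<rho>)"


section \<open>Characters and rational characters\<close>

text \<open>Characters are made extensional so that equal characters are equal as functions.\<close>

definition char_group :: "'a alg_group \<Rightarrow> ('a \<Rightarrow> complex) monoid" where
  "char_group K = \<lparr>carrier = alg_hom K Gm \<inter> extensional (carrier K),
                   monoid.mult = (\<lambda>\<chi> \<psi>. \<lambda>x\<in>carrier K. \<chi> x * \<psi> x),
                   one = (\<lambda>x\<in>carrier K. 1)\<rparr>"

text \<open>
  The tensor product of a (multiplicatively written) abelian group \<open>A\<close> with the rationals,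
  constructed as the localization of \<open>A\<close> at the positive integers: the class of \<open>(x, m)\<close> is
  \<open>x \<otimes> 1/m\<close>. The ring multiplication required by the module record has no meaning here.
\<close>

definition rat_rel :: "'a monoid \<Rightarrow> (('a \<times> nat) \<times> ('a \<times> nat)) set" where
  "rat_rel A = {((x, m), (y, n)). x \<in> carrier A \<and> y \<in> carrier A \<and> 0 < m \<and> 0 < n \<and>
     (\<exists>k::nat. 0 < k \<and> x [^]\<^bsub>A\<^esub> (k * n) = y [^]\<^bsub>A\<^esub> (k * m))}"

definition tensor_rat :: "'a monoid \<Rightarrow> (rat, ('a \<times> nat) set) module" where
  "tensor_rat A =
    \<lparr>carrier = (carrier A \<times> {0<..}) // rat_rel A,
     monoid.mult = undefined, one = undefined,
     zero = rat_rel A `` {(\<one>\<^bsub>A\<^esub>, 1)},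
     add = (\<lambda>X Y. \<Union>(x, m)\<in>X. \<Union>(y, n)\<in>Y.
              rat_rel A `` {(x [^]\<^bsub>A\<^esub> n \<otimes>\<^bsub>A\<^esub> y [^]\<^bsub>A\<^esub> m, m * n)}),
     module.smult = (\<lambda>q X. \<Union>(x, m)\<in>X.
              rat_rel A `` {(x [^]\<^bsub>A\<^esub> fst (quotient_of q), m * nat (snd (quotient_of q)))})\<rparr>"

definition rat_embed :: "'a monoid \<Rightarrow> 'a \<Rightarrow> ('a \<times> nat) set" where
  "rat_embed A x = rat_rel A `` {(x, 1)}"

type_synonym 'a rat_char = "(('a \<Rightarrow> complex) \<times> nat) set"

definition rat_chars :: "'a alg_group \<Rightarrow> (rat, 'a rat_char) module" where
  "rat_chars K = tensor_rat (char_group K)"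

definition char_pairing :: "('a \<Rightarrow> complex) \<Rightarrow> (complex \<Rightarrow> 'a) \<Rightarrow> int" where
  "char_pairing \<chi> \<gamma> = (THE c. \<forall>t. t \<noteq> 0 \<longrightarrow> \<chi> (\<gamma> t) = t powi c)"

definition rat_pairing :: "'a rat_char \<Rightarrow> (complex \<Rightarrow> 'a) \<Rightarrow> rat" where
  "rat_pairing \<theta> \<gamma> = (THE q. \<forall>(\<chi>, m)\<in>\<theta>. q = of_int (char_pairing \<chi> \<gamma>) / of_nat m)"


section \<open>Degeneracy\<close>

definition weights :: "'a alg_group \<Rightarrow> nat \<Rightarrow> ('a \<Rightarrow> complex mat) \<Rightarrow> ('a \<Rightarrow> complex) set" where
  "weights K d \<rho> = {\<xi> \<in> carrier (char_group K).
     \<exists>v\<in>carrier_vec d. v \<noteq> 0\<^sub>v d \<and> (\<forall>t\<in>carrier K. \<rho> t *\<^sub>v v = \<xi> t \<cdot>\<^sub>v v)}"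

definition degen :: "'a alg_group \<Rightarrow> nat \<Rightarrow> ('a \<Rightarrow> complex mat) \<Rightarrow> nat" where
  "degen K d \<rho> = (LEAST n. \<exists>(\<xi> :: nat \<Rightarrow> 'a \<Rightarrow> complex) (a :: nat \<Rightarrow> rat).
     (\<forall>i\<in>{1..n+1}. \<xi> i \<in> weights K d \<rho> \<and> 0 \<le> a i) \<and> (\<Sum>i\<in>{1..n+1}. a i) = 1 \<and>
     (\<Oplus>\<^bsub>rat_chars K\<^esub>i\<in>{1..n+1}. a i \<odot>\<^bsub>rat_chars K\<^esub> rat_embed (char_group K) (\<xi> i))
       = \<zero>\<^bsub>rat_chars K\<^esub>)"

text \<open>Here \<open>T\<close> is a maximal torus of \<open>H\<close>, so that the rank of \<open>H\<close> is that of \<open>T\<close>.\<close>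

definition nondegenerate :: "'a alg_group \<Rightarrow> 'a set \<Rightarrow> nat \<Rightarrow> ('a \<Rightarrow> complex mat) \<Rightarrow> bool" where
  "nondegenerate H T d \<rho> \<longleftrightarrow>
     0 < d \<and> degen (H\<lparr>carrier := T\<rparr>) d \<rho> = torus_rank (H\<lparr>carrier := T\<rparr>)"


section \<open>Weyl-generic representations\<close>

text \<open>Limits in the representation space are taken coordinatewise in the classical topology.\<close>

definition semistable ::
  "'a alg_group \<Rightarrow> nat \<Rightarrow> ('a \<Rightarrow> complex mat) \<Rightarrow> 'a rat_char \<Rightarrow> complex vec set" where
  "semistable K d \<rho> \<theta> = {x \<in> carrier_vec d. \<forall>\<gamma>\<in>alg_hom Gm K.
     (\<exists>l. \<forall>i<d. ((\<lambda>t. (\<rho> (\<gamma> t) *\<^sub>v x) $ i) \<longlongrightarrow> l i) (at 0)) \<longrightarrow> 0 \<le> rat_pairing \<theta> \<gamma>}"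

definition semistable_chars :: "'a alg_group \<Rightarrow> nat \<Rightarrow> ('a \<Rightarrow> complex mat) \<Rightarrow> 'a rat_char set" where
  "semistable_chars K d \<rho> = {\<theta> \<in> carrier (rat_chars K). semistable K d \<rho> \<theta> \<noteq> {}}"

definition rep_stabilizer :: "'a alg_group \<Rightarrow> ('a \<Rightarrow> complex mat) \<Rightarrow> complex vec \<Rightarrow> 'a set" where
  "rep_stabilizer K \<rho> x = {t \<in> carrier K. \<rho> t *\<^sub>v x = x}"

definition nongeneric_chars :: "'a alg_group \<Rightarrow> nat \<Rightarrow> ('a \<Rightarrow> complex mat) \<Rightarrow> 'a rat_char set" where
  "nongeneric_chars K d \<rho> = {\<theta> \<in> semistable_chars K d \<rho>.
     \<exists>x\<in>semistable K d \<rho> \<theta>. 0 < alg_dim K (rep_stabilizer K \<rho> x)}"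

text \<open>
  The Weyl group of \<open>(G, T)\<close> is the quotient of the normalizer of \<open>T\<close> by its centralizer and acts
  on characters of \<open>T\<close> by conjugation, so invariance under it is invariance under the normalizer.
\<close>

definition conj_char :: "'a alg_group \<Rightarrow> 'a set \<Rightarrow> 'a \<Rightarrow> ('a \<Rightarrow> complex) \<Rightarrow> 'a \<Rightarrow> complex" where
  "conj_char G T g \<chi> = (\<lambda>t\<in>T. \<chi> (inv\<^bsub>G\<^esub> g \<otimes>\<^bsub>G\<^esub> t \<otimes>\<^bsub>G\<^esub> g))"

definition weyl_invariant :: "'a alg_group \<Rightarrow> 'a set \<Rightarrow> 'a rat_char \<Rightarrow> bool" where
  "weyl_invariant G T \<theta> \<longleftrightarrow>
     (\<forall>g\<in>normalizer G T. (\<lambda>(\<chi>, m). (conj_char G T g \<chi>, m)) ` \<theta> = \<theta>)"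

definition weyl_generic :: "'a alg_group \<Rightarrow> 'a set \<Rightarrow> nat \<Rightarrow> ('a \<Rightarrow> complex mat) \<Rightarrow> bool" where
  "weyl_generic G T d \<rho> \<longleftrightarrow>
     \<not> {\<theta> \<in> semistable_chars (G\<lparr>carrier := T\<rparr>) d \<rho>. weyl_invariant G T \<theta>}
         \<subseteq> nongeneric_chars (G\<lparr>carrier := T\<rparr>) d \<rho>"

end

theory Submission
  imports Defs
begin

text \<open>
  The invariant character \<open>(h, z) \<mapsto> z ^ a\<close> of the torus witnesses that \<open>V\<close> is Weyl-generic. A vector
  whose components in all weight spaces of \<open>X\<close> are nonzero is semistable for it, because averaging over
  the Weyl group turns the inequalities for all weights into the inequality for the mean weight \<open>0\<close>.
  If conversely \<open>x\<close> is semistable, linear duality shows that this character is a rational combination of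
  the weights occurring in \<open>x\<close>; hence \<open>0\<close> is a combination of \<^emph>\<open>signed\<close> total weight one of the
  corresponding weights of \<open>X\<close>. If \<open>x\<close> had an infinite stabilizer, these weights would moreover lie in a
  hyperplane. The combinatorial core excludes this for nondegenerate \<open>X\<close>. A probability measure on weights
  in the hyperplane \<open>u = 0\<close> whose mean is constant on the level sets of \<open>u\<close> becomes, after averaging
  over the stabilizer of \<open>u\<close>, a convex combination with value \<open>0\<close> in a space of too small dimension, which
  contradicts nondegeneracy by Caratheodory's theorem. Suitable \<open>u\<close> force the components of the weights at a factor with
  \<open>n i \<ge> 3\<close> to be coordinate vectors up to a uniform sign, the \<open>n i\<close> to be pairwise coprime, and at most two
  of them to be \<open>\<ge> 3\<close>. The remaining cases are settled by a parity argument.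
\<close>

section \<open>Linear systems\<close>

text \<open>The weights of the dual summand are the negatives of those of \<open>X\<close>, so a
  character in the cone of the weights occurring in a vector of \<open>V\<close> is only a signed
  combination of weights of \<open>X\<close>. Nondegeneracy speaks of nonnegative coefficients and
  cannot be applied to the weights of one given vector. It is therefore turned into structure of the
  set of all weights of \<open>X\<close>, and this structure is rigid enough to bear negative
  coefficients. Besides being nonempty, that set enters only through its stability under the Weyl
  group and under one step down a root string; both are proved on matrices by following polynomial
  orbits. Factors \<open>SL(2)\<close> stand apart: their components can be far from unit vectors,
  and only the oddness of the difference of the two entries is forced, so counting has to be done
  modulo twice a number. The weight \<open>a\<close> must be nonzero, since division by it is what
  gives the signed combination total weight one. The maximal torus on which degeneracy is measured
  and the one on which genericity is tested are unrelated; each is conjugated to diagonal matrices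
  by an element of its own.\<close>

lemma homogeneous_system_nontrivial:
  fixes f :: "'l \<Rightarrow> 'a \<Rightarrow> 'k::field"
  assumes "finite L" "finite S" "card L < card S"
  shows "\<exists>c. (\<exists>x\<in>S. c x \<noteq> 0) \<and> (\<forall>l\<in>L. (\<Sum>x\<in>S. c x * f l x) = 0)"
  using assms
proof (induction L arbitrary: S f rule: finite_induct)
  case empty
  then obtain x where "x \<in> S" by (metis card.empty less_numeral_extra(3) ex_in_conv)
  then show ?case by (intro exI[of _ "\<lambda>_. 1"]) auto
next
  case (insert l L)
  show ?case
  proof (cases "\<forall>x\<in>S. f l x = 0")
    case True
    from insert.IH[of S f] insert.prems insert.hyps
    obtain c where "\<exists>x\<in>S. c x \<noteq> 0" "\<forall>l\<in>L. (\<Sum>x\<in>S. c x * f l x) = 0" by auto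
    then show ?thesis using True by (intro exI[of _ c]) auto
  next
    case False
    then obtain x0 where x0: "x0 \<in> S" "f l x0 \<noteq> 0" by auto
    \<comment> \<open>Gaussian elimination: the equation \<open>l\<close> is used to remove the
      unknown \<open>x0\<close> from the others, and \<open>c'\<close> recovers its value
      afterwards.\<close>
    define f' where "f' = (\<lambda>m x. f m x - f m x0 * f l x / f l x0)"
    have "card L < card (S - {x0})" using insert x0 by auto
    from insert.IH[OF _ this, of f'] insert.prems
    obtain c where c: "\<exists>x\<in>S - {x0}. c x \<noteq> 0" "\<forall>m\<in>L. (\<Sum>x\<in>S-{x0}. c x * f' m x) = 0" by auto
    define c' where "c' = c(x0 := - (\<Sum>x\<in>S-{x0}. c x * f l x) / f l x0)"
    have split: "(\<Sum>x\<in>S. c' x * f m x) = c' x0 * f m x0 + (\<Sum>x\<in>S-{x0}. c x * f m x)" for m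
      using x0 insert.prems by (simp add: sum.remove[of S x0] c'_def)
    have "(\<Sum>x\<in>S. c' x * f l x) = 0" unfolding split by (simp add: c'_def x0)
    moreover have "(\<Sum>x\<in>S. c' x * f m x) = 0" if "m \<in> L" for m
    proof -
      have "0 = (\<Sum>x\<in>S-{x0}. c x * f' m x)" using c that by simp
      also have "\<dots> = (\<Sum>x\<in>S-{x0}. c x * f m x) - (\<Sum>x\<in>S-{x0}. c x * f l x) * (f m x0 / f l x0)"
        unfolding sum_distrib_right sum_subtractf[symmetric] f'_def
        by (intro sum.cong) (auto simp: algebra_simps)
      finally show ?thesis unfolding split by (simp add: c'_def field_simps)
    qed
    moreover have "\<exists>x\<in>S. c' x \<noteq> 0" using c(1) by (auto simp: c'_def)
    ultimately show ?thesis by (intro exI[of _ c']) auto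
  qed
qed

text \<open>The Fredholm alternative, obtained by adding one vector \<open>v x\<close> at a time. It
  serves twice in the study of a stabilizer: the second alternative is excluded once by
  semistability and once by rigidity.\<close>

lemma solvable_or_separating_functional:
  fixes v :: "'a \<Rightarrow> 'e \<Rightarrow> 'k::field"
  assumes "finite S" "finite B"
  shows "(\<exists>c. \<forall>e\<in>B. (\<Sum>x\<in>S. c x * v x e) = b e) \<or>
    (\<exists>l. (\<forall>x\<in>S. (\<Sum>e\<in>B. l e * v x e) = 0) \<and> (\<Sum>e\<in>B. l e * b e) \<noteq> 0)"
  using assms(1)
proof (induction S arbitrary: b rule: finite_induct)
  case empty
  show ?case
  proof (cases "\<forall>e\<in>B. b e = 0")
    case False
    then obtain e where e: "e \<in> B" "b e \<noteq> 0" by auto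
    then have "(\<Sum>e'\<in>B. (if e' = e then 1 else 0) * b e') \<noteq> 0"
      using assms(2) by (simp add: if_distrib[of "\<lambda>x. x * _"] cong: if_cong)
    then show ?thesis by auto
  qed auto
next
  case (insert x S)
  have ext: "\<exists>c. \<forall>e\<in>B. (\<Sum>x\<in>insert x S. c x * v x e) = b e"
    if "\<forall>e\<in>B. (\<Sum>x\<in>S. c x * v x e) = b e - t * v x e" for c t
  proof (intro exI[of _ "c(x := t)"] ballI)
    fix e assume "e \<in> B"
    have "(\<Sum>y\<in>S. (c(x := t)) y * v y e) = (\<Sum>y\<in>S. c y * v y e)"
      using insert.hyps by (intro sum.cong) auto
    then show "(\<Sum>y\<in>insert x S. (c(x := t)) y * v y e) = b e"
      using that \<open>e \<in> B\<close> insert.hyps by simp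
  qed
  show ?case
  proof (cases "\<exists>c. \<forall>e\<in>B. (\<Sum>x\<in>S. c x * v x e) = b e")
    case True
    then show ?thesis using ext[of _ 0] by auto
  next
    case False
    then obtain l where l: "\<forall>x\<in>S. (\<Sum>e\<in>B. l e * v x e) = 0" "(\<Sum>e\<in>B. l e * b e) \<noteq> 0"
      using insert.IH by blast
    show ?thesis
    proof (cases "(\<Sum>e\<in>B. l e * v x e) = 0")
      case True
      then show ?thesis using l by auto
    next
      case nz: False
      \<comment> \<open>With this \<open>t\<close> the functional \<open>l\<close> vanishes on
        \<open>b - t * v x\<close>. If that vector is not in the span of \<open>S\<close> either,
        its separating functional \<open>m\<close> can be corrected by a multiple of
        \<open>l\<close>: this changes its values neither on \<open>S\<close> nor on
        \<open>b - t * v x\<close>, and makes it vanish on \<open>v x\<close>.\<close>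
      define t where "t = (\<Sum>e\<in>B. l e * b e) / (\<Sum>e\<in>B. l e * v x e)"
      consider c where "\<forall>e\<in>B. (\<Sum>x\<in>S. c x * v x e) = b e - t * v x e"
        | m where "\<forall>x\<in>S. (\<Sum>e\<in>B. m e * v x e) = 0" "(\<Sum>e\<in>B. m e * (b e - t * v x e)) \<noteq> 0"
        using insert.IH[of "\<lambda>e. b e - t * v x e"] by blast
      then show ?thesis
      proof cases
        case 1
        then show ?thesis using ext by blast
      next
        case 2
        define s where "s = (\<Sum>e\<in>B. m e * v x e) / (\<Sum>e\<in>B. l e * v x e)"
        define m' where "m' = (\<lambda>e. m e - s * l e)"
        have lin: "(\<Sum>e\<in>B. m' e * w e) = (\<Sum>e\<in>B. m e * w e) - s * (\<Sum>e\<in>B. l e * w e)" for w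
          unfolding m'_def sum_distrib_left sum_subtractf[symmetric]
          by (intro sum.cong) (auto simp: algebra_simps)
        have "(\<Sum>e\<in>B. m e * (b e - t * v x e)) = (\<Sum>e\<in>B. m e * b e) - t * (\<Sum>e\<in>B. m e * v x e)"
          unfolding sum_distrib_left sum_subtractf[symmetric]
          by (intro sum.cong) (auto simp: algebra_simps)
        then have "(\<Sum>e\<in>B. m e * b e) - t * (\<Sum>e\<in>B. m e * v x e) \<noteq> 0"
          using 2(2) by simp
        moreover have "t * (\<Sum>e\<in>B. m e * v x e) = s * (\<Sum>e\<in>B. l e * b e)"
          by (simp add: t_def s_def)
        ultimately have "(\<Sum>e\<in>B. m' e * b e) \<noteq> 0" unfolding lin by simp
        moreover have "\<forall>y\<in>insert x S. (\<Sum>e\<in>B. m' e * v y e) = 0"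
          using 2(1) l(1) nz unfolding lin s_def by auto
        ultimately show ?thesis by blast
      qed
    qed
  qed
qed

text \<open>As long as more than \<open>Suc (card L)\<close> points carry weight, they are affinely
  dependent, and a multiple of the dependence can be subtracted until a coefficient becomes zero.
  This is Caratheodory's theorem for points with coordinates \<open>f l x\<close>.\<close>

lemma caratheodory_system:
  fixes f :: "'l \<Rightarrow> 'a \<Rightarrow> 'k::linordered_field"
  assumes "finite L" "finite S" "\<forall>x\<in>S. 0 \<le> c x" "sum c S = 1"
    "\<forall>l\<in>L. (\<Sum>x\<in>S. c x * f l x) = 0"
  shows "\<exists>S' c'. S' \<subseteq> S \<and> card S' \<le> Suc (card L) \<and> (\<forall>x\<in>S'. 0 \<le> c' x) \<and> sum c' S' = 1 \<and>
    (\<forall>l\<in>L. (\<Sum>x\<in>S'. c' x * f l x) = 0)"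
  using assms(2-)
proof (induction "card S" arbitrary: S c rule: less_induct)
  case less
  show ?case
  proof (cases "card S \<le> Suc (card L)")
    case True
    then show ?thesis using less.prems by blast
  next
    case False
    \<comment> \<open>The additional index \<open>None\<close> stands for the equation that the
      dependence has total weight zero.\<close>
    define g where "g = (\<lambda>l x. case l of None \<Rightarrow> 1 | Some l \<Rightarrow> f l x)"
    have "card (insert None (Some ` L)) < card S"
      using False assms(1) by (simp add: card_image)
    from homogeneous_system_nontrivial[OF _ less.prems(1) this, of g] assms(1)
    obtain d where d: "\<exists>x\<in>S. d x \<noteq> 0" "(\<Sum>x\<in>S. d x) = 0" "\<forall>l\<in>L. (\<Sum>x\<in>S. d x * f l x) = 0"
      by (auto simp: g_def)
    define Q where "Q = {x\<in>S. 0 < d x}"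
    have "Q \<noteq> {}"
    proof
      assume "Q = {}"
      then have "\<forall>x\<in>S. 0 \<le> - d x" by (force simp: Q_def)
      then have "\<forall>x\<in>S. - d x = 0"
        using d(2) less.prems(1) by (subst sum_nonneg_eq_0_iff[symmetric]) (auto simp: sum_negf)
      then show False using d(1) by auto
    qed
    have finQ: "finite Q" using less.prems by (auto simp: Q_def)
    \<comment> \<open>The largest multiple of \<open>d\<close> that leaves all coefficients
      nonnegative; a point where the minimum is attained drops out.\<close>
    define t where "t = Min ((\<lambda>x. c x / d x) ` Q)"
    have "t \<in> (\<lambda>x. c x / d x) ` Q" unfolding t_def using finQ \<open>Q \<noteq> {}\<close> by (intro Min_in) auto
    then obtain x0 where x0: "x0 \<in> S" "0 < d x0" "t = c x0 / d x0" by (auto simp: Q_def)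
    have tmin: "t \<le> c x / d x" if "x \<in> Q" for x unfolding t_def using finQ that by auto
    have t0: "0 \<le> t" using x0 less.prems by auto
    define c' where "c' = (\<lambda>x. c x - t * d x)"
    have c'0: "0 \<le> c' x" if "x \<in> S" for x
    proof (cases "0 < d x")
      case True
      then show ?thesis using tmin[of x] that by (auto simp: Q_def c'_def field_simps)
    next
      case False
      then have "t * d x \<le> 0" using t0 by (simp add: mult_nonneg_nonpos)
      then show ?thesis using less.prems(2) that by (auto simp: c'_def intro: order.trans)
    qed
    have z: "c' x0 = 0" using x0 by (simp add: c'_def)
    have rem: "(\<Sum>x\<in>S - {x0}. c' x * w x) = (\<Sum>x\<in>S. c x * w x) - t * (\<Sum>x\<in>S. d x * w x)" for w
    proof -
      have "(\<Sum>x\<in>S - {x0}. c' x * w x) = (\<Sum>x\<in>S. c' x * w x)"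
        using x0 less.prems(1) z by (simp add: sum.remove[of S x0])
      also have "\<dots> = (\<Sum>x\<in>S. c x * w x) - t * (\<Sum>x\<in>S. d x * w x)"
        unfolding sum_distrib_left sum_subtractf[symmetric] c'_def
        by (intro sum.cong) (auto simp: algebra_simps)
      finally show ?thesis .
    qed
    have "card (S - {x0}) < card S" using x0 less.prems(1) by (meson card_Diff1_less)
    moreover have "sum c' (S - {x0}) = 1" using rem[of "\<lambda>_. 1"] d less.prems by simp
    moreover have "\<forall>l\<in>L. (\<Sum>x\<in>S - {x0}. c' x * f l x) = 0" using rem d less.prems by simp
    ultimately have "\<exists>S' c'. S' \<subseteq> S - {x0} \<and> card S' \<le> Suc (card L) \<and> (\<forall>x\<in>S'. 0 \<le> c' x) \<and> sum c' S' = 1 \<and>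
        (\<forall>l\<in>L. (\<Sum>x\<in>S'. c' x * f l x) = 0)"
      using less.hyps[of "S - {x0}" c'] less.prems(1) c'0 by auto
    then show ?thesis by blast
  qed
qed

section \<open>Configurations of weights\<close>

text \<open>
  The entry \<open>x i j\<close> is the exponent of the \<open>j\<close>-th diagonal entry of the \<open>i\<close>-th factor. A weight determines
  it only up to the addition of a constant for each \<open>i\<close>, since diagonal matrices have determinant one.
\<close>

locale weight_configuration =
  fixes A :: "'i set" and n :: "'i \<Rightarrow> nat" and \<Phi> :: "('i \<Rightarrow> nat \<Rightarrow> int) set"
  assumes finite_A: "finite A"
    and n_pos: "i \<in> A \<Longrightarrow> 1 \<le> n i"
    and nonempty: "\<Phi> \<noteq> {}"
    and shift: "x \<in> \<Phi> \<Longrightarrow> \<forall>i\<in>A. \<exists>c. \<forall>j<n i. y i j = x i j + c \<Longrightarrow> y \<in> \<Phi>"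
    and transposition: "x \<in> \<Phi> \<Longrightarrow> i \<in> A \<Longrightarrow> j < n i \<Longrightarrow> k < n i \<Longrightarrow> x(i := x i \<circ> transpose j k) \<in> \<Phi>"
    and move: "x \<in> \<Phi> \<Longrightarrow> i \<in> A \<Longrightarrow> j < n i \<Longrightarrow> k < n i \<Longrightarrow> x i k < x i j \<Longrightarrow>
      x(i := (x i)(j := x i j - 1, k := x i k + 1)) \<in> \<Phi>"
begin

lemma permute1:
  assumes "p permutes {..<n i}" "i \<in> A" "x \<in> \<Phi>"
  shows "x(i := x i \<circ> p) \<in> \<Phi>"
  using assms(1) finite_lessThan assms(3)
proof (induction p arbitrary: x rule: permutes_induct)
  case (swap a b p)
  have "x(i := x i \<circ> transpose a b) \<in> \<Phi>"
    using swap.prems swap.hyps transposition[OF _ assms(2)] by auto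
  from swap.IH[OF this] show ?case by (simp only: fun_upd_upd fun_upd_same comp_assoc)
qed auto

text \<open>The Weyl group of the product is the product of the symmetric groups, so one factor is
  permuted at a time. The final appeal to \<open>shift\<close> is due to the indices outside
  \<open>A\<close>, where \<open>g\<close> is arbitrary.\<close>

lemma permute:
  assumes "\<And>i. i \<in> A \<Longrightarrow> g i permutes {..<n i}" "x \<in> \<Phi>"
  shows "(\<lambda>i j. x i (g i j)) \<in> \<Phi>"
proof -
  have "(\<lambda>i. if i \<in> B then x i \<circ> g i else x i) \<in> \<Phi>" if "finite B" "B \<subseteq> A" for B
    using that
  proof (induction B rule: finite_induct)
    case empty
    then show ?case using assms(2) by simp
  next
    case (insert b B)
    let ?y = "\<lambda>i. if i \<in> B then x i \<circ> g i else x i"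
    have "?y(b := ?y b \<circ> g b) \<in> \<Phi>" using insert assms(1) by (rule_tac permute1) auto
    also have "?y(b := ?y b \<circ> g b) = (\<lambda>i. if i \<in> insert b B then x i \<circ> g i else x i)"
      using insert.hyps by auto
    finally show ?case .
  qed
  from this[OF finite_A subset_refl] show ?thesis
    by (rule shift) (auto intro!: exI[of _ 0])
qed

text \<open>The average of a Weyl orbit has constant entries in each factor and pairs to zero with
  \<open>u\<close>, which leaves only \<open>e\<close>. Later \<open>e\<close> is the pairing
  \<open>a * k\<close> of a one-parameter subgroup with the distinguished character.\<close>

lemma average_nonneg:
  fixes u :: "'i \<Rightarrow> nat \<Rightarrow> int"
  assumes sum0: "\<And>i. i \<in> A \<Longrightarrow> (\<Sum>j<n i. u i j) = 0"
    and nonneg: "\<And>x. x \<in> \<Phi> \<Longrightarrow> 0 \<le> (\<Sum>i\<in>A. \<Sum>j<n i. u i j * x i j) + e"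
  shows "0 \<le> e"
proof -
  obtain x where x: "x \<in> \<Phi>" using nonempty by auto
  define \<Gamma> where "\<Gamma> = PiE A (\<lambda>i. {p. p permutes {..<n i}})"
  have fin: "finite \<Gamma>" unfolding \<Gamma>_def by (intro finite_PiE finite_A finite_permutations) auto
  have ne: "\<Gamma> \<noteq> {}" unfolding \<Gamma>_def by (auto simp: PiE_eq_empty_iff intro!: exI[of _ id] permutes_id)
  have const: "(\<Sum>g\<in>\<Gamma>. x i (g i j)) = (\<Sum>g\<in>\<Gamma>. x i (g i k))" if "i \<in> A" "j < n i" "k < n i" for i j k
  proof -
    \<comment> \<open>Composition with a transposition is an involution of \<open>\<Gamma>\<close>
      that exchanges the values at \<open>j\<close> and \<open>k\<close>.\<close>
    let ?h = "\<lambda>g. g(i := g i \<circ> transpose j k)"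
    have h: "?h g \<in> \<Gamma>" if "g \<in> \<Gamma>" for g
    proof -
      have "g i permutes {..<n i}" using \<open>i \<in> A\<close> that by (auto simp: \<Gamma>_def)
      then have "g i \<circ> transpose j k permutes {..<n i}"
        using \<open>j < n i\<close> \<open>k < n i\<close> by (intro permutes_compose permutes_swap_id) auto
      then show ?thesis using that \<open>i \<in> A\<close> unfolding \<Gamma>_def by (auto simp: PiE_iff extensional_def)
    qed
    have inv: "?h (?h g) = g" for g by (simp add: comp_assoc)
    show ?thesis
      by (rule sum.reindex_bij_witness[of _ ?h ?h]) (use h inv in auto)
  qed
  have "0 \<le> (\<Sum>g\<in>\<Gamma>. (\<Sum>i\<in>A. \<Sum>j<n i. u i j * x i (g i j)) + e)"
  proof (rule sum_nonneg)
    fix g assume "g \<in> \<Gamma>"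
    then have "(\<lambda>i j. x i (g i j)) \<in> \<Phi>" using x by (rule_tac permute) (auto simp: \<Gamma>_def)
    from nonneg[OF this] show "0 \<le> (\<Sum>i\<in>A. \<Sum>j<n i. u i j * x i (g i j)) + e" .
  qed
  also have "\<dots> = (\<Sum>i\<in>A. \<Sum>j<n i. u i j * (\<Sum>g\<in>\<Gamma>. x i (g i j))) + card \<Gamma> * e"
    unfolding sum.distrib by (simp add: sum.swap[of _ A \<Gamma>] sum.swap[of _ "{..<_}" \<Gamma>] sum_distrib_left)
  also have "(\<Sum>i\<in>A. \<Sum>j<n i. u i j * (\<Sum>g\<in>\<Gamma>. x i (g i j))) = 0"
  proof (rule sum.neutral, rule ballI)
    fix i assume i: "i \<in> A"
    have "(\<Sum>j<n i. u i j * (\<Sum>g\<in>\<Gamma>. x i (g i j))) = (\<Sum>j<n i. u i j * (\<Sum>g\<in>\<Gamma>. x i (g i 0)))"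
    proof (rule sum.cong[OF refl])
      fix j assume "j \<in> {..<n i}"
      then show "u i j * (\<Sum>g\<in>\<Gamma>. x i (g i j)) = u i j * (\<Sum>g\<in>\<Gamma>. x i (g i 0))"
        using const[of i j 0] i n_pos[OF i] by simp
    qed
    also have "\<dots> = 0" unfolding sum_distrib_right[symmetric] using sum0[OF i] by simp
    finally show "(\<Sum>j<n i. u i j * (\<Sum>g\<in>\<Gamma>. x i (g i j))) = 0" .
  qed
  finally show ?thesis using fin ne by (simp add: zero_le_mult_iff card_gt_0_iff)
qed

text \<open>The rank of the product of the groups \<open>SL(n i)\<close>, equal to the dimension of
  the space of exponents modulo constants in each factor.\<close>

definition rank :: nat where "rank = (\<Sum>i\<in>A. n i - 1)"

end

text \<open>Degeneracy equal to the rank means that no \<open>rank\<close> weights have zero in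
  their convex hull. A weight is zero when its exponents are constant in every factor, whence the
  constants \<open>\<kappa>\<close>.\<close>

locale nondegenerate_configuration = weight_configuration A n \<Phi>
  for A :: "'i set" and n :: "'i \<Rightarrow> nat" and \<Phi> :: "('i \<Rightarrow> nat \<Rightarrow> int) set" +
  assumes nondegenerate: "\<And>(N::nat) x (c :: nat \<Rightarrow> rat). N \<le> rank \<Longrightarrow>
      \<forall>q<N. x q \<in> \<Phi> \<and> 0 \<le> c q \<Longrightarrow> (\<Sum>q<N. c q) = 1 \<Longrightarrow>
      \<forall>i\<in>A. \<exists>\<kappa>. \<forall>j<n i. (\<Sum>q<N. c q * of_int (x q i j)) = \<kappa> \<Longrightarrow> False"
begin

text \<open>Inside a hyperplane Caratheodory's theorem needs only \<open>rank\<close> weights to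
  reach zero, one fewer than nondegeneracy demands. The coordinates are differences with the entry
  at index \<open>0\<close> of each factor; the coordinate \<open>(i0, j1)\<close> is left out and
  recovered from \<open>orth\<close>.\<close>

lemma hyperplane_contradiction:
  fixes u :: "'i \<Rightarrow> nat \<Rightarrow> rat" and p :: "'k \<Rightarrow> rat"
  assumes sum0: "\<And>i. i \<in> A \<Longrightarrow> (\<Sum>j<n i. u i j) = 0"
    and nz: "i0 \<in> A" "j0 < n i0" "u i0 j0 \<noteq> 0"
    and K: "finite K" "\<And>k. k \<in> K \<Longrightarrow> y k \<in> \<Phi> \<and> 0 \<le> p k" "sum p K = 1"
    and orth: "\<And>k. k \<in> K \<Longrightarrow> (\<Sum>i\<in>A. \<Sum>j<n i. u i j * of_int (y k i j)) = 0"
    and bal: "\<And>i j. i \<in> A \<Longrightarrow> j < n i \<Longrightarrow> (\<Sum>k\<in>K. p k * of_int (y k i j)) = \<kappa> i"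
  shows False
proof -
  \<comment> \<open>The coordinate to be left out must be one of those in \<open>L0\<close>, so
    \<open>u i0\<close> must be nonzero somewhere away from index \<open>0\<close>. This holds
    because its entries sum to zero.\<close>
  have "\<exists>j1. 0 < j1 \<and> j1 < n i0 \<and> u i0 j1 \<noteq> 0"
  proof (rule ccontr)
    assume *: "\<not> ?thesis"
    then have "j0 = 0" using nz by auto
    have "(\<Sum>j<n i0. u i0 j) = (\<Sum>j<n i0. if j = 0 then u i0 0 else 0)"
      using * by (intro sum.cong) auto
    also have "\<dots> = u i0 0" using nz by simp
    finally show False using sum0[OF nz(1)] nz \<open>j0 = 0\<close> by simp
  qed
  then obtain j1 where j1: "0 < j1" "j1 < n i0" "u i0 j1 \<noteq> 0" by auto
  define L0 where "L0 = (SIGMA i:A. {1..<n i})"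
  define L where "L = L0 - {(i0, j1)}"
  define f where "f = (\<lambda>(i, j) k. of_int (y k i j) - of_int (y k i 0) :: rat)"
  have finL0: "finite L0" unfolding L0_def by (intro finite_SigmaI finite_A) auto
  have "(i0, j1) \<in> L0" using j1 nz by (auto simp: L0_def)
  then have "card L0 \<noteq> 0" using finL0 by auto
  have "card L0 = rank" unfolding L0_def rank_def using finite_A by (subst card_SigmaI) auto
  then have cardL: "Suc (card L) = rank"
    using \<open>(i0, j1) \<in> L0\<close> \<open>card L0 \<noteq> 0\<close> finL0 by (simp add: L_def)
  have "\<forall>l\<in>L. (\<Sum>k\<in>K. p k * f l k) = 0"
    using bal by (auto simp: L_def L0_def f_def algebra_simps sum_subtractf)
  moreover have "finite L" "\<forall>k\<in>K. 0 \<le> p k" using finL0 K(2) by (auto simp: L_def)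
  ultimately obtain S c where S: "S \<subseteq> K" "card S \<le> rank" "\<forall>k\<in>S. 0 \<le> c k" "sum c S = 1"
      "\<forall>l\<in>L. (\<Sum>k\<in>S. c k * f l k) = 0"
    using caratheodory_system[of L K p f] K(1,3) unfolding cardL by blast
  have finS: "finite S" using S K finite_subset by auto
  have all0: "(\<Sum>k\<in>S. c k * f (i,j) k) = 0" if "i \<in> A" "j < n i" for i j
  proof -
    have z: "(\<Sum>k\<in>S. c k * f (i,j) k) = 0" if "i \<in> A" "j < n i" "(i, j) \<noteq> (i0, j1)" for i j
    proof (cases "j = 0")
      case False
      then show ?thesis using S(5) that by (auto simp: L_def L0_def)
    qed (simp add: f_def)
    have "(\<Sum>i\<in>A. \<Sum>j<n i. u i j * f (i,j) k) = 0" if "k \<in> K" for k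
    proof -
      have "(\<Sum>i\<in>A. \<Sum>j<n i. u i j * f (i,j) k) =
        (\<Sum>i\<in>A. \<Sum>j<n i. u i j * of_int (y k i j)) - (\<Sum>i\<in>A. (\<Sum>j<n i. u i j) * of_int (y k i 0))"
        by (simp add: f_def algebra_simps sum_subtractf sum_distrib_left)
      then show ?thesis using orth[OF that] sum0 by simp
    qed
    then have "0 = (\<Sum>k\<in>S. c k * (\<Sum>i\<in>A. \<Sum>j<n i. u i j * f (i,j) k))"
      using S(1) by (intro sum.neutral[symmetric]) auto
    also have "\<dots> = (\<Sum>i\<in>A. \<Sum>j<n i. u i j * (\<Sum>k\<in>S. c k * f (i,j) k))"
      by (simp add: sum_distrib_left sum.swap[of _ A S] sum.swap[of _ "{..<_}" S] mult.left_commute)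
    also have "\<dots> = (\<Sum>i\<in>A. \<Sum>j<n i. if i = i0 then if j = j1 then u i0 j1 * (\<Sum>k\<in>S. c k * f (i0,j1) k) else 0 else 0)"
      using z by (intro sum.cong refl) auto
    also have "\<dots> = u i0 j1 * (\<Sum>k\<in>S. c k * f (i0,j1) k)"
    proof -
      have "(\<Sum>i\<in>A. \<Sum>j<n i. if i = i0 then if j = j1 then w else 0 else 0) = (w::rat)" for w
      proof -
        have "(\<Sum>i\<in>A. \<Sum>j<n i. if i = i0 then if j = j1 then w else 0 else 0) =
          (\<Sum>i\<in>A. if i = i0 then (\<Sum>j<n i0. if j = j1 then w else 0) else 0)"
          by (intro sum.cong) auto
        then show ?thesis using finite_A nz(1) j1 by simp
      qed
      then show ?thesis .
    qed
    finally have "(\<Sum>k\<in>S. c k * f (i0,j1) k) = 0" using j1 by simp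
    then show ?thesis using z that by (cases "(i,j) = (i0,j1)") auto
  qed
  obtain b where b: "bij_betw b {..<card S} S"
    using ex_bij_betw_nat_finite[OF finS] by (auto simp: atLeast0LessThan)
  have re: "(\<Sum>q<card S. g (b q)) = sum g S" for g :: "_ \<Rightarrow> rat"
    by (rule sum.reindex_bij_betw[OF b])
  show False
  proof (rule nondegenerate[of "card S" "\<lambda>q. y (b q)" "\<lambda>q. c (b q)"])
    show "\<forall>q<card S. y (b q) \<in> \<Phi> \<and> 0 \<le> c (b q)"
    proof (intro allI impI)
      fix q assume "q < card S"
      then have "b q \<in> S" using b by (auto simp: bij_betw_def)
      then show "y (b q) \<in> \<Phi> \<and> 0 \<le> c (b q)" using S(1,3) K(2) by auto
    qed
    show "\<forall>i\<in>A. \<exists>\<kappa>. \<forall>j<n i. (\<Sum>q<card S. c (b q) * of_int (y (b q) i j)) = \<kappa>"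
    proof (intro ballI exI allI impI)
      fix i j assume "i \<in> A" "j < n i"
      then show "(\<Sum>q<card S. c (b q) * of_int (y (b q) i j)) = (\<Sum>k\<in>S. c k * of_int (y k i 0))"
        using all0[of i j] re[of "\<lambda>k. c k * of_int (y k i j)"]
        by (simp add: f_def algebra_simps sum_subtractf)
    qed
  qed (use S re[of c] in auto)
qed

text \<open>The stabilizer of \<open>u\<close> in the Weyl group preserves the hyperplane and acts
  on each level set of \<open>u i\<close> as the full symmetric group. Averaging over it replaces an
  entry by the mean over its level set, so that balancing the levels is as good as balancing the
  single entries.\<close>

lemma level_contradiction:
  fixes u :: "'i \<Rightarrow> nat \<Rightarrow> rat" and p :: "'k \<Rightarrow> rat"
  assumes sum0: "\<And>i. i \<in> A \<Longrightarrow> (\<Sum>j<n i. u i j) = 0"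
    and nz: "i0 \<in> A" "j0 < n i0" "u i0 j0 \<noteq> 0"
    and K: "finite K" "\<And>k. k \<in> K \<Longrightarrow> x k \<in> \<Phi> \<and> 0 \<le> p k" "sum p K = 1"
    and orth: "\<And>k. k \<in> K \<Longrightarrow> (\<Sum>i\<in>A. \<Sum>j<n i. u i j * of_int (x k i j)) = 0"
    and lev: "\<And>i v. i \<in> A \<Longrightarrow> (\<Sum>k\<in>K. p k * (\<Sum>j | j < n i \<and> u i j = v. of_int (x k i j))) =
       \<kappa> i * of_nat (card {j. j < n i \<and> u i j = v})"
  shows False
proof -
  define \<Gamma> where "\<Gamma> = PiE A (\<lambda>i. {p. p permutes {..<n i} \<and> (\<forall>j<n i. u i (p j) = u i j)})"
  have \<Gamma>: "g i permutes {..<n i}" "j < n i \<Longrightarrow> u i (g i j) = u i j" if "g \<in> \<Gamma>" "i \<in> A" for g i j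
    using PiE_mem[OF that[unfolded \<Gamma>_def]] by auto
  have fin: "finite \<Gamma>" unfolding \<Gamma>_def
    by (intro finite_PiE finite_A finite_subset[OF _ finite_permutations[of "{..<n _}"]]) auto
  have ne: "\<Gamma> \<noteq> {}" unfolding \<Gamma>_def by (auto simp: PiE_eq_empty_iff intro!: exI[of _ id] permutes_id)
  have const: "(\<Sum>g\<in>\<Gamma>. of_int (x l i (g i j))) = (\<Sum>g\<in>\<Gamma>. of_int (x l i (g i k)) :: rat)"
    if "i \<in> A" "j < n i" "k < n i" "u i j = u i k" for i j k l
  proof -
    let ?h = "\<lambda>g. g(i := g i \<circ> transpose j k)"
    have h: "?h g \<in> \<Gamma>" if "g \<in> \<Gamma>" for g
    proof -
      have "g i permutes {..<n i}" "\<forall>j<n i. u i (g i j) = u i j" using \<open>i \<in> A\<close> that \<Gamma> by auto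
      then have "g i \<circ> transpose j k permutes {..<n i}" "\<forall>l<n i. u i ((g i \<circ> transpose j k) l) = u i l"
        using \<open>j < n i\<close> \<open>k < n i\<close> \<open>u i j = u i k\<close>
        by (auto intro!: permutes_compose permutes_swap_id simp: transpose_def)
      then show ?thesis using that \<open>i \<in> A\<close> unfolding \<Gamma>_def by (auto simp: PiE_iff extensional_def)
    qed
    have inv: "?h (?h g) = g" for g by (simp add: comp_assoc)
    show ?thesis
      by (rule sum.reindex_bij_witness[of _ ?h ?h]) (use h inv in auto)
  qed
  have gsum: "(\<Sum>j<n i. F (g i j)) = (\<Sum>j<n i. F j)" if "g \<in> \<Gamma>" "i \<in> A" for F :: "nat \<Rightarrow> rat" and g i
  proof (rule sum.reindex_bij_betw[of "g i"], rule permutes_imp_bij)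
    show "g i permutes {..<n i}" using that by (rule \<Gamma>)
  qed
  have gsuml: "(\<Sum>j | j < n i \<and> u i j = v. F (g i j)) = (\<Sum>j | j < n i \<and> u i j = v. F j)"
    if "g \<in> \<Gamma>" "i \<in> A" for F :: "nat \<Rightarrow> rat" and g i v
  proof -
    have *: "(\<Sum>j | j < n i \<and> u i j = v. F j) = (\<Sum>j<n i. if u i j = v then F j else 0)" for F :: "nat \<Rightarrow> rat"
      using sum.inter_filter[of "{..<n i}" F "\<lambda>j. u i j = v"] by simp
    have "(\<Sum>j<n i. if u i j = v then F (g i j) else 0) = (\<Sum>j<n i. if u i (g i j) = v then F (g i j) else 0)"
      using \<Gamma>(2)[OF that] by (intro sum.cong) auto
    also have "\<dots> = (\<Sum>j<n i. if u i j = v then F j else 0)"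
      by (rule gsum[OF that, of "\<lambda>j. if u i j = v then F j else 0"])
    finally show ?thesis unfolding * .
  qed
  define N where "N = (of_nat (card \<Gamma>) :: rat)"
  have N: "N > 0" using fin ne by (simp add: N_def card_gt_0_iff)
  define y where "y = (\<lambda>(k, g :: 'i \<Rightarrow> nat \<Rightarrow> nat) i (j :: nat). x k i (g i j))"
  define q where "q = (\<lambda>(k, g :: 'i \<Rightarrow> nat \<Rightarrow> nat). p k / N)"
  show False
  proof (rule hyperplane_contradiction[of u i0 j0 "K \<times> \<Gamma>" y q \<kappa>])
    have "sum q (K \<times> \<Gamma>) = (\<Sum>k\<in>K. \<Sum>g\<in>\<Gamma>. p k / N)"
      unfolding q_def by (rule sum.cartesian_product[symmetric])
    also have "\<dots> = (\<Sum>k\<in>K. p k)" using N unfolding N_def by simp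
    finally show "sum q (K \<times> \<Gamma>) = 1" using K(3) by simp
    show "y k \<in> \<Phi> \<and> 0 \<le> q k" if "k \<in> K \<times> \<Gamma>" for k
    proof -
      obtain l g where k: "k = (l, g)" "l \<in> K" "g \<in> \<Gamma>" using \<open>k \<in> K \<times> \<Gamma>\<close> by auto
      have "(\<lambda>i j. x l i (g i j)) \<in> \<Phi>" using k K(2) \<Gamma> by (rule_tac permute) auto
      then show ?thesis using k K(2) N by (auto simp: y_def q_def)
    qed
    show "(\<Sum>i\<in>A. \<Sum>j<n i. u i j * of_int (y k i j)) = 0" if "k \<in> K \<times> \<Gamma>" for k
    proof -
      obtain l g where k: "k = (l, g)" "l \<in> K" "g \<in> \<Gamma>" using \<open>k \<in> K \<times> \<Gamma>\<close> by auto
      have "(\<Sum>j<n i. u i j * of_int (y k i j)) = (\<Sum>j<n i. u i j * of_int (x l i j))" if "i \<in> A" for i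
      proof -
        have "(\<Sum>j<n i. u i j * of_int (y k i j)) = (\<Sum>j<n i. u i (g i j) * of_int (x l i (g i j)))"
          using \<Gamma>(2)[OF k(3) that] k(1) by (intro sum.cong) (auto simp: y_def)
        also have "\<dots> = (\<Sum>j<n i. u i j * of_int (x l i j))"
          by (rule gsum[OF k(3) that, of "\<lambda>j. u i j * of_int (x l i j)"])
        finally show ?thesis .
      qed
      then show ?thesis using orth[OF k(2)] by simp
    qed
    show "(\<Sum>k\<in>K \<times> \<Gamma>. q k * of_int (y k i j)) = \<kappa> i" if ij: "i \<in> A" "j < n i" for i j
    proof -
      \<comment> \<open>\<open>\<Gamma>\<close> moves \<open>j\<close> uniformly over its level set,
        so the average of an entry over \<open>\<Gamma>\<close> is the mean over that set, which
        \<open>lev\<close> controls.\<close>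
      define Lv where "Lv = {j'. j' < n i \<and> u i j' = u i j}"
      have "j \<in> Lv" "finite Lv" using ij by (auto simp: Lv_def)
      then have cL: "card Lv > 0" by (auto simp: card_gt_0_iff)
      have "of_nat (card Lv) * (\<Sum>g\<in>\<Gamma>. of_int (x l i (g i j))) = N * (\<Sum>j'\<in>Lv. of_int (x l i j'))" for l
      proof -
        have "of_nat (card Lv) * (\<Sum>g\<in>\<Gamma>. of_int (x l i (g i j))) = (\<Sum>j'\<in>Lv. \<Sum>g\<in>\<Gamma>. of_int (x l i (g i j')) :: rat)"
        proof -
          have "(\<Sum>g\<in>\<Gamma>. of_int (x l i (g i j'))) = (\<Sum>g\<in>\<Gamma>. of_int (x l i (g i j)) :: rat)" if "j' \<in> Lv" for j'
            using that ij by (intro const) (auto simp: Lv_def)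
          then show ?thesis by simp
        qed
        also have "\<dots> = (\<Sum>g\<in>\<Gamma>. \<Sum>j'\<in>Lv. of_int (x l i (g i j')))" by (rule sum.swap)
        also have "\<dots> = (\<Sum>g\<in>\<Gamma>. \<Sum>j'\<in>Lv. of_int (x l i j'))"
          unfolding Lv_def using ij by (intro sum.cong[OF refl] gsuml)
        finally show ?thesis by (simp add: N_def)
      qed
      then have *: "(\<Sum>g\<in>\<Gamma>. of_int (x l i (g i j))) = N * (\<Sum>j'\<in>Lv. of_int (x l i j')) / of_nat (card Lv)" for l
        using cL by (simp add: field_simps)
      have "(\<Sum>k\<in>K \<times> \<Gamma>. q k * of_int (y k i j)) = (\<Sum>l\<in>K. p l / N * (\<Sum>g\<in>\<Gamma>. of_int (x l i (g i j))))"
        unfolding sum_distrib_left sum.cartesian_product by (intro sum.cong) (auto simp: q_def y_def)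
      also have "\<dots> = (\<Sum>l\<in>K. p l * (\<Sum>j'\<in>Lv. of_int (x l i j'))) / of_nat (card Lv)"
        unfolding * sum_divide_distrib using N by (intro sum.cong) auto
      also have "\<dots> = \<kappa> i" using lev[OF ij(1), of "u i j"] cL unfolding Lv_def[symmetric] by simp
      finally show ?thesis .
    qed
  qed (use assms fin in auto)
qed

text \<open>The difference of two coordinates vanishes on a weight exactly when the two entries
  agree. What then matters is on which side of the mean entry the common value lies; both sides are
  multiplied by \<open>n i\<close> to stay within the integers.\<close>

definition twin_above :: "'i \<Rightarrow> ('i \<Rightarrow> nat \<Rightarrow> int) \<Rightarrow> bool" where
  "twin_above i x \<longleftrightarrow> (\<exists>j k. j < n i \<and> k < n i \<and> j \<noteq> k \<and> x i j = x i k \<and>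
     (\<Sum>l<n i. x i l) \<le> int (n i) * x i j)"

definition twin_below :: "'i \<Rightarrow> ('i \<Rightarrow> nat \<Rightarrow> int) \<Rightarrow> bool" where
  "twin_below i x \<longleftrightarrow> (\<exists>j k. j < n i \<and> k < n i \<and> j \<noteq> k \<and> x i j = x i k \<and>
     int (n i) * x i j \<le> (\<Sum>l<n i. x i l))"

text \<open>An instance of \<open>level_contradiction\<close> with \<open>u\<close> the difference
  of the first two coordinates of factor \<open>i\<close>. Its level sets there are
  \<open>{0}\<close>, \<open>{1}\<close> and the remaining indices, and a suitable mixture of a pair
  above the mean with a pair below it gives all levels the same mean.\<close>

lemma twins_at_01:
  assumes i: "i \<in> A" "2 \<le> n i" and xy: "x \<in> \<Phi>" "y \<in> \<Phi>"
    and x: "x i 0 = x i 1" "(\<Sum>l<n i. x i l) \<le> int (n i) * x i 0"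
    and y: "y i 0 = y i 1" "int (n i) * y i 0 \<le> (\<Sum>l<n i. y i l)"
  shows False
proof -
  define dx where "dx = (of_int (int (n i) * x i 0 - (\<Sum>l<n i. x i l)) :: rat)"
  define dy where "dy = (of_int ((\<Sum>l<n i. y i l) - int (n i) * y i 0) :: rat)"
  have d0: "0 \<le> dx" "0 \<le> dy" using x y by (auto simp: dx_def dy_def simp del: of_int_diff of_int_sum of_int_mult)
  \<comment> \<open>The mixture in which the excess of \<open>x\<close> over its mean cancels the
    deficit of \<open>y\<close>. If both are zero, \<open>x\<close> alone is taken.\<close>
  obtain p q :: rat where pq: "0 \<le> p" "0 \<le> q" "p + q = 1" "p * dx = q * dy"
  proof (cases "dx + dy = 0")
    case True
    then have "dx = 0" "dy = 0" using d0 by auto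
    then show ?thesis using that[of 1 0] by auto
  next
    case False
    then show ?thesis using that[of "dy / (dx + dy)" "dx / (dx + dy)"] d0
      by (auto simp: add_divide_distrib[symmetric] add.commute)
  qed
  define u where "u = (\<lambda>i' j. if i' = i then if j = 0 then 1 else if j = (1::nat) then -1 else 0 else 0 :: rat)"
  define z where "z = (\<lambda>b. if b then x else y)"
  define w where "w = (\<lambda>b. if b then p else q)"
  define t where "t = (\<lambda>i'. p * of_int (\<Sum>l<n i'. x i' l) + q * of_int (\<Sum>l<n i'. y i' l))"
  have split: "(\<Sum>j<n i. g j) = g 0 + g 1 + (\<Sum>j\<in>{2..<n i}. g j)" for g :: "nat \<Rightarrow> rat"
  proof -
    have "{..<n i} = insert 0 (insert 1 {2..<n i})" using i by auto
    then show ?thesis by simp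
  qed
  have ni: "of_nat (n i) \<noteq> (0::rat)" using i by simp
  \<comment> \<open>By the choice of \<open>p\<close> and \<open>q\<close> the mean entry of the
    mixture in factor \<open>i\<close> equals its entry at index \<open>0\<close>.\<close>
  have ti: "t i = of_nat (n i) * (p * of_int (x i 0) + q * of_int (y i 0))"
    using pq(4) by (simp add: t_def dx_def dy_def algebra_simps)
  show False
  proof (rule level_contradiction[of u i 0 UNIV z w "\<lambda>i'. t i' / of_nat (n i')"])
    show "(\<Sum>j<n i'. u i' j) = 0" if "i' \<in> A" for i'
    proof (cases "i' = i")
      case True
      then show ?thesis by (simp add: split u_def)
    qed (simp add: u_def)
    show "sum w UNIV = 1" using pq by (simp add: UNIV_bool w_def)
    show "(\<Sum>i\<in>A. \<Sum>j<n i. u i j * of_int (z k i j)) = 0" for k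
    proof (rule sum.neutral, rule ballI)
      fix i' assume "i' \<in> A"
      show "(\<Sum>j<n i'. u i' j * of_int (z k i' j)) = 0"
      proof (cases "i' = i")
        case True
        then show ?thesis using x y by (simp add: split u_def z_def)
      qed (simp add: u_def)
    qed
    show "(\<Sum>k\<in>UNIV. w k * (\<Sum>j | j < n i' \<and> u i' j = v. of_int (z k i' j))) =
        t i' / of_nat (n i') * of_nat (card {j. j < n i' \<and> u i' j = v})" if i': "i' \<in> A" for i' v
    proof (cases "i' = i")
      case False
      then have "{j. j < n i' \<and> u i' j = v} = (if v = 0 then {..<n i'} else {})" by (auto simp: u_def)
      then show ?thesis using n_pos[OF i'] by (simp add: UNIV_bool w_def z_def t_def)
    next
      case True
      consider "v = 1" | "v = -1" | "v = 0" | "v \<noteq> 1 \<and> v \<noteq> -1 \<and> v \<noteq> 0" by blast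
      then show ?thesis
      proof cases
        case 1
        then have "{j. j < n i' \<and> u i' j = v} = {0}" using i True by (auto simp: u_def)
        then show ?thesis using ti ni by (simp add: UNIV_bool w_def z_def True)
      next
        case 2
        then have "{j. j < n i' \<and> u i' j = v} = {1}" using i True by (auto simp: u_def)
        then show ?thesis using ti ni x y by (simp add: UNIV_bool w_def z_def True)
      next
        case 3
        then have *: "{j. j < n i' \<and> u i' j = v} = {2..<n i}" using i True by (auto simp: u_def)
        have f1: "t i = p * of_int (x i 0) * 2 + q * of_int (y i 0) * 2 +
            (p * (\<Sum>j = 2..<n i. of_int (x i j)) + q * (\<Sum>j = 2..<n i. of_int (y i j)))"
          unfolding t_def of_int_sum split using x y by (simp add: algebra_simps)
        have f2: "t i / of_nat (n i) * of_nat (n i - 2) = t i - 2 * (t i / of_nat (n i))"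
          using i ni by (simp add: of_nat_diff field_simps)
        have f3: "t i / of_nat (n i) = p * of_int (x i 0) + q * of_int (y i 0)" using ti ni by simp
        have "p * (\<Sum>j = 2..<n i. of_int (x i j)) + q * (\<Sum>j = 2..<n i. of_int (y i j)) =
            t i / of_nat (n i) * of_nat (n i - 2)"
          unfolding f2 using f1 f3 by linarith
        then show ?thesis unfolding * using True by (simp add: UNIV_bool w_def z_def add.commute)
      next
        case 4
        then have *: "{j. j < n i' \<and> u i' j = v} = {}" by (auto simp: u_def)
        show ?thesis unfolding * by simp
      qed
    qed
  qed (use i xy pq in \<open>auto simp: u_def z_def w_def\<close>)
qed

lemma permutation_from_01:
  assumes "j < m" "k < m" "j \<noteq> (k::nat)"
  obtains p where "p permutes {..<m}" "p 0 = j" "p 1 = k"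
proof -
  define k' where "k' = transpose 0 j k"
  have k': "k' \<noteq> 0" "k' < m" using assms by (auto simp: k'_def transpose_def)
  have "1 < m" using assms by auto
  show ?thesis
  proof (rule that[of "transpose 0 j \<circ> transpose 1 k'"])
    show "transpose 0 j \<circ> transpose 1 k' permutes {..<m}"
      using assms k' \<open>1 < m\<close> by (intro permutes_compose permutes_swap_id) auto
    show "(transpose 0 j \<circ> transpose 1 k') 0 = j" using k' by (auto simp: transpose_def)
    show "(transpose 0 j \<circ> transpose 1 k') 1 = k" using assms by (auto simp: transpose_def k'_def)
  qed
qed

text \<open>The two pairs may sit at different places of \<open>x\<close> and \<open>y\<close>; the
  Weyl group moves each of them to the indices \<open>0\<close> and \<open>1\<close>. The case
  \<open>x = y\<close> is allowed and is used.\<close>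

lemma twin_above_below:
  assumes i: "i \<in> A" and xy: "x \<in> \<Phi>" "y \<in> \<Phi>" and "twin_above i x" "twin_below i y"
  shows False
proof -
  obtain j k where jk: "j < n i" "k < n i" "j \<noteq> k" "x i j = x i k" "(\<Sum>l<n i. x i l) \<le> int (n i) * x i j"
    using assms by (auto simp: twin_above_def)
  obtain p where p: "p permutes {..<n i}" "p 0 = j" "p 1 = k" by (rule permutation_from_01[OF jk(1-3)])
  obtain j' k' where jk': "j' < n i" "k' < n i" "j' \<noteq> k'" "y i j' = y i k'" "int (n i) * y i j' \<le> (\<Sum>l<n i. y i l)"
    using assms by (auto simp: twin_below_def)
  obtain p' where p': "p' permutes {..<n i}" "p' 0 = j'" "p' 1 = k'" by (rule permutation_from_01[OF jk'(1-3)])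
  have s: "(\<Sum>l<n i. g (p l)) = (\<Sum>l<n i. g l)" if "p permutes {..<n i}" for g :: "nat \<Rightarrow> int" and p
    by (rule sum.reindex_bij_betw[OF permutes_imp_bij[OF that]])
  show False
    by (rule twins_at_01[of i "x(i := x i \<circ> p)" "y(i := y i \<circ> p')"])
      (use i xy p p' jk jk' s[OF p(1), of "x i"] s[OF p'(1), of "y i"] permute1 in auto)
qed

text \<open>If only \<open>c\<close> and \<open>c + 1\<close> occur, the mean lies between them, so
  a repeated \<open>c\<close> is a pair below and a repeated \<open>c + 1\<close> a pair above. Both
  cannot happen; hence one of the two values is taken exactly once, and \<open>\<sigma>\<close>
  records which.\<close>

lemma nearly_constant_type:
  assumes i: "i \<in> A" "2 \<le> n i" and x: "x \<in> \<Phi>"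
    and flat: "\<And>j k. j < n i \<Longrightarrow> k < n i \<Longrightarrow> x i j \<le> x i k + 1"
  shows "\<exists>\<sigma> c s. (\<sigma> = 1 \<or> \<sigma> = -1) \<and> s < n i \<and> (\<forall>j<n i. x i j = c + (if j = s then \<sigma> else 0))"
proof -
  define c where "c = Min (x i ` {..<n i})"
  have "c \<in> x i ` {..<n i}" unfolding c_def using i by (intro Min_in) (auto simp: lessThan_empty_iff)
  then obtain j0 where j0: "j0 < n i" "c = x i j0" by auto
  have cmin: "c \<le> x i j" if "j < n i" for j unfolding c_def using that by auto
  have c01: "x i j = c \<or> x i j = c + 1" if "j < n i" for j
    using cmin[OF that] flat[OF that j0(1)] j0 by linarith
  have lower: "int (n i) * c \<le> (\<Sum>l<n i. x i l)"
    using sum_bounded_below[of "{..<n i}" c "x i"] cmin by simp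
  have upper: "(\<Sum>l<n i. x i l) \<le> int (n i) * (c + 1)"
    using sum_bounded_above[of "{..<n i}" "x i" "c + 1"] c01 by force
  have above: "twin_above i x" if "j < n i" "k < n i" "j \<noteq> k" "x i j = c + 1" "x i k = c + 1" for j k
    unfolding twin_above_def using that upper by (intro exI[of _ j] exI[of _ k]) auto
  have below: "twin_below i x" if "j < n i" "k < n i" "j \<noteq> k" "x i j = c" "x i k = c" for j k
    unfolding twin_below_def using that lower by (intro exI[of _ j] exI[of _ k]) auto
  show ?thesis
  proof (cases "\<exists>s<n i. x i s = c + 1")
    case False
    then have all: "x i j = c" if "j < n i" for j using c01[OF that] that by auto
    then have "(\<Sum>l<n i. x i l) = int (n i) * c" by simp
    then have "twin_above i x"
      unfolding twin_above_def using i all by (intro exI[of _ 0] exI[of _ 1]) auto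
    then show ?thesis using twin_above_below[OF i(1) x x] below[of 0 1] all i by auto
  next
    case True
    then obtain s where s: "s < n i" "x i s = c + 1" by auto
    show ?thesis
    proof (cases "\<exists>s'<n i. s' \<noteq> s \<and> x i s' = c + 1")
      case False
      then have "\<forall>j<n i. x i j = c + (if j = s then 1 else 0)" using s c01 by auto
      then show ?thesis using s by blast
    next
      case True
      then obtain s' where "s' < n i" "s' \<noteq> s" "x i s' = c + 1" by auto
      then have ab: "twin_above i x" using s above[of s' s] by simp
      have "x i j \<noteq> c" if "j < n i" "j \<noteq> j0" for j
        using below[OF that(1) j0(1) that(2) _ j0(2)[symmetric]] twin_above_below[OF i(1) x x ab] by blast
      then have "\<forall>j<n i. x i j = (c + 1) + (if j = j0 then -1 else 0)" using j0 c01 by auto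
      then show ?thesis using j0 by blast
    qed
  qed
qed

section \<open>Descent along root strings and the shape of a weight in one factor\<close>

lemma move_sum:
  fixes f :: "nat \<Rightarrow> int"
  assumes "j < m" "k < m" "j \<noteq> k"
  shows "(\<Sum>l<m. (f(j := a, k := b)) l) = (\<Sum>l<m. f l) - f j - f k + a + b"
proof -
  have *: "(\<Sum>l<m. g l) = g j + g k + (\<Sum>l\<in>{..<m} - {j} - {k}. g l)" for g :: "nat \<Rightarrow> int"
    using assms by (simp add: sum.remove[of "{..<m}" j] sum.remove[of "{..<m} - {j}" k])
  show ?thesis unfolding *[of "f(j := a, k := b)"] *[of f] using assms by simp
qed

text \<open>The moved weight repeats its lower value below the mean, so no weight may have a pair
  above the mean. Undoing the move exposes such a pair: at \<open>j\<close> and \<open>s\<close> in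
  \<open>x\<close> itself, or, if \<open>j = s\<close>, after moving the unit from \<open>j\<close>
  to a third index instead of to \<open>k\<close>. Both arguments need three indices.\<close>

lemma no_move_to_positive_type:
  assumes i: "i \<in> A" "3 \<le> n i" and x: "x \<in> \<Phi>" and jk: "j < n i" "k < n i" "x i k + 2 \<le> x i j"
    and s: "s < n i" "\<And>l. l < n i \<Longrightarrow> ((x i)(j := x i j - 1, k := x i k + 1)) l = c + (if l = s then 1 else 0)"
  shows False
proof -
  let ?x' = "x(i := (x i)(j := x i j - 1, k := x i k + 1))"
  have "j \<noteq> k" using jk by auto
  have x': "?x' \<in> \<Phi>" using move[OF x i(1) jk(1,2)] jk by auto
  have sumx: "(\<Sum>l<n i. x i l) = int (n i) * c + 1"
  proof -
    have "(\<Sum>l<n i. ((x i)(j := x i j - 1, k := x i k + 1)) l) = (\<Sum>l<n i. c + (if l = s then 1 else 0))"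
      using s by (intro sum.cong) auto
    then show ?thesis using s unfolding move_sum[OF jk(1,2) \<open>j \<noteq> k\<close>] by (simp add: sum.distrib)
  qed
  have third: "\<exists>l<n i. l \<noteq> a \<and> l \<noteq> b" for a b
  proof -
    have "card ({..<n i} - {a, b}) > 0"
      using i card_mono[of "{a,b}" "{a,b}"] diff_card_le_card_Diff[of "{a,b}" "{..<n i}"]
      by (simp add: card_insert_if split: if_splits)
    then show ?thesis by (metis Diff_iff card_gt_0_iff ex_in_conv insertCI lessThan_iff)
  qed
  have below: "twin_below i ?x'"
  proof -
    obtain a where a: "a < n i" "a \<noteq> s" using third[of s s] by auto
    obtain b where b: "b < n i" "b \<noteq> s" "b \<noteq> a" using third[of s a] by auto
    have sumx': "(\<Sum>l<n i. ?x' i l) = int (n i) * c + 1"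
      unfolding fun_upd_same move_sum[OF jk(1,2) \<open>j \<noteq> k\<close>] using sumx by simp
    show ?thesis unfolding twin_below_def sumx'
      using a b s(2)[of a] s(2)[of b] by (intro exI[of _ a] exI[of _ b]) auto
  qed
  have val: "x i j = c + 1 + (if j = s then 1 else 0)" "x i k = c - 1 + (if k = s then 1 else 0)"
    "\<And>l. l < n i \<Longrightarrow> l \<noteq> j \<Longrightarrow> l \<noteq> k \<Longrightarrow> x i l = c + (if l = s then 1 else 0)"
  proof -
    show "x i j = c + 1 + (if j = s then 1 else 0)" using s(2)[OF jk(1)] \<open>j \<noteq> k\<close> by simp
    show "x i k = c - 1 + (if k = s then 1 else 0)" using s(2)[OF jk(2)] by simp
    show "x i l = c + (if l = s then 1 else 0)" if "l < n i" "l \<noteq> j" "l \<noteq> k" for l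
      using s(2)[OF that(1)] that by simp
  qed
  have "k \<noteq> s" using val(1,2) jk by (auto split: if_splits)
  show False
  proof (cases "j = s")
    case False
    then have "twin_above i x"
      unfolding twin_above_def sumx using val jk s(1) \<open>k \<noteq> s\<close> i
      by (intro exI[of _ j] exI[of _ s]) (auto simp: algebra_simps)
    then show False using twin_above_below[OF i(1) x x' _ below] by simp
  next
    case True
    obtain l where l: "l < n i" "l \<noteq> j" "l \<noteq> k" using third by blast
    have xl: "x i l = c" using val(3)[OF l] l True by simp
    let ?y = "x(i := (x i)(j := x i j - 1, l := x i l + 1))"
    have "?y \<in> \<Phi>" using move[OF x i(1) jk(1) l(1)] xl val True by auto
    moreover have "twin_above i ?y"
    proof -
      have sumy: "(\<Sum>l<n i. ?y i l) = int (n i) * c + 1"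
        unfolding fun_upd_same move_sum[OF jk(1) l(1) not_sym[OF l(2)]] using sumx by simp
      show ?thesis unfolding twin_above_def sumy
        using jk l xl val True i by (intro exI[of _ j] exI[of _ l]) (auto simp: algebra_simps)
    qed
    ultimately show False using twin_above_below[OF i(1) _ x' _ below] by blast
  qed
qed

text \<open>The negatives are the weights of the dual representation. This symmetry transfers
  statements about the sign \<open>1\<close> to the sign \<open>-1\<close>.\<close>

lemma negated: "nondegenerate_configuration A n {x. (\<lambda>i j. - x i j) \<in> \<Phi>}"
proof (intro nondegenerate_configuration.intro weight_configuration.intro nondegenerate_configuration_axioms.intro)
  show "finite A" by (rule finite_A)
  show "1 \<le> n i" if "i \<in> A" for i using that by (rule n_pos)
  show "{x. (\<lambda>i j. - x i j) \<in> \<Phi>} \<noteq> {}"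
  proof
    assume *: "{x. (\<lambda>i j. - x i j) \<in> \<Phi>} = {}"
    obtain x where "x \<in> \<Phi>" using nonempty by auto
    then have "(\<lambda>i j. - x i j) \<in> {x. (\<lambda>i j. - x i j) \<in> \<Phi>}" by simp
    then show False by (simp only: * empty_iff)
  qed
  show "y \<in> {x. (\<lambda>i j. - x i j) \<in> \<Phi>}"
    if "x \<in> {x. (\<lambda>i j. - x i j) \<in> \<Phi>}" and *: "\<forall>i\<in>A. \<exists>c. \<forall>j<n i. y i j = x i j + c" for x y
  proof -
    have "(\<lambda>i j. - y i j) \<in> \<Phi>"
    proof (rule shift[of "\<lambda>i j. - x i j"])
      show "\<forall>i\<in>A. \<exists>c. \<forall>j<n i. - y i j = - x i j + c"
      proof
        fix i assume "i \<in> A"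
        then obtain c where "\<forall>j<n i. y i j = x i j + c" using * by auto
        then show "\<exists>c. \<forall>j<n i. - y i j = - x i j + c" by (intro exI[of _ "- c"]) auto
      qed
    qed (use that in auto)
    then show ?thesis by simp
  qed
  show "x(i := x i \<circ> Transposition.transpose j k) \<in> {x. (\<lambda>i j. - x i j) \<in> \<Phi>}"
    if "x \<in> {x. (\<lambda>i j. - x i j) \<in> \<Phi>}" "i \<in> A" "j < n i" "k < n i" for x i j k
  proof -
    have m: "(\<lambda>i j. - x i j) \<in> \<Phi>" using that(1) by simp
    note transposition[OF m that(2-4)]
    also have "(\<lambda>i j. - x i j)(i := (\<lambda>j. - x i j) \<circ> transpose j k) = (\<lambda>i' j'. - (x(i := x i \<circ> transpose j k)) i' j')"
      by (auto simp: fun_eq_iff)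
    finally show ?thesis by (simp only: mem_Collect_eq)
  qed
  show "x(i := (x i)(j := x i j - 1, k := x i k + 1)) \<in> {x. (\<lambda>i j. - x i j) \<in> \<Phi>}"
    if "x \<in> {x. (\<lambda>i j. - x i j) \<in> \<Phi>}" "i \<in> A" "j < n i" "k < n i" "x i k < x i j" for x i j k
  proof -
    \<comment> \<open>Negation reverses the direction of a move, so \<open>j\<close> and
      \<open>k\<close> change roles.\<close>
    have m: "(\<lambda>i j. - x i j) \<in> \<Phi>" "- x i j < - x i k" using that(1,5) by simp_all
    note move[OF m(1) that(2,4,3) m(2)]
    also have "(\<lambda>i j. - x i j)(i := (\<lambda>j. - x i j)(k := - x i k - 1, j := - x i j + 1)) =
        (\<lambda>i' j'. - (x(i := (x i)(j := x i j - 1, k := x i k + 1))) i' j')"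
      using that by (auto simp: fun_eq_iff)
    finally show ?thesis by (simp only: mem_Collect_eq)
  qed
  show False if "N \<le> rank" "\<forall>q<N. x q \<in> {x. (\<lambda>i j. - x i j) \<in> \<Phi>} \<and> 0 \<le> c q" "(\<Sum>q<N. c q) = 1"
    and *: "\<forall>i\<in>A. \<exists>\<kappa>. \<forall>j<n i. (\<Sum>q<N. c q * of_int (x q i j)) = \<kappa>" for N x and c :: "nat \<Rightarrow> rat"
  proof (rule nondegenerate[of N "\<lambda>q i j. - x q i j" c])
    show "N \<le> rank" "(\<Sum>q<N. c q) = 1" by fact+
    show "\<forall>q<N. (\<lambda>i j. - x q i j) \<in> \<Phi> \<and> 0 \<le> c q" using that(2) by simp
    show "\<forall>i\<in>A. \<exists>\<kappa>. \<forall>j<n i. (\<Sum>q<N. c q * of_int (- x q i j)) = \<kappa>"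
    proof
      fix i assume "i \<in> A"
      then obtain \<kappa> where "\<forall>j<n i. (\<Sum>q<N. c q * of_int (x q i j)) = \<kappa>" using * by auto
      then show "\<exists>\<kappa>. \<forall>j<n i. (\<Sum>q<N. c q * of_int (- x q i j)) = \<kappa>"
        by (intro exI[of _ "- \<kappa>"]) (simp add: sum_negf)
    qed
  qed
qed

lemma sum_of_squares_move:
  assumes "j < n i" "k < n i" "x i k + 2 \<le> x i j"
  shows "(\<Sum>l<n i. (((x i)(j := x i j - 1, k := x i k + 1)) l)\<^sup>2) < (\<Sum>l<n i. (x i l)\<^sup>2 :: int)"
proof -
  have jk: "j \<noteq> k" using assms by auto
  have *: "(\<lambda>l. (((x i)(j := x i j - 1, k := x i k + 1)) l)\<^sup>2) =
      (\<lambda>l. (x i l)\<^sup>2)(j := (x i j - 1)\<^sup>2, k := (x i k + 1)\<^sup>2)"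
    by auto
  have "(x i j - 1)\<^sup>2 + (x i k + 1)\<^sup>2 < (x i j)\<^sup>2 + (x i k)\<^sup>2"
    using assms by (simp add: power2_eq_square algebra_simps)
  then show ?thesis unfolding * move_sum[OF assms(1,2) jk] by simp
qed

text \<open>The component of a weight of the standard representation for \<open>\<sigma> = 1\<close>
  and of its dual for \<open>\<sigma> = -1\<close>, up to the constant that determinant one makes
  invisible.\<close>

definition unit_type :: "'i \<Rightarrow> int \<Rightarrow> ('i \<Rightarrow> nat \<Rightarrow> int) \<Rightarrow> bool" where
  "unit_type i \<sigma> x \<longleftrightarrow> (\<exists>c s. s < n i \<and> (\<forall>j<n i. x i j = c + (if j = s then \<sigma> else 0)))"

text \<open>A move across a gap of at least two lowers the sum of squares, so by induction it would
  end at a signed unit vector. This is excluded by \<open>no_move_to_positive_type\<close>, applied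
  to \<open>\<Phi>\<close> or to its negative. Hence there is no gap and
  \<open>nearly_constant_type\<close> applies.\<close>

lemma unit_type_cases:
  assumes i: "i \<in> A" "3 \<le> n i" and "x \<in> \<Phi>"
  shows "unit_type i 1 x \<or> unit_type i (-1) x"
  using assms(3)
proof (induction "nat (\<Sum>l<n i. (x i l)\<^sup>2)" arbitrary: x rule: less_induct)
  case less
  show ?case
  proof (cases "\<exists>j<n i. \<exists>k<n i. x i k + 2 \<le> x i j")
    case False
    then have "x i j \<le> x i k + 1" if "j < n i" "k < n i" for j k using that by force
    then show ?thesis
      using nearly_constant_type[OF i(1) _ less.prems] i(2) unfolding unit_type_def by fastforce
  next
    case True
    then obtain j k where jk: "j < n i" "k < n i" "x i k + 2 \<le> x i j" by auto
    let ?y = "x(i := (x i)(j := x i j - 1, k := x i k + 1))"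
    have y: "?y \<in> \<Phi>" using move[OF less.prems i(1) jk(1,2)] jk by auto
    have "nat (\<Sum>l<n i. (?y i l)\<^sup>2) < nat (\<Sum>l<n i. (x i l)\<^sup>2)"
      using sum_of_squares_move[of j i k x, OF jk] sum_nonneg[of "{..<n i}" "\<lambda>l. (?y i l)\<^sup>2"]
      unfolding fun_upd_same by (simp only: nat_less_eq_zless zero_le_power2)
    from less.hyps[OF this y] show ?thesis
    proof
      assume "unit_type i 1 ?y"
      then obtain c s where "s < n i" "\<And>l. l < n i \<Longrightarrow> ?y i l = c + (if l = s then 1 else 0)"
        unfolding unit_type_def by blast
      then have False
        unfolding fun_upd_same by (rule no_move_to_positive_type[OF i less.prems jk])
      then show ?thesis ..
    next
      assume "unit_type i (-1) ?y"
      then obtain c s where s: "s < n i" "\<And>l. l < n i \<Longrightarrow> ?y i l = c + (if l = s then -1 else 0)"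
        unfolding unit_type_def by blast
      have mx: "(\<lambda>i j. - x i j) \<in> {x. (\<lambda>i j. - x i j) \<in> \<Phi>}" using less.prems by simp
      have jk': "- x i j + 2 \<le> - x i k" "k \<noteq> j" using jk(3) by auto
      have "((\<lambda>j. - x i j)(k := - x i k - 1, j := - x i j + 1)) l = - c + (if l = s then 1 else 0)"
        if "l < n i" for l
        using s(2)[OF that] jk'(2) by (auto split: if_splits)
      from nondegenerate_configuration.no_move_to_positive_type[OF negated i mx jk(2,1) jk'(1) s(1) this]
      show ?thesis by blast
    qed
  qed
qed

text \<open>Among three or more entries the generic value is repeated, below the mean for the sign
  \<open>1\<close> and above it for the sign \<open>-1\<close>, so weights of both signs would
  contradict \<open>twin_above_below\<close>.\<close>

lemma unit_type_uniform:
  assumes i: "i \<in> A" "3 \<le> n i" and xy: "x \<in> \<Phi>" "y \<in> \<Phi>" and "unit_type i 1 x"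
  shows "unit_type i 1 y"
proof (rule ccontr)
  assume "\<not> ?thesis"
  then have "unit_type i (-1) y" using unit_type_cases[OF i xy(2)] by simp
  then obtain d t where y: "t < n i" "\<And>j. j < n i \<Longrightarrow> y i j = d + (if j = t then -1 else 0)"
    unfolding unit_type_def by blast
  obtain c s where x: "s < n i" "\<And>j. j < n i \<Longrightarrow> x i j = c + (if j = s then 1 else 0)"
    using assms(5) unfolding unit_type_def by blast
  have sx: "(\<Sum>l<n i. x i l) = int (n i) * c + 1" using x by (simp add: sum.distrib)
  have sy: "(\<Sum>l<n i. y i l) = int (n i) * d - 1" using y by (simp add: sum.distrib)
  have two: "\<exists>a b. a < n i \<and> b < n i \<and> a \<noteq> b \<and> a \<noteq> s \<and> b \<noteq> s" for s
  proof -
    consider "s = 0" | "s = 1" | "s \<ge> 2" by linarith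
    then show ?thesis
    proof cases
      case 1 then show ?thesis using i by (intro exI[of _ 1] exI[of _ 2]) auto
    next
      case 2 then show ?thesis using i by (intro exI[of _ 0] exI[of _ 2]) auto
    next
      case 3 then show ?thesis using i by (intro exI[of _ 0] exI[of _ 1]) auto
    qed
  qed
  obtain a b where ab: "a < n i" "b < n i" "a \<noteq> b" "a \<noteq> s" "b \<noteq> s" using two by blast
  obtain a' b' where ab': "a' < n i" "b' < n i" "a' \<noteq> b'" "a' \<noteq> t" "b' \<noteq> t" using two by blast
  have "twin_below i x"
    unfolding twin_below_def sx using ab x(2)[OF ab(1)] x(2)[OF ab(2)]
    by (intro exI[of _ a] exI[of _ b]) simp
  moreover have "twin_above i y"
    unfolding twin_above_def sy using ab' y(2)[OF ab'(1)] y(2)[OF ab'(2)]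
    by (intro exI[of _ a'] exI[of _ b']) simp
  ultimately show False using twin_above_below[OF i(1) xy(2,1)] by blast
qed

text \<open>With only two entries, equal ones form a pair both above and below the mean, so the
  difference is never zero. A move changes the difference by two, and an even difference would
  descend to zero.\<close>

lemma odd_difference:
  assumes i: "i \<in> A" "n i = 2" and "x \<in> \<Phi>"
  shows "odd (x i 0 - x i 1)"
  using assms(3)
proof (induction "nat (\<Sum>l<n i. (x i l)\<^sup>2)" arbitrary: x rule: less_induct)
  case less
  have sum2: "(\<Sum>l<n i. f l) = f 0 + f 1" for f :: "nat \<Rightarrow> int" using i by (simp add: numeral_2_eq_2)
  have step: "odd (x i 0 - x i 1)"
    if jk: "j < n i" "k < n i" "x i k + 2 \<le> x i j" "{j, k} = {0, 1}" for j k
  proof -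
    let ?y = "x(i := (x i)(j := x i j - 1, k := x i k + 1))"
    have y: "?y \<in> \<Phi>" using move[OF less.prems i(1) jk(1,2)] jk by auto
    have "nat (\<Sum>l<n i. (?y i l)\<^sup>2) < nat (\<Sum>l<n i. (x i l)\<^sup>2)"
      using sum_of_squares_move[of j i k x, OF jk(1-3)] sum_nonneg[of "{..<n i}" "\<lambda>l. (?y i l)\<^sup>2"]
      unfolding fun_upd_same by (simp only: nat_less_eq_zless zero_le_power2)
    from less.hyps[OF this y] show ?thesis using jk(4) by (auto simp: doubleton_eq_iff)
  qed
  show ?case
  proof (rule ccontr)
    assume even: "\<not> odd (x i 0 - x i 1)"
    show False
    proof (cases "x i 0 = x i 1")
      case True
      have "twin_above i x" unfolding twin_above_def sum2 using True i by (intro exI[of _ 0] exI[of _ 1]) simp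
      moreover have "twin_below i x" unfolding twin_below_def sum2 using True i by (intro exI[of _ 0] exI[of _ 1]) simp
      ultimately show False using twin_above_below[OF i(1) less.prems less.prems] by blast
    next
      case False
      then have "x i 1 + 2 \<le> x i 0 \<or> x i 0 + 2 \<le> x i 1" using even by presburger
      then show False using step[of 0 1] step[of 1 0] i even by (auto simp: insert_commute)
    qed
  qed
qed

text \<open>A weight with least sum of squares admits no lowering move, so it is flat in all factors
  at once and is a tuple of signed unit vectors. Its Weyl orbit is a copy of the product of the
  index sets, with signs independent of the positions \<open>s\<close>; the constructions that
  follow take place on this orbit.\<close>

lemma cells:
  obtains \<sigma> :: "'i \<Rightarrow> int" where "\<And>i. i \<in> A \<Longrightarrow> \<sigma> i = 1 \<or> \<sigma> i = -1"
    "\<And>s. (\<And>i. i \<in> A \<Longrightarrow> s i < n i) \<Longrightarrow> (\<lambda>i j. if j = s i then \<sigma> i else 0) \<in> \<Phi>"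
proof -
  define m where "m = (\<lambda>x :: 'i \<Rightarrow> nat \<Rightarrow> int. nat (\<Sum>i\<in>A. \<Sum>l<n i. (x i l)\<^sup>2))"
  obtain x where x: "x \<in> \<Phi>" "\<And>y. y \<in> \<Phi> \<Longrightarrow> m x \<le> m y"
    using ex_has_least_nat[of "\<lambda>x. x \<in> \<Phi>" _ m] nonempty by blast
  have flat: "x i j \<le> x i k + 1" if "i \<in> A" "j < n i" "k < n i" for i j k
  proof (rule ccontr)
    assume "\<not> ?thesis"
    then have gap: "x i k + 2 \<le> x i j" by simp
    let ?y = "x(i := (x i)(j := x i j - 1, k := x i k + 1))"
    have y: "?y \<in> \<Phi>" using move[OF x(1) that] gap by auto
    have "(\<Sum>i'\<in>A. \<Sum>l<n i'. (?y i' l)\<^sup>2) < (\<Sum>i'\<in>A. \<Sum>l<n i'. (x i' l)\<^sup>2)"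
    proof (rule sum_strict_mono_ex1[OF finite_A])
      show "\<forall>i'\<in>A. (\<Sum>l<n i'. (?y i' l)\<^sup>2) \<le> (\<Sum>l<n i'. (x i' l)\<^sup>2)"
      proof
        fix i' assume "i' \<in> A"
        show "(\<Sum>l<n i'. (?y i' l)\<^sup>2) \<le> (\<Sum>l<n i'. (x i' l)\<^sup>2)"
        proof (cases "i' = i")
          case True
          show ?thesis using sum_of_squares_move[of j i k x, OF that(2,3) gap] unfolding True fun_upd_same by simp
        qed simp
      qed
      show "\<exists>i'\<in>A. (\<Sum>l<n i'. (?y i' l)\<^sup>2) < (\<Sum>l<n i'. (x i' l)\<^sup>2)"
        by (rule bexI[OF _ that(1)]) (use sum_of_squares_move[of j i k x, OF that(2,3) gap] in \<open>simp only: fun_upd_same\<close>)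
    qed
    moreover have "0 \<le> (\<Sum>i'\<in>A. \<Sum>l<n i'. (?y i' l)\<^sup>2)" by (intro sum_nonneg) simp
    ultimately have "m ?y < m x" unfolding m_def by (simp only: nat_less_eq_zless)
    then show False using x(2)[OF y] by simp
  qed
  have "\<exists>\<sigma> c s. (\<sigma> = 1 \<or> \<sigma> = -1) \<and> s < n i \<and> (\<forall>j<n i. x i j = c + (if j = s then \<sigma> else 0))"
    if i: "i \<in> A" for i
  proof (cases "2 \<le> n i")
    case True
    then show ?thesis using nearly_constant_type[OF i True x(1)] flat[OF i] by blast
  next
    case False
    then have "n i = 1" using n_pos[OF i] by simp
    then show ?thesis by (intro exI[of _ 1] exI[of _ "x i 0 - 1"] exI[of _ 0]) simp
  qed
  then obtain \<sigma> c s0 where *: "\<And>i. i \<in> A \<Longrightarrow> (\<sigma> i = 1 \<or> \<sigma> i = -1) \<and> s0 i < n i \<and>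
      (\<forall>j<n i. x i j = c i + (if j = s0 i then \<sigma> i else 0))"
    by metis
  show ?thesis
  proof (rule that[of \<sigma>])
    show "\<sigma> i = 1 \<or> \<sigma> i = -1" if "i \<in> A" for i using * that by blast
    show "(\<lambda>i j. if j = s i then \<sigma> i else 0) \<in> \<Phi>" if s: "\<And>i. i \<in> A \<Longrightarrow> s i < n i" for s
    proof -
      define g where "g = (\<lambda>i. transpose (s0 i) (s i))"
      have "(\<lambda>i j. x i (g i j)) \<in> \<Phi>"
        by (rule permute[OF _ x(1)]) (unfold g_def, rule permutes_swap_id, use * s in auto)
      then show ?thesis
      proof (rule shift)
        show "\<forall>i\<in>A. \<exists>c. \<forall>j<n i. (if j = s i then \<sigma> i else 0) = x i (g i j) + c"
        proof
          fix i assume i: "i \<in> A"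
          have "(if j = s i then \<sigma> i else 0) = x i (g i j) + (- c i)" if "j < n i" for j
          proof -
            have "g i j < n i" using that * [OF i] s[OF i] by (auto simp: g_def transpose_def)
            moreover have "g i j = s0 i \<longleftrightarrow> j = s i" by (auto simp: g_def transpose_def)
            ultimately show ?thesis using *[OF i] by simp
          qed
          then show "\<exists>c. \<forall>j<n i. (if j = s i then \<sigma> i else 0) = x i (g i j) + c" by blast
        qed
      qed
    qed
  qed
qed

text \<open>A probabilistic form of \<open>level_contradiction\<close> on the weights of
  \<open>cells\<close>: under \<open>p\<close> the value of \<open>f i\<close> at the chosen
  position has the law it has for a uniformly chosen index, and yet the sum over all factors is
  identically zero. Such couplings are then built from coincidences between the numbers
  \<open>n i\<close>.\<close>

lemma coupling_contradiction:
  fixes f :: "'i \<Rightarrow> nat \<Rightarrow> rat" and p :: "'k \<Rightarrow> rat"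
  assumes sum0: "\<And>i. i \<in> A \<Longrightarrow> (\<Sum>j<n i. f i j) = 0"
    and nz: "i0 \<in> A" "j0 < n i0" "f i0 j0 \<noteq> 0"
    and K: "finite K" "\<And>k. k \<in> K \<Longrightarrow> 0 \<le> p k" "sum p K = 1"
    and s: "\<And>k i. k \<in> K \<Longrightarrow> i \<in> A \<Longrightarrow> s k i < n i"
    and orth: "\<And>k. k \<in> K \<Longrightarrow> (\<Sum>i\<in>A. f i (s k i)) = 0"
    and lev: "\<And>i v. i \<in> A \<Longrightarrow> (\<Sum>k\<in>K. if f i (s k i) = v then p k else 0) =
       of_nat (card {j. j < n i \<and> f i j = v}) / of_nat (n i)"
  shows False
proof -
  obtain \<sigma> :: "'i \<Rightarrow> int" where \<sigma>: "\<And>i. i \<in> A \<Longrightarrow> \<sigma> i = 1 \<or> \<sigma> i = -1"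
    "\<And>s. (\<And>i. i \<in> A \<Longrightarrow> s i < n i) \<Longrightarrow> (\<lambda>i j. if j = s i then \<sigma> i else 0) \<in> \<Phi>"
    using cells by blast
  \<comment> \<open>The signs of the unit vectors are absorbed into the functional.\<close>
  define u where "u = (\<lambda>i j. of_int (\<sigma> i) * f i j)"
  have one: "(\<Sum>j<n i. u i j * of_int (if j = t then \<sigma> i else 0)) = f i t" if "i \<in> A" "t < n i" for i t
  proof -
    have "(\<Sum>j<n i. u i j * of_int (if j = t then \<sigma> i else 0)) = (\<Sum>j<n i. if j = t then f i j else 0)"
      using \<sigma>(1)[OF that(1)] by (intro sum.cong) (auto simp: u_def)
    then show ?thesis using that by simp
  qed
  show False
  proof (rule level_contradiction[of u i0 j0 K "\<lambda>k i j. if j = s k i then \<sigma> i else 0" p "\<lambda>i. of_int (\<sigma> i) / of_nat (n i)"])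
    show "(\<Sum>j<n i. u i j) = 0" if "i \<in> A" for i
      using sum0[OF that] by (simp add: u_def sum_distrib_left[symmetric])
    show "u i0 j0 \<noteq> 0" using nz \<sigma>(1)[OF nz(1)] by (auto simp: u_def)
    show "(\<lambda>i j. if j = s k i then \<sigma> i else 0) \<in> \<Phi> \<and> 0 \<le> p k" if "k \<in> K" for k
      using \<sigma>(2)[of "s k"] s[OF that] K(2)[OF that] by simp
    show "(\<Sum>i\<in>A. \<Sum>j<n i. u i j * of_int (if j = s k i then \<sigma> i else 0)) = 0" if "k \<in> K" for k
    proof -
      have "(\<Sum>i\<in>A. \<Sum>j<n i. u i j * of_int (if j = s k i then \<sigma> i else 0)) = (\<Sum>i\<in>A. f i (s k i))"
        using one s[OF that] by (intro sum.cong[OF refl]) blast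
      then show ?thesis using orth[OF that] by simp
    qed
    show "(\<Sum>k\<in>K. p k * (\<Sum>j | j < n i \<and> u i j = v. of_int (if j = s k i then \<sigma> i else 0))) =
        of_int (\<sigma> i) / of_nat (n i) * of_nat (card {j. j < n i \<and> u i j = v})" if i: "i \<in> A" for i v
    proof -
      define w where "w = of_int (\<sigma> i) * v"
      have uv: "u i j = v \<longleftrightarrow> f i j = w" for j using \<sigma>(1)[OF i] by (auto simp: u_def w_def)
      have "(\<Sum>j | j < n i \<and> u i j = v. of_int (if j = s k i then \<sigma> i else 0)) =
          (if f i (s k i) = w then of_int (\<sigma> i) else (0::rat))" if "k \<in> K" for k
      proof -
        have fin: "finite {j. j < n i \<and> u i j = v}" by simp
        have "(\<Sum>j | j < n i \<and> u i j = v. of_int (if j = s k i then \<sigma> i else 0)) =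
          (\<Sum>j | j < n i \<and> u i j = v. if j = s k i then of_int (\<sigma> i) else (0::rat))" by (intro sum.cong) auto
        also have "\<dots> = (if s k i \<in> {j. j < n i \<and> u i j = v} then of_int (\<sigma> i) else 0)"
          unfolding sum.delta[OF fin] ..
        finally show ?thesis using s[OF that i] by (simp add: uv)
      qed
      then have "(\<Sum>k\<in>K. p k * (\<Sum>j | j < n i \<and> u i j = v. of_int (if j = s k i then \<sigma> i else 0))) =
          (\<Sum>k\<in>K. of_int (\<sigma> i) * (if f i (s k i) = w then p k else 0))"
        by (intro sum.cong) auto
      also have "\<dots> = of_int (\<sigma> i) * (of_nat (card {j. j < n i \<and> f i j = w}) / of_nat (n i))"
        unfolding sum_distrib_left[symmetric] lev[OF i] ..
      finally show ?thesis by (simp add: uv)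
    qed
  qed (use nz K in auto)
qed

end

lemma card_two_levels:
  fixes v c d :: rat
  assumes "a \<le> m" "c \<noteq> d"
  shows "card {j. j < m \<and> (if j < a then c else d) = v} = (if v = c then a else if v = d then m - a else 0)"
proof -
  have "{j. j < m \<and> (if j < a then c else d) = v} = (if v = c then {..<a} else if v = d then {a..<m} else {})"
    using assms by auto
  then show ?thesis by simp
qed

lemma card_three_levels:
  fixes v :: rat
  assumes "2 * a \<le> m"
  shows "card {j. j < m \<and> (if j < a then 1 else if j < 2 * a then - 1 else 0) = v} =
    (if v = 1 \<or> v = -1 then a else if v = 0 then m - 2 * a else 0)"
proof -
  have "{j. j < m \<and> (if j < a then 1 else if j < 2 * a then - 1 else 0) = v} =
    (if v = 1 then {..<a} else if v = -1 then {a..<2*a} else if v = 0 then {2*a..<m} else {})"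
    using assms by auto
  then show ?thesis by simp
qed

lemma sum_two_levels:
  fixes c d :: rat
  assumes "a \<le> m"
  shows "(\<Sum>j<m. if j < a then c else d) = of_nat a * c + of_nat (m - a) * d"
proof -
  have *: "{..<a} \<union> {a..<m} = {..<m}" using assms by auto
  have "(\<Sum>j<m. if j < a then c else d) = (\<Sum>j<a. if j < a then c else d) + (\<Sum>j=a..<m. if j < a then c else d)"
    unfolding *[symmetric] by (rule sum.union_disjoint) auto
  also have "(\<Sum>j<a. if j < a then c else d) = of_nat a * c" by simp
  also have "(\<Sum>j=a..<m. if j < a then c else d) = of_nat (m - a) * d" by simp
  finally show ?thesis .
qed

section \<open>Arithmetic restrictions on the sizes of the factors\<close>

context nondegenerate_configuration
begin

text \<open>For a common divisor \<open>g\<close> both index sets contain a subset of proportion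
  exactly \<open>1 / g\<close>. Taking the centred indicator of the one and minus the centred
  indicator of the other, the coupling in which the two events coincide has sum zero.\<close>

lemma pairwise_coprime:
  assumes "i \<in> A" "i' \<in> A" "i \<noteq> i'" "2 \<le> n i" "2 \<le> n i'"
  shows "coprime (n i) (n i')"
proof (rule ccontr)
  assume "\<not> coprime (n i) (n i')"
  define g where "g = gcd (n i) (n i')"
  have "g \<noteq> 1" "g \<noteq> 0" using \<open>\<not> coprime _ _\<close> assms by (auto simp: g_def coprime_iff_gcd_eq_1)
  then have g2: "2 \<le> g" by simp
  define a where "a = (\<lambda>l. n l div g)"
  have an: "n l = g * a l" "1 \<le> a l" if "l \<in> {i, i'}" for l
  proof -
    have "g dvd n l" using that by (auto simp: g_def)
    then show "n l = g * a l" by (simp add: a_def)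
    then show "1 \<le> a l" using that assms by (cases "a l") auto
  qed
  have al: "a l < n l - 0" "a l \<le> n l - 1" if "l \<in> {i, i'}" for l
  proof -
    have "2 * a l \<le> g * a l" using g2 by (rule mult_right_mono) simp
    then have "2 * a l \<le> n l" using an(1)[OF that] by simp
    then show "a l < n l - 0" "a l \<le> n l - 1" using an(2)[OF that] by linarith+
  qed
  define r :: rat where "r = 1 / of_nat g"
  have r: "0 < r" "r \<le> 1 / 2" using g2 by (auto simp: r_def field_simps)
  have anr: "of_nat (a l) = r * of_nat (n l)" if "l \<in> {i, i'}" for l
    using an(1)[OF that] g2 by (simp add: r_def)
  define e where "e = (\<lambda>l. if l = i then 1 else -1 :: rat)"
  define f where "f = (\<lambda>l j. if l \<in> {i, i'} then if j < a l then e l * (1 - r) else - e l * r else 0)"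
  have e: "e l = 1 \<or> e l = -1" for l by (simp add: e_def)
  \<comment> \<open>Two atoms: \<open>True\<close>, of probability \<open>r\<close>, takes index
    \<open>0\<close>, which lies in both subsets; \<open>False\<close> takes the last index, which
    lies in neither.\<close>
  show False
  proof (rule coupling_contradiction[of f i 0 UNIV "\<lambda>b. if b then r else 1 - r" "\<lambda>b l. if b then 0 else n l - 1"])
    show "(\<Sum>j<n l. f l j) = 0" if "l \<in> A" for l
    proof (cases "l \<in> {i, i'}")
      case True
      have "(\<Sum>j<n l. f l j) = of_nat (a l) * (e l * (1 - r)) + of_nat (n l - a l) * (- e l * r)"
        using sum_two_levels[of "a l" "n l" "e l * (1 - r)" "- e l * r"] al[OF True] True by (simp add: f_def)
      also have "\<dots> = 0" using al[OF True] anr[OF True] by (simp add: of_nat_diff algebra_simps)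
      finally show ?thesis .
    qed (auto simp: f_def)
    show "f i 0 \<noteq> 0" using an[of i] r by (simp add: f_def e_def)
    show "(\<Sum>l\<in>A. f l (if b then 0 else n l - 1)) = 0" for b
    proof -
      have "(\<Sum>l\<in>A. f l (if b then 0 else n l - 1)) = (\<Sum>l\<in>{i, i'}. f l (if b then 0 else n l - 1))"
        using assms finite_A by (intro sum.mono_neutral_right) (auto simp: f_def)
      also have "\<dots> = 0" using assms(3) an[of i] an[of i'] al[of i] al[of i'] by (cases b) (auto simp: f_def e_def)
      finally show ?thesis .
    qed
    show "(\<Sum>b\<in>UNIV. if f l (if b then 0 else n l - 1) = v then if b then r else 1 - r else 0) =
      of_nat (card {j. j < n l \<and> f l j = v}) / of_nat (n l)" if "l \<in> A" for l v
    proof (cases "l \<in> {i, i'}")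
      case True
      have ne: "e l * (1 - r) \<noteq> - e l * r" using e[of l] r by (auto simp: algebra_simps)
      have "card {j. j < n l \<and> f l j = v} = (if v = e l * (1 - r) then a l else if v = - e l * r then n l - a l else 0)"
        using card_two_levels[of "a l" "n l" "e l * (1 - r)" "- e l * r" v] al[OF True] ne True by (simp add: f_def)
      moreover have "f l 0 = e l * (1 - r)" "f l (n l - 1) = - e l * r"
        using True an[OF True] al[OF True] by (auto simp: f_def)
      moreover have "of_nat (n l - a l) / of_nat (n l) = 1 - r" "of_nat (a l) / of_nat (n l) = r"
        using al[OF True] anr[OF True] n_pos[OF that] by (auto simp: of_nat_diff field_simps)
      ultimately show ?thesis using ne by (auto simp: UNIV_bool)
    next
      case False
      then have "{j. j < n l \<and> f l j = v} = (if v = 0 then {..<n l} else {})" by (auto simp: f_def)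
      then show ?thesis using False n_pos[OF that] by (auto simp: UNIV_bool f_def)
    qed
  qed (use r n_pos assms in \<open>auto simp: UNIV_bool Suc_le_eq\<close>)
qed

text \<open>Three variables with values \<open>1\<close>, \<open>-1\<close>, \<open>0\<close> of
  probabilities \<open>q\<close>, \<open>q\<close>, \<open>1 - 2 * q\<close> are coupled so that at
  each atom either all vanish or exactly two are nonzero and opposite. The pair weights solve
  \<open>p12 + p13 = q i1\<close> and its two analogues. They are nonnegative by the triangle
  inequality, and the zero atom keeps a nonnegative weight since each \<open>q\<close> is at most
  one third.\<close>

lemma at_most_two_large_factors:
  assumes "i1 \<in> A" "i2 \<in> A" "i3 \<in> A" "i1 \<noteq> i2" "i1 \<noteq> i3" "i2 \<noteq> i3" "3 \<le> n i1" "3 \<le> n i2" "3 \<le> n i3"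
  shows False
proof -
  define B where "B = {i1, i2, i3}"
  have BA: "B \<subseteq> A" and B3: "\<And>l. l \<in> B \<Longrightarrow> 3 \<le> n l" using assms by (auto simp: B_def)
  \<comment> \<open>Rounding a third of \<open>n l\<close> down keeps the proportions between one
    sixth and one third, and any two numbers of that interval have a sum at least as large as a
    third one.\<close>
  define a where "a = (\<lambda>l. n l div 3)"
  have a: "1 \<le> a l" "3 * a l \<le> n l" "n l \<le> 6 * a l" if "l \<in> B" for l
    using B3[OF that] unfolding a_def by presburger+
  define q where "q = (\<lambda>l. of_nat (a l) / of_nat (n l) :: rat)"
  have q: "1/6 \<le> q l" "q l \<le> 1/3" if "l \<in> B" for l
  proof -
    have "of_nat (n l) \<le> (of_nat (6 * a l) :: rat)" "of_nat (3 * a l) \<le> (of_nat (n l) :: rat)"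
      using a[OF that] by (auto simp only: of_nat_le_iff)
    then show "1/6 \<le> q l" "q l \<le> 1/3" using B3[OF that] by (auto simp: q_def field_simps)
  qed
  define p12 where "p12 = (q i1 + q i2 - q i3) / 2"
  define p13 where "p13 = (q i1 + q i3 - q i2) / 2"
  define p23 where "p23 = (q i2 + q i3 - q i1) / 2"
  define p where "p = [p12, p12, p13, p13, p23, p23, 1 - (q i1 + q i2 + q i3)]"
  \<comment> \<open>The list for \<open>l\<close> gives the values of \<open>f l\<close> at the
    seven atoms in the order of \<open>p\<close>: two opposite atoms for each pair of factors, then
    the zero atom. At each atom the values for the three factors sum to zero.\<close>
  define E where "E = (\<lambda>l. if l = i1 then [1,-1,1,-1,0,0,0] else if l = i2 then [-1,1,0,0,1,-1,0]
     else if l = i3 then [0,0,-1,1,-1,1,0] else replicate 7 (0::rat))"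
  define f where "f = (\<lambda>l j. if l \<in> B then if j < a l then 1 else if j < 2 * a l then -1 else 0 else 0 :: rat)"
  \<comment> \<open>One index for each value of \<open>f l\<close>: the level sets are the blocks
    starting at \<open>0\<close>, \<open>a l\<close> and \<open>2 * a l\<close>.\<close>
  define s where "s = (\<lambda>k l. if E l ! k = 1 then 0 else if E l ! k = -1 then a l else if l \<in> B then 2 * a l else (0::nat))"
  have k7: "k \<in> {..<7} \<longleftrightarrow> k = 0 \<or> k = 1 \<or> k = 2 \<or> k = 3 \<or> k = 4 \<or> k = 5 \<or> k = (6::nat)" for k by auto
  have E01: "E l ! k \<in> {1, -1, 0}" if "k \<in> {..<7}" for k l
    using that unfolding k7 E_def by (elim disjE) auto
  have fs: "f l (s k l) = E l ! k" if "k \<in> {..<7}" for k l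
  proof (cases "l \<in> B")
    case True
    then show ?thesis using E01[OF that, of l] a[OF True] by (auto simp: f_def s_def)
  next
    case False
    then have "E l ! k = 0" using that unfolding k7 by (elim disjE) (auto simp: E_def B_def)
    then show ?thesis using False by (simp add: f_def)
  qed
  have sum7: "(\<Sum>k<7. g k) = g 0 + g 1 + g 2 + g 3 + g 4 + g 5 + g (6::nat)" for g :: "nat \<Rightarrow> rat"
    by (simp add: eval_nat_numeral)
  show False
  proof (rule coupling_contradiction[of f i1 0 "{..<7}" "\<lambda>k. p ! k" s])
    show "(\<Sum>j<n l. f l j) = 0" if "l \<in> A" for l
    proof (cases "l \<in> B")
      case True
      have "(\<Sum>j<n l. f l j) = (\<Sum>j<n l. if j < 2 * a l then (if j < a l then 1 else -1) else 0)"
        using True by (intro sum.cong) (auto simp: f_def)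
      also have "\<dots> = (\<Sum>j<2 * a l. if j < a l then 1 else -1)"
        using a[OF True] by (intro sum.mono_neutral_cong_right) auto
      also have "\<dots> = 0" using sum_two_levels[of "a l" "2 * a l" 1 "-1"] by simp
      finally show ?thesis .
    qed (simp add: f_def)
    show "f i1 0 \<noteq> 0" using a[of i1] by (simp add: f_def B_def)
    show "0 \<le> p ! k" if "k \<in> {..<7}" for k
      using that q[of i1] q[of i2] q[of i3] unfolding k7
      by (elim disjE) (auto simp: p_def p12_def p13_def p23_def B_def)
    show "sum ((!) p) {..<7} = 1" unfolding sum7 by (simp add: p_def p12_def p13_def p23_def field_simps)
    show "s k l < n l" if "k \<in> {..<7}" "l \<in> A" for k l
    proof (cases "l \<in> B")
      case True
      then show ?thesis using a[OF True] by (auto simp: s_def)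
    next
      case False
      then have "E l ! k = 0" using that(1) unfolding k7 by (elim disjE) (auto simp: E_def B_def)
      then show ?thesis using False n_pos[OF that(2)] by (simp add: s_def)
    qed
    show "(\<Sum>l\<in>A. f l (s k l)) = 0" if "k \<in> {..<7}" for k
    proof -
      have "(\<Sum>l\<in>A. f l (s k l)) = (\<Sum>l\<in>B. f l (s k l))"
        using BA finite_A by (intro sum.mono_neutral_right) (auto simp: f_def)
      also have "\<dots> = (\<Sum>l\<in>B. E l ! k)" using fs[OF that] by simp
      also have "\<dots> = E i1 ! k + E i2 ! k + E i3 ! k" using assms(4-6) by (simp add: B_def)
      also have "\<dots> = 0" using that assms(4-6) unfolding k7 by (elim disjE) (auto simp: E_def)
      finally show ?thesis .
    qed
    show "(\<Sum>k<7. if f l (s k l) = v then p ! k else 0) = of_nat (card {j. j < n l \<and> f l j = v}) / of_nat (n l)"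
      if "l \<in> A" for l v
    proof (cases "l \<in> B")
      case True
      have "card {j. j < n l \<and> f l j = v} = (if v = 1 \<or> v = -1 then a l else if v = 0 then n l - 2 * a l else 0)"
        using card_three_levels[of "a l" "n l" v] a[OF True] True by (simp add: f_def)
      then have "of_nat (card {j. j < n l \<and> f l j = v}) / of_nat (n l) =
          (if v = 1 \<or> v = -1 then q l else if v = 0 then 1 - 2 * q l else 0)"
        using a[OF True] n_pos[OF that] by (simp add: q_def of_nat_diff diff_divide_distrib)
      moreover have "(\<Sum>k<7. if f l (s k l) = v then p ! k else 0) = (\<Sum>k<7. if E l ! k = v then p ! k else 0)"
        using fs by (intro sum.cong) auto
      moreover have "(\<Sum>k<7. if E l ! k = v then p ! k else 0) =
          (if v = 1 \<or> v = -1 then q l else if v = 0 then 1 - 2 * q l else 0)"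
      proof -
        consider "v = 1" | "v = -1" | "v = 0" | "v \<noteq> 1 \<and> v \<noteq> -1 \<and> v \<noteq> 0" by blast
        then show ?thesis using True assms(4-6) unfolding sum7 B_def
          by cases (auto simp: E_def p_def p12_def p13_def p23_def field_simps)
      qed
      ultimately show ?thesis by simp
    next
      case False
      then have "{j. j < n l \<and> f l j = v} = (if v = 0 then {..<n l} else {})" by (auto simp: f_def)
      moreover have "(\<Sum>k<7. p ! k) = 1" unfolding sum7 by (simp add: p_def p12_def p13_def p23_def field_simps)
      ultimately show ?thesis using False n_pos[OF that] by (auto simp: f_def)
    qed
  qed (use assms in auto)
qed

end

text \<open>A set that is a union of fibres of both maps has mass \<open>card P / m\<close> and also
  \<open>card Q / k\<close>; for coprime \<open>m\<close> and \<open>k\<close> this forces an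
  integer. Only masses are compared, so \<open>c\<close> may be signed.\<close>

lemma uniform_fibres_union:
  fixes c :: "'a \<Rightarrow> rat"
  assumes fin: "finite S" and cop: "coprime m k" and m: "1 \<le> m" and k: "1 \<le> k"
    and fm: "\<And>j. j < m \<Longrightarrow> (\<Sum>x\<in>S. if js x = j then c x else 0) = 1 / of_nat m"
    and fk: "\<And>l. l < k \<Longrightarrow> (\<Sum>x\<in>S. if ks x = l then c x else 0) = 1 / of_nat k"
    and P: "P \<subseteq> {..<m}" "P \<noteq> {}" and Q: "Q \<subseteq> {..<k}"
    and PQ: "\<And>x. x \<in> S \<Longrightarrow> js x \<in> P \<longleftrightarrow> ks x \<in> Q"
  shows "P = {..<m} \<and> Q = {..<k}"
proof -
  have union: "(\<Sum>x\<in>S. if g x \<in> R then c x else 0) = of_nat (card R) / of_nat r"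
    if f: "\<And>j. j < r \<Longrightarrow> (\<Sum>x\<in>S. if g x = j then c x else 0) = 1 / of_nat r" and R: "R \<subseteq> {..<r}"
    for g :: "'a \<Rightarrow> nat" and R r
  proof -
    have "finite R" using R finite_subset by blast
    have "(\<Sum>x\<in>S. if g x \<in> R then c x else 0) = (\<Sum>x\<in>S. \<Sum>j\<in>R. if g x = j then c x else 0)"
      using \<open>finite R\<close> by (intro sum.cong) auto
    also have "\<dots> = (\<Sum>j\<in>R. \<Sum>x\<in>S. if g x = j then c x else 0)" by (rule sum.swap)
    also have "\<dots> = (\<Sum>j\<in>R. 1 / of_nat r)" using f R by (intro sum.cong) auto
    finally show ?thesis by simp
  qed
  have "(\<Sum>x\<in>S. if js x \<in> P then c x else 0) = (\<Sum>x\<in>S. if ks x \<in> Q then c x else 0)"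
    using PQ by (intro sum.cong) auto
  moreover have "(\<Sum>x\<in>S. if js x \<in> P then c x else 0) = of_nat (card P) / of_nat m"
    by (rule union) (use fm P in auto)
  moreover have "(\<Sum>x\<in>S. if ks x \<in> Q then c x else 0) = of_nat (card Q) / of_nat k"
    by (rule union) (use fk Q in auto)
  ultimately have "of_nat (card P) / of_nat m = (of_nat (card Q) / of_nat k :: rat)" by simp
  then have "of_nat (card P * k) = (of_nat (card Q * m) :: rat)" using m k by (simp add: field_simps)
  then have eq: "card P * k = card Q * m" by (simp only: of_nat_eq_iff)
  have cP: "card P \<noteq> 0" "card P \<le> m" using P card_mono[OF _ P(1)] finite_subset[OF P(1)] by auto
  have "m dvd card P * k" unfolding eq by simp
  then have "m dvd card P" using cop by (simp add: coprime_dvd_mult_left_iff)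
  then have cm: "card P = m" using cP by (simp add: dvd_imp_le le_antisym)
  then have "card Q = k" using eq m by (simp add: mult.commute)
  then show ?thesis using cm P(1) Q by (simp add: card_subset_eq)
qed

text \<open>For \<open>t = 0\<close> the level set of \<open>v\<close> at \<open>v 0\<close> and
  that of \<open>w\<close> at \<open>- v 0\<close> have the same preimage, so both functions are
  constant and hence zero. For \<open>t \<noteq> 0\<close> the same argument is applied to classes
  modulo \<open>2 * t\<close>, and summation over all indices then produces a contradiction of
  parities.\<close>

lemma bipartite_rigidity:
  fixes c :: "'a \<Rightarrow> rat"
  assumes fin: "finite S" and cop: "coprime m k" and m: "1 \<le> m" and k: "1 \<le> k"
    and js: "\<And>x. x \<in> S \<Longrightarrow> js x < m" and ks: "\<And>x. x \<in> S \<Longrightarrow> ks x < k"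
    and fm: "\<And>j. j < m \<Longrightarrow> (\<Sum>x\<in>S. if js x = j then c x else 0) = 1 / of_nat m"
    and fk: "\<And>l. l < k \<Longrightarrow> (\<Sum>x\<in>S. if ks x = l then c x else 0) = 1 / of_nat k"
    and v: "(\<Sum>j<m. v j) = 0" and w: "(\<Sum>l<k. w l) = 0"
    and eq: "\<And>x. x \<in> S \<Longrightarrow> v (js x) + w (ks x) + t * of_int (z x) = (0::rat)"
    and odd: "t \<noteq> 0 \<Longrightarrow> odd m \<and> odd k \<and> (\<forall>x\<in>S. odd (z x))"
  shows "t = 0 \<and> (\<forall>j<m. v j = 0) \<and> (\<forall>l<k. w l = 0)"
proof (cases "t = 0")
  case True
  define P where "P = {j. j < m \<and> v j = v 0}"
  define Q where "Q = {l. l < k \<and> w l = - v 0}"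
  have "P = {..<m} \<and> Q = {..<k}"
  proof (rule uniform_fibres_union[OF fin cop m k fm fk])
    show "js x \<in> P \<longleftrightarrow> ks x \<in> Q" if "x \<in> S" for x
      using eq[OF that] js[OF that] ks[OF that] True by (auto simp: P_def Q_def)
    have "0 \<in> P" using m by (simp add: P_def)
    then show "P \<noteq> {}" by blast
  qed (auto simp: P_def Q_def)
  then have vw: "\<forall>j<m. v j = v 0" "\<forall>l<k. w l = - v 0" unfolding P_def Q_def by blast+
  have "(\<Sum>j<m. v j) = (\<Sum>j<m. v 0)" by (intro sum.cong refl) (use vw(1) in blast)
  then have v0: "v 0 = 0" using v m by simp
  show ?thesis using vw True unfolding v0 by simp
next
  case False
  \<comment> \<open>Because \<open>z\<close> is odd, \<open>t * z\<close> is congruent to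
    \<open>t\<close> modulo \<open>2 * t\<close>, so the class of \<open>v 0\<close> on one side
    corresponds to the class of \<open>t - v 0\<close> on the other.\<close>
  define P where "P = {j. j < m \<and> (\<exists>q::int. v j = v 0 + 2 * t * of_int q)}"
  define Q where "Q = {l. l < k \<and> (\<exists>q::int. w l = - v 0 + t * of_int (2 * q + 1))}"
  have all: "P = {..<m} \<and> Q = {..<k}"
  proof (rule uniform_fibres_union[OF fin cop m k fm fk])
    show "js x \<in> P \<longleftrightarrow> ks x \<in> Q" if "x \<in> S" for x
    proof -
      have "odd (z x)" using odd[OF False] that by blast
      then obtain h where h: "z x = 2 * h + 1" by (auto elim: oddE)
      have e: "v (js x) = - w (ks x) - t * of_int (2 * h + 1)" using eq[OF that] h by (simp add: algebra_simps)
      show ?thesis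
      proof
        assume "js x \<in> P"
        then obtain q where "v (js x) = v 0 + 2 * t * of_int q" by (auto simp: P_def)
        then have "w (ks x) = - v 0 + t * of_int (2 * (- q - h - 1) + 1)" using e by (simp add: algebra_simps)
        then show "ks x \<in> Q" using ks[OF that] unfolding Q_def by blast
      next
        assume "ks x \<in> Q"
        then obtain q where "w (ks x) = - v 0 + t * of_int (2 * q + 1)" by (auto simp: Q_def)
        then have "v (js x) = v 0 + 2 * t * of_int (- q - h - 1)" using e by (simp add: algebra_simps)
        then show "js x \<in> P" using js[OF that] unfolding P_def by blast
      qed
    qed
    have "0 \<in> P" using m by (auto simp: P_def intro!: exI[of _ 0])
    then show "P \<noteq> {}" by blast
  qed (auto simp: P_def Q_def)
  then have "\<forall>j<m. \<exists>q::int. v j = v 0 + 2 * t * of_int q" "\<forall>l<k. \<exists>q::int. w l = - v 0 + t * of_int (2 * q + 1)"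
    unfolding P_def Q_def by blast+
  then obtain q r :: "nat \<Rightarrow> int" where qr: "\<And>j. j < m \<Longrightarrow> v j = v 0 + 2 * t * of_int (q j)"
      "\<And>l. l < k \<Longrightarrow> w l = - v 0 + t * of_int (2 * r l + 1)"
    by metis
  define X Y where "X = (\<Sum>j<m. q j)" "Y = (\<Sum>l<k. r l)"
  have "0 = (\<Sum>j<m. v 0 + 2 * t * of_int (q j))"
    unfolding v[symmetric] by (intro sum.cong refl qr(1)) simp
  also have "\<dots> = of_nat m * v 0 + 2 * t * of_int X" by (simp add: sum.distrib X_Y_def sum_distrib_left)
  finally have 1: "of_nat m * v 0 = - (2 * t * of_int X)" by simp
  have "0 = (\<Sum>l<k. - v 0 + t * of_int (2 * r l + 1))"
    unfolding w[symmetric] by (intro sum.cong refl qr(2)) simp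
  also have "\<dots> = (\<Sum>l<k. (t - v 0) + 2 * t * of_int (r l))"
    by (intro sum.cong) (auto simp: algebra_simps)
  also have "\<dots> = of_nat k * (t - v 0) + 2 * t * of_int Y"
    by (simp add: sum.distrib X_Y_def sum_distrib_left)
  finally have 2: "of_nat k * v 0 = t * of_int (2 * Y + int k)" by (simp add: algebra_simps)
  \<comment> \<open>Eliminating \<open>v 0\<close> gives
    \<open>m * (2 * Y + k) = - 2 * X * k\<close>, whose left side is a product of odd
    numbers.\<close>
  have "of_nat m * (t * of_int (2 * Y + int k)) = of_nat k * (- (2 * t * of_int X))"
    unfolding 1[symmetric] 2[symmetric] by simp
  then have "t * of_int (int m * (2 * Y + int k)) = t * of_int (- (2 * X * int k))" by (simp add: algebra_simps)
  then have "(of_int (int m * (2 * Y + int k)) :: rat) = of_int (- (2 * X * int k))" by (simp only: mult_left_cancel[OF False])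
  then have "int m * (2 * Y + int k) = - (2 * X * int k)" by (simp only: of_int_eq_iff)
  then have "even (int m * (2 * Y + int k))" by simp
  then have False using odd[OF False] by simp
  then show ?thesis ..
qed

context nondegenerate_configuration
begin

text \<open>
  The coefficients \<open>c\<close> may be negative, so that \<open>bal\<close> alone does not contradict nondegeneracy.
\<close>

theorem rigidity:
  fixes u :: "'i \<Rightarrow> nat \<Rightarrow> rat" and c :: "'k \<Rightarrow> rat"
  assumes K: "finite K" "\<And>k. k \<in> K \<Longrightarrow> x k \<in> \<Phi>" "sum c K = 1"
    and bal: "\<And>i. i \<in> A \<Longrightarrow> \<exists>\<kappa>. \<forall>j<n i. (\<Sum>k\<in>K. c k * of_int (x k i j)) = \<kappa>"
    and sum0: "\<And>i. i \<in> A \<Longrightarrow> (\<Sum>j<n i. u i j) = 0"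
    and orth: "\<And>k. k \<in> K \<Longrightarrow> (\<Sum>i\<in>A. \<Sum>j<n i. u i j * of_int (x k i j)) = 0"
    and ij: "i \<in> A" "j < n i"
  shows "u i j = 0"
proof -
  define T where "T = {i\<in>A. 3 \<le> n i}"
  define U where "U = {i\<in>A. n i = 2}"
  have finTU: "finite T" "finite U" using finite_A by (auto simp: T_def U_def)
  have "\<exists>\<sigma>. (\<sigma> = 1 \<or> \<sigma> = -1) \<and> (\<forall>y\<in>\<Phi>. unit_type i \<sigma> y)" if "i \<in> T" for i
  proof (cases "\<exists>y\<in>\<Phi>. unit_type i 1 y")
    case True
    then show ?thesis using unit_type_uniform that by (auto simp: T_def)
  next
    case False
    then show ?thesis using unit_type_cases that by (auto simp: T_def)
  qed
  then obtain \<sigma> where \<sigma>: "\<And>i. i \<in> T \<Longrightarrow> \<sigma> i = 1 \<or> \<sigma> i = -1"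
      "\<And>i y. i \<in> T \<Longrightarrow> y \<in> \<Phi> \<Longrightarrow> unit_type i (\<sigma> i) y"
    by metis
  then have "\<exists>d s. s < n i \<and> (\<forall>j<n i. x k i j = d + (if j = s then \<sigma> i else 0))" if "i \<in> T" "k \<in> K" for i k
    using K(2)[OF that(2)] that(1) unfolding unit_type_def by blast
  then obtain d s where ds: "\<And>i k. i \<in> T \<Longrightarrow> k \<in> K \<Longrightarrow> s i k < n i"
      "\<And>i k j. i \<in> T \<Longrightarrow> k \<in> K \<Longrightarrow> j < n i \<Longrightarrow> x k i j = d i k + (if j = s i k then \<sigma> i else 0)"
    by metis
  \<comment> \<open>Balance of the entries in factor \<open>i\<close> says that all fibres of
    \<open>s i\<close> have the same mass; together they have mass one.\<close>
  have fib: "(\<Sum>k\<in>K. if s i k = j then c k else 0) = 1 / of_nat (n i)" if i: "i \<in> T" "j < n i" for i j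
  proof -
    obtain \<kappa> where \<kappa>: "\<And>j. j < n i \<Longrightarrow> (\<Sum>k\<in>K. c k * of_int (x k i j)) = \<kappa>"
      using bal[of i] i by (auto simp: T_def)
    define F where "F = (\<lambda>j. \<Sum>k\<in>K. if s i k = j then c k else 0)"
    have "\<kappa> = (\<Sum>k\<in>K. c k * of_int (d i k)) + of_int (\<sigma> i) * F j" if "j < n i" for j
    proof -
      have "\<kappa> = (\<Sum>k\<in>K. c k * of_int (d i k) + of_int (\<sigma> i) * (if s i k = j then c k else 0))"
        unfolding \<kappa>[OF that, symmetric] using ds(2)[OF i(1) _ that] by (intro sum.cong) (auto simp: algebra_simps)
      then show ?thesis by (simp add: sum.distrib sum_distrib_left F_def)
    qed
    then have "of_int (\<sigma> i) * F j' = of_int (\<sigma> i) * F j" if "j' < n i" for j'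
      using i(2) that by (metis add_left_cancel)
    then have Fj: "F j' = F j" if "j' < n i" for j' using \<sigma>(1)[OF i(1)] that by auto
    have "(\<Sum>j'<n i. F j') = (\<Sum>k\<in>K. \<Sum>j'<n i. if s i k = j' then c k else 0)"
      unfolding F_def by (rule sum.swap)
    also have "\<dots> = (\<Sum>k\<in>K. c k)" using ds(1)[OF i(1)] by (intro sum.cong) auto
    finally have "(\<Sum>j'<n i. F j') = 1" using K(3) by simp
    moreover have "(\<Sum>j'<n i. F j') = (\<Sum>j'<n i. F j)" using Fj by (intro sum.cong) auto
    ultimately have "of_nat (n i) * F j = 1" by simp
    then show ?thesis using i(2) by (simp add: F_def field_simps)
  qed
  have u2: "u i 1 = - u i 0" if "i \<in> U" for i
    using sum0[of i] that by (auto simp: U_def numeral_2_eq_2)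
  have u1: "u i j = 0" if "i \<in> A" "i \<notin> T" "i \<notin> U" "j < n i" for i j
  proof -
    have "n i = 1" using that n_pos[OF that(1)] unfolding T_def U_def by auto
    then show ?thesis using sum0[OF that(1)] that(4) by simp
  qed
  have key: "(\<Sum>i\<in>T. of_int (\<sigma> i) * u i (s i k)) + (\<Sum>i\<in>U. u i 0 * of_int (x k i 0 - x k i 1)) = 0"
    if k: "k \<in> K" for k
  proof -
    let ?g = "\<lambda>i. \<Sum>j<n i. u i j * of_int (x k i j)"
    have "(\<Sum>i\<in>A. ?g i) = (\<Sum>i\<in>T \<union> U. ?g i)"
      using finite_A u1 by (intro sum.mono_neutral_right) (auto simp: T_def U_def)
    also have "\<dots> = (\<Sum>i\<in>T. ?g i) + (\<Sum>i\<in>U. ?g i)"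
      using finTU by (intro sum.union_disjoint) (auto simp: T_def U_def)
    also have "(\<Sum>i\<in>T. ?g i) = (\<Sum>i\<in>T. of_int (\<sigma> i) * u i (s i k))"
    proof (rule sum.cong[OF refl])
      fix i assume i: "i \<in> T"
      have "?g i = (\<Sum>j<n i. u i j * of_int (d i k) + (if j = s i k then of_int (\<sigma> i) * u i j else 0))"
        using ds(2)[OF i k] by (intro sum.cong) (auto simp: algebra_simps)
      also have "\<dots> = (\<Sum>j<n i. u i j) * of_int (d i k) + of_int (\<sigma> i) * u i (s i k)"
        using ds(1)[OF i k] by (simp add: sum.distrib sum_distrib_right)
      finally show "?g i = of_int (\<sigma> i) * u i (s i k)" using sum0[of i] i by (simp add: T_def)
    qed
    also have "(\<Sum>i\<in>U. ?g i) = (\<Sum>i\<in>U. u i 0 * of_int (x k i 0 - x k i 1))"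
    proof (rule sum.cong[OF refl])
      fix i assume i: "i \<in> U"
      then have "n i = Suc (Suc 0)" by (simp add: U_def)
      then have "?g i = u i 0 * of_int (x k i 0) + u i 1 * of_int (x k i 1)" by simp
      then show "?g i = u i 0 * of_int (x k i 0 - x k i 1)" using u2[OF i] by (simp add: algebra_simps)
    qed
    finally show ?thesis using orth[OF k] by simp
  qed
  have "\<exists>B1 B2. T = B1 \<union> B2 \<and> B1 \<inter> B2 = {} \<and> (B1 = {} \<or> (\<exists>i. B1 = {i})) \<and> (B2 = {} \<or> (\<exists>i. B2 = {i}))"
  proof (cases "T = {}")
    case False
    then obtain i1 where i1: "i1 \<in> T" by auto
    show ?thesis
    proof (cases "T = {i1}")
      case True
      then show ?thesis by (intro exI[of _ T] exI[of _ "{}"]) auto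
    next
      case False
      then obtain i2 where i2: "i2 \<in> T" "i2 \<noteq> i1" using i1 by auto
      have "i3 = i1 \<or> i3 = i2" if "i3 \<in> T" for i3
        using at_most_two_large_factors[of i1 i2 i3] i1 i2 that by (auto simp: T_def)
      then have "T = {i1} \<union> {i2}" using i1 i2 by auto
      then show ?thesis using i2 by (intro exI[of _ "{i1}"] exI[of _ "{i2}"]) auto
    qed
  qed auto
  then obtain B1 B2 where B: "T = B1 \<union> B2" "B1 \<inter> B2 = {}" "B1 = {} \<or> (\<exists>i. B1 = {i})" "B2 = {} \<or> (\<exists>i. B2 = {i})"
    by blast
  have U1: "U = {} \<or> (\<exists>i. U = {i})"
  proof (rule ccontr)
    assume *: "\<not> ?thesis"
    then obtain i i' where "i \<in> U" "i' \<in> U" "i \<noteq> i'" by blast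
    then show False using pairwise_coprime[of i i'] by (simp add: U_def)
  qed
  \<comment> \<open>An absent large factor is replaced by an index set with one point and the zero
    function, so that there are always two slots.\<close>
  define N where "N = (\<lambda>B. if B = {} then 1 else n (the_elem B))"
  define J where "J = (\<lambda>B k. if B = {} then 0 else s (the_elem B) k)"
  define V where "V = (\<lambda>B j. if B = {} then 0 else of_int (\<sigma> (the_elem B)) * u (the_elem B) j)"
  have slot: "1 \<le> N B" "\<And>k. k \<in> K \<Longrightarrow> J B k < N B"
      "\<And>j. j < N B \<Longrightarrow> (\<Sum>k\<in>K. if J B k = j then c k else 0) = 1 / of_nat (N B)"
      "(\<Sum>j<N B. V B j) = 0" "\<And>k. V B (J B k) = (\<Sum>i\<in>B. of_int (\<sigma> i) * u i (s i k))"
      "(\<forall>j<N B. V B j = 0) \<Longrightarrow> \<forall>i\<in>B. \<forall>j<n i. u i j = 0"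
    if "B \<subseteq> T" "B = {} \<or> (\<exists>i. B = {i})" for B
  proof -
    consider "B = {}" | i where "B = {i}" "i \<in> T" using \<open>B \<subseteq> T\<close> \<open>B = {} \<or> _\<close> by blast
    note cs = this
    show "1 \<le> N B" using cs n_pos by cases (auto simp: N_def T_def)
    show "J B k < N B" if "k \<in> K" for k using cs ds(1)[OF _ that] by cases (auto simp: N_def J_def)
    show "(\<Sum>k\<in>K. if J B k = j then c k else 0) = 1 / of_nat (N B)" if "j < N B" for j
      using cs that fib K(3) by cases (auto simp: N_def J_def)
    show "(\<Sum>j<N B. V B j) = 0"
      using cs sum0 by cases (auto simp: N_def V_def T_def sum_distrib_left[symmetric])
    show "V B (J B k) = (\<Sum>i\<in>B. of_int (\<sigma> i) * u i (s i k))" for k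
      using cs by cases (auto simp: V_def J_def)
    show "\<forall>i\<in>B. \<forall>j<n i. u i j = 0" if "\<forall>j<N B. V B j = 0"
      using cs
    proof cases
      case (2 i)
      then show ?thesis using that \<sigma>(1)[OF 2(2)] by (auto simp: V_def N_def)
    qed simp
  qed
  have BT: "B1 \<subseteq> T" "B2 \<subseteq> T" using B by auto
  \<comment> \<open>The factor with two entries contributes \<open>t * z\<close>. If there is none,
    \<open>t\<close> is zero and the value of \<open>z\<close> is a placeholder.\<close>
  define t where "t = (if U = {} then 0 else u (the_elem U) 0)"
  define z where "z = (\<lambda>k. if U = {} then 1 else x k (the_elem U) 0 - x k (the_elem U) 1)"
  have tz: "t * of_int (z k) = (\<Sum>i\<in>U. u i 0 * of_int (x k i 0 - x k i 1))" for k
    using U1 by (auto simp: t_def z_def)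
  have cop: "coprime (N B1) (N B2)"
  proof (cases "B1 = {} \<or> B2 = {}")
    case True
    then show ?thesis by (auto simp: N_def)
  next
    case False
    then obtain i1 i2 where i12: "B1 = {i1}" "B2 = {i2}" using B by blast
    then have "i1 \<in> T" "i2 \<in> T" "i1 \<noteq> i2" using B(1,2) by auto
    then have "coprime (n i1) (n i2)" by (intro pairwise_coprime) (auto simp: T_def)
    then show ?thesis using i12 by (simp add: N_def)
  qed
  have oddN: "odd (N B)" if BB: "U \<noteq> {}" "B \<subseteq> T" "B = {} \<or> (\<exists>i. B = {i})" for B
  proof (cases "B = {}")
    case False
    then obtain i i0 where i: "B = {i}" "U = {i0}" using BB U1 by blast
    then have "i \<in> A" "3 \<le> n i" "i0 \<in> A" "n i0 = 2" using BB by (auto simp: T_def U_def)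
    then have "coprime (n i) 2" using pairwise_coprime[of i i0] by fastforce
    then show ?thesis using i by (simp add: N_def)
  qed (simp add: N_def)
  have "t = 0 \<and> (\<forall>j<N B1. V B1 j = 0) \<and> (\<forall>j<N B2. V B2 j = 0)"
  proof (rule bipartite_rigidity[OF K(1) cop])
    show "V B1 (J B1 k) + V B2 (J B2 k) + t * of_int (z k) = 0" if "k \<in> K" for k
      using key[OF that] finTU B(2) unfolding slot(5)[OF BT(1) B(3)] slot(5)[OF BT(2) B(4)] tz B(1)
      by (simp add: sum.union_disjoint)
    show "odd (N B1) \<and> odd (N B2) \<and> (\<forall>k\<in>K. odd (z k))" if "t \<noteq> 0"
    proof -
      have "U \<noteq> {}" using that by (auto simp: t_def)
      then obtain i0 where "U = {i0}" using U1 by blast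
      note \<open>U \<noteq> {}\<close> this
      moreover have "odd (x k i0 0 - x k i0 1)" if "k \<in> K" "U = {i0}" for k i0
        using odd_difference[OF _ _ K(2)[OF that(1)], of i0] that(2) by (auto simp: U_def)
      ultimately show ?thesis using oddN BT B(3,4) by (simp add: z_def)
    qed
  qed (use slot[OF BT(1) B(3)] slot[OF BT(2) B(4)] in auto)
  then have z: "t = 0" "\<forall>i\<in>T. \<forall>j<n i. u i j = 0"
    using slot(6)[OF BT(1) B(3)] slot(6)[OF BT(2) B(4)] B(1) by auto
  have "u i j = 0" if "i \<in> U" "j < n i"
  proof -
    have "U = {i}" using U1 that(1) by auto
    then have "u i 0 = 0" using z(1) by (simp add: t_def)
    moreover have "n i = 2" using that by (simp add: U_def)
    ultimately show ?thesis using u2[OF that(1)] that(2) by (auto simp: less_2_cases_iff)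
  qed
  then show ?thesis using z(2) u1[OF ij(1) _ _ ij(2)] ij(2) by blast
qed

end

section \<open>Algebras of functions\<close>

definition function_algebra :: "('a \<Rightarrow> complex) set \<Rightarrow> bool" where
  "function_algebra R \<longleftrightarrow> (\<forall>c. (\<lambda>_. c) \<in> R) \<and>
     (\<forall>f\<in>R. \<forall>g\<in>R. (\<lambda>x. f x + g x) \<in> R \<and> (\<lambda>x. f x * g x) \<in> R)"

text \<open>Regular functions on a closed subgroup are restrictions. Asking only for agreement on
  \<open>K\<close> leaves the values elsewhere free, so expressions such as
  \<open>inverse (f x)\<close> can be regular without being globally defined by a member of
  \<open>R\<close>.\<close>

definition regular_on :: "('a \<Rightarrow> complex) set \<Rightarrow> 'a set \<Rightarrow> ('a \<Rightarrow> complex) set" where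
  "regular_on R K = {f. \<exists>\<psi>\<in>R. \<forall>x\<in>K. \<psi> x = f x}"

lemma function_algebra_generated [intro]: "function_algebra (generated_algebra S)"
  unfolding function_algebra_def by (auto intro: generated_algebra.intros)

lemma regular_onI: "\<psi> \<in> R \<Longrightarrow> (\<And>x. x \<in> K \<Longrightarrow> \<psi> x = f x) \<Longrightarrow> f \<in> regular_on R K"
  unfolding regular_on_def by blast

lemma regular_on_cong: "f \<in> regular_on R K \<Longrightarrow> (\<And>x. x \<in> K \<Longrightarrow> f x = g x) \<Longrightarrow> g \<in> regular_on R K"
  unfolding regular_on_def by auto

lemma regular_on_subset: "f \<in> regular_on R K \<Longrightarrow> L \<subseteq> K \<Longrightarrow> f \<in> regular_on R L"
  unfolding regular_on_def by auto

lemma regular_on_const: "function_algebra R \<Longrightarrow> (\<lambda>_. c) \<in> regular_on R K"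
  by (rule regular_onI[of "\<lambda>_. c"]) (auto simp: function_algebra_def)

lemma regular_on_add:
  assumes "function_algebra R" "f \<in> regular_on R K" "g \<in> regular_on R K"
  shows "(\<lambda>x. f x + g x) \<in> regular_on R K"
proof -
  obtain f' g' where fg: "f' \<in> R" "\<forall>x\<in>K. f' x = f x" "g' \<in> R" "\<forall>x\<in>K. g' x = g x"
    using assms unfolding regular_on_def by auto
  then have "(\<lambda>x. f' x + g' x) \<in> R" using assms(1) unfolding function_algebra_def by blast
  then show ?thesis by (rule regular_onI) (use fg in simp)
qed

lemma regular_on_mult:
  assumes "function_algebra R" "f \<in> regular_on R K" "g \<in> regular_on R K"
  shows "(\<lambda>x. f x * g x) \<in> regular_on R K"
proof -
  obtain f' g' where fg: "f' \<in> R" "\<forall>x\<in>K. f' x = f x" "g' \<in> R" "\<forall>x\<in>K. g' x = g x"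
    using assms unfolding regular_on_def by auto
  then have "(\<lambda>x. f' x * g' x) \<in> R" using assms(1) unfolding function_algebra_def by blast
  then show ?thesis by (rule regular_onI) (use fg in simp)
qed

lemma regular_on_sum:
  assumes "function_algebra R" "\<And>i. i \<in> I \<Longrightarrow> f i \<in> regular_on R K"
  shows "(\<lambda>x. \<Sum>i\<in>I. f i x) \<in> regular_on R K"
  using assms(2)
proof (induction I rule: infinite_finite_induct)
  case (insert i I)
  then have "(\<lambda>x. f i x + (\<Sum>i\<in>I. f i x)) \<in> regular_on R K" using assms(1) by (intro regular_on_add) auto
  then show ?case using insert.hyps by simp
qed (use assms(1) in \<open>auto intro: regular_on_const\<close>)

lemma regular_on_prod:
  assumes "function_algebra R" "\<And>i. i \<in> I \<Longrightarrow> f i \<in> regular_on R K"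
  shows "(\<lambda>x. \<Prod>i\<in>I. f i x) \<in> regular_on R K"
  using assms(2)
proof (induction I rule: infinite_finite_induct)
  case (insert i I)
  then have "(\<lambda>x. f i x * (\<Prod>i\<in>I. f i x)) \<in> regular_on R K" using assms(1) by (intro regular_on_mult) auto
  then show ?case using insert.hyps by simp
qed (use assms(1) in \<open>auto intro: regular_on_const\<close>)

lemma regular_on_power:
  assumes "function_algebra R" "f \<in> regular_on R K"
  shows "(\<lambda>x. f x ^ m) \<in> regular_on R K"
  by (induction m) (auto intro: regular_on_const regular_on_mult assms)

lemma regular_on_powi:
  assumes "function_algebra R" "f \<in> regular_on R K" "(\<lambda>x. inverse (f x)) \<in> regular_on R K"
  shows "(\<lambda>x. f x powi m) \<in> regular_on R K"
proof (cases "0 \<le> m")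
  case True
  then show ?thesis using regular_on_power[OF assms(1,2), of "nat m"] by (simp add: power_int_def)
next
  case False
  then show ?thesis using regular_on_power[OF assms(1,3), of "nat (- m)"]
    by (simp add: power_int_def power_inverse)
qed

lemma regular_on_compose:
  assumes "\<phi> \<in> generated_algebra S" "function_algebra R"
    and "\<And>s. s \<in> S \<Longrightarrow> (\<lambda>x. s (h x)) \<in> regular_on R K"
  shows "(\<lambda>x. \<phi> (h x)) \<in> regular_on R K"
  using assms(1)
  by induction (use assms in \<open>auto intro: regular_on_const regular_on_add regular_on_mult\<close>)

lemma regular_on_det:
  assumes R: "function_algebra R" and c: "\<And>x. x \<in> K \<Longrightarrow> A x \<in> carrier_mat m m"
    and e: "\<And>i j. i < m \<Longrightarrow> j < m \<Longrightarrow> (\<lambda>x. A x $$ (i,j)) \<in> regular_on R K"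
  shows "(\<lambda>x. det (A x)) \<in> regular_on R K"
proof (rule regular_on_cong)
  show "(\<lambda>x. \<Sum>p | p permutes {0..<m}. signof p * (\<Prod>i = 0..<m. A x $$ (i, p i))) \<in> regular_on R K"
    by (intro regular_on_sum regular_on_mult regular_on_prod regular_on_const R e) auto
  show "(\<Sum>p | p permutes {0..<m}. signof p * (\<Prod>i = 0..<m. A x $$ (i, p i))) = det (A x)" if "x \<in> K" for x
    using det_def'[OF c[OF that]] by simp
qed

text \<open>The entries of the adjugate are signed minors. This is what makes the dual
  representation algebraic, the inverse of \<open>X h\<close> being its adjugate divided by its
  determinant.\<close>

lemma regular_on_adj:
  assumes R: "function_algebra R" and c: "\<And>x. x \<in> K \<Longrightarrow> A x \<in> carrier_mat m m"
    and e: "\<And>i j. i < m \<Longrightarrow> j < m \<Longrightarrow> (\<lambda>x. A x $$ (i,j)) \<in> regular_on R K"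
    and ij: "i < m" "j < m"
  shows "(\<lambda>x. adj_mat (A x) $$ (i,j)) \<in> regular_on R K"
proof (rule regular_on_cong)
  show "(\<lambda>x. (-1)^(j+i) * det (mat_delete (A x) j i)) \<in> regular_on R K"
  proof (intro regular_on_mult regular_on_const R regular_on_det)
    show "mat_delete (A x) j i \<in> carrier_mat (m-1) (m-1)" if "x \<in> K" for x
      using c[OF that] by (rule mat_delete_carrier)
    show "(\<lambda>x. mat_delete (A x) j i $$ (k,l)) \<in> regular_on R K" if kl: "k < m - 1" "l < m - 1" for k l
    proof (rule regular_on_cong)
      show "(\<lambda>x. A x $$ (if k < j then k else Suc k, if l < i then l else Suc l)) \<in> regular_on R K"
        using kl by (intro e) auto
      show "A x $$ (if k < j then k else Suc k, if l < i then l else Suc l) = mat_delete (A x) j i $$ (k,l)"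
        if "x \<in> K" for x
        using c[OF that] kl by (auto simp: mat_delete_def)
    qed
  qed
  show "(-1)^(j+i) * det (mat_delete (A x) j i) = adj_mat (A x) $$ (i,j)" if "x \<in> K" for x
    using c[OF that] ij by (auto simp: adj_mat_def cofactor_def)
qed

lemma regular_on_matmult:
  assumes R: "function_algebra R" and c: "\<And>x. x \<in> K \<Longrightarrow> A x \<in> carrier_mat l m \<and> B x \<in> carrier_mat m r"
    and e: "\<And>i j. i < l \<Longrightarrow> j < m \<Longrightarrow> (\<lambda>x. A x $$ (i,j)) \<in> regular_on R K"
      "\<And>i j. i < m \<Longrightarrow> j < r \<Longrightarrow> (\<lambda>x. B x $$ (i,j)) \<in> regular_on R K"
    and ij: "i < l" "j < r"
  shows "(\<lambda>x. (A x * B x) $$ (i,j)) \<in> regular_on R K"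
proof (rule regular_on_cong)
  show "(\<lambda>x. \<Sum>k=0..<m. A x $$ (i,k) * B x $$ (k,j)) \<in> regular_on R K"
    using ij by (intro regular_on_sum regular_on_mult R e) auto
  show "(\<Sum>k=0..<m. A x $$ (i,k) * B x $$ (k,j)) = (A x * B x) $$ (i,j)" if "x \<in> K" for x
    using c[OF that] ij by (auto simp: scalar_prod_def)
qed

lemma alg_homI:
  assumes "f \<in> hom G H" "regular H = generated_algebra S" "function_algebra (regular G)"
    and "\<And>s. s \<in> S \<Longrightarrow> (\<lambda>x. s (f x)) \<in> regular_on (regular G) (carrier G)"
  shows "f \<in> alg_hom G H"
proof -
  have "(\<lambda>x. \<phi> (f x)) \<in> regular_on (regular G) (carrier G)" if "\<phi> \<in> regular H" for \<phi>
    using regular_on_compose[OF _ assms(3,4)] that assms(2) by auto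
  then show ?thesis using assms(1) unfolding alg_hom_def regular_on_def by auto
qed

lemma alg_hom_regular:
  assumes "f \<in> alg_hom G H" "\<phi> \<in> regular_on (regular H) (carrier H)"
  shows "(\<lambda>x. \<phi> (f x)) \<in> regular_on (regular G) (carrier G)"
proof -
  obtain \<phi>' where "\<phi>' \<in> regular H" "\<forall>y\<in>carrier H. \<phi>' y = \<phi> y" using assms(2) unfolding regular_on_def by auto
  moreover then obtain \<psi> where "\<psi> \<in> regular G" "\<forall>x\<in>carrier G. \<psi> x = \<phi>' (f x)"
    using assms(1) unfolding alg_hom_def by blast
  moreover have "f x \<in> carrier H" if "x \<in> carrier G" for x
    using assms(1) that unfolding alg_hom_def by (auto dest: hom_in_carrier)
  ultimately show ?thesis by (intro regular_onI[of \<psi>]) auto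
qed

lemma alg_hom_comp:
  assumes "f \<in> alg_hom G H" "g \<in> alg_hom H L"
  shows "(\<lambda>x. g (f x)) \<in> alg_hom G L"
proof -
  have "(\<lambda>x. g (f x)) \<in> hom G L"
    using assms by (auto simp: alg_hom_def hom_def Pi_iff)
  moreover have "\<exists>\<psi>\<in>regular G. \<forall>x\<in>carrier G. \<psi> x = \<phi> (g (f x))" if "\<phi> \<in> regular L" for \<phi>
  proof -
    have "(\<lambda>y. \<phi> (g y)) \<in> regular_on (regular H) (carrier H)"
      using assms(2) that unfolding alg_hom_def regular_on_def by auto
    from alg_hom_regular[OF assms(1) this] show ?thesis unfolding regular_on_def by auto
  qed
  ultimately show ?thesis unfolding alg_hom_def by simp
qed

section \<open>Linear combinations of characters\<close>

definition finite_comb :: "'a set \<Rightarrow> ('a \<Rightarrow> complex) set \<Rightarrow> ('a \<Rightarrow> complex) \<Rightarrow> bool" where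
  "finite_comb K C f \<longleftrightarrow> (\<exists>F c. finite F \<and> F \<subseteq> C \<and> (\<forall>x\<in>K. f x = (\<Sum>\<chi>\<in>F. c \<chi> * \<chi> x)))"

lemma finite_comb_cong:
  assumes "finite_comb K C f" "\<And>x. x \<in> K \<Longrightarrow> f x = g x"
  shows "finite_comb K C g"
proof -
  obtain F c where "finite F" "F \<subseteq> C" "\<forall>x\<in>K. f x = (\<Sum>\<chi>\<in>F. c \<chi> * \<chi> x)"
    using assms(1) unfolding finite_comb_def by auto
  then show ?thesis unfolding finite_comb_def
    using assms(2) by (intro exI[of _ F] exI[of _ c]) auto
qed

lemma finite_comb_zero: "finite_comb K C (\<lambda>_. 0)"
  unfolding finite_comb_def by (intro exI[of _ "{}"]) auto

lemma finite_comb_add_char: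
  assumes "finite_comb K C f" "\<chi> \<in> C"
  shows "finite_comb K C (\<lambda>x. a * \<chi> x + f x)"
proof -
  obtain F c where F: "finite F" "F \<subseteq> C" "\<forall>x\<in>K. f x = (\<Sum>\<chi>\<in>F. c \<chi> * \<chi> x)"
    using assms unfolding finite_comb_def by auto
  define c' where "c' = (\<lambda>\<psi>. (if \<psi> \<in> F then c \<psi> else 0) + (if \<psi> = \<chi> then a else 0))"
  have "(\<Sum>\<psi>\<in>insert \<chi> F. c' \<psi> * \<psi> x) = a * \<chi> x + f x" if "x \<in> K" for x
  proof -
    have "(\<Sum>\<psi>\<in>insert \<chi> F. c' \<psi> * \<psi> x) =
      (\<Sum>\<psi>\<in>insert \<chi> F. (if \<psi> \<in> F then c \<psi> * \<psi> x else 0) + (if \<psi> = \<chi> then a * \<chi> x else 0))"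
      by (intro sum.cong) (auto simp: c'_def algebra_simps)
    also have "\<dots> = (\<Sum>\<psi>\<in>insert \<chi> F. if \<psi> \<in> F then c \<psi> * \<psi> x else 0) + a * \<chi> x"
      using F(1) by (simp add: sum.distrib)
    also have "(\<Sum>\<psi>\<in>insert \<chi> F. if \<psi> \<in> F then c \<psi> * \<psi> x else 0) = (\<Sum>\<psi>\<in>F. c \<psi> * \<psi> x)"
      using F(1) by (intro sum.mono_neutral_cong_right) auto
    finally show ?thesis using F(3) that by simp
  qed
  then show ?thesis unfolding finite_comb_def
    using F assms(2) by (intro exI[of _ "insert \<chi> F"] exI[of _ c']) auto
qed

lemma finite_comb_char: "\<chi> \<in> C \<Longrightarrow> (\<And>x. x \<in> K \<Longrightarrow> \<chi> x = f x) \<Longrightarrow> finite_comb K C f"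
  by (rule finite_comb_cong[OF finite_comb_add_char[OF finite_comb_zero, of \<chi> C K 1]]) auto

lemma finite_comb_add:
  assumes "finite_comb K C f" "finite_comb K C g"
  shows "finite_comb K C (\<lambda>x. f x + g x)"
proof -
  obtain F c where F: "finite F" "F \<subseteq> C" "\<forall>x\<in>K. f x = (\<Sum>\<chi>\<in>F. c \<chi> * \<chi> x)"
    using assms unfolding finite_comb_def by auto
  have "finite_comb K C (\<lambda>x. (\<Sum>\<chi>\<in>F. c \<chi> * \<chi> x) + g x)" using F(1,2)
  proof (induction F rule: finite_induct)
    case (insert \<chi> F)
    then have "finite_comb K C (\<lambda>x. c \<chi> * \<chi> x + ((\<Sum>\<chi>\<in>F. c \<chi> * \<chi> x) + g x))"
      by (intro finite_comb_add_char) auto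
    then show ?case using insert.hyps by (simp add: add.assoc)
  qed (use assms in simp)
  then show ?thesis by (rule finite_comb_cong) (use F in simp)
qed

lemma finite_comb_sum:
  "(\<And>i. i \<in> I \<Longrightarrow> finite_comb K C (f i)) \<Longrightarrow> finite_comb K C (\<lambda>x. \<Sum>i\<in>I. f i x)"
proof (induction I rule: infinite_finite_induct)
  case (insert i I)
  then have "finite_comb K C (\<lambda>x. f i x + (\<Sum>i\<in>I. f i x))" by (intro finite_comb_add) auto
  then show ?case using insert.hyps by simp
qed (auto intro: finite_comb_zero)

lemma finite_comb_scale:
  assumes "finite_comb K C f"
  shows "finite_comb K C (\<lambda>x. a * f x)"
proof -
  obtain F c where "finite F" "F \<subseteq> C" "\<forall>x\<in>K. f x = (\<Sum>\<chi>\<in>F. c \<chi> * \<chi> x)"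
    using assms unfolding finite_comb_def by auto
  then show ?thesis unfolding finite_comb_def
    by (intro exI[of _ F] exI[of _ "\<lambda>\<chi>. a * c \<chi>"]) (auto simp: sum_distrib_left mult.assoc)
qed

definition char_closed :: "'a set \<Rightarrow> ('a \<Rightarrow> complex) set \<Rightarrow> bool" where
  "char_closed K C \<longleftrightarrow> (\<exists>\<chi>\<in>C. \<forall>x\<in>K. \<chi> x = 1) \<and>
     (\<forall>\<chi>\<in>C. \<forall>\<psi>\<in>C. \<exists>\<omega>\<in>C. \<forall>x\<in>K. \<omega> x = \<chi> x * \<psi> x)"

lemma finite_comb_mult:
  assumes C: "char_closed K C" and "finite_comb K C f" "finite_comb K C g"
  shows "finite_comb K C (\<lambda>x. f x * g x)"
proof -
  obtain F c where F: "finite F" "F \<subseteq> C" "\<forall>x\<in>K. f x = (\<Sum>\<chi>\<in>F. c \<chi> * \<chi> x)"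
    using assms unfolding finite_comb_def by auto
  obtain E d where E: "finite E" "E \<subseteq> C" "\<forall>x\<in>K. g x = (\<Sum>\<chi>\<in>E. d \<chi> * \<chi> x)"
    using assms unfolding finite_comb_def by auto
  have "finite_comb K C (\<lambda>x. \<chi> x * \<psi> x)" if "\<chi> \<in> F" "\<psi> \<in> E" for \<chi> \<psi>
  proof -
    have "\<chi> \<in> C" "\<psi> \<in> C" using that F E by auto
    then obtain \<omega> where "\<omega> \<in> C" "\<forall>x\<in>K. \<omega> x = \<chi> x * \<psi> x" using C unfolding char_closed_def by blast
    then show ?thesis by (intro finite_comb_char[of \<omega>]) auto
  qed
  then have "finite_comb K C (\<lambda>x. \<Sum>\<chi>\<in>F. \<Sum>\<psi>\<in>E. (c \<chi> * d \<psi>) * (\<chi> x * \<psi> x))"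
    by (intro finite_comb_sum finite_comb_scale)
  then show ?thesis
    by (rule finite_comb_cong) (use F E in \<open>auto simp: sum_product mult_ac\<close>)
qed

lemma finite_comb_const: "char_closed K C \<Longrightarrow> finite_comb K C (\<lambda>_. a)"
proof -
  assume "char_closed K C"
  then obtain \<chi> where "\<chi> \<in> C" "\<forall>x\<in>K. \<chi> x = 1" unfolding char_closed_def by blast
  then have "finite_comb K C (\<lambda>_. 1)" by (intro finite_comb_char[of \<chi>]) auto
  from finite_comb_scale[OF this, of a] show ?thesis by simp
qed

lemma finite_comb_generated:
  assumes "f \<in> generated_algebra S" "char_closed K C" "\<And>s. s \<in> S \<Longrightarrow> finite_comb K C (\<lambda>x. s (h x))"
  shows "finite_comb K C (\<lambda>x. f (h x))"
  using assms(1)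
  by induction (use assms in \<open>auto intro: finite_comb_const finite_comb_add finite_comb_mult\<close>)

section \<open>Independence of characters and isotypic components\<close>

locale char_family =
  fixes K :: "('a, 'b) monoid_scheme" (structure) and C :: "('a \<Rightarrow> complex) set"
  assumes monoid_K: "monoid K"
    and char_ext: "\<chi> \<in> C \<Longrightarrow> \<chi> \<in> extensional (carrier K)"
    and char_one: "\<chi> \<in> C \<Longrightarrow> \<chi> \<one> = 1"
    and char_mult: "\<chi> \<in> C \<Longrightarrow> x \<in> carrier K \<Longrightarrow> y \<in> carrier K \<Longrightarrow> \<chi> (x \<otimes> y) = \<chi> x * \<chi> y"
begin

lemma char_neq:
  assumes "\<chi> \<in> C" "\<psi> \<in> C" "\<chi> \<noteq> \<psi>"
  obtains y where "y \<in> carrier K" "\<chi> y \<noteq> \<psi> y"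
  using extensionalityI[OF char_ext[OF assms(1)] char_ext[OF assms(2)]] assms(3) by blast

text \<open>Dedekind's argument: translating a relation by \<open>y\<close> and subtracting
  \<open>\<chi>0 y\<close> times the relation removes \<open>\<chi>0\<close>, where \<open>y\<close>
  is chosen to separate \<open>\<psi>\<close> from \<open>\<chi>0\<close>. Extensionality guarantees
  that distinct members of the family differ somewhere on the carrier.\<close>

lemma characters_independent:
  assumes "finite F" "F \<subseteq> C" "\<And>x. x \<in> carrier K \<Longrightarrow> (\<Sum>\<chi>\<in>F. c \<chi> * \<chi> x) = 0" "\<psi> \<in> F"
  shows "c \<psi> = 0"
proof -
  interpret monoid K by (rule monoid_K)
  have "\<forall>\<psi>\<in>F. c \<psi> = 0" using assms(1-3)
  proof (induction F arbitrary: c rule: finite_induct)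
    case (insert \<chi>0 F)
    have split: "c \<chi>0 * \<chi>0 x + (\<Sum>\<chi>\<in>F. c \<chi> * \<chi> x) = 0" if "x \<in> carrier K" for x
      using insert.prems(2)[OF that] insert.hyps by simp
    have F0: "c \<psi> = 0" if \<psi>: "\<psi> \<in> F" for \<psi>
    proof -
      have C: "\<psi> \<in> C" "\<chi>0 \<in> C" "\<psi> \<noteq> \<chi>0" using \<psi> insert by auto
      obtain y where y: "y \<in> carrier K" "\<psi> y \<noteq> \<chi>0 y" using char_neq[OF C] .
      have "(\<Sum>\<chi>\<in>F. (c \<chi> * (\<chi> y - \<chi>0 y)) * \<chi> x) = 0" if x: "x \<in> carrier K" for x
      proof -
        have "c \<chi>0 * (\<chi>0 x * \<chi>0 y) + (\<Sum>\<chi>\<in>F. c \<chi> * (\<chi> x * \<chi> y)) = c \<chi>0 * \<chi>0 (x \<otimes> y) + (\<Sum>\<chi>\<in>F. c \<chi> * \<chi> (x \<otimes> y))"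
          using char_mult[OF _ x y(1)] insert.prems(1) by (intro arg_cong2[where f="(+)"] sum.cong) auto
        also have "\<dots> = 0" using split[of "x \<otimes> y"] x y by simp
        finally have "c \<chi>0 * (\<chi>0 x * \<chi>0 y) + (\<Sum>\<chi>\<in>F. c \<chi> * (\<chi> x * \<chi> y)) = 0" .
        moreover have "c \<chi>0 * \<chi>0 x * \<chi>0 y + (\<Sum>\<chi>\<in>F. c \<chi> * \<chi> x) * \<chi>0 y = 0"
          using split[OF x] by (simp add: distrib_right[symmetric])
        ultimately have "(\<Sum>\<chi>\<in>F. c \<chi> * (\<chi> x * \<chi> y)) - (\<Sum>\<chi>\<in>F. c \<chi> * \<chi> x) * \<chi>0 y = 0"
          by (simp add: algebra_simps) (metis add_left_cancel)
        moreover have "(\<Sum>\<chi>\<in>F. (c \<chi> * (\<chi> y - \<chi>0 y)) * \<chi> x) =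
            (\<Sum>\<chi>\<in>F. c \<chi> * (\<chi> x * \<chi> y)) - (\<Sum>\<chi>\<in>F. c \<chi> * \<chi> x) * \<chi>0 y"
          unfolding sum_distrib_right sum_subtractf[symmetric] by (intro sum.cong) (auto simp: algebra_simps)
        ultimately show ?thesis by simp
      qed
      then have "c \<psi> * (\<psi> y - \<chi>0 y) = 0"
        using insert.IH[of "\<lambda>\<chi>. c \<chi> * (\<chi> y - \<chi>0 y)"] insert.prems(1) \<psi> by auto
      then show ?thesis using y by simp
    qed
    then have "c \<chi>0 = 0" using split[of \<one>] char_one[of \<chi>0] insert.prems(1) by simp
    then show ?case using F0 by simp
  qed simp
  then show ?thesis using assms(4) by blast
qed

lemma characters_independent2:
  assumes "finite F" "F \<subseteq> C" "\<And>x. x \<in> carrier K \<Longrightarrow> (\<Sum>\<chi>\<in>F. c \<chi> * \<chi> x) = (\<Sum>\<chi>\<in>F. d \<chi> * \<chi> x)" "\<psi> \<in> F"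
  shows "c \<psi> = d \<psi>"
  using characters_independent[OF assms(1,2), of "\<lambda>\<chi>. c \<chi> - d \<chi>"] assms(3,4)
  by (simp add: left_diff_distrib sum_subtractf)

text \<open>The matrices \<open>P \<chi>\<close> are the projections to the isotypic components.\<close>

definition isotypic :: "('a \<Rightarrow> complex mat) \<Rightarrow> nat \<Rightarrow> ('a \<Rightarrow> complex) set \<Rightarrow> (('a \<Rightarrow> complex) \<Rightarrow> complex mat) \<Rightarrow> bool" where
  "isotypic \<rho> d F P \<longleftrightarrow> finite F \<and> F \<subseteq> C \<and>
     (\<forall>\<chi>\<in>F. P \<chi> \<in> carrier_mat d d \<and> P \<chi> \<noteq> 0\<^sub>m d d) \<and>
     (\<forall>\<chi>\<in>F. \<forall>\<psi>\<in>F. P \<chi> * P \<psi> = (if \<chi> = \<psi> then P \<chi> else 0\<^sub>m d d)) \<and>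
     (\<forall>x\<in>carrier K. \<forall>i<d. \<forall>j<d. \<rho> x $$ (i,j) = (\<Sum>\<chi>\<in>F. \<chi> x * P \<chi> $$ (i,j)))"

text \<open>Expanding the matrix entries in characters writes \<open>\<rho> x\<close> as the sum of
  the \<open>\<chi> x\<close> times \<open>P \<chi>\<close>. Comparing coefficients in
  \<open>\<rho> (x \<otimes> y) = \<rho> x * \<rho> y\<close>, in \<open>x\<close> and then in
  \<open>y\<close>, shows that the matrices \<open>P \<chi>\<close> are orthogonal idempotents.
  Characters with \<open>P \<chi> = 0\<close> are discarded.\<close>

theorem isotypic_decomposition:
  assumes \<rho>: "\<And>x. x \<in> carrier K \<Longrightarrow> \<rho> x \<in> carrier_mat d d" "\<rho> \<one> = 1\<^sub>m d"
    "\<And>x y. x \<in> carrier K \<Longrightarrow> y \<in> carrier K \<Longrightarrow> \<rho> (x \<otimes> y) = \<rho> x * \<rho> y"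
    and comb: "\<And>i j. i < d \<Longrightarrow> j < d \<Longrightarrow> finite_comb (carrier K) C (\<lambda>x. \<rho> x $$ (i,j))"
  shows "\<exists>F P. isotypic \<rho> d F P"
proof -
  interpret monoid K by (rule monoid_K)
  define Q where "Q = (\<lambda>ij F c. finite F \<and> F \<subseteq> C \<and> (\<forall>x\<in>carrier K. \<rho> x $$ ij = (\<Sum>\<chi>\<in>F. c \<chi> * \<chi> x)))"
  have "\<exists>F c. fst ij < d \<and> snd ij < d \<longrightarrow> Q ij F c" for ij
    using comb[of "fst ij" "snd ij"] unfolding finite_comb_def Q_def prod.collapse by blast
  then obtain F0 c0 where Q: "\<And>ij. fst ij < d \<and> snd ij < d \<longrightarrow> Q ij (F0 ij) (c0 ij)" by metis
  have F0: "finite (F0 (i,j)) \<and> F0 (i,j) \<subseteq> C \<and>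
      (\<forall>x\<in>carrier K. \<rho> x $$ (i,j) = (\<Sum>\<chi>\<in>F0 (i,j). c0 (i,j) \<chi> * \<chi> x))" if "i < d" "j < d" for i j
    using Q[of "(i,j)"] that unfolding Q_def by simp
  define F1 where "F1 = (\<Union>i<d. \<Union>j<d. F0 (i,j))"
  have F1: "finite F1" "F1 \<subseteq> C" using F0 unfolding F1_def by (auto intro!: finite_UN_I)
  define P where "P = (\<lambda>\<chi>. mat d d (\<lambda>ij. if \<chi> \<in> F0 ij then c0 ij \<chi> else 0))"
  have P: "P \<chi> \<in> carrier_mat d d" for \<chi> by (simp add: P_def)
  have dec1: "\<rho> x $$ (i,j) = (\<Sum>\<chi>\<in>F1. \<chi> x * P \<chi> $$ (i,j))" if x: "x \<in> carrier K" and ij: "i < d" "j < d" for x i j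
  proof -
    have "(\<Sum>\<chi>\<in>F1. \<chi> x * P \<chi> $$ (i,j)) = (\<Sum>\<chi>\<in>F0 (i,j). c0 (i,j) \<chi> * \<chi> x)"
      using F1(1) ij by (intro sum.mono_neutral_cong_right) (auto simp: F1_def P_def)
    then show ?thesis using F0[OF ij] x by simp
  qed
  define F where "F = {\<chi>\<in>F1. P \<chi> \<noteq> 0\<^sub>m d d}"
  have F: "finite F" "F \<subseteq> C" using F1 by (auto simp: F_def)
  have dec: "\<rho> x $$ (i,j) = (\<Sum>\<chi>\<in>F. \<chi> x * P \<chi> $$ (i,j))" if x: "x \<in> carrier K" and ij: "i < d" "j < d" for x i j
    unfolding dec1[OF that] F_def using F1(1) ij by (intro sum.mono_neutral_right) auto
  have PP: "(P \<chi> * P \<psi>) $$ (i,j) = (if \<chi> = \<psi> then P \<chi> $$ (i,j) else 0)"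
    if \<chi>\<psi>: "\<chi> \<in> F" "\<psi> \<in> F" and ij: "i < d" "j < d" for \<chi> \<psi> i j
  proof -
    have pe: "(P \<chi> * P \<psi>) $$ (i,j) = (\<Sum>k=0..<d. P \<chi> $$ (i,k) * P \<psi> $$ (k,j))" for \<chi> \<psi>
      using P[of \<chi>] P[of \<psi>] ij by (auto simp: scalar_prod_def)
    \<comment> \<open>The comparison in \<open>x\<close>, with \<open>y\<close> fixed; the result is
      a relation between characters of \<open>y\<close>, to which independence is applied once
      more.\<close>
    have fix_y: "(\<Sum>\<psi>\<in>F. \<psi> y * (P \<chi> * P \<psi>) $$ (i,j)) = \<chi> y * P \<chi> $$ (i,j)"
      if \<chi>: "\<chi> \<in> F" and y: "y \<in> carrier K" for \<chi> y
    proof (rule characters_independent2[OF F _ \<chi>, of "\<lambda>\<chi>. \<Sum>\<psi>\<in>F. \<psi> y * (P \<chi> * P \<psi>) $$ (i,j)"])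
      fix x assume x: "x \<in> carrier K"
      have "(\<Sum>\<chi>\<in>F. (\<Sum>\<psi>\<in>F. \<psi> y * (P \<chi> * P \<psi>) $$ (i,j)) * \<chi> x) =
          (\<Sum>\<chi>\<in>F. \<Sum>\<psi>\<in>F. \<Sum>k=0..<d. (\<chi> x * P \<chi> $$ (i,k)) * (\<psi> y * P \<psi> $$ (k,j)))"
        unfolding pe sum_distrib_right sum_distrib_left by (intro sum.cong refl) (simp add: mult_ac)
      also have "\<dots> = (\<Sum>k=0..<d. (\<Sum>\<chi>\<in>F. \<chi> x * P \<chi> $$ (i,k)) * (\<Sum>\<psi>\<in>F. \<psi> y * P \<psi> $$ (k,j)))"
        unfolding sum_product sum.swap[of _ "{0..<d}" F] ..
      also have "\<dots> = (\<Sum>k=0..<d. \<rho> x $$ (i,k) * \<rho> y $$ (k,j))"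
        using dec[OF x] dec[OF y] ij by (intro sum.cong) auto
      also have "\<dots> = (\<rho> x * \<rho> y) $$ (i,j)" using \<rho>(1)[OF x] \<rho>(1)[OF y] ij by (auto simp: scalar_prod_def)
      also have "\<dots> = \<rho> (x \<otimes> y) $$ (i,j)" using \<rho>(3)[OF x y] by simp
      also have "\<dots> = (\<Sum>\<chi>\<in>F. \<chi> (x \<otimes> y) * P \<chi> $$ (i,j))" using x y ij by (intro dec) auto
      also have "\<dots> = (\<Sum>\<chi>\<in>F. \<chi> y * P \<chi> $$ (i,j) * \<chi> x)"
        using F(2) char_mult[OF _ x y] by (intro sum.cong) (auto simp: mult_ac)
      finally show "(\<Sum>\<chi>\<in>F. (\<Sum>\<psi>\<in>F. \<psi> y * (P \<chi> * P \<psi>) $$ (i,j)) * \<chi> x) = (\<Sum>\<chi>\<in>F. \<chi> y * P \<chi> $$ (i,j) * \<chi> x)" .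
    qed
    show ?thesis
    proof (rule characters_independent2[OF F _ \<chi>\<psi>(2), of "\<lambda>\<psi>. (P \<chi> * P \<psi>) $$ (i,j)" "\<lambda>\<psi>. if \<chi> = \<psi> then P \<chi> $$ (i,j) else 0"])
      fix y assume y: "y \<in> carrier K"
      have "(\<Sum>\<psi>\<in>F. (if \<chi> = \<psi> then P \<chi> $$ (i,j) else 0) * \<psi> y) = (\<Sum>\<psi>\<in>F. if \<psi> = \<chi> then \<psi> y * P \<chi> $$ (i,j) else 0)"
        by (intro sum.cong) auto
      also have "\<dots> = \<chi> y * P \<chi> $$ (i,j)" using F(1) \<chi>\<psi>(1) by simp
      finally show "(\<Sum>\<psi>\<in>F. (P \<chi> * P \<psi>) $$ (i,j) * \<psi> y) = (\<Sum>\<psi>\<in>F. (if \<chi> = \<psi> then P \<chi> $$ (i,j) else 0) * \<psi> y)"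
        using fix_y[OF \<chi>\<psi>(1) y] by (simp add: mult.commute)
    qed
  qed
  have "P \<chi> * P \<psi> = (if \<chi> = \<psi> then P \<chi> else 0\<^sub>m d d)" if "\<chi> \<in> F" "\<psi> \<in> F" for \<chi> \<psi>
    using PP[OF that] P[of \<chi>] P[of \<psi>] by (intro eq_matI) auto
  moreover have "P \<chi> \<noteq> 0\<^sub>m d d" if "\<chi> \<in> F" for \<chi> using that by (simp add: F_def)
  ultimately have "isotypic \<rho> d F P" unfolding isotypic_def using F P dec by blast
  then show ?thesis by blast
qed

end

lemma alg_hom_carrier: "f \<in> alg_hom G H \<Longrightarrow> x \<in> carrier G \<Longrightarrow> f x \<in> carrier H"
  unfolding alg_hom_def using hom_in_carrier[of f G H x] by simp

section \<open>The groups\<close>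

lemma alg_prod_simps [simp]:
  "carrier (alg_prod I G) = (\<Pi>\<^sub>E i\<in>I. carrier (G i))"
  "x \<otimes>\<^bsub>alg_prod I G\<^esub> y = (\<lambda>i\<in>I. x i \<otimes>\<^bsub>G i\<^esub> y i)"
  "\<one>\<^bsub>alg_prod I G\<^esub> = (\<lambda>i\<in>I. \<one>\<^bsub>G i\<^esub>)"
  by (simp_all add: alg_prod_def monoid.defs)

lemma regular_alg_prod:
  "regular (alg_prod I G) = generated_algebra {\<lambda>x. \<phi> (x i) | i \<phi>. i \<in> I \<and> \<phi> \<in> regular (G i)}"
  by (simp add: alg_prod_def monoid.defs)

lemma alg_dirprod_simps [simp]:
  "carrier (alg_dirprod G H) = carrier G \<times> carrier H"
  "x \<otimes>\<^bsub>alg_dirprod G H\<^esub> y = (fst x \<otimes>\<^bsub>G\<^esub> fst y, snd x \<otimes>\<^bsub>H\<^esub> snd y)"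
  "\<one>\<^bsub>alg_dirprod G H\<^esub> = (\<one>\<^bsub>G\<^esub>, \<one>\<^bsub>H\<^esub>)"
  by (simp_all add: alg_dirprod_def monoid.defs mult_DirProd')

lemma regular_alg_dirprod:
  "regular (alg_dirprod G H) = generated_algebra ({\<lambda>x. \<phi> (fst x) | \<phi>. \<phi> \<in> regular G} \<union>
     {\<lambda>x. \<psi> (snd x) | \<psi>. \<psi> \<in> regular H})"
  by (simp add: alg_dirprod_def monoid.defs)

lemma Gm_simps [simp]:
  "carrier Gm = - {0}" "x \<otimes>\<^bsub>Gm\<^esub> y = x * y" "\<one>\<^bsub>Gm\<^esub> = 1"
  "regular Gm = generated_algebra {\<lambda>z. z, inverse}"
  by (simp_all add: Gm_def)

lemma SL_simps [simp]:
  "carrier (SL m) = {A \<in> carrier_mat m m. det A = 1}" "x \<otimes>\<^bsub>SL m\<^esub> y = x * y" "\<one>\<^bsub>SL m\<^esub> = 1\<^sub>m m"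
  by (simp_all add: SL_def)

lemma regular_SL: "regular (SL m) = generated_algebra {\<lambda>A. A $$ (i, j) | i j. i < m \<and> j < m}"
  by (simp add: SL_def)

lemma GL_simps [simp]:
  "carrier (GL m) = {A \<in> carrier_mat m m. det A \<noteq> 0}" "x \<otimes>\<^bsub>GL m\<^esub> y = x * y" "\<one>\<^bsub>GL m\<^esub> = 1\<^sub>m m"
  by (simp_all add: GL_def)

lemma regular_GL: "regular (GL m) = generated_algebra
    (insert (\<lambda>A. inverse (det A)) {\<lambda>A. A $$ (i, j) | i j. i < m \<and> j < m})"
  by (simp add: GL_def)

lemma group_Gm: "group Gm"
  by (rule groupI) (auto intro!: bexI[of _ "inverse _"])

lemma inv_Gm: "x \<noteq> 0 \<Longrightarrow> inv\<^bsub>Gm\<^esub> x = inverse x"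
  by (rule group.inv_equality[OF group_Gm]) auto

lemma adj_mat_det_1:
  fixes A :: "complex mat"
  assumes "A \<in> carrier_mat m m" "det A = 1"
  shows "adj_mat A * A = 1\<^sub>m m" "A * adj_mat A = 1\<^sub>m m" "adj_mat A \<in> carrier_mat m m" "det (adj_mat A) = 1"
proof -
  have one: "1 \<cdot>\<^sub>m 1\<^sub>m m = (1\<^sub>m m :: complex mat)" by auto
  show *: "adj_mat A * A = 1\<^sub>m m" "A * adj_mat A = 1\<^sub>m m" "adj_mat A \<in> carrier_mat m m"
    using adj_mat[OF assms(1)] assms(2) one by auto
  show "det (adj_mat A) = 1" using det_mult[OF *(3) assms(1)] * assms by simp
qed

lemma group_SL: "group (SL m)"
proof (rule groupI)
  show "\<exists>y\<in>carrier (SL m). y \<otimes>\<^bsub>SL m\<^esub> x = \<one>\<^bsub>SL m\<^esub>" if "x \<in> carrier (SL m)" for x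
    using that adj_mat_det_1[of x m] by (intro bexI[of _ "adj_mat x"]) auto
qed (auto simp: det_mult assoc_mult_mat)

lemma inv_SL: "A \<in> carrier (SL m) \<Longrightarrow> inv\<^bsub>SL m\<^esub> A = adj_mat A"
  using adj_mat_det_1[of A m] by (intro group.inv_equality[OF group_SL]) auto

lemma group_cong:
  assumes "group G" "carrier H = carrier G" "\<And>x y. x \<otimes>\<^bsub>H\<^esub> y = x \<otimes>\<^bsub>G\<^esub> y" "\<one>\<^bsub>H\<^esub> = \<one>\<^bsub>G\<^esub>"
  shows "group H"
proof -
  interpret group G by fact
  show ?thesis
    by (rule groupI; unfold assms(2-)) (auto simp: m_assoc intro: l_inv_ex)
qed

lemma group_alg_prod: "(\<And>i. i \<in> I \<Longrightarrow> group (G i)) \<Longrightarrow> group (alg_prod I G)"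
  by (rule group_cong[OF product_group]) auto

lemma inv_alg_prod:
  assumes "\<And>i. i \<in> I \<Longrightarrow> group (G i)" "x \<in> carrier (alg_prod I G)"
  shows "inv\<^bsub>alg_prod I G\<^esub> x = (\<lambda>i\<in>I. inv\<^bsub>G i\<^esub> (x i))"
proof (rule group.inv_equality[OF group_alg_prod[OF assms(1)]])
  show "(\<lambda>i\<in>I. inv\<^bsub>G i\<^esub> (x i)) \<otimes>\<^bsub>alg_prod I G\<^esub> x = \<one>\<^bsub>alg_prod I G\<^esub>"
    using assms by (auto simp: PiE_iff group.l_inv intro!: restrict_ext)
  show "(\<lambda>i\<in>I. inv\<^bsub>G i\<^esub> (x i)) \<in> carrier (alg_prod I G)"
    using assms by (auto simp: PiE_iff)
qed (use assms in auto)

lemma group_alg_dirprod: "group G \<Longrightarrow> group H \<Longrightarrow> group (alg_dirprod G H)"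
  by (rule group_cong[OF DirProd_group]) (auto simp: mult_DirProd')

lemma inv_alg_dirprod:
  assumes "group G" "group H" "x \<in> carrier (alg_dirprod G H)"
  shows "inv\<^bsub>alg_dirprod G H\<^esub> x = (inv\<^bsub>G\<^esub> (fst x), inv\<^bsub>H\<^esub> (snd x))"
  using assms by (intro group.inv_equality[OF group_alg_dirprod[OF assms(1,2)]]) (auto simp: group.l_inv)

lemma function_algebras [simp]:
  "function_algebra (regular (alg_prod I G))" "function_algebra (regular (alg_dirprod G' H'))"
  "function_algebra (regular Gm)" "function_algebra (regular (SL m))" "function_algebra (regular (GL m))"
  by (auto simp: regular_alg_prod regular_alg_dirprod regular_SL regular_GL)

lemma regular_on_carrier_update [simp]: "regular (G\<lparr>carrier := K\<rparr>) = regular G"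
  by simp

lemma alg_prod_regular:
  assumes "i \<in> I" "\<phi> \<in> regular_on (regular (G i)) (carrier (G i))" "K \<subseteq> carrier (alg_prod I G)"
  shows "(\<lambda>x. \<phi> (x i)) \<in> regular_on (regular (alg_prod I G)) K"
proof -
  obtain \<psi> where \<psi>: "\<psi> \<in> regular (G i)" "\<forall>x\<in>carrier (G i). \<psi> x = \<phi> x" using assms(2) unfolding regular_on_def by auto
  have "(\<lambda>x. \<psi> (x i)) \<in> regular (alg_prod I G)"
    unfolding regular_alg_prod using \<psi> assms(1) by (intro generated_algebra.gen) auto
  then show ?thesis by (rule regular_onI) (use \<psi> assms in \<open>auto simp: PiE_iff\<close>)
qed

lemma SL_entry_regular:
  assumes "i < m" "j < m"
  shows "(\<lambda>A. A $$ (i,j)) \<in> regular_on (regular (SL m)) K"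
  by (rule regular_onI[of "\<lambda>A. A $$ (i,j)"]) (use assms in \<open>auto simp: regular_SL intro: generated_algebra.gen\<close>)

lemma GL_entry_regular:
  assumes "i < m" "j < m"
  shows "(\<lambda>A. A $$ (i,j)) \<in> regular_on (regular (GL m)) K"
  by (rule regular_onI[of "\<lambda>A. A $$ (i,j)"]) (use assms in \<open>auto simp: regular_GL intro: generated_algebra.gen\<close>)

lemma Gm_regular: "(\<lambda>z. z) \<in> regular_on (regular Gm) K" "inverse \<in> regular_on (regular Gm) K"
  by (rule regular_onI[of "\<lambda>z. z"]; simp add: generated_algebra.gen)
    (rule regular_onI[of inverse]; simp add: generated_algebra.gen)

lemma Gm_powi_regular: "(\<lambda>z. z powi k) \<in> regular_on (regular Gm) K"
  by (intro regular_on_powi Gm_regular) auto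

section \<open>Simultaneous diagonalisation\<close>

text \<open>The determinant is linear in column \<open>k\<close>: the cofactors along that column do
  not depend on its entries.\<close>

lemma det_replace_column:
  fixes N :: "complex mat"
  assumes N: "N \<in> carrier_mat d d" and k: "k < d" and F: "finite F"
    and col: "\<And>i. i < d \<Longrightarrow> N $$ (i,k) = (\<Sum>\<chi>\<in>F. w \<chi> i)" and nz: "det N \<noteq> 0"
  shows "\<exists>\<chi>\<in>F. det (mat d d (\<lambda>(i,j). if j = k then w \<chi> i else N $$ (i,j))) \<noteq> 0"
proof (rule ccontr)
  assume *: "\<not> ?thesis"
  let ?N = "\<lambda>\<chi>. mat d d (\<lambda>(i,j). if j = k then w \<chi> i else N $$ (i,j))"
  have cof: "cofactor (?N \<chi>) i k = cofactor N i k" if "i < d" for \<chi> i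
  proof -
    have "mat_delete (?N \<chi>) i k = mat_delete N i k"
      using N that k by (intro eq_matI) (auto simp: mat_delete_def)
    then show ?thesis by (simp add: cofactor_def)
  qed
  have "det N = (\<Sum>i<d. (\<Sum>\<chi>\<in>F. w \<chi> i) * cofactor N i k)"
    unfolding laplace_expansion_column[OF N k] using col by (intro sum.cong) auto
  also have "\<dots> = (\<Sum>\<chi>\<in>F. \<Sum>i<d. w \<chi> i * cofactor N i k)"
    unfolding sum_distrib_right by (rule sum.swap)
  also have "\<dots> = (\<Sum>\<chi>\<in>F. det (?N \<chi>))"
  proof (rule sum.cong[OF refl])
    fix \<chi> assume "\<chi> \<in> F"
    have "det (?N \<chi>) = (\<Sum>i<d. ?N \<chi> $$ (i,k) * cofactor (?N \<chi>) i k)"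
      by (rule laplace_expansion_column) (use k in auto)
    also have "\<dots> = (\<Sum>i<d. w \<chi> i * cofactor N i k)" using cof k by (intro sum.cong) auto
    finally show "(\<Sum>i<d. w \<chi> i * cofactor N i k) = det (?N \<chi>)" by simp
  qed
  also have "\<dots> = 0" using * by (intro sum.neutral) auto
  finally show False using nz by simp
qed

context char_family
begin

lemma isotypicD:
  assumes "isotypic \<rho> d F P"
  shows "finite F" "F \<subseteq> C" "\<chi> \<in> F \<Longrightarrow> P \<chi> \<in> carrier_mat d d" "\<chi> \<in> F \<Longrightarrow> P \<chi> \<noteq> 0\<^sub>m d d"
    "\<chi> \<in> F \<Longrightarrow> \<psi> \<in> F \<Longrightarrow> P \<chi> * P \<psi> = (if \<chi> = \<psi> then P \<chi> else 0\<^sub>m d d)"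
    "x \<in> carrier K \<Longrightarrow> i < d \<Longrightarrow> j < d \<Longrightarrow> \<rho> x $$ (i,j) = (\<Sum>\<chi>\<in>F. \<chi> x * P \<chi> $$ (i,j))"
  using assms unfolding isotypic_def by blast+

lemma isotypic_eigen:
  assumes iso: "isotypic \<rho> d F P" and \<rho>: "x \<in> carrier K" "\<rho> x \<in> carrier_mat d d" and \<chi>F: "\<chi> \<in> F"
  shows "\<rho> x * P \<chi> = \<chi> x \<cdot>\<^sub>m P \<chi>" "P \<chi> * \<rho> x = \<chi> x \<cdot>\<^sub>m P \<chi>"
proof -
  have F: "finite F" "\<chi> \<in> F" "\<And>\<chi>. \<chi> \<in> F \<Longrightarrow> P \<chi> \<in> carrier_mat d d"
    using isotypicD[OF iso] \<chi>F by auto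
  note PP = isotypicD(5)[OF iso] and dec = isotypicD(6)[OF iso \<rho>(1)]
  have e: "(P \<psi> * P \<chi>) $$ (i,j) = (\<Sum>k=0..<d. P \<psi> $$ (i,k) * P \<chi> $$ (k,j))"
    if "i < d" "j < d" "\<psi> \<in> F" "\<chi> \<in> F" for i j \<psi> \<chi>
    using F(3)[OF that(3)] F(3)[OF that(4)] that by (auto simp: scalar_prod_def)
  have z: "(P \<psi> * P \<chi>) $$ (i,j) = (if \<psi> = \<chi> then P \<chi> $$ (i,j) else 0)"
    if "i < d" "j < d" "\<psi> \<in> F" "\<chi> \<in> F" for i j \<psi> \<chi>
    using PP[OF that(3,4)] that by auto
  show "\<rho> x * P \<chi> = \<chi> x \<cdot>\<^sub>m P \<chi>"
  proof (rule eq_matI)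
    fix i j assume "i < dim_row (\<chi> x \<cdot>\<^sub>m P \<chi>)" "j < dim_col (\<chi> x \<cdot>\<^sub>m P \<chi>)"
    then have ij: "i < d" "j < d" using F(3)[OF F(2)] by auto
    have "(\<rho> x * P \<chi>) $$ (i,j) = (\<Sum>k=0..<d. (\<Sum>\<psi>\<in>F. \<psi> x * P \<psi> $$ (i,k)) * P \<chi> $$ (k,j))"
      using \<rho> F(3)[OF F(2)] ij by (auto simp: scalar_prod_def dec)
    also have "\<dots> = (\<Sum>k=0..<d. \<Sum>\<psi>\<in>F. \<psi> x * P \<psi> $$ (i,k) * P \<chi> $$ (k,j))"
      by (simp add: sum_distrib_right)
    also have "\<dots> = (\<Sum>\<psi>\<in>F. \<Sum>k=0..<d. \<psi> x * P \<psi> $$ (i,k) * P \<chi> $$ (k,j))" by (rule sum.swap)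
    also have "\<dots> = (\<Sum>\<psi>\<in>F. \<psi> x * (P \<psi> * P \<chi>) $$ (i,j))"
      using e ij F(2) by (intro sum.cong) (auto simp: sum_distrib_left mult.assoc)
    also have "\<dots> = (\<Sum>\<psi>\<in>F. if \<psi> = \<chi> then \<chi> x * P \<chi> $$ (i,j) else 0)"
      using z ij F(2) by (intro sum.cong) auto
    finally show "(\<rho> x * P \<chi>) $$ (i,j) = (\<chi> x \<cdot>\<^sub>m P \<chi>) $$ (i,j)"
      using F(1,2) ij carrier_matD[OF F(3)[OF F(2)]] by simp
  qed (use \<rho> F(3)[OF F(2)] in auto)
  show "P \<chi> * \<rho> x = \<chi> x \<cdot>\<^sub>m P \<chi>"
  proof (rule eq_matI)
    fix i j assume "i < dim_row (\<chi> x \<cdot>\<^sub>m P \<chi>)" "j < dim_col (\<chi> x \<cdot>\<^sub>m P \<chi>)"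
    then have ij: "i < d" "j < d" using F(3)[OF F(2)] by auto
    have "(P \<chi> * \<rho> x) $$ (i,j) = (\<Sum>k=0..<d. P \<chi> $$ (i,k) * (\<Sum>\<psi>\<in>F. \<psi> x * P \<psi> $$ (k,j)))"
      using \<rho> F(3)[OF F(2)] ij by (auto simp: scalar_prod_def dec)
    also have "\<dots> = (\<Sum>k=0..<d. \<Sum>\<psi>\<in>F. \<psi> x * (P \<chi> $$ (i,k) * P \<psi> $$ (k,j)))"
      unfolding sum_distrib_left by (intro sum.cong refl) (simp add: mult.left_commute)
    also have "\<dots> = (\<Sum>\<psi>\<in>F. \<Sum>k=0..<d. \<psi> x * (P \<chi> $$ (i,k) * P \<psi> $$ (k,j)))" by (rule sum.swap)
    also have "\<dots> = (\<Sum>\<psi>\<in>F. \<psi> x * (P \<chi> * P \<psi>) $$ (i,j))"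
      using e ij F(2) by (intro sum.cong) (auto simp: sum_distrib_left mult_ac)
    also have "\<dots> = (\<Sum>\<psi>\<in>F. if \<psi> = \<chi> then \<chi> x * P \<chi> $$ (i,j) else 0)"
      using z[OF ij F(2)] by (intro sum.cong) auto
    finally show "(P \<chi> * \<rho> x) $$ (i,j) = (\<chi> x \<cdot>\<^sub>m P \<chi>) $$ (i,j)"
      using F(1,2) ij carrier_matD[OF F(3)[OF F(2)]] by simp
  qed (use \<rho> F(3)[OF F(2)] in auto)
qed

text \<open>An eigenbasis is built by replacing the columns of the identity matrix, one after the
  other, by columns of the projections. An identity column is the sum of the corresponding
  projection columns, so one of these keeps the determinant nonzero. Scaling by a
  \<open>d\<close>-th root of the inverse determinant lands in \<open>SL d\<close>, where the
  adjugate is the inverse.\<close>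

theorem diagonalisable:
  assumes \<rho>: "\<And>x. x \<in> carrier K \<Longrightarrow> \<rho> x \<in> carrier_mat d d" "\<rho> \<one> = 1\<^sub>m d"
    "\<And>x y. x \<in> carrier K \<Longrightarrow> y \<in> carrier K \<Longrightarrow> \<rho> (x \<otimes> y) = \<rho> x * \<rho> y"
    and comb: "\<And>i j. i < d \<Longrightarrow> j < d \<Longrightarrow> finite_comb (carrier K) C (\<lambda>x. \<rho> x $$ (i,j))"
  shows "\<exists>B\<in>carrier (SL d). \<forall>x\<in>carrier K. \<forall>i<d. \<forall>j<d. i \<noteq> j \<longrightarrow> (adj_mat B * (\<rho> x * B)) $$ (i,j) = 0"
proof -
  interpret monoid K by (rule monoid_K)
  obtain F P where iso: "isotypic \<rho> d F P" using isotypic_decomposition[OF \<rho> comb] by blast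
  note FP = isotypicD[OF iso]
  define N where "N = (\<lambda>k g. mat d d (\<lambda>(i,j). if j < k then P (g j) $$ (i,j) else if i = j then 1 else 0))"
  have "\<exists>g. (\<forall>j<k. g j \<in> F) \<and> det (N k g) \<noteq> 0" if "k \<le> d" for k
    using that
  proof (induction k)
    case 0
    have "N 0 g = 1\<^sub>m d" for g by (intro eq_matI) (auto simp: N_def)
    then show ?case by auto
  next
    case (Suc k)
    then obtain g where g: "\<forall>j<k. g j \<in> F" "det (N k g) \<noteq> 0" by auto
    have k: "k < d" using Suc by simp
    have "N k g $$ (i,k) = (\<Sum>\<chi>\<in>F. P \<chi> $$ (i,k))" if "i < d" for i
    proof -
      have "N k g $$ (i,k) = \<rho> \<one> $$ (i,k)" using that k \<rho>(2) by (simp add: N_def)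
      also have "\<dots> = (\<Sum>\<chi>\<in>F. P \<chi> $$ (i,k))"
        unfolding FP(6)[OF one_closed that k] using FP(2) char_one by (intro sum.cong) auto
      finally show ?thesis .
    qed
    from det_replace_column[OF _ k FP(1) this g(2)]
    obtain \<chi> where \<chi>: "\<chi> \<in> F" "det (mat d d (\<lambda>(i,j). if j = k then P \<chi> $$ (i,k) else N k g $$ (i,j))) \<noteq> 0"
      by (auto simp: N_def)
    have "mat d d (\<lambda>(i,j). if j = k then P \<chi> $$ (i,k) else N k g $$ (i,j)) = N (Suc k) (g(k := \<chi>))"
      by (intro eq_matI) (auto simp: N_def less_Suc_eq)
    then have "det (N (Suc k) (g(k := \<chi>))) \<noteq> 0" using \<chi>(2) by metis
    moreover have "\<forall>j<Suc k. (g(k := \<chi>)) j \<in> F" using \<chi>(1) g(1) by (auto simp: less_Suc_eq)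
    ultimately show ?case by blast
  qed
  from this[OF order.refl] obtain g where g: "\<And>j. j < d \<Longrightarrow> g j \<in> F" "det (N d g) \<noteq> 0" by auto
  have "\<exists>c. c ^ d * det (N d g) = 1"
  proof (cases "d = 0")
    case True
    then show ?thesis using g by (simp add: N_def)
  next
    case False
    have "card {z. z ^ d = inverse (det (N d g))} = d" using False g(2) by (intro card_nth_roots) auto
    then have "{z. z ^ d = inverse (det (N d g))} \<noteq> {}" using False by (metis card.empty)
    then obtain z where "z ^ d = inverse (det (N d g))" by blast
    then show ?thesis using g(2) by (intro exI[of _ z]) simp
  qed
  then obtain c where c: "c ^ d * det (N d g) = 1" by blast
  define B where "B = c \<cdot>\<^sub>m N d g"
  have Nc: "N d g \<in> carrier_mat d d" by (simp add: N_def)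
  have Bc: "B \<in> carrier_mat d d" "det B = 1" using Nc c by (auto simp: B_def)
  have "(adj_mat B * (\<rho> x * B)) $$ (i,j) = 0" if x: "x \<in> carrier K" and ij: "i < d" "j < d" "i \<noteq> j" for x i j
    proof -
      have gj: "g j \<in> F" using g(1) ij by simp
      have eig: "\<rho> x * P (g j) = g j x \<cdot>\<^sub>m P (g j)"
        by (rule isotypic_eigen(1)[OF iso x \<rho>(1)[OF x] gj])
      have "(\<rho> x * B) $$ (l,j) = g j x * B $$ (l,j)" if l: "l < d" for l
      proof -
        have "(\<rho> x * B) $$ (l,j) = c * (\<rho> x * P (g j)) $$ (l,j)"
          using \<rho>(1)[OF x] Bc(1) Nc FP(3)[OF gj] l ij
          by (auto simp: scalar_prod_def B_def N_def sum_distrib_left mult_ac)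
        also have "\<dots> = g j x * B $$ (l,j)"
          unfolding eig using FP(3)[OF gj] l ij Nc by (auto simp: B_def N_def)
        finally show ?thesis .
      qed
      then have "(adj_mat B * (\<rho> x * B)) $$ (i,j) = (\<Sum>l=0..<d. adj_mat B $$ (i,l) * (g j x * B $$ (l,j)))"
        using \<rho>(1)[OF x] Bc adj_mat_det_1(3)[OF Bc] ij by (auto simp: scalar_prod_def)
      also have "\<dots> = g j x * (adj_mat B * B) $$ (i,j)"
        using Bc adj_mat_det_1(3)[OF Bc] ij by (auto simp: scalar_prod_def sum_distrib_left mult_ac)
      also have "\<dots> = 0" using adj_mat_det_1(1)[OF Bc] ij by simp
      finally show ?thesis .
    qed
  moreover have "B \<in> carrier (SL d)" using Bc by simp
  ultimately show ?thesis by blast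
qed

end

section \<open>Split tori\<close>

definition torus_chars :: "nat \<Rightarrow> ((nat \<Rightarrow> complex) \<Rightarrow> complex) set" where
  "torus_chars r = range (\<lambda>e. \<lambda>t\<in>carrier (split_torus r). \<Prod>i<r. t i powi (e i :: int))"

lemma torus_charI: "(\<lambda>t\<in>carrier (split_torus r). \<Prod>i<r. t i powi e i) \<in> torus_chars r"
  unfolding torus_chars_def by (rule rangeI)

lemma split_torus_simps [simp]:
  "carrier (split_torus r) = (\<Pi>\<^sub>E i\<in>{..<r}. - {0})"
  "x \<otimes>\<^bsub>split_torus r\<^esub> y = (\<lambda>i\<in>{..<r}. x i * y i)"
  "\<one>\<^bsub>split_torus r\<^esub> = (\<lambda>i\<in>{..<r}. 1)"
  by (auto simp: split_torus_def)

lemma group_split_torus: "group (split_torus r)"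
  unfolding split_torus_def by (intro group_alg_prod group_Gm)

lemma char_family_torus: "char_family (split_torus r) (torus_chars r)"
proof (rule char_family.intro)
  show "monoid (split_torus r)" using group_split_torus by (rule group.is_monoid)
  show "\<chi> \<in> extensional (carrier (split_torus r))" if "\<chi> \<in> torus_chars r" for \<chi>
    using that unfolding torus_chars_def by auto
  show "\<chi> \<one>\<^bsub>split_torus r\<^esub> = 1" if "\<chi> \<in> torus_chars r" for \<chi>
    using that unfolding torus_chars_def by auto
  show "\<chi> (x \<otimes>\<^bsub>split_torus r\<^esub> y) = \<chi> x * \<chi> y"
    if "\<chi> \<in> torus_chars r" "x \<in> carrier (split_torus r)" "y \<in> carrier (split_torus r)" for \<chi> x y
  proof -
    have "x \<otimes>\<^bsub>split_torus r\<^esub> y \<in> carrier (split_torus r)"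
      using that by (intro monoid.m_closed group.is_monoid group_split_torus)
    then show ?thesis
      using that unfolding torus_chars_def by (auto simp: power_int_mult_distrib prod.distrib)
  qed
qed

lemma char_closed_torus: "char_closed (carrier (split_torus r)) (torus_chars r)"
  unfolding char_closed_def
proof (intro conjI ballI)
  show "\<exists>\<chi>\<in>torus_chars r. \<forall>x\<in>carrier (split_torus r). \<chi> x = 1"
    unfolding torus_chars_def by (rule bexI[OF _ rangeI[of _ "\<lambda>_. 0"]]) auto
  fix \<chi> \<psi> assume "\<chi> \<in> torus_chars r" "\<psi> \<in> torus_chars r"
  then obtain e f where ef: "\<chi> = (\<lambda>t\<in>carrier (split_torus r). \<Prod>i<r. t i powi e i)"
      "\<psi> = (\<lambda>t\<in>carrier (split_torus r). \<Prod>i<r. t i powi f i)"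
    unfolding torus_chars_def by blast
  let ?\<omega> = "\<lambda>t\<in>carrier (split_torus r). \<Prod>i<r. t i powi (e i + f i)"
  have "?\<omega> t = \<chi> t * \<psi> t" if t: "t \<in> carrier (split_torus r)" for t
    unfolding ef restrict_apply'[OF t] prod.distrib[symmetric]
    by (rule prod.cong[OF refl], rule power_int_add) (use t in auto)
  moreover have "?\<omega> \<in> torus_chars r"
    by (rule torus_charI)
  ultimately show "\<exists>\<omega>\<in>torus_chars r. \<forall>x\<in>carrier (split_torus r). \<omega> x = \<chi> x * \<psi> x"
    by (rule_tac bexI[of _ ?\<omega>]) (rule ballI)
qed

text \<open>Regular functions on a split torus are Laurent polynomials in the coordinates.\<close>

lemma torus_regular_comb:
  assumes "f \<in> regular_on (regular (split_torus r)) (carrier (split_torus r))"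
  shows "finite_comb (carrier (split_torus r)) (torus_chars r) f"
proof -
  obtain g where g: "g \<in> regular (split_torus r)" "\<forall>x\<in>carrier (split_torus r). g x = f x"
    using assms unfolding regular_on_def by auto
  have single: "finite_comb (carrier (split_torus r)) (torus_chars r) (\<lambda>t. t i powi k)" if "i < r" for i k
  proof (rule finite_comb_char)
    show "(\<lambda>t\<in>carrier (split_torus r). \<Prod>j<r. t j powi (if j = i then k else 0)) \<in> torus_chars r"
      by (rule torus_charI)
    show "(\<lambda>t\<in>carrier (split_torus r). \<Prod>j<r. t j powi (if j = i then k else 0)) x = x i powi k"
      if "x \<in> carrier (split_torus r)" for x
    proof -
      have "(\<Prod>j<r. x j powi (if j = i then k else 0)) = (\<Prod>j<r. if j = i then x j powi k else 1)"
        by (intro prod.cong) auto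
      then show ?thesis using that \<open>i < r\<close> by simp
    qed
  qed
  have "finite_comb (carrier (split_torus r)) (torus_chars r) (\<lambda>x. g x)"
  proof (rule finite_comb_generated[OF g(1)[unfolded split_torus_def regular_alg_prod] char_closed_torus])
    fix s assume "s \<in> {\<lambda>x. \<phi> (x i) |i \<phi>. i \<in> {..<r} \<and> \<phi> \<in> regular Gm}"
    then obtain i \<phi> where s: "s = (\<lambda>x. \<phi> (x i))" "i < r" "\<phi> \<in> generated_algebra {\<lambda>z. z, inverse}" by auto
    have "finite_comb (carrier (split_torus r)) (torus_chars r) (\<lambda>x. \<phi> (x i))"
      by (rule finite_comb_generated[OF s(3) char_closed_torus])
        (use single[OF s(2), of 1] single[OF s(2), of "-1"] in auto)
    then show "finite_comb (carrier (split_torus r)) (torus_chars r) (\<lambda>x. s x)" using s by simp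
  qed
  then show ?thesis by (rule finite_comb_cong) (use g in auto)
qed

text \<open>The claim for a split torus is transported along an isomorphism. The diagonalising
  matrix has determinant one, so conjugation by it is inner in \<open>SL m\<close>.\<close>

theorem torus_diagonalisable:
  assumes "torus K" "\<rho> \<in> alg_hom K (SL m)"
  shows "\<exists>B\<in>carrier (SL m). \<forall>x\<in>carrier K. \<forall>i<m. \<forall>j<m. i \<noteq> j \<longrightarrow> (adj_mat B * (\<rho> x * B)) $$ (i,j) = 0"
proof -
  obtain r f g where fg: "f \<in> alg_hom (split_torus r) K" "g \<in> alg_hom K (split_torus r)" "\<forall>y\<in>carrier K. f (g y) = y"
    using assms(1) unfolding torus_def alg_iso_def by blast
  interpret char_family "split_torus r" "torus_chars r" by (rule char_family_torus)
  have h: "(\<lambda>t. \<rho> (f t)) \<in> alg_hom (split_torus r) (SL m)" using alg_hom_comp[OF fg(1) assms(2)] .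
  then have hh: "(\<lambda>t. \<rho> (f t)) \<in> hom (split_torus r) (SL m)" by (simp add: alg_hom_def)
  have "\<exists>B\<in>carrier (SL m). \<forall>x\<in>carrier (split_torus r). \<forall>i<m. \<forall>j<m.
      i \<noteq> j \<longrightarrow> (adj_mat B * (\<rho> (f x) * B)) $$ (i,j) = 0"
  proof (rule diagonalisable[of "\<lambda>t. \<rho> (f t)" m])
    show "\<rho> (f x) \<in> carrier_mat m m" if "x \<in> carrier (split_torus r)" for x
      using hom_in_carrier[OF hh that] by simp
    show "\<rho> (f \<one>\<^bsub>split_torus r\<^esub>) = 1\<^sub>m m" using hom_one[OF hh group_split_torus group_SL] by simp
    show "\<rho> (f (x \<otimes>\<^bsub>split_torus r\<^esub> y)) = \<rho> (f x) * \<rho> (f y)"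
      if "x \<in> carrier (split_torus r)" "y \<in> carrier (split_torus r)" for x y
      using hom_mult[OF hh that] by simp
    show "finite_comb (carrier (split_torus r)) (torus_chars r) (\<lambda>x. \<rho> (f x) $$ (i,j))" if "i < m" "j < m" for i j
      by (rule torus_regular_comb[OF alg_hom_regular[OF h SL_entry_regular[OF that]]])
  qed
  then obtain B where B: "B \<in> carrier (SL m)"
    "\<And>x i j. x \<in> carrier (split_torus r) \<Longrightarrow> i < m \<Longrightarrow> j < m \<Longrightarrow> i \<noteq> j \<Longrightarrow> (adj_mat B * (\<rho> (f x) * B)) $$ (i,j) = 0"
    by blast
  have "(adj_mat B * (\<rho> x * B)) $$ (i,j) = 0" if x: "x \<in> carrier K" and ij: "i < m" "j < m" "i \<noteq> j" for x i j
  proof -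
    have "g x \<in> carrier (split_torus r)" using alg_hom_carrier[OF fg(2) x] .
    from B(2)[OF this ij] show ?thesis using fg(3) x by simp
  qed
  then show ?thesis using B(1) by blast
qed

lemma alg_iso_sym: "alg_iso G H \<Longrightarrow> alg_iso H G"
  unfolding alg_iso_def by blast

lemma alg_iso_trans:
  assumes "alg_iso G H" "alg_iso H L"
  shows "alg_iso G L"
proof -
  obtain f g where fg: "f \<in> alg_hom G H" "g \<in> alg_hom H G" "\<forall>x\<in>carrier G. g (f x) = x" "\<forall>y\<in>carrier H. f (g y) = y"
    using assms(1) unfolding alg_iso_def by blast
  obtain p q where pq: "p \<in> alg_hom H L" "q \<in> alg_hom L H" "\<forall>x\<in>carrier H. q (p x) = x" "\<forall>y\<in>carrier L. p (q y) = y"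
    using assms(2) unfolding alg_iso_def by blast
  have "f x \<in> carrier H" if "x \<in> carrier G" for x using alg_hom_carrier[OF fg(1) that] .
  moreover have "q y \<in> carrier H" if "y \<in> carrier L" for y using alg_hom_carrier[OF pq(2) that] .
  ultimately show ?thesis unfolding alg_iso_def
    using fg pq alg_hom_comp[OF fg(1) pq(1)] alg_hom_comp[OF pq(2) fg(2)] by (intro bexI) auto
qed

text \<open>A split torus of rank \<open>r\<close> has \<open>2 ^ r\<close> elements of order
  dividing two, a number that isomorphisms preserve. This makes the definite description in
  \<open>torus_rank\<close> meaningful.\<close>

lemma split_torus_rank_unique:
  assumes "alg_iso (split_torus r) (split_torus s)"
  shows "r = s"
proof -
  define tors where "tors = (\<lambda>r. {t \<in> carrier (split_torus r). t \<otimes>\<^bsub>split_torus r\<^esub> t = \<one>\<^bsub>split_torus r\<^esub>})"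
  have "tors r = (\<Pi>\<^sub>E i\<in>{..<r}. {1, -1 :: complex})" for r
  proof -
    have sq: "z * z = 1 \<longleftrightarrow> z = 1 \<or> z = -1" for z :: complex
      using power2_eq_1_iff[of z] by (simp add: power2_eq_square)
    have eq: "(\<lambda>i\<in>{..<r}. t i * t i) = (\<lambda>i\<in>{..<r}. 1) \<longleftrightarrow> (\<forall>i<r. t i * t i = 1)" for t :: "nat \<Rightarrow> complex"
      by (auto simp: fun_eq_iff restrict_def)
    have "t \<in> tors r \<longleftrightarrow> (\<forall>i<r. t i \<noteq> 0) \<and> t \<in> extensional {..<r} \<and> (\<forall>i<r. t i = 1 \<or> t i = -1)" for t
      unfolding tors_def mem_Collect_eq split_torus_simps eq sq PiE_iff by auto
    moreover have "t i \<noteq> 0" if "t i = 1 \<or> t i = -1" for t :: "nat \<Rightarrow> complex" and i using that by auto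
    ultimately show ?thesis unfolding set_eq_iff PiE_iff by blast
  qed
  then have card: "card (tors r) = 2 ^ r" for r by (simp add: card_PiE numeral_2_eq_2)
  obtain f g where fg: "f \<in> alg_hom (split_torus r) (split_torus s)" "g \<in> alg_hom (split_torus s) (split_torus r)"
      "\<forall>x\<in>carrier (split_torus r). g (f x) = x" "\<forall>y\<in>carrier (split_torus s). f (g y) = y"
    using assms unfolding alg_iso_def by blast
  have maps: "h t \<in> tors q" if "h \<in> alg_hom (split_torus p) (split_torus q)" "t \<in> tors p" for h t p q
  proof -
    have h: "h \<in> hom (split_torus p) (split_torus q)" using that(1) by (simp add: alg_hom_def)
    have t: "t \<in> carrier (split_torus p)" "t \<otimes>\<^bsub>split_torus p\<^esub> t = \<one>\<^bsub>split_torus p\<^esub>"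
      using that(2) unfolding tors_def by auto
    have "h t \<otimes>\<^bsub>split_torus q\<^esub> h t = \<one>\<^bsub>split_torus q\<^esub>"
      using hom_mult[OF h t(1) t(1)] unfolding t(2) hom_one[OF h group_split_torus group_split_torus] by (rule sym)
    then show ?thesis using hom_in_carrier[OF h t(1)] unfolding tors_def by blast
  qed
  have "bij_betw f (tors r) (tors s)"
  proof (rule bij_betw_byWitness[of _ g])
    show "\<forall>a\<in>tors r. g (f a) = a" "\<forall>a\<in>tors s. f (g a) = a" using fg unfolding tors_def by blast+
  qed (use maps fg in blast)+
  then have "(2::nat) ^ r = 2 ^ s" using card bij_betw_same_card by metis
  then show ?thesis by simp
qed

lemma torus_rank_eq:
  assumes "alg_iso (split_torus r) K"
  shows "torus_rank K = r"
  unfolding torus_rank_def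
  by (rule the_equality) (use assms split_torus_rank_unique alg_iso_trans alg_iso_sym in blast)+

section \<open>Root subgroups\<close>

text \<open>The matrix with rows \<open>(a, b)\<close> and \<open>(c, d)\<close> placed in the rows
  and columns \<open>j\<close>, \<open>k\<close> of the identity matrix. For determinant one this is
  the copy of \<open>SL(2)\<close> attached to a root; its unipotent, diagonal and Weyl elements are
  special cases.\<close>

definition root_block :: "nat \<Rightarrow> nat \<Rightarrow> nat \<Rightarrow> complex \<Rightarrow> complex \<Rightarrow> complex \<Rightarrow> complex \<Rightarrow> complex mat" where
  "root_block m j k a b c d = mat m m (\<lambda>(p,q).
     if p = j then (if q = j then a else if q = k then b else 0)
     else if p = k then (if q = j then c else if q = k then d else 0)
     else if p = q then 1 else 0)"

lemma root_block_carrier [simp]: "root_block m j k a b c d \<in> carrier_mat m m"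
  by (simp add: root_block_def)

lemma root_block_dim [simp]: "dim_row (root_block m j k a b c d) = m" "dim_col (root_block m j k a b c d) = m"
  by (simp_all add: root_block_def)

lemma root_block_left:
  assumes "j < m" "k < m" "j \<noteq> k" "T \<in> carrier_mat m m" "p < m" "r < m"
  shows "(root_block m j k a b c d * T) $$ (p,r) =
    (if p = j then a * T $$ (j,r) + b * T $$ (k,r) else if p = k then c * T $$ (j,r) + d * T $$ (k,r) else T $$ (p,r))"
proof -
  let ?B = "root_block m j k a b c d"
  have "(?B * T) $$ (p,r) = (\<Sum>q\<in>{0..<m}. ?B $$ (p,q) * T $$ (q,r))"
    using assms by (auto simp: scalar_prod_def root_block_def)
  also have "\<dots> = (\<Sum>q\<in>{j,k,p}. ?B $$ (p,q) * T $$ (q,r))"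
    using assms by (intro sum.mono_neutral_right) (auto simp: root_block_def)
  also have "\<dots> = (if p = j then a * T $$ (j,r) + b * T $$ (k,r) else if p = k then c * T $$ (j,r) + d * T $$ (k,r) else T $$ (p,r))"
    using assms by (auto simp: root_block_def insert_commute)
  finally show ?thesis .
qed

lemma root_block_right:
  assumes "j < m" "k < m" "j \<noteq> k" "T \<in> carrier_mat m m" "p < m" "r < m"
  shows "(T * root_block m j k a b c d) $$ (p,r) =
    (if r = j then T $$ (p,j) * a + T $$ (p,k) * c else if r = k then T $$ (p,j) * b + T $$ (p,k) * d else T $$ (p,r))"
proof -
  let ?B = "root_block m j k a b c d"
  have "(T * ?B) $$ (p,r) = (\<Sum>q\<in>{0..<m}. T $$ (p,q) * ?B $$ (q,r))"
    using assms by (auto simp: scalar_prod_def root_block_def)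
  also have "\<dots> = (\<Sum>q\<in>{j,k,r}. T $$ (p,q) * ?B $$ (q,r))"
    using assms by (intro sum.mono_neutral_right) (auto simp: root_block_def)
  also have "\<dots> = (if r = j then T $$ (p,j) * a + T $$ (p,k) * c else if r = k then T $$ (p,j) * b + T $$ (p,k) * d else T $$ (p,r))"
    using assms by (auto simp: root_block_def insert_commute)
  finally show ?thesis .
qed

lemma root_block_mult:
  assumes "j < m" "k < m" "j \<noteq> k"
  shows "root_block m j k a b c d * root_block m j k a' b' c' d' =
    root_block m j k (a*a'+b*c') (a*b'+b*d') (c*a'+d*c') (c*b'+d*d')"
proof (rule eq_matI)
  fix p r assume "p < dim_row (root_block m j k (a*a'+b*c') (a*b'+b*d') (c*a'+d*c') (c*b'+d*d'))"
    "r < dim_col (root_block m j k (a*a'+b*c') (a*b'+b*d') (c*a'+d*c') (c*b'+d*d'))"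
  then have pr: "p < m" "r < m" by (simp_all add: root_block_def)
  show "(root_block m j k a b c d * root_block m j k a' b' c' d') $$ (p,r) =
      root_block m j k (a*a'+b*c') (a*b'+b*d') (c*a'+d*c') (c*b'+d*d') $$ (p,r)"
    unfolding root_block_left[OF assms root_block_carrier pr]
    using assms pr by (auto simp: root_block_def)
qed (simp_all add: root_block_def)

lemma det_root_block_unipotent:
  assumes "j < m" "k < m" "j \<noteq> k"
  shows "det (root_block m j k 1 b 0 1) = 1" "det (root_block m j k 1 0 c 1) = 1"
proof -
  have "root_block m j k 1 b 0 1 = addrow_mat m b j k"
    by (rule eq_matI) (use assms in \<open>auto simp: root_block_def\<close>)
  then show "det (root_block m j k 1 b 0 1) = 1" using det_addrow_mat[of j k] assms by simp
  have "root_block m j k 1 0 c 1 = addrow_mat m c k j"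
    by (rule eq_matI) (use assms in \<open>auto simp: root_block_def\<close>)
  then show "det (root_block m j k 1 0 c 1) = 1" using det_addrow_mat[of k j] assms by simp
qed

section \<open>Products of special linear groups\<close>

locale sl_product =
  fixes I :: "'i set" and n :: "'i \<Rightarrow> nat"
  assumes finite_I: "finite I" and n_pos: "i \<in> I \<Longrightarrow> 1 \<le> n i"
begin

definition H :: "('i \<Rightarrow> complex mat) alg_group" where "H = alg_prod I (\<lambda>i. SL (n i))"

text \<open>The reference torus of diagonal matrices, to which every maximal torus of
  \<open>H\<close> turns out to be conjugate.\<close>

definition D :: "('i \<Rightarrow> complex mat) set" where
  "D = {x \<in> carrier H. \<forall>i\<in>I. \<forall>j<n i. \<forall>k<n i. j \<noteq> k \<longrightarrow> x i $$ (j,k) = 0}"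

definition diag :: "('i \<Rightarrow> nat \<Rightarrow> complex) \<Rightarrow> 'i \<Rightarrow> complex mat" where
  "diag c = (\<lambda>i\<in>I. mat (n i) (n i) (\<lambda>(j,k). if j = k then c i j else 0))"

text \<open>The character of \<open>D\<close> with exponents \<open>x\<close>. On \<open>D\<close>
  it does not change when a constant is added to \<open>x\<close> within one factor.\<close>

definition mono :: "('i \<Rightarrow> nat \<Rightarrow> int) \<Rightarrow> ('i \<Rightarrow> complex mat) \<Rightarrow> complex" where
  "mono x h = (\<Prod>i\<in>I. \<Prod>j<n i. (h i $$ (j,j)) powi (x i j))"

definition lift :: "'i \<Rightarrow> complex mat \<Rightarrow> 'i \<Rightarrow> complex mat" where
  "lift i B = (\<lambda>i'\<in>I. if i' = i then B else 1\<^sub>m (n i'))"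

lemma carrier_H: "x \<in> carrier H \<longleftrightarrow> x \<in> extensional I \<and> (\<forall>i\<in>I. x i \<in> carrier_mat (n i) (n i) \<and> det (x i) = 1)"
  by (auto simp: H_def PiE_iff)

lemma mult_H: "x \<otimes>\<^bsub>H\<^esub> y = (\<lambda>i\<in>I. x i * y i)"
  by (simp add: H_def)

lemma one_H: "\<one>\<^bsub>H\<^esub> = (\<lambda>i\<in>I. 1\<^sub>m (n i))"
  by (simp add: H_def)

lemma group_H: "group H"
  unfolding H_def by (intro group_alg_prod group_SL)

lemma inv_H: "x \<in> carrier H \<Longrightarrow> inv\<^bsub>H\<^esub> x = (\<lambda>i\<in>I. adj_mat (x i))"
  unfolding H_def by (subst inv_alg_prod) (auto intro!: group_SL restrict_ext inv_SL)

lemma function_algebra_H [simp]: "function_algebra (regular H)"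
  by (simp add: H_def)

lemma H_entry_regular:
  assumes "i \<in> I" "j < n i" "k < n i" "K \<subseteq> carrier H"
  shows "(\<lambda>x. x i $$ (j,k)) \<in> regular_on (regular H) K"
  using alg_prod_regular[of i I "\<lambda>A. A $$ (j,k)" "\<lambda>i. SL (n i)" K] SL_entry_regular[of j "n i" k] assms
  unfolding H_def by blast

text \<open>The coordinate ring of the product is generated in two stages, by pullbacks from the
  factors and, within a factor, by matrix entries. This rule flattens the two inductions into
  one.\<close>

lemma regular_H_induct [consumes 1, case_names const add mult entry]:
  assumes f: "f \<in> regular H"
    and const: "\<And>c. P (\<lambda>_. c)" and add: "\<And>f g. P f \<Longrightarrow> P g \<Longrightarrow> P (\<lambda>x. f x + g x)"
    and mult: "\<And>f g. P f \<Longrightarrow> P g \<Longrightarrow> P (\<lambda>x. f x * g x)"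
    and entry: "\<And>i j k. i \<in> I \<Longrightarrow> j < n i \<Longrightarrow> k < n i \<Longrightarrow> P (\<lambda>x. x i $$ (j,k))"
  shows "P f"
  using f unfolding H_def regular_alg_prod
proof induction
  case (gen f)
  then obtain i \<phi> where f: "f = (\<lambda>x. \<phi> (x i))" "i \<in> I" "\<phi> \<in> regular (SL (n i))" by auto
  show ?case using f(3) unfolding f(1) regular_SL
  proof induction
    case (gen \<phi>)
    then obtain j k where "\<phi> = (\<lambda>A. A $$ (j,k))" "j < n i" "k < n i" by auto
    then show ?case using entry f(2) by simp
  qed (use const add mult in auto)
qed (use const add mult in auto)

lemma hom_into_H:
  assumes f: "f \<in> hom G H" and R: "function_algebra (regular G)"
    and e: "\<And>i j k. i \<in> I \<Longrightarrow> j < n i \<Longrightarrow> k < n i \<Longrightarrow> (\<lambda>x. f x i $$ (j,k)) \<in> regular_on (regular G) (carrier G)"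
  shows "f \<in> alg_hom G H"
proof -
  have "(\<lambda>x. \<phi> (f x)) \<in> regular_on (regular G) (carrier G)" if "\<phi> \<in> regular H" for \<phi>
    using that
    by (induction rule: regular_H_induct) (use R e in \<open>auto intro: regular_on_const regular_on_add regular_on_mult\<close>)
  then show ?thesis using f unfolding alg_hom_def regular_on_def by auto
qed

lemma D_subset: "D \<subseteq> carrier H" by (auto simp: D_def)

lemma D_offdiag: "t \<in> D \<Longrightarrow> i \<in> I \<Longrightarrow> j < n i \<Longrightarrow> k < n i \<Longrightarrow> j \<noteq> k \<Longrightarrow> t i $$ (j,k) = 0"
  by (simp add: D_def)

lemma D_carrier: "t \<in> D \<Longrightarrow> i \<in> I \<Longrightarrow> t i \<in> carrier_mat (n i) (n i)"
  using D_subset carrier_H by blast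

lemma D_prod: assumes "t \<in> D" "i \<in> I" shows "(\<Prod>j<n i. t i $$ (j,j)) = 1"
proof -
  have "det (t i) = prod_list (diag_mat (t i))"
    by (rule det_upper_triangular[OF _ D_carrier[OF assms]])
      (use D_carrier[OF assms] D_offdiag[OF assms] in \<open>auto intro!: upper_triangularI\<close>)
  also have "\<dots> = (\<Prod>j<n i. t i $$ (j,j))"
    using D_carrier[OF assms] by (simp add: prod_list_diag_prod atLeast0LessThan)
  finally show ?thesis using assms D_subset carrier_H by auto
qed

lemma D_nonzero: assumes "t \<in> D" "i \<in> I" "j < n i" shows "t i $$ (j,j) \<noteq> 0"
proof
  assume "t i $$ (j,j) = 0"
  then have "(\<Prod>j<n i. t i $$ (j,j)) = 0" using assms(3) by (intro prod_zero) auto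
  then show False using D_prod[OF assms(1,2)] by simp
qed

lemma diag_entry: "i \<in> I \<Longrightarrow> j < n i \<Longrightarrow> k < n i \<Longrightarrow> diag c i $$ (j,k) = (if j = k then c i j else 0)"
  by (simp add: diag_def)

lemma diag_in_D: assumes "\<And>i. i \<in> I \<Longrightarrow> (\<Prod>j<n i. c i j) = 1" shows "diag c \<in> D"
proof -
  have "det (diag c i) = 1" if i: "i \<in> I" for i
  proof -
    have "det (diag c i) = prod_list (diag_mat (diag c i))"
      by (rule det_upper_triangular[of _ "n i"]) (use i in \<open>auto simp: diag_def intro!: upper_triangularI\<close>)
    also have "\<dots> = (\<Prod>j<n i. c i j)"
      using i by (simp add: prod_list_diag_prod atLeast0LessThan diag_def)
    finally show ?thesis using assms[OF i] by simp
  qed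
  then have "diag c \<in> carrier H" unfolding carrier_H by (auto simp: diag_def)
  then show ?thesis unfolding D_def by (auto simp: diag_entry)
qed

lemma D_ext: assumes "s \<in> D" "t \<in> D" "\<And>i j. i \<in> I \<Longrightarrow> j < n i \<Longrightarrow> s i $$ (j,j) = t i $$ (j,j)" shows "s = t"
proof (rule extensionalityI[of _ I])
  show "s \<in> extensional I" "t \<in> extensional I" using assms D_subset carrier_H by blast+
  show "s i = t i" if i: "i \<in> I" for i
  proof (rule eq_matI)
    fix j k assume "j < dim_row (t i)" "k < dim_col (t i)"
    then have jk: "j < n i" "k < n i" using D_carrier[OF assms(2) i] by auto
    show "s i $$ (j,k) = t i $$ (j,k)"
    proof (cases "j = k")
      case True
      then show ?thesis using assms(3)[OF i] jk by simp
    next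
      case False
      then show ?thesis using D_offdiag[OF assms(1) i jk] D_offdiag[OF assms(2) i jk] by simp
    qed
  qed (use D_carrier[OF assms(1) i] D_carrier[OF assms(2) i] in auto)
qed

lemma diag_of_D: assumes "t \<in> D" shows "diag (\<lambda>i j. t i $$ (j,j)) = t"
  by (rule D_ext[OF diag_in_D assms]) (use D_prod[OF assms] in \<open>auto simp: diag_entry\<close>)

lemma diag_mult: "diag c \<otimes>\<^bsub>H\<^esub> diag c' = diag (\<lambda>i j. c i j * c' i j)"
proof -
  have "diag c i * diag c' i = diag (\<lambda>i j. c i j * c' i j) i" if i: "i \<in> I" for i
  proof (rule eq_matI)
    fix j k assume "j < dim_row (diag (\<lambda>i j. c i j * c' i j) i)" "k < dim_col (diag (\<lambda>i j. c i j * c' i j) i)"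
    then have jk: "j < n i" "k < n i" using i by (auto simp: diag_def)
    have "(diag c i * diag c' i) $$ (j,k) = (\<Sum>l\<in>{0..<n i}. diag c i $$ (j,l) * diag c' i $$ (l,k))"
      using jk i by (auto simp: scalar_prod_def diag_def)
    also have "\<dots> = (\<Sum>l\<in>{0..<n i}. if l = j then c i j * diag c' i $$ (j,k) else 0)"
      using jk i by (intro sum.cong) (auto simp: diag_entry)
    finally show "(diag c i * diag c' i) $$ (j,k) = diag (\<lambda>i j. c i j * c' i j) i $$ (j,k)"
      using jk i by (simp add: diag_entry)
  qed (use i in \<open>auto simp: diag_def\<close>)
  then show ?thesis unfolding mult_H by (auto simp: diag_def)
qed

lemma D_mult_entry:
  assumes "s \<in> D" "t \<in> D" "i \<in> I" "j < n i"
  shows "(s \<otimes>\<^bsub>H\<^esub> t) i $$ (j,j) = s i $$ (j,j) * t i $$ (j,j)"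
  using diag_mult[of "\<lambda>i j. s i $$ (j,j)" "\<lambda>i j. t i $$ (j,j)"] assms by (simp add: diag_of_D diag_entry)

lemma subgroup_D: "subgroup D H"
proof (rule group.subgroupI[OF group_H D_subset])
  have "\<one>\<^bsub>H\<^esub> = diag (\<lambda>_ _. 1)" unfolding one_H diag_def by (intro restrict_ext eq_matI) auto
  then have one: "\<one>\<^bsub>H\<^esub> \<in> D" using diag_in_D[of "\<lambda>_ _. 1"] by simp
  then show "D \<noteq> {}" by blast
  show mult: "s \<otimes>\<^bsub>H\<^esub> t \<in> D" if "s \<in> D" "t \<in> D" for s t
    using diag_mult[of "\<lambda>i j. s i $$ (j,j)" "\<lambda>i j. t i $$ (j,j)"] that
      diag_in_D[of "\<lambda>i j. s i $$ (j,j) * t i $$ (j,j)"] by (simp add: diag_of_D prod.distrib D_prod)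
  show "inv\<^bsub>H\<^esub> t \<in> D" if t: "t \<in> D" for t
  proof -
    let ?s = "diag (\<lambda>i j. inverse (t i $$ (j,j)))"
    have s: "?s \<in> D" by (rule diag_in_D) (use D_prod[OF t] in \<open>simp add: prod_inversef[unfolded comp_def]\<close>)
    have "?s \<otimes>\<^bsub>H\<^esub> t = \<one>\<^bsub>H\<^esub>"
    proof (rule D_ext[OF mult[OF s t] one])
      fix i j assume ij: "i \<in> I" "j < n i"
      show "(?s \<otimes>\<^bsub>H\<^esub> t) i $$ (j,j) = \<one>\<^bsub>H\<^esub> i $$ (j,j)"
        unfolding D_mult_entry[OF s t ij] using ij D_nonzero[OF t ij] by (simp add: diag_entry one_H)
    qed
    then have "inv\<^bsub>H\<^esub> t = ?s" using s t D_subset by (intro group.inv_equality[OF group_H]) auto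
    then show ?thesis using s by simp
  qed
qed

lemma group_D: "group (H\<lparr>carrier := D\<rparr>)"
  by (rule subgroup.subgroup_is_group[OF subgroup_D group_H])

lemma mono_mult: "s \<in> D \<Longrightarrow> t \<in> D \<Longrightarrow> mono x (s \<otimes>\<^bsub>H\<^esub> t) = mono x s * mono x t"
  by (simp add: mono_def D_mult_entry power_int_mult_distrib prod.distrib)

lemma mono_one: "mono x \<one>\<^bsub>H\<^esub> = 1"
  by (simp add: mono_def one_H)

lemma mono_add: assumes "t \<in> D" shows "mono (\<lambda>i j. x i j + y i j) t = mono x t * mono y t"
  using D_nonzero[OF assms] by (simp add: mono_def power_int_add prod.distrib)

lemma mono_zero: "mono (\<lambda>_ _. 0) t = 1"
  by (simp add: mono_def)

lemma mono_cong: "(\<And>i j. i \<in> I \<Longrightarrow> j < n i \<Longrightarrow> x i j = y i j) \<Longrightarrow> mono x t = mono y t"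
  by (simp add: mono_def)

lemma mono_const: assumes "t \<in> D" shows "mono (\<lambda>i _. c i) t = 1"
proof -
  have "(\<Prod>j<n i. (t i $$ (j,j)) powi c i) = 1" if "i \<in> I" for i
  proof -
    have "(\<Prod>j\<in>J. (t i $$ (j,j)) powi c i) = (\<Prod>j\<in>J. t i $$ (j,j)) powi c i" if "finite J" for J
      using that by (induction J rule: finite_induct) (auto simp: power_int_mult_distrib)
    then show ?thesis using D_prod[OF assms that] by simp
  qed
  then show ?thesis by (simp add: mono_def)
qed

lemma mono_single: assumes "i \<in> I" "j < n i"
  shows "mono (\<lambda>i' j'. if i' = i \<and> j' = j then c else 0) t = (t i $$ (j,j)) powi c"
proof -
  have "mono (\<lambda>i' j'. if i' = i \<and> j' = j then c else 0) t =
      (\<Prod>i'\<in>I. if i' = i then (\<Prod>j'<n i. if j' = j then (t i $$ (j,j)) powi c else 1) else 1)"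
    unfolding mono_def
  proof (rule prod.cong[OF refl])
    fix i'
    have *: "(\<Prod>j'<n i. t i $$ (j',j') powi (if i = i \<and> j' = j then c else 0)) =
        (\<Prod>j'<n i. if j' = j then (t i $$ (j,j)) powi c else 1)"
      by (intro prod.cong) auto
    show "(\<Prod>j'<n i'. t i' $$ (j',j') powi (if i' = i \<and> j' = j then c else 0)) =
        (if i' = i then (\<Prod>j'<n i. if j' = j then (t i $$ (j,j)) powi c else 1) else 1)"
    proof (cases "i' = i")
      case True
      show ?thesis unfolding True * by simp
    qed simp
  qed
  then show ?thesis using assms finite_I by simp
qed

text \<open>The diagonal entries of a factor multiply to one on \<open>D\<close>, so the inverse of
  one entry is the product of the others.\<close>

lemma D_inverse_entry_regular:
  assumes "i \<in> I" "j < n i"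
  shows "(\<lambda>t. inverse (t i $$ (j,j))) \<in> regular_on (regular H) D"
proof (rule regular_on_cong)
  show "(\<lambda>t. \<Prod>l\<in>{..<n i} - {j}. t i $$ (l,l)) \<in> regular_on (regular H) D"
    by (intro regular_on_prod H_entry_regular) (use assms D_subset in auto)
  show "(\<Prod>l\<in>{..<n i} - {j}. t i $$ (l,l)) = inverse (t i $$ (j,j))" if "t \<in> D" for t
  proof -
    have "(\<Prod>l<n i. t i $$ (l,l)) = t i $$ (j,j) * (\<Prod>l\<in>{..<n i} - {j}. t i $$ (l,l))"
      using assms by (intro prod.remove) auto
    then have "t i $$ (j,j) * (\<Prod>l\<in>{..<n i} - {j}. t i $$ (l,l)) = 1" using D_prod[OF that assms(1)] by simp
    then show ?thesis by (rule inverse_unique[symmetric])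
  qed
qed

lemma mono_regular: "mono x \<in> regular_on (regular H) D"
proof -
  have "(\<lambda>t. \<Prod>i\<in>I. \<Prod>j<n i. (t i $$ (j,j)) powi (x i j)) \<in> regular_on (regular H) D"
    by (intro regular_on_prod regular_on_powi H_entry_regular D_inverse_entry_regular) (use D_subset in auto)
  then show ?thesis by (rule regular_on_cong) (simp add: mono_def)
qed

definition monomials :: "(('i \<Rightarrow> complex mat) \<Rightarrow> complex) set" where
  "monomials = range (\<lambda>x. restrict (mono x) D)"

lemma char_family_D: "char_family (H\<lparr>carrier := D\<rparr>) monomials"
proof (rule char_family.intro)
  show "monoid (H\<lparr>carrier := D\<rparr>)" using group_D by (rule group.is_monoid)
  show "\<chi> \<in> extensional (carrier (H\<lparr>carrier := D\<rparr>))" if "\<chi> \<in> monomials" for \<chi>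
    using that unfolding monomials_def by auto
  have one: "\<one>\<^bsub>H\<^esub> \<in> D" using subgroup.one_closed[OF subgroup_D] .
  show "\<chi> \<one>\<^bsub>H\<lparr>carrier := D\<rparr>\<^esub> = 1" if "\<chi> \<in> monomials" for \<chi>
    using that one unfolding monomials_def by (auto simp: mono_one)
  show "\<chi> (x \<otimes>\<^bsub>H\<lparr>carrier := D\<rparr>\<^esub> y) = \<chi> x * \<chi> y"
    if "\<chi> \<in> monomials" "x \<in> carrier (H\<lparr>carrier := D\<rparr>)" "y \<in> carrier (H\<lparr>carrier := D\<rparr>)" for \<chi> x y
  proof -
    have "x \<in> D" "y \<in> D" using that by auto
    moreover from this have "x \<otimes>\<^bsub>H\<^esub> y \<in> D" using subgroup.m_closed[OF subgroup_D] by blast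
    ultimately show ?thesis using that(1) unfolding monomials_def by (auto simp: mono_mult)
  qed
qed

lemma monos_char_closed: "char_closed D monomials"
  unfolding char_closed_def
proof (intro conjI ballI)
  show "\<exists>\<chi>\<in>monomials. \<forall>x\<in>D. \<chi> x = 1"
    unfolding monomials_def by (rule bexI[OF _ rangeI[of _ "\<lambda>_ _. 0"]]) (simp add: mono_zero)
  fix \<chi> \<psi> assume "\<chi> \<in> monomials" "\<psi> \<in> monomials"
  then obtain x y where xy: "\<chi> = restrict (mono x) D" "\<psi> = restrict (mono y) D" unfolding monomials_def by blast
  show "\<exists>\<omega>\<in>monomials. \<forall>x\<in>D. \<omega> x = \<chi> x * \<psi> x"
    unfolding monomials_def by (rule bexI[OF _ rangeI[of _ "\<lambda>i j. x i j + y i j"]]) (simp add: xy mono_add)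
qed

text \<open>On \<open>D\<close> the off-diagonal entries vanish and the diagonal ones are themselves
  monomials.\<close>

lemma D_regular_comb:
  assumes "f \<in> regular_on (regular H) D"
  shows "finite_comb D monomials f"
proof -
  obtain g where g: "g \<in> regular H" "\<forall>x\<in>D. g x = f x" using assms unfolding regular_on_def by auto
  have "finite_comb D monomials g" using g(1)
  proof (induction rule: regular_H_induct)
    case (entry i j k)
    show ?case
    proof (cases "j = k")
      case True
      have "finite_comb D monomials (\<lambda>t. t i $$ (j,j))"
      proof (rule finite_comb_char)
        show "restrict (mono (\<lambda>i' j'. if i' = i \<and> j' = j then 1 else 0)) D \<in> monomials" unfolding monomials_def by (rule rangeI)
        show "restrict (mono (\<lambda>i' j'. if i' = i \<and> j' = j then 1 else 0)) D t = t i $$ (j,j)" if "t \<in> D" for t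
          unfolding restrict_apply'[OF that] mono_single[OF entry(1,2)] by simp
      qed
      then show ?thesis using True by simp
    next
      case False
      show ?thesis by (rule finite_comb_cong[OF finite_comb_zero]) (use D_offdiag entry False in auto)
    qed
  qed (auto intro: finite_comb_const finite_comb_add finite_comb_mult monos_char_closed)
  then show ?thesis by (rule finite_comb_cong) (use g in auto)
qed

lemma lift_in_H: "i \<in> I \<Longrightarrow> B \<in> carrier_mat (n i) (n i) \<Longrightarrow> det B = 1 \<Longrightarrow> lift i B \<in> carrier H"
  unfolding carrier_H by (auto simp: lift_def)

lemma lift_mult: "i \<in> I \<Longrightarrow> B \<in> carrier_mat (n i) (n i) \<Longrightarrow> B' \<in> carrier_mat (n i) (n i) \<Longrightarrow>
    lift i B \<otimes>\<^bsub>H\<^esub> lift i B' = lift i (B * B')"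
  unfolding mult_H lift_def by (auto intro!: restrict_ext)

text \<open>Along a curve whose matrix entries are polynomials, a polynomial in the entries is again
  a polynomial. Applied to root subgroups, it makes the orbits of vectors polynomial.\<close>

lemma regular_H_poly:
  assumes "f \<in> regular_on (regular H) (carrier H)" "\<And>s. g s \<in> carrier H"
    and e: "\<And>i j k. i \<in> I \<Longrightarrow> j < n i \<Longrightarrow> k < n i \<Longrightarrow> \<exists>p. \<forall>s. g s i $$ (j,k) = poly p s"
  shows "\<exists>p. \<forall>s. f (g s) = poly p s"
proof -
  obtain h where h: "h \<in> regular H" "\<forall>x\<in>carrier H. h x = f x" using assms(1) unfolding regular_on_def by auto
  have "\<exists>p. \<forall>s. h (g s) = poly p s" using h(1)
  proof (induction rule: regular_H_induct)
    case (const c)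
    then show ?case by (intro exI[of _ "[:c:]"]) simp
  next
    case (add f f')
    then show ?case by (metis poly_add)
  next
    case (mult f f')
    then show ?case by (metis poly_mult)
  next
    case (entry i j k)
    then show ?case using e by blast
  qed
  then show ?thesis using h(2) assms(2) by metis
qed

end

section \<open>Representations of products of special linear groups\<close>

locale sl_rep = sl_product I n for I :: "'i set" and n :: "'i \<Rightarrow> nat" +
  fixes d :: nat and X :: "('i \<Rightarrow> complex mat) \<Rightarrow> complex mat"
  assumes X: "X \<in> alg_hom H (GL d)"
begin

lemma X_hom: "X \<in> hom H (GL d)" using X by (simp add: alg_hom_def)

lemma X_carrier: "h \<in> carrier H \<Longrightarrow> X h \<in> carrier_mat d d"
  using hom_in_carrier[OF X_hom] by simp

lemma X_mult: "g \<in> carrier H \<Longrightarrow> h \<in> carrier H \<Longrightarrow> X (g \<otimes>\<^bsub>H\<^esub> h) = X g * X h"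
  using hom_mult[OF X_hom] by simp

text \<open>An idempotent matrix of nonzero determinant is the identity; the cancellation is carried
  out with the adjugate.\<close>

lemma X_one: "X \<one>\<^bsub>H\<^esub> = 1\<^sub>m d"
proof -
  interpret group H by (rule group_H)
  have c: "X \<one>\<^bsub>H\<^esub> \<in> carrier_mat d d" "det (X \<one>\<^bsub>H\<^esub>) \<noteq> 0" using hom_in_carrier[OF X_hom one_closed] by simp_all
  have e: "X \<one>\<^bsub>H\<^esub> * X \<one>\<^bsub>H\<^esub> = X \<one>\<^bsub>H\<^esub>" using X_mult[OF one_closed one_closed] by simp
  let ?d = "det (X \<one>\<^bsub>H\<^esub>)" and ?A = "adj_mat (X \<one>\<^bsub>H\<^esub>)"
  note adj = adj_mat[OF c(1)]
  have "?A * (X \<one>\<^bsub>H\<^esub> * X \<one>\<^bsub>H\<^esub>) = (?A * X \<one>\<^bsub>H\<^esub>) * X \<one>\<^bsub>H\<^esub>"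
    using assoc_mult_mat[OF adj(1) c(1) c(1)] by simp
  then have "?d \<cdot>\<^sub>m 1\<^sub>m d = (?d \<cdot>\<^sub>m 1\<^sub>m d) * X \<one>\<^bsub>H\<^esub>" unfolding e adj(3) .
  also have "\<dots> = ?d \<cdot>\<^sub>m X \<one>\<^bsub>H\<^esub>"
    using mult_smult_assoc_mat[OF one_carrier_mat c(1)] c(1) by simp
  finally have eq: "?d \<cdot>\<^sub>m 1\<^sub>m d = ?d \<cdot>\<^sub>m X \<one>\<^bsub>H\<^esub>" .
  show ?thesis
  proof (rule eq_matI)
    fix i j assume "i < dim_row (1\<^sub>m d :: complex mat)" "j < dim_col (1\<^sub>m d :: complex mat)"
    then have ij: "i < d" "j < d" by auto
    have "(?d \<cdot>\<^sub>m 1\<^sub>m d) $$ (i,j) = (?d \<cdot>\<^sub>m X \<one>\<^bsub>H\<^esub>) $$ (i,j)" using eq by simp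
    then have "?d * (1\<^sub>m d $$ (i,j)) = ?d * (X \<one>\<^bsub>H\<^esub> $$ (i,j))" using ij c(1) by simp
    then show "X \<one>\<^bsub>H\<^esub> $$ (i,j) = 1\<^sub>m d $$ (i,j)" using c(2) by simp
  qed (use c(1) in auto)
qed

lemma X_mult_vec:
  "g \<in> carrier H \<Longrightarrow> h \<in> carrier H \<Longrightarrow> v \<in> carrier_vec d \<Longrightarrow> X (g \<otimes>\<^bsub>H\<^esub> h) *\<^sub>v v = X g *\<^sub>v (X h *\<^sub>v v)"
  unfolding X_mult by (rule assoc_mult_mat_vec[OF X_carrier X_carrier])

lemma X_entry_regular: "i < d \<Longrightarrow> j < d \<Longrightarrow> (\<lambda>h. X h $$ (i,j)) \<in> regular_on (regular H) (carrier H)"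
  by (rule alg_hom_regular[OF X GL_entry_regular])

lemma X_injective:
  assumes "h \<in> carrier H" "v \<in> carrier_vec d" "X h *\<^sub>v v = 0\<^sub>v d"
  shows "v = 0\<^sub>v d"
proof -
  interpret group H by (rule group_H)
  have "v = X (inv\<^bsub>H\<^esub> h \<otimes>\<^bsub>H\<^esub> h) *\<^sub>v v" using assms by (simp add: X_one)
  also have "\<dots> = X (inv\<^bsub>H\<^esub> h) *\<^sub>v 0\<^sub>v d" using X_mult_vec[of "inv\<^bsub>H\<^esub> h" h v] assms by simp
  also have "\<dots> = 0\<^sub>v d" using X_carrier[of "inv\<^bsub>H\<^esub> h"] assms(1) by (intro eq_vecI) (auto simp: scalar_prod_def)
  finally show ?thesis .
qed

text \<open>All exponents that represent a weight are collected, not one for each character, so that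
  the set is closed under the shifts required of a configuration.\<close>

definition weight_exponents :: "('i \<Rightarrow> nat \<Rightarrow> int) set" where
  "weight_exponents = {x. \<exists>v\<in>carrier_vec d. v \<noteq> 0\<^sub>v d \<and> (\<forall>h\<in>D. X h *\<^sub>v v = mono x h \<cdot>\<^sub>v v)}"

lemma weight_shift:
  assumes "x \<in> weight_exponents" "\<forall>i\<in>I. \<exists>c. \<forall>j<n i. y i j = x i j + c"
  shows "y \<in> weight_exponents"
proof -
  obtain c where c: "\<And>i j. i \<in> I \<Longrightarrow> j < n i \<Longrightarrow> y i j = x i j + c i" using assms(2) by metis
  have "mono y t = mono x t" if "t \<in> D" for t
  proof -
    have "mono y t = mono (\<lambda>i j. x i j + c i) t" by (rule mono_cong) (rule c)
    then show ?thesis using mono_add[OF that, of x "\<lambda>i _. c i"] mono_const[OF that, of c] by simp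
  qed
  then show ?thesis using assms(1) unfolding weight_exponents_def by auto
qed

lemma D_lift_commute:
  assumes i: "i \<in> I" and B: "B \<in> carrier_mat (n i) (n i)" "B' \<in> carrier_mat (n i) (n i)"
    and e: "diag c i * B = B' * diag c' i" and eq: "\<And>i' l. i' \<in> I \<Longrightarrow> i' \<noteq> i \<Longrightarrow> l < n i' \<Longrightarrow> c i' l = c' i' l"
  shows "diag c \<otimes>\<^bsub>H\<^esub> lift i B = lift i B' \<otimes>\<^bsub>H\<^esub> diag c'"
  unfolding mult_H
proof (rule restrict_ext)
  fix i' assume i': "i' \<in> I"
  show "diag c i' * lift i B i' = lift i B' i' * diag c' i'"
  proof (cases "i' = i")
    case True
    then show ?thesis using e i by (simp add: lift_def)
  next
    case False
    have "diag c i' = diag c' i'" using eq[OF i' False] i' by (auto simp: diag_def intro!: eq_matI)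
    moreover have "diag c' i' \<in> carrier_mat (n i') (n i')" using i' by (simp add: diag_def)
    ultimately show ?thesis using False i' by (simp add: lift_def)
  qed
qed

text \<open>Conjugation by a diagonal matrix multiplies the entry \<open>(k, j)\<close> by the value
  of the corresponding root.\<close>

lemma lower_commute:
  assumes i: "i \<in> I" "j < n i" "k < n i" "j \<noteq> k" and t: "t \<in> D"
  shows "t \<otimes>\<^bsub>H\<^esub> lift i (root_block (n i) j k 1 0 s 1) =
    lift i (root_block (n i) j k 1 0 (s * (t i $$ (k,k) / t i $$ (j,j))) 1) \<otimes>\<^bsub>H\<^esub> t"
proof -
  let ?c = "\<lambda>i j. t i $$ (j,j)" and ?B = "root_block (n i) j k 1 0 s 1"
  let ?B' = "root_block (n i) j k 1 0 (s * (t i $$ (k,k) / t i $$ (j,j))) 1"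
  have dc: "diag ?c i \<in> carrier_mat (n i) (n i)" using i by (simp add: diag_def)
  have nz: "t i $$ (j,j) \<noteq> 0" using D_nonzero[OF t i(1,2)] .
  have "diag ?c i * ?B = ?B' * diag ?c i"
  proof (rule eq_matI)
    fix p r assume "p < dim_row (?B' * diag ?c i)" "r < dim_col (?B' * diag ?c i)"
    then have pr: "p < n i" "r < n i" using dc by auto
    show "(diag ?c i * ?B) $$ (p,r) = (?B' * diag ?c i) $$ (p,r)"
      unfolding root_block_left[OF i(2-4) dc pr] root_block_right[OF i(2-4) dc pr]
      using nz i pr by (auto simp: diag_entry)
  qed (use dc in auto)
  then have "diag ?c \<otimes>\<^bsub>H\<^esub> lift i ?B = lift i ?B' \<otimes>\<^bsub>H\<^esub> diag ?c" using i by (intro D_lift_commute) auto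
  then show ?thesis unfolding diag_of_D[OF t] .
qed

lemma weyl_commute:
  assumes i: "i \<in> I" "j < n i" "k < n i" "j \<noteq> k"
  shows "diag c \<otimes>\<^bsub>H\<^esub> lift i (root_block (n i) j k 0 1 (-1) 0) =
    lift i (root_block (n i) j k 0 1 (-1) 0) \<otimes>\<^bsub>H\<^esub> diag (\<lambda>i' l. if i' = i then c i (transpose j k l) else c i' l)"
proof (rule D_lift_commute)
  let ?B = "root_block (n i) j k 0 1 (-1) 0" and ?c = "\<lambda>i' l. if i' = i then c i (transpose j k l) else c i' l"
  have dc: "diag c i \<in> carrier_mat (n i) (n i)" "diag ?c i \<in> carrier_mat (n i) (n i)" using i by (simp_all add: diag_def)
  show "diag c i * ?B = ?B * diag ?c i"
  proof (rule eq_matI)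
    fix p r assume "p < dim_row (?B * diag ?c i)" "r < dim_col (?B * diag ?c i)"
    then have pr: "p < n i" "r < n i" using dc by auto
    show "(diag c i * ?B) $$ (p,r) = (?B * diag ?c i) $$ (p,r)"
      unfolding root_block_left[OF i(2-4) dc(2) pr] root_block_right[OF i(2-4) dc(1) pr]
      using i pr by (auto simp: diag_entry transpose_def)
  qed (use dc in auto)
qed (use i in auto)

text \<open>The Weyl element is a product of three unipotent root elements and so has determinant
  one.\<close>

lemma weyl_lift:
  assumes i: "i \<in> I" "j < n i" "k < n i" "j \<noteq> k"
  shows "lift i (root_block (n i) j k 0 1 (-1) 0) \<in> carrier H"
proof -
  let ?R = "root_block (n i) j k 1 1 0 1" and ?L = "root_block (n i) j k 1 0 (-1) 1"
  have "root_block (n i) j k 0 1 (-1) 0 = ?R * (?L * ?R)" by (simp add: root_block_mult[OF i(2-4)])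
  moreover have "det (?R * (?L * ?R)) = 1"
    using det_root_block_unipotent[OF i(2-4)]
    by (simp add: det_mult[of _ "n i"] mult_carrier_mat[of _ "n i" "n i" _ "n i"])
  ultimately have "det (root_block (n i) j k 0 1 (-1) 0) = 1" by simp
  then show ?thesis using i by (intro lift_in_H) auto
qed

lemma transposed_diag:
  assumes t: "t \<in> D" and i: "i \<in> I" "j < n i" "k < n i"
  defines "t' \<equiv> diag (\<lambda>i' l. if i' = i then t i $$ (transpose j k l, transpose j k l) else t i' $$ (l,l))"
  shows "t' \<in> D" "mono x t' = mono (x(i := x i \<circ> transpose j k)) t"
proof -
  have re: "(\<Prod>l<n i. f (transpose j k l)) = (\<Prod>l<n i. f l)" for f :: "nat \<Rightarrow> complex"
    by (rule prod.reindex_bij_betw[OF permutes_imp_bij[OF permutes_swap_id]]) (use i in auto)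
  show "t' \<in> D" unfolding t'_def
  proof (rule diag_in_D)
    fix i' assume "i' \<in> I"
    then show "(\<Prod>l<n i'. if i' = i then t i $$ (transpose j k l, transpose j k l) else t i' $$ (l,l)) = 1"
      using re[of "\<lambda>l. t i $$ (l,l)"] D_prod[OF t] by (cases "i' = i") auto
  qed
  show "mono x t' = mono (x(i := x i \<circ> transpose j k)) t"
    unfolding mono_def
  proof (rule prod.cong[OF refl])
    fix i' assume i': "i' \<in> I"
    show "(\<Prod>l<n i'. t' i' $$ (l,l) powi x i' l) = (\<Prod>l<n i'. t i' $$ (l,l) powi (x(i := x i \<circ> transpose j k)) i' l)"
    proof (cases "i' = i")
      case True
      have "(\<Prod>l<n i. t' i $$ (l,l) powi x i l) =
          (\<Prod>l<n i. (\<lambda>l. t i $$ (l,l) powi x i (transpose j k l)) (transpose j k l))"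
        using i by (intro prod.cong) (auto simp: t'_def diag_entry)
      also have "\<dots> = (\<Prod>l<n i. t i $$ (l,l) powi x i (transpose j k l))" by (rule re)
      finally show ?thesis using True by simp
    next
      case False
      then show ?thesis using i' by (intro prod.cong) (auto simp: t'_def diag_entry)
    qed
  qed
qed

lemma weyl_weight_vector:
  assumes i: "i \<in> I" "j < n i" "k < n i" "j \<noteq> k"
    and v: "v \<in> carrier_vec d" "\<And>h. h \<in> D \<Longrightarrow> X h *\<^sub>v v = mono x h \<cdot>\<^sub>v v" and t: "t \<in> D"
  shows "X t *\<^sub>v (X (lift i (root_block (n i) j k 0 1 (-1) 0)) *\<^sub>v v) =
    mono (x(i := x i \<circ> transpose j k)) t \<cdot>\<^sub>v (X (lift i (root_block (n i) j k 0 1 (-1) 0)) *\<^sub>v v)"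
proof -
  let ?w = "lift i (root_block (n i) j k 0 1 (-1) 0)"
  let ?t' = "diag (\<lambda>i' l. if i' = i then t i $$ (transpose j k l, transpose j k l) else t i' $$ (l,l))"
  have t': "?t' \<in> D" by (rule transposed_diag[OF t i(1-3)])
  have w: "?w \<in> carrier H" by (rule weyl_lift[OF i])
  have tH: "t \<in> carrier H" "?t' \<in> carrier H" using t t' D_subset by auto
  have "X t *\<^sub>v (X ?w *\<^sub>v v) = X (t \<otimes>\<^bsub>H\<^esub> ?w) *\<^sub>v v" using X_mult_vec[OF tH(1) w v(1)] by simp
  also have "t \<otimes>\<^bsub>H\<^esub> ?w = ?w \<otimes>\<^bsub>H\<^esub> ?t'"
    using weyl_commute[OF i, of "\<lambda>i j. t i $$ (j,j)"] unfolding diag_of_D[OF t] .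
  also have "X (?w \<otimes>\<^bsub>H\<^esub> ?t') *\<^sub>v v = X ?w *\<^sub>v (mono x ?t' \<cdot>\<^sub>v v)"
    using X_mult_vec[OF w tH(2) v(1)] v(2)[OF t'] by simp
  also have "\<dots> = mono x ?t' \<cdot>\<^sub>v (X ?w *\<^sub>v v)"
    using X_carrier[OF w] v(1) by (simp add: mult_mat_vec)
  also have "mono x ?t' = mono (x(i := x i \<circ> transpose j k)) t" by (rule transposed_diag(2)[OF t i(1-3)])
  finally show ?thesis .
qed

lemma weight_transposition:
  assumes x: "x \<in> weight_exponents" and i: "i \<in> I" "j < n i" "k < n i"
  shows "x(i := x i \<circ> transpose j k) \<in> weight_exponents"
proof (cases "j = k")
  case False
  obtain v where v: "v \<in> carrier_vec d" "v \<noteq> 0\<^sub>v d" "\<And>h. h \<in> D \<Longrightarrow> X h *\<^sub>v v = mono x h \<cdot>\<^sub>v v"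
    using x unfolding weight_exponents_def by blast
  let ?w = "lift i (root_block (n i) j k 0 1 (-1) 0)"
  have w: "?w \<in> carrier H" by (rule weyl_lift[OF i False])
  have "X ?w *\<^sub>v v \<in> carrier_vec d" using X_carrier[OF w] v(1) by simp
  moreover have "X ?w *\<^sub>v v \<noteq> 0\<^sub>v d" using X_injective[OF w v(1)] v(2) by blast
  moreover have "\<forall>t\<in>D. X t *\<^sub>v (X ?w *\<^sub>v v) = mono (x(i := x i \<circ> transpose j k)) t \<cdot>\<^sub>v (X ?w *\<^sub>v v)"
    using weyl_weight_vector[OF i False v(1,3)] by blast
  ultimately show ?thesis unfolding weight_exponents_def by blast
qed (use x in simp)

lemma orbit_poly:
  assumes g: "\<And>s. g s \<in> carrier H" and v: "v \<in> carrier_vec d"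
    and e: "\<And>i j k. i \<in> I \<Longrightarrow> j < n i \<Longrightarrow> k < n i \<Longrightarrow> \<exists>p. \<forall>s. g s i $$ (j,k) = poly p s"
  shows "\<exists>p. \<forall>r<d. \<forall>s. (X (g s) *\<^sub>v v) $ r = poly (p r) s"
proof -
  have "\<exists>p. \<forall>s. (X (g s) *\<^sub>v v) $ r = poly p s" if r: "r < d" for r
  proof -
    have "(\<lambda>h. \<Sum>q=0..<d. X h $$ (r,q) * v $ q) \<in> regular_on (regular H) (carrier H)"
      using r by (intro regular_on_sum regular_on_mult regular_on_const X_entry_regular) auto
    from regular_H_poly[OF this g e] obtain p where
      p: "\<And>s. (\<Sum>q=0..<d. X (g s) $$ (r,q) * v $ q) = poly p s" by blast
    have "(X (g s) *\<^sub>v v) $ r = poly p s" for s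
      using p[of s] X_carrier[OF g[of s]] v r by (simp add: scalar_prod_def)
    then show ?thesis by blast
  qed
  then show ?thesis by metis
qed

lemma root_curve_poly:
  assumes "i \<in> I" and that: "i' \<in> I" "a < n i'" "b < n i'"
  shows "\<exists>p. \<forall>s. lift i (root_block (n i) j k 1 0 s 1) i' $$ (a,b) = poly p s" (is ?L)
    and "\<exists>p. \<forall>s. lift i (root_block (n i) j k 1 s 0 1) i' $$ (a,b) = poly p s" (is ?R)
proof -
  have "\<exists>p. \<forall>s. f s = poly p s" if "f = (\<lambda>_. c) \<or> f = (\<lambda>s. s)" for f :: "complex \<Rightarrow> complex" and c
    using that by (elim disjE) (auto intro: exI[of _ "[:c:]"] exI[of _ "[:0,1:]"])
  note P = this
  show ?L
  proof (cases "i' = i")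
    case True
    show ?thesis unfolding True using that assms True
      by (intro P[where c = "root_block (n i) j k 1 0 0 1 $$ (a,b)"]) (auto simp: lift_def root_block_def fun_eq_iff)
  next
    case False
    then show ?thesis using that by (intro P[where c = "1\<^sub>m (n i') $$ (a,b)"]) (auto simp: lift_def)
  qed
  show ?R
  proof (cases "i' = i")
    case True
    show ?thesis unfolding True using that assms True
      by (intro P[where c = "root_block (n i) j k 1 0 0 1 $$ (a,b)"]) (auto simp: lift_def root_block_def fun_eq_iff)
  next
    case False
    then show ?thesis using that by (intro P[where c = "1\<^sub>m (n i') $$ (a,b)"]) (auto simp: lift_def)
  qed
qed

text \<open>
  Let \<open>v\<close> be a weight vector. The derivative at \<open>0\<close> of its orbit under the lowering root subgroup has the
  lowered weight. If it vanishes, \<open>v\<close> is fixed by that subgroup; its orbit under the raising one is then a polynomial that decays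
  like a negative power, by the decomposition of a raising element as a product of two lowering
  elements, a diagonal one and a Weyl element.
\<close>

lemma lowering_weight:
  assumes x: "x \<in> weight_exponents" and i: "i \<in> I" "j < n i" "k < n i" "x i k < x i j"
  shows "x(i := (x i)(j := x i j - 1, k := x i k + 1)) \<in> weight_exponents"
proof (rule ccontr)
  let ?y = "x(i := (x i)(j := x i j - 1, k := x i k + 1))"
  assume notin: "?y \<notin> weight_exponents"
  have jk: "j \<noteq> k" using i by auto
  note i3 = i(1-3) and i4 = i(1-3) jk
  interpret group H by (rule group_H)
  obtain v where v: "v \<in> carrier_vec d" "v \<noteq> 0\<^sub>v d" "\<And>h. h \<in> D \<Longrightarrow> X h *\<^sub>v v = mono x h \<cdot>\<^sub>v v"
    using x unfolding weight_exponents_def by blast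
  define B where "B = root_block (n i) j k"
  define L where "L = (\<lambda>s. lift i (B 1 0 s 1))"
  define R where "R = (\<lambda>s. lift i (B 1 s 0 1))"
  define w where "w = lift i (B 0 1 (-1) 0)"
  define h where "h = (\<lambda>s. lift i (B s 0 0 (1/s)))"
  have BM: "B a b c e * B a' b' c' e' = B (a*a'+b*c') (a*b'+b*e') (c*a'+e*c') (c*b'+e*e')" for a b c e a' b' c' e'
    unfolding B_def by (rule root_block_mult) (use i4 in auto)
  have BC [simp]: "B a b c e \<in> carrier_mat (n i) (n i)" for a b c e by (simp add: B_def)
  have LM: "lift i (B a b c e) \<otimes>\<^bsub>H\<^esub> lift i (B a' b' c' e') =
      lift i (B (a*a'+b*c') (a*b'+b*e') (c*a'+e*c') (c*b'+e*e'))" for a b c e a' b' c' e'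
    using lift_mult[OF i(1) BC BC] unfolding BM .
  have LH: "L s \<in> carrier H" "R s \<in> carrier H" for s
    unfolding L_def R_def B_def using det_root_block_unipotent[OF i4(2-4)] i(1) by (auto intro!: lift_in_H)
  have wH: "w \<in> carrier H" unfolding w_def B_def by (rule weyl_lift[OF i4])
  have h_eq: "h s = diag (\<lambda>i' l. if i' = i then if l = j then s else if l = k then 1/s else 1 else 1)" for s
    unfolding h_def lift_def diag_def B_def
    by (intro restrict_ext) (use i4 in \<open>auto simp: root_block_def intro!: eq_matI\<close>)
  have two: "(\<Prod>l<n i. if l = j then a else if l = k then b else 1) = a * b" for a b :: complex
  proof -
    have "(\<Prod>l<n i. if l = j then a else if l = k then b else 1) = (\<Prod>l\<in>{j,k}. if l = j then a else if l = k then b else 1)"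
      using i4 by (intro prod.mono_neutral_right) auto
    then show ?thesis using jk by simp
  qed
  have hD: "h s \<in> D" if "s \<noteq> 0" for s unfolding h_eq
  proof (rule diag_in_D)
    fix i' assume "i' \<in> I"
    show "(\<Prod>l<n i'. if i' = i then if l = j then s else if l = k then 1/s else 1 else 1) = 1"
      using two[of s "1/s"] that by (cases "i' = i") auto
  qed
  have mono_h: "mono y (h s) = s powi (y i j) * (1/s) powi (y i k)" for y s
  proof -
    have "mono y (h s) = (\<Prod>i'\<in>I. if i' = i then s powi (y i j) * (1/s) powi (y i k) else 1)"
      unfolding mono_def
    proof (rule prod.cong[OF refl])
      fix i' assume i': "i' \<in> I"
      show "(\<Prod>l<n i'. h s i' $$ (l,l) powi y i' l) = (if i' = i then s powi (y i j) * (1/s) powi (y i k) else 1)"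
      proof (cases "i' = i")
        case True
        have "(\<Prod>l<n i. h s i $$ (l,l) powi y i l) =
            (\<Prod>l<n i. if l = j then s powi (y i j) else if l = k then (1/s) powi (y i k) else 1)"
          using i(1) by (intro prod.cong) (auto simp: h_eq diag_entry)
        then show ?thesis using two True by simp
      next
        case False
        then show ?thesis using i' by (auto simp: h_eq diag_entry intro!: prod.neutral)
      qed
    qed
    then show ?thesis using i(1) finite_I by simp
  qed
  have "\<exists>p. \<forall>r<d. \<forall>s. (X (L s) *\<^sub>v v) $ r = poly (p r) s"
    by (rule orbit_poly[OF LH(1) v(1)]) (unfold L_def B_def, rule root_curve_poly(1)[OF i(1)])
  then obtain p where p: "\<And>r s. r < d \<Longrightarrow> (X (L s) *\<^sub>v v) $ r = poly (p r) s" by blast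
  have L0: "L 0 = \<one>\<^bsub>H\<^esub>"
    unfolding L_def lift_def one_H B_def by (intro restrict_ext) (auto simp: root_block_def intro!: eq_matI)
  have p0: "poly (p r) 0 = v $ r" if "r < d" for r
    using p[OF that, of 0] unfolding L0 X_one using v(1) by simp
  \<comment> \<open>The image of \<open>v\<close> under the lowering operator of the Lie
    algebra.\<close>
  define v1 where "v1 = vec d (\<lambda>r. coeff (p r) 1)"
  have act: "(X g *\<^sub>v vec d f) $ r = (\<Sum>q=0..<d. X g $$ (r,q) * f q)" if "g \<in> carrier H" "r < d" for g f r
    using X_carrier[OF that(1)] that(2) by (auto simp: scalar_prod_def)
  have Lv: "X (L s) *\<^sub>v v = vec d (\<lambda>r. poly (p r) s)" for s
    using p X_carrier[OF LH(1)[of s]] by (intro eq_vecI) (auto simp del: index_mult_mat_vec)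
  have "X t *\<^sub>v v1 = mono ?y t \<cdot>\<^sub>v v1" if t: "t \<in> D" for t
  proof -
    define \<beta> where "\<beta> = t i $$ (k,k) / t i $$ (j,j)"
    have tH: "t \<in> carrier H" using t D_subset by blast
    have "X t *\<^sub>v (X (L s) *\<^sub>v v) = mono x t \<cdot>\<^sub>v (X (L (s * \<beta>)) *\<^sub>v v)" for s
    proof -
      have "X t *\<^sub>v (X (L s) *\<^sub>v v) = X (L (s * \<beta>) \<otimes>\<^bsub>H\<^esub> t) *\<^sub>v v"
        using lower_commute[OF i4 t, of s] X_mult_vec[OF tH LH(1)[of s] v(1)] unfolding L_def B_def \<beta>_def by simp
      also have "\<dots> = X (L (s * \<beta>)) *\<^sub>v (mono x t \<cdot>\<^sub>v v)"
        using X_mult_vec[OF LH(1) tH v(1)] v(3)[OF t] by simp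
      also have "\<dots> = mono x t \<cdot>\<^sub>v (X (L (s * \<beta>)) *\<^sub>v v)"
        by (rule mult_mat_vec[OF X_carrier[OF LH(1)] v(1)])
      finally show ?thesis .
    qed
    then have Xp: "X t *\<^sub>v vec d (\<lambda>r. poly (p r) s) = mono x t \<cdot>\<^sub>v vec d (\<lambda>r. poly (p r) (s * \<beta>))" for s
      unfolding Lv .
    have eq: "(\<Sum>q=0..<d. X t $$ (r,q) * poly (p q) s) = mono x t * poly (p r) (s * \<beta>)" if "r < d" for r s
    proof -
      have "(\<Sum>q=0..<d. X t $$ (r,q) * poly (p q) s) = (X t *\<^sub>v vec d (\<lambda>q. poly (p q) s)) $ r"
        by (rule act[OF tH that, symmetric])
      also have "\<dots> = mono x t * poly (p r) (s * \<beta>)" unfolding Xp using that by simp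
      finally show ?thesis .
    qed
    \<comment> \<open>The relation holds for all values of the parameter, hence between polynomials;
      its coefficients of degree one give the eigenvalue equation for \<open>v1\<close>.\<close>
    have "(\<Sum>q=0..<d. smult (X t $$ (r,q)) (p q)) = smult (mono x t) (pcompose (p r) [:0,\<beta>:])" if "r < d" for r
      unfolding poly_eq_poly_eq_iff[symmetric] fun_eq_iff using eq[OF that]
      by (simp add: poly_sum poly_pcompose mult.commute)
    then have "coeff (\<Sum>q=0..<d. smult (X t $$ (r,q)) (p q)) 1 = coeff (smult (mono x t) (pcompose (p r) [:0,\<beta>:])) 1"
      if "r < d" for r using that by simp
    then have eq1: "(\<Sum>q=0..<d. X t $$ (r,q) * coeff (p q) 1) = mono x t * (\<beta> * coeff (p r) 1)" if "r < d" for r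
      using that by (simp add: coeff_sum coeff_pcompose_linear)
    have "mono ?y t = mono x t * \<beta>"
    proof -
      let ?e = "\<lambda>l c i' j'. if i' = i \<and> j' = l then c else (0::int)"
      have "mono ?y t = mono (\<lambda>i' j'. (x i' j' + ?e j (-1) i' j') + ?e k 1 i' j') t"
        using jk by (intro mono_cong) auto
      also have "\<dots> = mono x t * (t i $$ (j,j)) powi (-1) * (t i $$ (k,k)) powi 1"
        unfolding mono_add[OF t] mono_single[OF i(1,2)] mono_single[OF i(1,3)] ..
      also have "\<dots> = mono x t * \<beta>" by (simp add: \<beta>_def divide_inverse power_int_minus)
      finally show ?thesis .
    qed
    then show ?thesis
      using act[OF tH] eq1 X_carrier[OF tH] unfolding v1_def by (intro eq_vecI) auto
  qed
  moreover have "v1 \<in> carrier_vec d" by (simp add: v1_def)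
  ultimately have v10: "v1 = 0\<^sub>v d" using notin unfolding weight_exponents_def by blast
  have c1: "coeff (p q) 1 = 0" if "q < d" for q
    using that arg_cong[OF v10, of "\<lambda>u. u $ q"] by (simp add: v1_def)
  have Ladd: "L s \<otimes>\<^bsub>H\<^esub> L u = L (s + u)" for s u unfolding L_def LM by simp
  have inv_L: "X (L s) *\<^sub>v v = v" for s
  proof -
    \<comment> \<open>By the group law the orbit at \<open>s + u\<close> is \<open>X (L s)\<close>
      applied to the orbit at \<open>u\<close>. The derivative at \<open>s\<close> is therefore a
      linear image of the derivative at \<open>0\<close>, which vanishes.\<close>
    have "pderiv (p r) = 0" if r: "r < d" for r
    proof -
      have "poly (pderiv (p r)) s = 0" for s
      proof -
        have "poly (pcompose (p r) [:s,1:]) u = poly (\<Sum>q=0..<d. smult (X (L s) $$ (r,q)) (p q)) u" for u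
        proof -
          have "poly (p r) (s + u) = (X (L s \<otimes>\<^bsub>H\<^esub> L u) *\<^sub>v v) $ r" unfolding Ladd p[OF r] ..
          also have "\<dots> = (X (L s) *\<^sub>v vec d (\<lambda>q. poly (p q) u)) $ r"
            using X_mult_vec[OF LH(1) LH(1) v(1)] Lv by simp
          finally show ?thesis unfolding act[OF LH(1) r] by (simp add: poly_sum poly_pcompose add.commute)
        qed
        then have "pcompose (p r) [:s,1:] = (\<Sum>q=0..<d. smult (X (L s) $$ (r,q)) (p q))"
          unfolding poly_eq_poly_eq_iff[symmetric] fun_eq_iff by blast
        then have "coeff (pderiv (pcompose (p r) [:s,1:])) 0 = coeff (pderiv (\<Sum>q=0..<d. smult (X (L s) $$ (r,q)) (p q))) 0"
          by simp
        also have "\<dots> = 0" using c1 by (simp add: coeff_pderiv coeff_sum)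
        finally show ?thesis
          by (simp add: pderiv_pcompose pderiv_pCons poly_0_coeff_0[symmetric] poly_pcompose)
      qed
      then show ?thesis using poly_all_0_iff_0 by blast
    qed
    then have deg: "degree (p r) = 0" if "r < d" for r using that by (simp add: pderiv_eq_0_iff)
    have "poly (p r) s = poly (p r) 0" if "r < d" for r s
      by (rule degree_eq_zeroE[OF deg[OF that]]) simp
    then show ?thesis using p0 v(1) unfolding Lv by (intro eq_vecI) auto
  qed
  \<comment> \<open>The pairing of the weight with the coroot, positive by hypothesis; it is the
    rate of the decay.\<close>
  define m where "m = nat (x i j - x i k)"
  have m: "m > 0" "x i j - x i k = int m" using i(4) by (auto simp: m_def)
  define wv where "wv = X w *\<^sub>v v"
  have wvc: "wv \<in> carrier_vec d" unfolding wv_def using X_carrier[OF wH] v(1) by simp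
  have hw: "X (h s) *\<^sub>v wv = (1/s)^m \<cdot>\<^sub>v wv" if s: "s \<noteq> 0" for s
  proof -
    have "X (h s) *\<^sub>v wv = mono (x(i := x i \<circ> transpose j k)) (h s) \<cdot>\<^sub>v wv"
      unfolding wv_def w_def B_def by (rule weyl_weight_vector[OF i4 v(1,3) hD[OF s]])
    also have "mono (x(i := x i \<circ> transpose j k)) (h s) = s powi (x i k) * (1/s) powi (x i j)"
      unfolding mono_h by simp
    also have "\<dots> = (1/s) powi (x i j - x i k)"
      using s by (simp add: power_int_diff power_int_divide_distrib field_simps)
    also have "\<dots> = (1/s)^m" unfolding m(2) by simp
    finally show ?thesis .
  qed
  \<comment> \<open>The Bruhat decomposition of an upper unipotent matrix with respect to the lower
    triangular Borel subgroup of \<open>SL(2)\<close>.\<close>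
  have Rdec: "R s = L (1/s) \<otimes>\<^bsub>H\<^esub> (h s \<otimes>\<^bsub>H\<^esub> (w \<otimes>\<^bsub>H\<^esub> L (1/s)))" if "s \<noteq> 0" for s
    using that unfolding R_def L_def h_def w_def LM by simp
  have Rv: "X (R s) *\<^sub>v v = (1/s)^m \<cdot>\<^sub>v (X (L (1/s)) *\<^sub>v wv)" if s: "s \<noteq> 0" for s
  proof -
    have hH: "h s \<in> carrier H" using hD[OF s] D_subset by blast
    have "X (R s) *\<^sub>v v = X (L (1/s)) *\<^sub>v (X (h s) *\<^sub>v (X w *\<^sub>v (X (L (1/s)) *\<^sub>v v)))"
      unfolding Rdec[OF s] using LH wH hH v(1) X_carrier by (simp add: X_mult_vec)
    also have "\<dots> = X (L (1/s)) *\<^sub>v ((1/s)^m \<cdot>\<^sub>v wv)" unfolding inv_L wv_def[symmetric] hw[OF s] ..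
    also have "\<dots> = (1/s)^m \<cdot>\<^sub>v (X (L (1/s)) *\<^sub>v wv)"
      by (rule mult_mat_vec[OF X_carrier[OF LH(1)] wvc])
    finally show ?thesis .
  qed
  have "\<exists>p. \<forall>r<d. \<forall>s. (X (L s) *\<^sub>v wv) $ r = poly (p r) s"
    by (rule orbit_poly[OF LH(1) wvc]) (unfold L_def B_def, rule root_curve_poly(1)[OF i(1)])
  then obtain y where y: "\<And>r s. r < d \<Longrightarrow> (X (L s) *\<^sub>v wv) $ r = poly (y r) s" by blast
  have "\<exists>p. \<forall>r<d. \<forall>s. (X (R s) *\<^sub>v v) $ r = poly (p r) s"
    by (rule orbit_poly[OF LH(2) v(1)]) (unfold R_def B_def, rule root_curve_poly(2)[OF i(1)])
  then obtain q where q: "\<And>r s. r < d \<Longrightarrow> (X (R s) *\<^sub>v v) $ r = poly (q r) s" by blast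
  have q0: "q r = 0" if r: "r < d" for r
  proof -
    \<comment> \<open>\<open>q r\<close> is a polynomial whose value at \<open>s\<close> is also
      \<open>(1/s) ^ m\<close> times a polynomial in \<open>1/s\<close>. After reversal of the
      coefficients the left side has degree at most \<open>?N\<close>, the right side at least
      \<open>?N + m\<close> unless it is zero.\<close>
    let ?N = "degree (q r)"
    have "poly (reflect_poly (q r)) u = poly (monom 1 (?N + m) * y r) u" if u: "u \<noteq> 0" for u
    proof -
      have dim: "dim_vec (X (L u) *\<^sub>v wv) = d" using X_carrier[OF LH(1)[of u]] by simp
      have "poly (q r) (1/u) = ((1/(1/u))^m \<cdot>\<^sub>v (X (L (1/(1/u))) *\<^sub>v wv)) $ r"
        unfolding q[OF r, symmetric] using Rv[of "1/u"] u by simp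
      also have "\<dots> = u^m * poly (y r) u"
        unfolding y[OF r, symmetric] using u r dim by (simp del: index_mult_mat_vec)
      finally have "poly (q r) (1/u) = u^m * poly (y r) u" .
      then show ?thesis using u by (simp add: poly_reflect_poly_nz poly_monom power_add inverse_eq_divide)
    qed
    \<comment> \<open>The additional factor \<open>[:0,1:]\<close> covers the point
      \<open>u = 0\<close>, at which the identity has not been established.\<close>
    then have "poly ([:0,1:] * reflect_poly (q r)) u = poly ([:0,1:] * (monom 1 (?N + m) * y r)) u" for u
      by (cases "u = 0") auto
    then have "[:0,1:] * reflect_poly (q r) = [:0,1:] * (monom 1 (?N + m) * y r)"
      unfolding poly_eq_poly_eq_iff[symmetric] fun_eq_iff by blast
    then have eq: "reflect_poly (q r) = monom 1 (?N + m) * y r"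
      by (subst (asm) mult_cancel_left) auto
    have "y r = 0"
    proof (rule ccontr)
      assume "y r \<noteq> 0"
      then have "degree (monom 1 (?N + m) * y r) = ?N + m + degree (y r)"
        by (subst degree_mult_eq) (auto simp: degree_monom_eq monom_eq_0_iff)
      then show False using degree_reflect_poly_le[of "q r"] m(1) unfolding eq by simp
    qed
    then show ?thesis using eq by simp
  qed
  have "R 0 = \<one>\<^bsub>H\<^esub>"
    unfolding R_def lift_def one_H B_def by (intro restrict_ext) (auto simp: root_block_def intro!: eq_matI)
  then have "v $ r = 0" if "r < d" for r using q[OF that, of 0] q0[OF that] v(1) X_one by simp
  then have "v = 0\<^sub>v d" using v(1) by (intro eq_vecI) auto
  then show False using v(2) by simp
qed

end

section \<open>Maximal tori\<close>

lemma alg_hom_cong: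
  assumes "f \<in> alg_hom G H" "monoid G" "\<And>x. x \<in> carrier G \<Longrightarrow> f' x = f x"
  shows "f' \<in> alg_hom G H"
proof -
  interpret monoid G by fact
  show ?thesis using assms(1,3) unfolding alg_hom_def hom_def by auto
qed

lemma alg_hom_restrict_codomain:
  assumes "f \<in> alg_hom G H" "\<And>x. x \<in> carrier G \<Longrightarrow> f x \<in> K"
  shows "f \<in> alg_hom G (H\<lparr>carrier := K\<rparr>)"
  using assms unfolding alg_hom_def hom_def by auto

lemma alg_hom_restrict_domain:
  assumes "f \<in> alg_hom G H" "K \<subseteq> carrier G"
  shows "f \<in> alg_hom (G\<lparr>carrier := K\<rparr>) H"
  using assms unfolding alg_hom_def hom_def by (auto simp: subset_iff Pi_iff) blast

lemma alg_hom_widen_codomain: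
  assumes "f \<in> alg_hom G (H\<lparr>carrier := K\<rparr>)" "K \<subseteq> carrier H"
  shows "f \<in> alg_hom G H"
  using assms unfolding alg_hom_def hom_def by auto

lemma alg_hom_pair:
  assumes "f \<in> alg_hom K A" "g \<in> alg_hom K B" "function_algebra (regular K)"
  shows "(\<lambda>x. (f x, g x)) \<in> alg_hom K (alg_dirprod A B)"
proof (rule alg_homI[OF _ regular_alg_dirprod assms(3)])
  show "(\<lambda>x. (f x, g x)) \<in> hom K (alg_dirprod A B)"
    using assms(1,2) unfolding alg_hom_def hom_def by auto
  fix s assume "s \<in> {\<lambda>x. \<phi> (fst x) |\<phi>. \<phi> \<in> regular A} \<union> {\<lambda>x. \<psi> (snd x) |\<psi>. \<psi> \<in> regular B}"
  then show "(\<lambda>x. s (f x, g x)) \<in> regular_on (regular K) (carrier K)"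
    using assms(1,2) unfolding alg_hom_def regular_on_def by auto
qed

lemma fst_alg_hom: "fst \<in> alg_hom (alg_dirprod A B) A"
proof -
  have reg: "(\<lambda>x. \<phi> (fst x)) \<in> regular (alg_dirprod A B)" if "\<phi> \<in> regular A" for \<phi>
    unfolding regular_alg_dirprod by (rule generated_algebra.gen) (use that in blast)
  have "fst \<in> hom (alg_dirprod A B) A" by (auto simp: hom_def)
  moreover have "\<exists>\<psi>'\<in>regular (alg_dirprod A B). \<forall>x\<in>carrier (alg_dirprod A B). \<psi>' x = \<phi> (fst x)"
    if "\<phi> \<in> regular A" for \<phi>
    by (rule bexI[OF _ reg[OF that]]) simp
  ultimately show ?thesis unfolding alg_hom_def by blast
qed

lemma snd_alg_hom: "snd \<in> alg_hom (alg_dirprod A B) B"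
proof -
  have reg: "(\<lambda>x. \<psi> (snd x)) \<in> regular (alg_dirprod A B)" if "\<psi> \<in> regular B" for \<psi>
    unfolding regular_alg_dirprod by (rule generated_algebra.gen) (use that in blast)
  have "snd \<in> hom (alg_dirprod A B) B" by (auto simp: hom_def)
  moreover have "\<exists>\<psi>'\<in>regular (alg_dirprod A B). \<forall>x\<in>carrier (alg_dirprod A B). \<psi>' x = \<psi> (snd x)"
    if "\<psi> \<in> regular B" for \<psi>
    by (rule bexI[OF _ reg[OF that]]) simp
  ultimately show ?thesis unfolding alg_hom_def by blast
qed

lemma torus_coordinate_regular:
  assumes "i < r"
  shows "(\<lambda>t. t i) \<in> regular_on (regular (split_torus r)) (carrier (split_torus r))"
    "(\<lambda>t. inverse (t i)) \<in> regular_on (regular (split_torus r)) (carrier (split_torus r))"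
proof -
  have sub: "carrier (split_torus r) \<subseteq> carrier (alg_prod {..<r} (\<lambda>_. Gm))" by (simp add: split_torus_def)
  have i: "i \<in> {..<r}" using assms by simp
  show "(\<lambda>t. t i) \<in> regular_on (regular (split_torus r)) (carrier (split_torus r))"
    using alg_prod_regular[OF i Gm_regular(1) sub] unfolding split_torus_def .
  show "(\<lambda>t. inverse (t i)) \<in> regular_on (regular (split_torus r)) (carrier (split_torus r))"
    using alg_prod_regular[OF i Gm_regular(2) sub] unfolding split_torus_def .
qed

lemma function_algebra_split_torus [simp]: "function_algebra (regular (split_torus r))"
  by (simp add: split_torus_def)

lemma hom_into_split_torus:
  assumes f: "f \<in> hom G (split_torus r)" and R: "function_algebra (regular G)"
    and e: "\<And>i. i < r \<Longrightarrow> (\<lambda>x. f x i) \<in> regular_on (regular G) (carrier G)"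
      "\<And>i. i < r \<Longrightarrow> (\<lambda>x. inverse (f x i)) \<in> regular_on (regular G) (carrier G)"
  shows "f \<in> alg_hom G (split_torus r)"
proof (rule alg_homI[OF f _ R])
  show "regular (split_torus r) = generated_algebra {\<lambda>x. \<phi> (x i) | i \<phi>. i \<in> {..<r} \<and> \<phi> \<in> regular Gm}"
    unfolding split_torus_def by (rule regular_alg_prod)
  fix s :: "(nat \<Rightarrow> complex) \<Rightarrow> complex" assume "s \<in> {\<lambda>x. \<phi> (x i) | i \<phi>. i \<in> {..<r} \<and> \<phi> \<in> regular Gm}"
  then obtain i \<phi> where s: "s = (\<lambda>x. \<phi> (x i))" "i < r" "\<phi> \<in> generated_algebra {\<lambda>z. z, inverse}" by auto
  show "(\<lambda>x. s (f x)) \<in> regular_on (regular G) (carrier G)"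
    unfolding s(1) by (rule regular_on_compose[OF s(3) R]) (use e s(2) in auto)
qed

lemma torus_times_Gm:
  assumes "alg_iso (split_torus r) K" and K: "monoid K"
  shows "alg_iso (split_torus (Suc r)) (alg_dirprod K Gm)"
proof -
  obtain f g where fg: "f \<in> alg_hom (split_torus r) K" "g \<in> alg_hom K (split_torus r)"
     "\<forall>x\<in>carrier (split_torus r). g (f x) = x" "\<forall>y\<in>carrier K. f (g y) = y"
    using assms unfolding alg_iso_def by blast
  let ?res = "\<lambda>t :: nat \<Rightarrow> complex. restrict t {..<r}"
  have res: "?res \<in> alg_hom (split_torus (Suc r)) (split_torus r)"
  proof (rule hom_into_split_torus)
    show "?res \<in> hom (split_torus (Suc r)) (split_torus r)"
    proof (rule homI)
      show "?res t \<in> carrier (split_torus r)" if "t \<in> carrier (split_torus (Suc r))" for t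
        using that by (auto simp: PiE_iff)
      show "?res (s \<otimes>\<^bsub>split_torus (Suc r)\<^esub> t) = ?res s \<otimes>\<^bsub>split_torus r\<^esub> ?res t" for s t
        by (rule ext) (simp add: restrict_def)
    qed
    show "(\<lambda>x. ?res x i) \<in> regular_on (regular (split_torus (Suc r))) (carrier (split_torus (Suc r)))" if "i < r" for i
      using torus_coordinate_regular(1)[of i "Suc r"] that by simp
    show "(\<lambda>x. inverse (?res x i)) \<in> regular_on (regular (split_torus (Suc r))) (carrier (split_torus (Suc r)))" if "i < r" for i
      using torus_coordinate_regular(2)[of i "Suc r"] that by simp
  qed simp
  have last: "(\<lambda>t. t r) \<in> alg_hom (split_torus (Suc r)) Gm"
  proof (rule alg_homI)
    show "regular Gm = generated_algebra {\<lambda>z. z, inverse}" by simp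
    show "(\<lambda>x. s (x r)) \<in> regular_on (regular (split_torus (Suc r))) (carrier (split_torus (Suc r)))"
      if "s \<in> {\<lambda>z. z, inverse}" for s :: "complex \<Rightarrow> complex"
      using that torus_coordinate_regular[of r "Suc r"] by auto
  qed (auto simp: hom_def PiE_iff)
  define p where "p = (\<lambda>t. (f (?res t), t r))"
  define q where "q = (\<lambda>xz. \<lambda>i\<in>{..<Suc r}. if i < r then g (fst xz) i else snd xz)"
  have p: "p \<in> alg_hom (split_torus (Suc r)) (alg_dirprod K Gm)"
    unfolding p_def by (rule alg_hom_pair[OF alg_hom_comp[OF res fg(1)] last]) simp
  have gc: "g x \<in> carrier (split_torus r)" if "x \<in> carrier K" for x using alg_hom_carrier[OF fg(2) that] .
  have q: "q \<in> alg_hom (alg_dirprod K Gm) (split_torus (Suc r))"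
  proof (rule hom_into_split_torus)
    show "q \<in> hom (alg_dirprod K Gm) (split_torus (Suc r))"
    proof (rule homI)
      show "q x \<in> carrier (split_torus (Suc r))" if "x \<in> carrier (alg_dirprod K Gm)" for x
        using that gc[of "fst x"] by (auto simp: q_def PiE_iff)
      show "q (x \<otimes>\<^bsub>alg_dirprod K Gm\<^esub> y) = q x \<otimes>\<^bsub>split_torus (Suc r)\<^esub> q y"
        if "x \<in> carrier (alg_dirprod K Gm)" "y \<in> carrier (alg_dirprod K Gm)" for x y
      proof -
        have "g (fst x \<otimes>\<^bsub>K\<^esub> fst y) = g (fst x) \<otimes>\<^bsub>split_torus r\<^esub> g (fst y)"
          using fg(2) that unfolding alg_hom_def by (auto simp: hom_def)
        then show ?thesis by (auto simp: q_def intro!: restrict_ext)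
      qed
    qed
    show "(\<lambda>x. q x i) \<in> regular_on (regular (alg_dirprod K Gm)) (carrier (alg_dirprod K Gm))" if i: "i < Suc r" for i
    proof (cases "i < r")
      case True
      have "(\<lambda>x. g (fst x) i) \<in> regular_on (regular (alg_dirprod K Gm)) (carrier (alg_dirprod K Gm))"
        by (rule alg_hom_regular[OF fst_alg_hom alg_hom_regular[OF fg(2) torus_coordinate_regular(1)[OF True]]])
      then show ?thesis using True by (simp add: q_def)
    next
      case False
      have "(\<lambda>x. snd x) \<in> regular_on (regular (alg_dirprod K Gm)) (carrier (alg_dirprod K Gm))"
        by (rule alg_hom_regular[OF snd_alg_hom Gm_regular(1)])
      then show ?thesis using False i by (simp add: q_def)
    qed
    show "(\<lambda>x. inverse (q x i)) \<in> regular_on (regular (alg_dirprod K Gm)) (carrier (alg_dirprod K Gm))" if i: "i < Suc r" for i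
    proof (cases "i < r")
      case True
      have "(\<lambda>x. inverse (g (fst x) i)) \<in> regular_on (regular (alg_dirprod K Gm)) (carrier (alg_dirprod K Gm))"
        by (rule alg_hom_regular[OF fst_alg_hom alg_hom_regular[OF fg(2) torus_coordinate_regular(2)[OF True]]])
      then show ?thesis using True by (simp add: q_def)
    next
      case False
      have "(\<lambda>x. inverse (snd x)) \<in> regular_on (regular (alg_dirprod K Gm)) (carrier (alg_dirprod K Gm))"
        by (rule alg_hom_regular[OF snd_alg_hom Gm_regular(2)])
      then show ?thesis using False i by (simp add: q_def)
    qed
  qed simp
  have "q (p t) = t" if t: "t \<in> carrier (split_torus (Suc r))" for t
  proof -
    have "?res t \<in> carrier (split_torus r)" using alg_hom_carrier[OF res t] .
    then have "g (f (?res t)) = ?res t" using fg(3) by blast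
    then show ?thesis using t by (auto simp: p_def q_def PiE_iff extensional_def fun_eq_iff less_Suc_eq)
  qed
  moreover have "p (q x) = x" if x: "x \<in> carrier (alg_dirprod K Gm)" for x
  proof -
    have "?res (q x) = g (fst x)"
      using x gc[of "fst x"] by (intro extensionalityI[of _ "{..<r}"]) (auto simp: q_def PiE_iff)
    then show ?thesis using x fg(4) by (auto simp: p_def q_def)
  qed
  ultimately show ?thesis unfolding alg_iso_def using p q by blast
qed

lemma subtorus_conj:
  assumes G: "group G" and R: "\<And>g. g \<in> carrier G \<Longrightarrow> (\<lambda>x. g \<otimes>\<^bsub>G\<^esub> x \<otimes>\<^bsub>G\<^esub> inv\<^bsub>G\<^esub> g) \<in> alg_hom G G"
    and S: "subtorus G S" and g: "g \<in> carrier G"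
  shows "subtorus G ((\<lambda>x. g \<otimes>\<^bsub>G\<^esub> x \<otimes>\<^bsub>G\<^esub> inv\<^bsub>G\<^esub> g) ` S)"
proof -
  interpret group G by (rule G)
  let ?c = "\<lambda>x. g \<otimes>\<^bsub>G\<^esub> x \<otimes>\<^bsub>G\<^esub> inv\<^bsub>G\<^esub> g" and ?c' = "\<lambda>x. inv\<^bsub>G\<^esub> g \<otimes>\<^bsub>G\<^esub> x \<otimes>\<^bsub>G\<^esub> g"
  have cc': "?c (?c' x) = x" "?c' (?c x) = x" if "x \<in> carrier G" for x
    using that g by (simp_all add: m_assoc inv_solve_left r_inv_ex flip: m_assoc) (simp_all add: m_assoc)
  have c': "?c' \<in> alg_hom G G" using R[of "inv\<^bsub>G\<^esub> g"] g by simp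
  have sub: "subgroup S G" "zariski_closed G S" "torus (G\<lparr>carrier := S\<rparr>)" using S by (auto simp: subtorus_def)
  have SG: "S \<subseteq> carrier G" using sub(1) subgroup.subset by blast
  have hc: "?c \<in> hom G G" using R[OF g] by (simp add: alg_hom_def)
  have "group_hom G G ?c" by (intro group_hom.intro group_hom_axioms.intro G hc)
  then have 1: "subgroup (?c ` S) G" using sub(1) by (rule group_hom.subgroup_img_is_subgroup)
  have 2: "zariski_closed G (?c ` S)"
  proof -
    obtain F where F: "F \<subseteq> regular G" "S = {x \<in> carrier G. \<forall>\<phi>\<in>F. \<phi> x = 0}"
      using sub(2) unfolding zariski_closed_def by blast
    \<comment> \<open>The equations of the conjugate set are those of \<open>S\<close> composed with
      the inverse conjugation.\<close>
    have "\<exists>\<psi>\<in>regular G. \<forall>x\<in>carrier G. \<psi> x = \<phi> (?c' x)" if "\<phi> \<in> F" for \<phi>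
      using c' F(1) that unfolding alg_hom_def by blast
    then obtain \<psi> where \<psi>: "\<And>\<phi>. \<phi> \<in> F \<Longrightarrow> \<psi> \<phi> \<in> regular G \<and> (\<forall>x\<in>carrier G. \<psi> \<phi> x = \<phi> (?c' x))" by metis
    have "?c ` S = {x \<in> carrier G. \<forall>\<phi>\<in>\<psi> ` F. \<phi> x = 0}"
    proof (intro equalityI subsetI)
      fix y assume "y \<in> ?c ` S"
      then obtain x where x: "x \<in> S" "y = ?c x" by blast
      then have xG: "x \<in> carrier G" using SG by blast
      have "y \<in> carrier G" using x xG g by simp
      moreover have "\<psi> \<phi> y = 0" if "\<phi> \<in> F" for \<phi>
        using \<psi>[OF that] \<open>y \<in> carrier G\<close> cc'(2)[OF xG] x F(2) that by auto
      ultimately show "y \<in> {x \<in> carrier G. \<forall>\<phi>\<in>\<psi> ` F. \<phi> x = 0}" by blast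
    next
      fix y assume "y \<in> {x \<in> carrier G. \<forall>\<phi>\<in>\<psi> ` F. \<phi> x = 0}"
      then have y: "y \<in> carrier G" "\<And>\<phi>. \<phi> \<in> F \<Longrightarrow> \<psi> \<phi> y = 0" by auto
      then have "?c' y \<in> S" unfolding F(2) using \<psi> g by auto
      then show "y \<in> ?c ` S" using cc'(1)[OF y(1)] by (metis imageI)
    qed
    moreover have "\<psi> ` F \<subseteq> regular G" using \<psi> by auto
    ultimately show ?thesis unfolding zariski_closed_def by (intro exI[of _ "\<psi> ` F"] conjI)
  qed
  have 3: "torus (G\<lparr>carrier := ?c ` S\<rparr>)"
  proof -
    have "alg_iso (G\<lparr>carrier := S\<rparr>) (G\<lparr>carrier := ?c ` S\<rparr>)"
      unfolding alg_iso_def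
    proof (intro bexI conjI ballI)
      show "?c \<in> alg_hom (G\<lparr>carrier := S\<rparr>) (G\<lparr>carrier := ?c ` S\<rparr>)"
        by (rule alg_hom_restrict_codomain[OF alg_hom_restrict_domain[OF R[OF g] SG]]) simp
      show "?c' \<in> alg_hom (G\<lparr>carrier := ?c ` S\<rparr>) (G\<lparr>carrier := S\<rparr>)"
      proof (rule alg_hom_restrict_codomain[OF alg_hom_restrict_domain[OF c']])
        show "?c ` S \<subseteq> carrier G" using SG g by auto
        show "?c' x \<in> S" if "x \<in> carrier (G\<lparr>carrier := ?c ` S\<rparr>)" for x
          using that cc'(2) SG by auto
      qed
      show "?c' (?c x) = x" if "x \<in> carrier (G\<lparr>carrier := S\<rparr>)" for x using that cc'(2) SG by auto
      show "?c (?c' y) = y" if "y \<in> carrier (G\<lparr>carrier := ?c ` S\<rparr>)" for y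
        using that cc'(1) SG g by auto
    qed
    then show ?thesis using sub(3) alg_iso_trans unfolding torus_def by blast
  qed
  show ?thesis unfolding subtorus_def using 1 2 3 by blast
qed

section \<open>Conjugacy of maximal tori\<close>

context sl_product
begin

definition G :: "(('i \<Rightarrow> complex mat) \<times> complex) alg_group" where "G = alg_dirprod H Gm"

definition r :: nat where "r = (\<Sum>i\<in>I. n i - 1)"

definition cj :: "('i \<Rightarrow> complex mat) \<Rightarrow> ('i \<Rightarrow> complex mat) \<Rightarrow> ('i \<Rightarrow> complex mat)" where
  "cj g x = g \<otimes>\<^bsub>H\<^esub> x \<otimes>\<^bsub>H\<^esub> inv\<^bsub>H\<^esub> g"

lemma group_G: "group G" unfolding G_def by (intro group_alg_dirprod group_H group_Gm)

lemma G_simps [simp]: "carrier G = carrier H \<times> (-{0})" "x \<otimes>\<^bsub>G\<^esub> y = (fst x \<otimes>\<^bsub>H\<^esub> fst y, snd x * snd y)"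
  "\<one>\<^bsub>G\<^esub> = (\<one>\<^bsub>H\<^esub>, 1)" "function_algebra (regular G)"
  by (simp_all add: G_def)

lemma inv_G: assumes "x \<in> carrier G" shows "inv\<^bsub>G\<^esub> x = (inv\<^bsub>H\<^esub> (fst x), inverse (snd x))"
proof -
  have c: "x \<in> carrier (alg_dirprod H Gm)" "snd x \<noteq> 0" using assms by (auto simp: G_def)
  show ?thesis unfolding G_def by (simp only: inv_alg_dirprod[OF group_H group_Gm c(1)] inv_Gm[OF c(2)])
qed

lemma cj_alg_hom: assumes g: "g \<in> carrier H" shows "cj g \<in> alg_hom H H"
proof (rule hom_into_H)
  interpret group H by (rule group_H)
  show "cj g \<in> hom H H"
  proof (rule homI)
    show "cj g (x \<otimes>\<^bsub>H\<^esub> y) = cj g x \<otimes>\<^bsub>H\<^esub> cj g y" if "x \<in> carrier H" "y \<in> carrier H" for x y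
    proof -
      have "inv\<^bsub>H\<^esub> g \<otimes>\<^bsub>H\<^esub> (g \<otimes>\<^bsub>H\<^esub> z) = z" if "z \<in> carrier H" for z using that g by (simp flip: m_assoc)
      then show ?thesis unfolding cj_def using that g by (simp add: m_assoc)
    qed
  qed (use g in \<open>simp add: cj_def\<close>)
  fix i j k assume i: "i \<in> I" and jk: "j < n i" "k < n i"
  have gi: "g i \<in> carrier_mat (n i) (n i)" "adj_mat (g i) \<in> carrier_mat (n i) (n i)"
    using g i adj_mat(1) unfolding carrier_H by auto
  have xi: "x i \<in> carrier_mat (n i) (n i)" if "x \<in> carrier H" for x using that i unfolding carrier_H by auto
  have "(\<lambda>x. (g i * x i * adj_mat (g i)) $$ (j,k)) \<in> regular_on (regular H) (carrier H)"
  proof (rule regular_on_matmult[of _ _ _ "n i" "n i" _ "n i"])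
    show "(\<lambda>x. (g i * x i) $$ (a,b)) \<in> regular_on (regular H) (carrier H)" if "a < n i" "b < n i" for a b
      by (rule regular_on_matmult[of _ _ _ "n i" "n i" _ "n i"])
        (use that gi xi i H_entry_regular in \<open>auto intro: regular_on_const\<close>)
  qed (use jk gi xi in \<open>auto intro: regular_on_const\<close>)
  then show "(\<lambda>x. cj g x i $$ (j,k)) \<in> regular_on (regular H) (carrier H)"
    by (rule regular_on_cong) (use i g in \<open>simp add: cj_def mult_H inv_H\<close>)
qed simp

lemma cj_inverse: assumes "g \<in> carrier H" "x \<in> carrier H"
  shows "cj g x \<in> carrier H" "cj (inv\<^bsub>H\<^esub> g) (cj g x) = x" "cj g (cj (inv\<^bsub>H\<^esub> g) x) = x"
proof -
  interpret group H by (rule group_H)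
  show "cj g x \<in> carrier H" using assms by (simp add: cj_def)
  show "cj (inv\<^bsub>H\<^esub> g) (cj g x) = x"
    unfolding cj_def using assms by (simp add: m_assoc) (simp flip: m_assoc)
  show "cj g (cj (inv\<^bsub>H\<^esub> g) x) = x"
    unfolding cj_def using assms by (simp add: m_assoc) (simp flip: m_assoc)
qed

lemma G_conj: assumes "g \<in> carrier G" "x \<in> carrier G"
  shows "g \<otimes>\<^bsub>G\<^esub> x \<otimes>\<^bsub>G\<^esub> inv\<^bsub>G\<^esub> g = (cj (fst g) (fst x), snd x)"
  using assms by (cases g, cases x) (simp add: inv_G cj_def)

lemma G_conj_alg_hom: assumes "g \<in> carrier G" shows "(\<lambda>x. g \<otimes>\<^bsub>G\<^esub> x \<otimes>\<^bsub>G\<^esub> inv\<^bsub>G\<^esub> g) \<in> alg_hom G G"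
proof (rule alg_hom_cong)
  show "(\<lambda>x. (cj (fst g) (fst x), snd x)) \<in> alg_hom G G"
    unfolding G_def
    by (rule alg_hom_pair[OF alg_hom_comp[OF fst_alg_hom cj_alg_hom] snd_alg_hom]) (use assms in \<open>auto simp: G_def\<close>)
qed (use assms G_conj group_G group.is_monoid in \<open>auto simp del: G_simps\<close>)

text \<open>Coordinates are the diagonal entries except the last of each factor, which determinant
  one makes the inverse of the product of the others. The bijection \<open>b\<close> numbers the
  positions that are kept.\<close>

lemma D_split_torus: "alg_iso (split_torus r) (H\<lparr>carrier := D\<rparr>)"
proof -
  define S where "S = (SIGMA i:I. {..<n i - 1})"
  have S: "finite S" "card S = r" unfolding S_def r_def using finite_I by auto
  obtain b where b: "bij_betw b {..<r} S"
    using ex_bij_betw_nat_finite[OF S(1)] S(2) by (auto simp: atLeast0LessThan)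
  define e where "e = the_inv_into {..<r} b"
  have be: "b (e s) = s" "e s < r" if "s \<in> S" for s
    using b that f_the_inv_into_f_bij_betw[OF b] bij_betw_apply[OF bij_betw_the_inv_into[OF b]] unfolding e_def by auto
  have eb: "e (b q) = q" "b q \<in> S" if "q < r" for q
    using b that the_inv_into_f_f[of b "{..<r}" q] unfolding e_def bij_betw_def by auto
  define c where "c = (\<lambda>t i j. if j < n i - 1 then t (e (i,j)) else \<Prod>l<n i - 1. inverse (t (e (i,l))) :: complex)"
  have e_lt: "e (i,j) < r" if "i \<in> I" "j < n i - 1" for i j using be(2)[of "(i,j)"] that by (auto simp: S_def)
  have c1: "(\<Prod>j<n i. c t i j) = 1" if t: "t \<in> carrier (split_torus r)" and i: "i \<in> I" for t i
  proof -
    obtain m where m: "n i = Suc m" using n_pos[OF i] by (cases "n i") auto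
    have "t (e (i,l)) \<noteq> 0" if "l < m" for l
      using e_lt[of i l] that t i m by (auto simp: PiE_iff)
    then have "(\<Prod>l<m. t (e (i,l)) * inverse (t (e (i,l)))) = 1" by (intro prod.neutral) auto
    then show ?thesis unfolding m by (simp add: c_def m prod.distrib)
  qed
  define f where "f = (\<lambda>t. diag (c t))"
  define g where "g = (\<lambda>x. \<lambda>q\<in>{..<r}. x (fst (b q)) $$ (snd (b q), snd (b q)) :: complex)"
  have bI: "fst (b q) \<in> I" "snd (b q) < n (fst (b q))" "snd (b q) < n (fst (b q)) - 1" if "q < r" for q
    using eb(2)[OF that] by (auto simp: S_def)
  have fD: "f t \<in> D" if "t \<in> carrier (split_torus r)" for t
    unfolding f_def using c1[OF that] by (rule diag_in_D)
  have f: "f \<in> alg_hom (split_torus r) (H\<lparr>carrier := D\<rparr>)"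
  proof (rule alg_hom_restrict_codomain[OF hom_into_H])
    show "f \<in> hom (split_torus r) H"
    proof (rule homI)
      show "f t \<in> carrier H" if "t \<in> carrier (split_torus r)" for t using fD[OF that] D_subset by blast
      show "f (s \<otimes>\<^bsub>split_torus r\<^esub> t) = f s \<otimes>\<^bsub>H\<^esub> f t" for s t
      proof -
        have "c (s \<otimes>\<^bsub>split_torus r\<^esub> t) i j = c s i j * c t i j" if "i \<in> I" for i j
          using e_lt[OF that] unfolding c_def by (auto simp: prod.distrib[symmetric] mult.commute intro!: prod.cong)
        then show ?thesis unfolding f_def diag_mult by (auto simp: diag_def intro!: restrict_ext eq_matI)
      qed
    qed
    show "(\<lambda>x. f x i $$ (j, k)) \<in> regular_on (regular (split_torus r)) (carrier (split_torus r))"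
      if "i \<in> I" "j < n i" "k < n i" for i j k
    proof (cases "j = k")
      case True
      have "(\<lambda>t. c t i j) \<in> regular_on (regular (split_torus r)) (carrier (split_torus r))"
      proof (cases "j < n i - 1")
        case True
        then show ?thesis using torus_coordinate_regular(1)[OF e_lt[OF that(1) True]] by (simp add: c_def)
      next
        case False
        have "(\<lambda>t. \<Prod>l<n i - 1. inverse (t (e (i,l)))) \<in> regular_on (regular (split_torus r)) (carrier (split_torus r))"
          by (intro regular_on_prod torus_coordinate_regular(2) e_lt) (use that in auto)
        then show ?thesis using False by (simp add: c_def)
      qed
      then show ?thesis using that True by (simp add: f_def diag_entry)
    next
      case False
      then show ?thesis using that by (simp add: f_def diag_entry regular_on_const)
    qed
  qed (use fD in auto)
  have g: "g \<in> alg_hom (H\<lparr>carrier := D\<rparr>) (split_torus r)"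
  proof (rule hom_into_split_torus)
    show "g \<in> hom (H\<lparr>carrier := D\<rparr>) (split_torus r)"
    proof (rule homI)
      show "g x \<in> carrier (split_torus r)" if "x \<in> carrier (H\<lparr>carrier := D\<rparr>)" for x
        using that bI D_nonzero by (auto simp: g_def)
      show "g (x \<otimes>\<^bsub>H\<lparr>carrier := D\<rparr>\<^esub> y) = g x \<otimes>\<^bsub>split_torus r\<^esub> g y"
        if "x \<in> carrier (H\<lparr>carrier := D\<rparr>)" "y \<in> carrier (H\<lparr>carrier := D\<rparr>)" for x y
        using that bI D_mult_entry by (auto simp: g_def intro!: restrict_ext)
    qed
    show "(\<lambda>x. g x q) \<in> regular_on (regular (H\<lparr>carrier := D\<rparr>)) (carrier (H\<lparr>carrier := D\<rparr>))" if "q < r" for q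
      using H_entry_regular[OF bI(1)[OF that] bI(2)[OF that] bI(2)[OF that] D_subset] that by (simp add: g_def)
    show "(\<lambda>x. inverse (g x q)) \<in> regular_on (regular (H\<lparr>carrier := D\<rparr>)) (carrier (H\<lparr>carrier := D\<rparr>))" if "q < r" for q
      using D_inverse_entry_regular[OF bI(1)[OF that] bI(2)[OF that]] that by (simp add: g_def)
  qed simp
  have "g (f t) = t" if t: "t \<in> carrier (split_torus r)" for t
  proof (rule extensionalityI[of _ "{..<r}"])
    show "t \<in> extensional {..<r}" using t by (auto simp: PiE_iff)
    fix q assume "q \<in> {..<r}"
    then have q: "q < r" by simp
    have "g (f t) q = c t (fst (b q)) (snd (b q))" using q bI[OF q] by (simp add: g_def f_def diag_entry)
    also have "\<dots> = t q" using bI(3)[OF q] eb(1)[OF q] by (simp add: c_def)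
    finally show "g (f t) q = t q" .
  qed (simp add: g_def)
  moreover have "f (g x) = x" if x: "x \<in> D" for x
  proof (rule D_ext)
    have gx: "g x \<in> carrier (split_torus r)" using alg_hom_carrier[OF g] x by simp
    show "f (g x) \<in> D" by (rule fD[OF gx])
    fix i j assume ij: "i \<in> I" "j < n i"
    have gi: "g x (e (i,l)) = x i $$ (l,l)" if "l < n i - 1" for l
      using be[of "(i,l)"] that ij by (auto simp: g_def S_def)
    have "f (g x) i $$ (j,j) = c (g x) i j" using ij by (simp add: f_def diag_entry)
    also have "\<dots> = x i $$ (j,j)"
    proof (cases "j < n i - 1")
      case False
      obtain m where m: "n i = Suc m" using n_pos[OF ij(1)] by (cases "n i") auto
      have jm: "j = m" using False ij m by auto
      have "(\<Prod>l<m. x i $$ (l,l)) * x i $$ (m,m) = 1" using D_prod[OF x ij(1)] by (simp add: m)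
      then have "inverse (\<Prod>l<m. x i $$ (l,l)) = x i $$ (m,m)" by (rule inverse_unique)
      moreover have "(\<Prod>l<m. inverse (g x (e (i,l)))) = inverse (\<Prod>l<m. x i $$ (l,l))"
        using gi m by (simp add: prod_inversef[unfolded comp_def, symmetric])
      ultimately show ?thesis using False by (simp add: c_def m jm)
    qed (simp add: c_def gi)
    finally show "f (g x) i $$ (j,j) = x i $$ (j,j)" .
  qed (use x in simp)
  ultimately show ?thesis unfolding alg_iso_def using f g by (intro bexI[of _ f] bexI[of _ g]) auto
qed

lemma H_entry_in_regular:
  assumes "i \<in> I" "j < n i" "k < n i"
  shows "(\<lambda>x. x i $$ (j,k)) \<in> regular H"
proof -
  have "(\<lambda>A. A $$ (j,k)) \<in> regular (SL (n i))"
    unfolding regular_SL by (rule generated_algebra.gen) (use assms in blast)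
  then show ?thesis unfolding H_def regular_alg_prod using assms(1)
    by (intro generated_algebra.gen CollectI exI[of _ i] exI[of _ "\<lambda>A. A $$ (j,k)"]) simp
qed

lemma subtorus_D: "subtorus H D"
proof -
  note gen = H_entry_in_regular
  have "zariski_closed H D" unfolding zariski_closed_def
    by (rule exI[of _ "(\<lambda>(i,j,k) x. x i $$ (j,k)) ` {(i,j,k). i \<in> I \<and> j < n i \<and> k < n i \<and> j \<noteq> k}"])
      (use gen in \<open>auto simp: D_def\<close>)
  then show ?thesis unfolding subtorus_def torus_def using subgroup_D D_split_torus by blast
qed

lemma DG_eq: "G\<lparr>carrier := D \<times> (-{0})\<rparr> = alg_dirprod (H\<lparr>carrier := D\<rparr>) Gm"
  by (simp add: G_def alg_dirprod_def monoid.defs DirProd_def)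

lemma subtorus_DG: "subtorus G (D \<times> (-{0}))"
proof -
  note gen = H_entry_in_regular
  have gen': "(\<lambda>x. fst x i $$ (j,k)) \<in> regular G" if "i \<in> I" "j < n i" "k < n i" for i j k
    unfolding G_def regular_alg_dirprod by (rule generated_algebra.gen) (use gen[OF that] in auto)
  have "zariski_closed G (D \<times> (-{0}))" unfolding zariski_closed_def
    by (rule exI[of _ "(\<lambda>(i,j,k) x. fst x i $$ (j,k)) ` {(i,j,k). i \<in> I \<and> j < n i \<and> k < n i \<and> j \<noteq> k}"])
      (use gen' in \<open>auto simp: D_def\<close>)
  moreover have "subgroup (D \<times> (-{0})) G"
  proof (rule group.subgroupI[OF group_G])
    show "D \<times> (-{0}) \<subseteq> carrier G" using D_subset by auto
    have "(\<one>\<^bsub>H\<^esub>, 1::complex) \<in> D \<times> (-{0})" using subgroup.one_closed[OF subgroup_D] by simp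
    then show "D \<times> (-{0::complex}) \<noteq> {}" by blast
    show "inv\<^bsub>G\<^esub> a \<in> D \<times> (-{0})" if "a \<in> D \<times> (-{0})" for a
    proof -
      have "a \<in> carrier G" using that D_subset by auto
      then show ?thesis using that subgroup.m_inv_closed[OF subgroup_D] by (auto simp only: inv_G) auto
    qed
    show "a \<otimes>\<^bsub>G\<^esub> b \<in> D \<times> (-{0})" if "a \<in> D \<times> (-{0})" "b \<in> D \<times> (-{0})" for a b
      using that subgroup.m_closed[OF subgroup_D] by auto
  qed
  moreover have "torus (G\<lparr>carrier := D \<times> (-{0})\<rparr>)"
    unfolding DG_eq torus_def using torus_times_Gm[OF D_split_torus group.is_monoid[OF group_D]] by blast
  ultimately show ?thesis unfolding subtorus_def by blast
qed

text \<open>The projections to the factors \<open>SL(n i)\<close> are diagonalised separately, and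
  the diagonalising matrices together form one element of \<open>H\<close>.\<close>

lemma simultaneous_conj:
  assumes K: "torus K" and \<rho>: "\<rho> \<in> alg_hom K H"
  shows "\<exists>g\<in>carrier H. \<forall>x\<in>carrier K. cj (inv\<^bsub>H\<^esub> g) (\<rho> x) \<in> D"
proof -
  interpret group H by (rule group_H)
  have "\<exists>B\<in>carrier (SL (n i)). \<forall>x\<in>carrier K. \<forall>j<n i. \<forall>k<n i. j \<noteq> k \<longrightarrow> (adj_mat B * (\<rho> x i * B)) $$ (j,k) = 0"
    if i: "i \<in> I" for i
  proof (rule torus_diagonalisable[OF K])
    have "(\<lambda>x. x i) \<in> alg_hom H (SL (n i))"
    proof (rule alg_homI[OF _ regular_SL])
      show "(\<lambda>x. x i) \<in> hom H (SL (n i))" using i unfolding hom_def by (auto simp: carrier_H mult_H)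
      show "(\<lambda>x. s (x i)) \<in> regular_on (regular H) (carrier H)"
        if "s \<in> {\<lambda>A. A $$ (j, k) |j k. j < n i \<and> k < n i}" for s
        using that H_entry_regular[OF i] by auto
    qed simp
    from alg_hom_comp[OF \<rho> this] show "(\<lambda>x. \<rho> x i) \<in> alg_hom K (SL (n i))" .
  qed
  then obtain B where B: "\<And>i. i \<in> I \<Longrightarrow> B i \<in> carrier (SL (n i))"
    "\<And>i x j k. i \<in> I \<Longrightarrow> x \<in> carrier K \<Longrightarrow> j < n i \<Longrightarrow> k < n i \<Longrightarrow> j \<noteq> k \<Longrightarrow> (adj_mat (B i) * (\<rho> x i * B i)) $$ (j,k) = 0"
    by metis
  define g where "g = restrict B I"
  have g: "g \<in> carrier H" unfolding carrier_H using B(1) by (auto simp: g_def)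
  have "cj (inv\<^bsub>H\<^esub> g) (\<rho> x) \<in> D" if x: "x \<in> carrier K" for x
  proof -
    have \<rho>x: "\<rho> x \<in> carrier H" using alg_hom_carrier[OF \<rho> x] .
    have "cj (inv\<^bsub>H\<^esub> g) (\<rho> x) i = adj_mat (B i) * (\<rho> x i * B i)" if i: "i \<in> I" for i
    proof -
      have "cj (inv\<^bsub>H\<^esub> g) (\<rho> x) = inv\<^bsub>H\<^esub> g \<otimes>\<^bsub>H\<^esub> \<rho> x \<otimes>\<^bsub>H\<^esub> g"
        unfolding cj_def inv_inv[OF g] ..
      then have "cj (inv\<^bsub>H\<^esub> g) (\<rho> x) i = adj_mat (B i) * \<rho> x i * B i"
        unfolding mult_H inv_H[OF g] using i by (simp add: g_def)
      also have "\<dots> = adj_mat (B i) * (\<rho> x i * B i)"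
      proof (rule assoc_mult_mat)
        show "adj_mat (B i) \<in> carrier_mat (n i) (n i)" "B i \<in> carrier_mat (n i) (n i)" "\<rho> x i \<in> carrier_mat (n i) (n i)"
          using B(1)[OF i] adj_mat(1) \<rho>x i unfolding carrier_H by auto
      qed
      finally show ?thesis .
    qed
    moreover have "cj (inv\<^bsub>H\<^esub> g) (\<rho> x) \<in> carrier H" using cj_inverse(1)[OF inv_closed[OF g] \<rho>x] .
    ultimately show ?thesis unfolding D_def using B(2)[OF _ x] by simp
  qed
  then show ?thesis using g by blast
qed

text \<open>A conjugate of \<open>D\<close> contains \<open>T\<close> and is itself a subtorus, so
  maximality of \<open>T\<close> gives equality.\<close>

theorem maximal_torus_H:
  assumes "maximal_torus H T"
  shows "\<exists>g\<in>carrier H. T = cj g ` D"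
proof -
  interpret group H by (rule group_H)
  have T: "subtorus H T" "\<And>T'. subtorus H T' \<Longrightarrow> T \<subseteq> T' \<Longrightarrow> T' = T" using assms unfolding maximal_torus_def by auto
  have TH: "T \<subseteq> carrier H" "torus (H\<lparr>carrier := T\<rparr>)" using T(1) subgroup.subset unfolding subtorus_def by auto
  have "(\<lambda>x. x) \<in> alg_hom H H" unfolding alg_hom_def hom_def by auto
  from simultaneous_conj[OF TH(2) alg_hom_restrict_domain[OF this TH(1)]]
  obtain g where g: "g \<in> carrier H" "\<And>x. x \<in> T \<Longrightarrow> cj (inv\<^bsub>H\<^esub> g) x \<in> D" by auto
  have "T \<subseteq> cj g ` D"
  proof
    fix x assume x: "x \<in> T"
    then have "cj g (cj (inv\<^bsub>H\<^esub> g) x) = x" using cj_inverse(3)[OF g(1)] TH(1) by blast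
    then show "x \<in> cj g ` D" using g(2)[OF x] by (intro image_eqI[of _ _ "cj (inv\<^bsub>H\<^esub> g) x"]) simp_all
  qed
  moreover have "subtorus H (cj g ` D)"
    using subtorus_conj[OF group_H _ subtorus_D g(1)] cj_alg_hom unfolding cj_def by blast
  ultimately show ?thesis using T(2) g(1) by blast
qed

text \<open>Only the first projection of \<open>T\<close> has to be diagonalised; the component in
  \<open>Gm\<close> is central and comes along unchanged.\<close>

theorem maximal_torus_G:
  assumes "maximal_torus G T"
  shows "\<exists>g\<in>carrier H. T = (\<lambda>x. (cj g (fst x), snd x)) ` (D \<times> (-{0}))"
proof -
  interpret H: group H by (rule group_H)
  have T: "subtorus G T" "\<And>T'. subtorus G T' \<Longrightarrow> T \<subseteq> T' \<Longrightarrow> T' = T" using assms unfolding maximal_torus_def by auto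
  have TG: "T \<subseteq> carrier G" "torus (G\<lparr>carrier := T\<rparr>)" using T(1) subgroup.subset unfolding subtorus_def by blast+
  have "fst \<in> alg_hom G H" unfolding G_def by (rule fst_alg_hom)
  from simultaneous_conj[OF TG(2) alg_hom_restrict_domain[OF this TG(1)]]
  obtain g where g: "g \<in> carrier H" "\<And>x. x \<in> T \<Longrightarrow> cj (inv\<^bsub>H\<^esub> g) (fst x) \<in> D" by auto
  let ?c = "\<lambda>x. (cj g (fst x), snd x)"
  have "T \<subseteq> ?c ` (D \<times> (-{0}))"
  proof
    fix x assume x: "x \<in> T"
    then have xG: "fst x \<in> carrier H" "snd x \<noteq> 0" using TG(1) by auto
    have "x = ?c (cj (inv\<^bsub>H\<^esub> g) (fst x), snd x)" using cj_inverse(3)[OF g(1) xG(1)] by simp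
    then show "x \<in> ?c ` (D \<times> (-{0}))" using g(2)[OF x] xG(2) by blast
  qed
  moreover have "subtorus G (?c ` (D \<times> (-{0})))"
  proof -
    have gG: "(g, 1) \<in> carrier G" using g(1) by simp
    have "(\<lambda>x. (g, 1) \<otimes>\<^bsub>G\<^esub> x \<otimes>\<^bsub>G\<^esub> inv\<^bsub>G\<^esub> (g, 1)) ` (D \<times> (-{0})) = ?c ` (D \<times> (-{0}))"
      using G_conj[OF gG] D_subset by (intro image_cong refl) (auto simp del: G_simps(2))
    then show ?thesis using subtorus_conj[OF group_G G_conj_alg_hom subtorus_DG gG] by simp
  qed
  ultimately show ?thesis using T(2) g(1) by blast
qed

end

section \<open>Rational characters\<close>

text \<open>The operations on the localization are unions over representatives. Such a union
  collapses as soon as its members do not depend on the representative.\<close>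

lemma UN_pair_const: "p \<in> S \<Longrightarrow> (\<And>a b. (a, b) \<in> S \<Longrightarrow> f a b = C) \<Longrightarrow> (\<Union>(a, b)\<in>S. f a b) = C"
  by (cases p) fastforce

locale char_localization = comm_group G for G :: "'a monoid" (structure)
begin

abbreviation frac :: "'a \<Rightarrow> nat \<Rightarrow> ('a \<times> nat) set" where "frac x m \<equiv> rat_rel G `` {(x, m)}"

lemma equiv_rat_rel: "equiv (carrier G \<times> {0<..}) (rat_rel G)"
proof (rule equivI)
  show "rat_rel G \<subseteq> (carrier G \<times> {0<..}) \<times> (carrier G \<times> {0<..})" by (auto simp: rat_rel_def)
  show "refl_on (carrier G \<times> {0<..}) (rat_rel G)"
    by (auto simp: refl_on_def rat_rel_def intro!: exI[of _ 1])
  show "sym (rat_rel G)"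
  proof (rule symI)
    fix X Y assume "(X, Y) \<in> rat_rel G"
    then obtain x m y n k where "X = (x,m)" "Y = (y,n)" "x \<in> carrier G" "y \<in> carrier G" "0 < m" "0 < n" "0 < k"
      "x [^] (k * n) = y [^] (k * m)" unfolding rat_rel_def by auto
    then show "(Y, X) \<in> rat_rel G" unfolding rat_rel_def by (auto intro!: exI[of _ k])
  qed
  show "trans (rat_rel G)"
  proof (rule transI)
    fix X Y Z assume "(X, Y) \<in> rat_rel G" "(Y, Z) \<in> rat_rel G"
    then obtain x m y n z p k l where e: "X = (x,m)" "Y = (y,n)" "Z = (z,p)"
      "x \<in> carrier G" "y \<in> carrier G" "z \<in> carrier G" "0 < m" "0 < n" "0 < p" "0 < k" "0 < l"
      "x [^] (k * n) = y [^] (k * m)" "y [^] (l * p) = z [^] (l * n)"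
      unfolding rat_rel_def by auto
    have "x [^] (k * l * n * p) = (x [^] (k * n)) [^] (l * p)" using e(4) by (simp add: nat_pow_pow mult_ac)
    also have "\<dots> = (y [^] (l * p)) [^] (k * m)" unfolding e(12) using e(5) by (simp add: nat_pow_pow mult_ac)
    also have "\<dots> = z [^] (k * l * n * m)" unfolding e(13) using e(6) by (simp add: nat_pow_pow mult_ac)
    finally show "(X, Z) \<in> rat_rel G" unfolding rat_rel_def using e
      by (auto intro!: exI[of _ "k * l * n"])
  qed
qed

lemma frac_eqI:
  assumes "x \<in> carrier G" "y \<in> carrier G" "0 < m" "0 < n" "0 < k" "x [^] (k * n) = y [^] (k * m)"
  shows "frac x m = frac y n"
proof -
  have "((x,m),(y,n)) \<in> rat_rel G" unfolding rat_rel_def using assms by auto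
  then show ?thesis by (rule equiv_class_eq[OF equiv_rat_rel])
qed

lemma in_frac:
  "(y, n) \<in> frac x m \<longleftrightarrow> x \<in> carrier G \<and> y \<in> carrier G \<and> 0 < m \<and> 0 < n \<and> (\<exists>k. 0 < k \<and> x [^] (k * n) = y [^] (k * m))"
  by (auto simp: rat_rel_def)

lemma frac_self: "x \<in> carrier G \<Longrightarrow> 0 < m \<Longrightarrow> (x, m) \<in> frac x m"
  unfolding in_frac by (auto intro!: exI[of _ 1])

lemma carrier_tensor: "carrier (tensor_rat G) = {frac x m | x m. x \<in> carrier G \<and> 0 < m}"
  by (auto simp: tensor_rat_def quotient_def)

lemma frac_expand: "x \<in> carrier G \<Longrightarrow> 0 < m \<Longrightarrow> 0 < k \<Longrightarrow> frac x m = frac (x [^] k) (k * m)"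
  by (rule frac_eqI[of _ _ _ _ 1]) (auto simp: nat_pow_pow mult_ac)

lemma add_frac:
  assumes "x \<in> carrier G" "y \<in> carrier G" "0 < m" "0 < n"
  shows "frac x m \<oplus>\<^bsub>tensor_rat G\<^esub> frac y n = frac (x [^] n \<otimes> y [^] m) (m * n)"
proof -
  have *: "frac (x' [^] n' \<otimes> y' [^] m') (m' * n') = frac (x [^] n \<otimes> y [^] m) (m * n)"
    if xm: "(x', m') \<in> frac x m" and yn: "(y', n') \<in> frac y n" for x' m' y' n'
  proof -
    obtain k where k: "x' \<in> carrier G" "0 < m'" "0 < k" "x [^] (k * m') = x' [^] (k * m)" using xm unfolding in_frac by auto
    obtain l where l: "y' \<in> carrier G" "0 < n'" "0 < l" "y [^] (l * n') = y' [^] (l * n)" using yn unfolding in_frac by auto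
    have pow: "(a [^] p \<otimes> b [^] q) [^] s = a [^] (p * s) \<otimes> b [^] (q * s)"
      if "a \<in> carrier G" "b \<in> carrier G" for a b and p q s :: nat
      using that by (simp add: nat_pow_distrib nat_pow_pow)
    show ?thesis
    proof (rule frac_eqI[where k = "k * l"])
      have "x' [^] (n' * (k * l * (m * n))) = (x' [^] (k * m)) [^] (n' * l * n)" using k by (simp add: nat_pow_pow mult_ac)
      also have "\<dots> = x [^] (n * (k * l * (m' * n')))" unfolding k(4)[symmetric] using assms by (simp add: nat_pow_pow mult_ac)
      finally have 1: "x' [^] (n' * (k * l * (m * n))) = x [^] (n * (k * l * (m' * n')))" .
      have "y' [^] (m' * (k * l * (m * n))) = (y' [^] (l * n)) [^] (m' * k * m)" using l by (simp add: nat_pow_pow mult_ac)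
      also have "\<dots> = y [^] (m * (k * l * (m' * n')))" unfolding l(4)[symmetric] using assms by (simp add: nat_pow_pow mult_ac)
      finally have 2: "y' [^] (m' * (k * l * (m * n))) = y [^] (m * (k * l * (m' * n')))" .
      show "(x' [^] n' \<otimes> y' [^] m') [^] (k * l * (m * n)) = (x [^] n \<otimes> y [^] m) [^] (k * l * (m' * n'))"
        unfolding pow[OF k(1) l(1)] pow[OF assms(1,2)] 1 2 ..
    qed (use assms k l in auto)
  qed
  have "frac x m \<oplus>\<^bsub>tensor_rat G\<^esub> frac y n = (\<Union>(x', m')\<in>frac x m. \<Union>(y', n')\<in>frac y n. frac (x' [^] n' \<otimes> y' [^] m') (m' * n'))"
    by (simp add: tensor_rat_def)
  also have "\<dots> = frac (x [^] n \<otimes> y [^] m) (m * n)"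
    by (rule UN_pair_const[OF frac_self[OF assms(1,3)]], rule UN_pair_const[OF frac_self[OF assms(2,4)]]) (rule *)
  finally show ?thesis .
qed

text \<open>Convex combinations involve nonnegative scalars, for which the integer power in the
  definition becomes a natural one.\<close>

lemma smult_frac:
  assumes "x \<in> carrier G" "0 < m" "0 \<le> q"
  shows "q \<odot>\<^bsub>tensor_rat G\<^esub> frac x m = frac (x [^] nat (fst (quotient_of q))) (m * nat (snd (quotient_of q)))"
proof -
  obtain a b where ab: "quotient_of q = (a, b)" by force
  have b: "0 < b" using quotient_of_denom_pos[OF ab] .
  have "q = of_int a / of_int b" by (rule quotient_of_div[OF ab])
  then have a: "0 \<le> a" using assms(3) b by (simp add: zero_le_divide_iff)
  have pw: "z [^] a = z [^] nat a" for z using a by (metis int_pow_int int_nat_eq)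
  have *: "frac (x' [^] nat a) (m' * nat b) = frac (x [^] nat a) (m * nat b)"
    if xm: "(x', m') \<in> frac x m" for x' m'
  proof -
    obtain k where k: "x' \<in> carrier G" "0 < m'" "0 < k" "x [^] (k * m') = x' [^] (k * m)" using xm unfolding in_frac by auto
    show ?thesis
    proof (rule frac_eqI[where k = k])
      have "(x' [^] nat a) [^] (k * (m * nat b)) = (x' [^] (k * m)) [^] (nat a * nat b)" using k by (simp add: nat_pow_pow mult_ac)
      also have "\<dots> = (x [^] nat a) [^] (k * (m' * nat b))" unfolding k(4)[symmetric] using assms by (simp add: nat_pow_pow mult_ac)
      finally show "(x' [^] nat a) [^] (k * (m * nat b)) = (x [^] nat a) [^] (k * (m' * nat b))" .
    qed (use assms k b in auto)
  qed
  have "q \<odot>\<^bsub>tensor_rat G\<^esub> frac x m = (\<Union>(x', m')\<in>frac x m. frac (x' [^] nat a) (m' * nat b))"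
    by (simp add: tensor_rat_def ab pw)
  also have "\<dots> = frac (x [^] nat a) (m * nat b)"
    by (rule UN_pair_const[OF frac_self[OF assms(1,2)]]) (rule *)
  finally show ?thesis by (simp add: ab)
qed

lemma add_frac_common:
  assumes "x \<in> carrier G" "y \<in> carrier G" "0 < m"
  shows "frac x m \<oplus>\<^bsub>tensor_rat G\<^esub> frac y m = frac (x \<otimes> y) m"
  unfolding add_frac[OF assms(1,2,3,3)]
  by (rule frac_eqI[of _ _ _ _ 1]) (use assms in \<open>auto simp: nat_pow_distrib nat_pow_pow\<close>)

lemma zero_tensor: "0 < m \<Longrightarrow> \<zero>\<^bsub>tensor_rat G\<^esub> = frac \<one> m"
  unfolding tensor_rat_def by simp (rule frac_eqI[of _ _ _ _ 1], auto)

text \<open>Over a common denominator, addition is multiplication of numerators. The laws of an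
  abelian monoid thereby reduce to those of the group.\<close>

lemma common_denominator:
  assumes "X \<in> carrier (tensor_rat G)" "Y \<in> carrier (tensor_rat G)" "Z \<in> carrier (tensor_rat G)"
  shows "\<exists>x y z N. x \<in> carrier G \<and> y \<in> carrier G \<and> z \<in> carrier G \<and> 0 < N \<and> X = frac x N \<and> Y = frac y N \<and> Z = frac z N"
proof -
  obtain x m y n z p where *: "X = frac x m" "x \<in> carrier G" "0 < m" "Y = frac y n" "y \<in> carrier G" "0 < n"
      "Z = frac z p" "z \<in> carrier G" "0 < p"
    using assms unfolding carrier_tensor by blast
  have "X = frac (x [^] (n * p)) (m * n * p)" unfolding *(1) using frac_expand[of x m "n * p"] * by (simp add: mult_ac)
  moreover have "Y = frac (y [^] (m * p)) (m * n * p)" unfolding *(4) using frac_expand[of y n "m * p"] * by (simp add: mult_ac)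
  moreover have "Z = frac (z [^] (m * n)) (m * n * p)" unfolding *(7) using frac_expand[of z p "m * n"] * by (simp add: mult_ac)
  ultimately show ?thesis using *
    by (intro exI[of _ "x [^] (n * p)"] exI[of _ "y [^] (m * p)"] exI[of _ "z [^] (m * n)"] exI[of _ "m * n * p"]) auto
qed

lemma frac_closed: "x \<in> carrier G \<Longrightarrow> 0 < m \<Longrightarrow> frac x m \<in> carrier (tensor_rat G)"
  unfolding carrier_tensor by blast

lemma abelian_monoid_tensor: "abelian_monoid (tensor_rat G)"
proof (rule abelian_monoidI)
  show "\<zero>\<^bsub>tensor_rat G\<^esub> \<in> carrier (tensor_rat G)" unfolding zero_tensor[of 1, simplified] by (rule frac_closed) auto
  fix X Y assume X: "X \<in> carrier (tensor_rat G)" and Y: "Y \<in> carrier (tensor_rat G)"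
  obtain x y N where xy: "x \<in> carrier G" "y \<in> carrier G" "0 < N" "X = frac x N" "Y = frac y N"
    using common_denominator[OF X Y Y] by blast
  show "X \<oplus>\<^bsub>tensor_rat G\<^esub> Y \<in> carrier (tensor_rat G)"
    unfolding xy(4,5) add_frac_common[OF xy(1-3)] using xy by (intro frac_closed) auto
  show "\<zero>\<^bsub>tensor_rat G\<^esub> \<oplus>\<^bsub>tensor_rat G\<^esub> X = X"
    unfolding xy(4) zero_tensor[OF xy(3)] add_frac_common[OF one_closed xy(1,3)] using xy by simp
  show "X \<oplus>\<^bsub>tensor_rat G\<^esub> Y = Y \<oplus>\<^bsub>tensor_rat G\<^esub> X"
    unfolding xy(4,5) add_frac_common[OF xy(1-3)] add_frac_common[OF xy(2,1,3)] using xy by (simp add: m_comm)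
next
  fix X Y Z assume "X \<in> carrier (tensor_rat G)" "Y \<in> carrier (tensor_rat G)" "Z \<in> carrier (tensor_rat G)"
  from common_denominator[OF this] obtain x y z N where
    xyz: "x \<in> carrier G" "y \<in> carrier G" "z \<in> carrier G" "0 < N" "X = frac x N" "Y = frac y N" "Z = frac z N" by blast
  show "(X \<oplus>\<^bsub>tensor_rat G\<^esub> Y) \<oplus>\<^bsub>tensor_rat G\<^esub> Z = X \<oplus>\<^bsub>tensor_rat G\<^esub> (Y \<oplus>\<^bsub>tensor_rat G\<^esub> Z)"
    unfolding xyz(5-7) add_frac_common[OF xyz(1,2,4)] add_frac_common[OF xyz(2,3,4)]
      add_frac_common[OF m_closed[OF xyz(1,2)] xyz(3,4)] add_frac_common[OF xyz(1) m_closed[OF xyz(2,3)] xyz(4)]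
    using xyz by (simp add: m_assoc)
qed

lemma finsum_frac:
  assumes "finite S" "\<And>i. i \<in> S \<Longrightarrow> x i \<in> carrier G" "0 < N"
  shows "finsum (tensor_rat G) (\<lambda>i. frac (x i) N) S = frac (finprod G x S) N"
  using assms(1,2)
proof (induction S rule: finite_induct)
  interpret T: abelian_monoid "tensor_rat G" by (rule abelian_monoid_tensor)
  case empty
  then show ?case using zero_tensor[OF assms(3)] by simp
next
  interpret T: abelian_monoid "tensor_rat G" by (rule abelian_monoid_tensor)
  case (insert i S)
  have "finsum (tensor_rat G) (\<lambda>i. frac (x i) N) (insert i S) =
      frac (x i) N \<oplus>\<^bsub>tensor_rat G\<^esub> finsum (tensor_rat G) (\<lambda>i. frac (x i) N) S"
    by (rule T.finsum_insert) (use insert assms(3) in \<open>auto intro!: frac_closed simp del: Image_singleton_iff\<close>)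
  also have "\<dots> = frac (x i \<otimes> finprod G x S) N"
    using insert assms(3) by (simp add: add_frac_common del: Image_singleton_iff)
  finally show ?case using insert by (simp add: finprod_insert)
qed

text \<open>Rational coefficients are brought to the common denominator \<open>N\<close>.\<close>

lemma rational_combination_zero:
  fixes a :: "'j \<Rightarrow> rat"
  assumes S: "finite S" and x: "\<And>i. i \<in> S \<Longrightarrow> x i \<in> carrier G" and a: "\<And>i. i \<in> S \<Longrightarrow> 0 \<le> a i"
    and N: "0 < N" "\<And>i. i \<in> S \<Longrightarrow> a i * of_nat N = of_nat (c i)"
    and one: "finprod G (\<lambda>i. x i [^] c i) S = \<one>"
  shows "(\<Oplus>\<^bsub>tensor_rat G\<^esub>i\<in>S. a i \<odot>\<^bsub>tensor_rat G\<^esub> rat_embed G (x i)) = \<zero>\<^bsub>tensor_rat G\<^esub>"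
proof -
  interpret T: abelian_monoid "tensor_rat G" by (rule abelian_monoid_tensor)
  have "a i \<odot>\<^bsub>tensor_rat G\<^esub> rat_embed G (x i) = frac (x i [^] c i) N" if i: "i \<in> S" for i
  proof -
    obtain p q where pq: "quotient_of (a i) = (p, q)" by force
    have q: "0 < q" using quotient_of_denom_pos[OF pq] .
    have ai: "a i = of_int p / of_int q" by (rule quotient_of_div[OF pq])
    then have p: "0 \<le> p" using a[OF i] q by (simp add: zero_le_divide_iff)
    have "(of_int (p * int N) :: rat) = of_int (int (c i) * q)" using N(2)[OF i] q unfolding ai by (simp add: field_simps)
    then have "p * int N = int (c i) * q" by (simp only: of_int_eq_iff)
    then have eq: "nat p * N = c i * nat q" using p q by (metis int_nat_eq nat_int nat_mult_distrib of_nat_0_le_iff order_less_imp_le)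
    have "a i \<odot>\<^bsub>tensor_rat G\<^esub> frac (x i) 1 = frac (x i [^] nat p) (1 * nat q)"
      using smult_frac[OF x[OF i] _ a[OF i], of 1] unfolding pq by simp
    also have "\<dots> = frac (x i [^] c i) N"
    proof (rule frac_eqI[of _ _ _ _ 1])
      show "(x i [^] nat p) [^] (1 * N) = (x i [^] c i) [^] (1 * (1 * nat q))"
        unfolding nat_pow_pow[OF x[OF i]] using eq by simp
    qed (use x[OF i] q N(1) in auto)
    finally show ?thesis unfolding rat_embed_def .
  qed
  then have "(\<Oplus>\<^bsub>tensor_rat G\<^esub>i\<in>S. a i \<odot>\<^bsub>tensor_rat G\<^esub> rat_embed G (x i)) = (\<Oplus>\<^bsub>tensor_rat G\<^esub>i\<in>S. frac (x i [^] c i) N)"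
    using x N(1) by (intro T.finsum_cong') (auto intro!: frac_closed simp del: Image_singleton_iff)
  also have "\<dots> = frac (finprod G (\<lambda>i. x i [^] c i) S) N" using x by (intro finsum_frac S N(1)) auto
  also have "\<dots> = \<zero>\<^bsub>tensor_rat G\<^esub>" unfolding one zero_tensor[OF N(1)] ..
  finally show ?thesis .
qed

end

section \<open>Character groups\<close>

text \<open>The coordinate ring of \<open>Gm\<close> is generated by the identity and the inverse,
  so these are the two functions whose pullbacks have to be regular.\<close>

lemma carrier_char_group:
  assumes "function_algebra (regular K)"
  shows "\<chi> \<in> carrier (char_group K) \<longleftrightarrow> \<chi> \<in> extensional (carrier K) \<and> \<chi> \<in> hom K Gm \<and>
    \<chi> \<in> regular_on (regular K) (carrier K) \<and> (\<lambda>x. inverse (\<chi> x)) \<in> regular_on (regular K) (carrier K)"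
proof
  assume "\<chi> \<in> carrier (char_group K)"
  then have "\<chi> \<in> alg_hom K Gm" "\<chi> \<in> extensional (carrier K)" by (auto simp: char_group_def)
  then show "\<chi> \<in> extensional (carrier K) \<and> \<chi> \<in> hom K Gm \<and>
    \<chi> \<in> regular_on (regular K) (carrier K) \<and> (\<lambda>x. inverse (\<chi> x)) \<in> regular_on (regular K) (carrier K)"
    using alg_hom_regular[of \<chi> K Gm, OF _ Gm_regular(1)] alg_hom_regular[of \<chi> K Gm, OF _ Gm_regular(2)]
    by (simp add: alg_hom_def)
next
  assume *: "\<chi> \<in> extensional (carrier K) \<and> \<chi> \<in> hom K Gm \<and>
    \<chi> \<in> regular_on (regular K) (carrier K) \<and> (\<lambda>x. inverse (\<chi> x)) \<in> regular_on (regular K) (carrier K)"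
  have "\<chi> \<in> alg_hom K Gm"
  proof (rule alg_homI[OF _ Gm_simps(4) assms])
    show "(\<lambda>x. s (\<chi> x)) \<in> regular_on (regular K) (carrier K)" if "s \<in> {\<lambda>z. z, inverse}" for s
      using that * by auto
  qed (use * in auto)
  then show "\<chi> \<in> carrier (char_group K)" using * by (simp add: char_group_def)
qed

lemma char_group_simps [simp]:
  "\<chi> \<otimes>\<^bsub>char_group K\<^esub> \<psi> = (\<lambda>x\<in>carrier K. \<chi> x * \<psi> x)" "\<one>\<^bsub>char_group K\<^esub> = (\<lambda>x\<in>carrier K. 1)"
  by (simp_all add: char_group_def)

lemma comm_group_char_group:
  assumes K: "group K" and R: "function_algebra (regular K)"
  shows "comm_group (char_group K)"
proof -
  interpret group K by (rule K)
  note cc = carrier_char_group[OF R]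
  have nz: "\<chi> x \<noteq> 0" if "\<chi> \<in> carrier (char_group K)" "x \<in> carrier K" for \<chi> x
    using that hom_in_carrier[of \<chi> K Gm x] unfolding cc by simp
  have ext: "\<chi> \<in> extensional (carrier K)" if "\<chi> \<in> carrier (char_group K)" for \<chi> using that cc by blast
  have mult: "\<chi> (x \<otimes>\<^bsub>K\<^esub> y) = \<chi> x * \<chi> y" if "\<chi> \<in> carrier (char_group K)" "x \<in> carrier K" "y \<in> carrier K" for \<chi> x y
    using that hom_mult[of \<chi> K Gm x y] unfolding cc by simp
  have mk: "restrict f (carrier K) \<in> carrier (char_group K)"
    if "\<And>x. x \<in> carrier K \<Longrightarrow> f x \<noteq> 0" "\<And>x y. x \<in> carrier K \<Longrightarrow> y \<in> carrier K \<Longrightarrow> f (x \<otimes>\<^bsub>K\<^esub> y) = f x * f y"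
      "f \<in> regular_on (regular K) (carrier K)" "(\<lambda>x. inverse (f x)) \<in> regular_on (regular K) (carrier K)" for f
  proof -
    have "restrict f (carrier K) \<in> regular_on (regular K) (carrier K)"
      by (rule regular_on_cong[OF that(3)]) simp
    moreover have "(\<lambda>x. inverse (restrict f (carrier K) x)) \<in> regular_on (regular K) (carrier K)"
      by (rule regular_on_cong[OF that(4)]) simp
    ultimately show ?thesis unfolding cc using that(1,2) by (auto intro!: homI)
  qed
  show ?thesis
  proof (rule comm_groupI)
    show "\<chi> \<otimes>\<^bsub>char_group K\<^esub> \<psi> \<in> carrier (char_group K)"
      if "\<chi> \<in> carrier (char_group K)" "\<psi> \<in> carrier (char_group K)" for \<chi> \<psi>
      unfolding char_group_simps
    proof (rule mk)
      show "(\<lambda>x. \<chi> x * \<psi> x) \<in> regular_on (regular K) (carrier K)"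
        using that unfolding cc by (intro regular_on_mult R) auto
      show "(\<lambda>x. inverse (\<chi> x * \<psi> x)) \<in> regular_on (regular K) (carrier K)"
        using that unfolding cc inverse_mult_distrib by (intro regular_on_mult R) auto
    qed (simp_all add: nz[OF that(1)] nz[OF that(2)] mult[OF that(1)] mult[OF that(2)])
    show "\<one>\<^bsub>char_group K\<^esub> \<in> carrier (char_group K)"
      unfolding char_group_simps by (rule mk) (auto intro: regular_on_const R)
    show "\<chi> \<otimes>\<^bsub>char_group K\<^esub> \<psi> = \<psi> \<otimes>\<^bsub>char_group K\<^esub> \<chi>" for \<chi> \<psi> by (auto simp: mult.commute intro!: restrict_ext)
    show "\<chi> \<otimes>\<^bsub>char_group K\<^esub> \<psi> \<otimes>\<^bsub>char_group K\<^esub> \<omega> = \<chi> \<otimes>\<^bsub>char_group K\<^esub> (\<psi> \<otimes>\<^bsub>char_group K\<^esub> \<omega>)" for \<chi> \<psi> \<omega>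
      by (auto simp: mult.assoc intro!: restrict_ext)
    show "\<one>\<^bsub>char_group K\<^esub> \<otimes>\<^bsub>char_group K\<^esub> \<chi> = \<chi>" if "\<chi> \<in> carrier (char_group K)" for \<chi>
      using ext[OF that] by (auto intro!: extensionalityI[of _ "carrier K"])
    show "\<exists>\<psi>\<in>carrier (char_group K). \<psi> \<otimes>\<^bsub>char_group K\<^esub> \<chi> = \<one>\<^bsub>char_group K\<^esub>"
      if "\<chi> \<in> carrier (char_group K)" for \<chi>
    proof (rule bexI)
      show "restrict (\<lambda>x. inverse (\<chi> x)) (carrier K) \<in> carrier (char_group K)"
        by (rule mk) (use that in \<open>simp_all add: nz[OF that] mult[OF that] cc\<close>)
      show "restrict (\<lambda>x. inverse (\<chi> x)) (carrier K) \<otimes>\<^bsub>char_group K\<^esub> \<chi> = \<one>\<^bsub>char_group K\<^esub>"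
        using nz[OF that] by (auto intro!: restrict_ext)
    qed
  qed
qed

lemma char_group_pow:
  assumes "x \<in> carrier K"
  shows "(\<chi> [^]\<^bsub>char_group K\<^esub> (k::nat)) x = \<chi> x ^ k"
  by (induction k) (use assms in \<open>auto simp: nat_pow_def mult.commute\<close>)

lemma char_group_finprod:
  assumes "group K" "function_algebra (regular K)" "finite S" "\<And>i. i \<in> S \<Longrightarrow> \<chi> i \<in> carrier (char_group K)" "x \<in> carrier K"
  shows "(finprod (char_group K) \<chi> S) x = (\<Prod>i\<in>S. \<chi> i x)"
  using assms(3,4)
proof (induction S rule: finite_induct)
  interpret comm_group "char_group K" by (rule comm_group_char_group[OF assms(1,2)])
  case empty
  then show ?case using assms(5) by simp
next
  interpret comm_group "char_group K" by (rule comm_group_char_group[OF assms(1,2)])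
  case (insert i S)
  then show ?case using assms(5) by (simp add: finprod_insert)
qed

section \<open>Weights and degeneracy\<close>

lemma common_multiple_of_denominators:
  fixes a :: "'j \<Rightarrow> rat"
  assumes "finite S"
  shows "\<exists>N>0. \<forall>i\<in>S. \<exists>k::int. a i * of_nat N = of_int k"
  using assms
proof (induction S rule: finite_induct)
  case empty
  then show ?case by (intro exI[of _ 1]) auto
next
  case (insert i S)
  then obtain N where N: "N > 0" "\<forall>i\<in>S. \<exists>k::int. a i * of_nat N = of_int k" by auto
  obtain p q where pq: "quotient_of (a i) = (p, q)" by force
  have q: "0 < q" using quotient_of_denom_pos[OF pq] .
  have ai: "a i = of_int p / of_int q" by (rule quotient_of_div[OF pq])
  show ?case
  proof (intro exI[of _ "N * nat q"] conjI ballI)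
    show "0 < N * nat q" using N(1) q by simp
    fix j assume "j \<in> insert i S"
    then show "\<exists>k::int. a j * of_nat (N * nat q) = of_int k"
    proof
      assume "j = i"
      then show ?thesis using q ai by (intro exI[of _ "p * int N"]) simp
    next
      assume "j \<in> S"
      then obtain k :: int where "a j * of_nat N = of_int k" using N(2) by auto
      then show ?thesis using q by (intro exI[of _ "k * q"]) (simp add: mult.assoc[symmetric])
    qed
  qed
qed

context sl_rep
begin

sublocale chars: char_family "H\<lparr>carrier := D\<rparr>" monomials by (rule char_family_D)

lemma isotypic_exists: "\<exists>F P. chars.isotypic X d F P"
proof (rule chars.isotypic_decomposition)
  show "X x \<in> carrier_mat d d" if "x \<in> carrier (H\<lparr>carrier := D\<rparr>)" for x using that D_subset X_carrier by auto
  show "X \<one>\<^bsub>H\<lparr>carrier := D\<rparr>\<^esub> = 1\<^sub>m d" by (simp add: X_one)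
  show "X (x \<otimes>\<^bsub>H\<lparr>carrier := D\<rparr>\<^esub> y) = X x * X y"
    if "x \<in> carrier (H\<lparr>carrier := D\<rparr>)" "y \<in> carrier (H\<lparr>carrier := D\<rparr>)" for x y
    using that D_subset by (simp add: X_mult subset_iff)
  show "finite_comb (carrier (H\<lparr>carrier := D\<rparr>)) monomials (\<lambda>x. X x $$ (i,j))" if "i < d" "j < d" for i j
    using D_regular_comb[OF regular_on_subset[OF X_entry_regular[OF that] D_subset]] by simp
qed

text \<open>A nonzero column of \<open>P \<chi>\<close> is a weight vector for
  \<open>\<chi>\<close>. Conversely, a weight vector whose character is missing from
  \<open>F\<close> would give a nontrivial relation between distinct characters.\<close>

lemma isotypic_weight_iff:
  assumes iso: "chars.isotypic X d F P"
  shows "x \<in> weight_exponents \<longleftrightarrow> restrict (mono x) D \<in> F"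
proof
  note FP = chars.isotypicD[OF iso, simplified]
  assume xF: "restrict (mono x) D \<in> F"
  let ?\<chi> = "restrict (mono x) D"
  have P: "P ?\<chi> \<in> carrier_mat d d" "P ?\<chi> \<noteq> 0\<^sub>m d d" using FP(3,4) xF by auto
  then obtain i j where ij: "i < d" "j < d" "P ?\<chi> $$ (i,j) \<noteq> 0" by (metis eq_matI carrier_matD index_zero_mat)
  define v where "v = col (P ?\<chi>) j"
  have v: "v \<in> carrier_vec d" using carrier_matD[OF P(1)] by (intro carrier_vecI) (simp add: v_def)
  have "v \<noteq> 0\<^sub>v d" using ij P by (auto simp: v_def dest!: arg_cong[of _ _ "\<lambda>w. w $ i"])
  moreover have "X h *\<^sub>v v = mono x h \<cdot>\<^sub>v v" if h: "h \<in> D" for h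
  proof -
    have Xh: "X h \<in> carrier_mat d d" using h D_subset X_carrier by auto
    have "X h * P ?\<chi> = ?\<chi> h \<cdot>\<^sub>m P ?\<chi>"
      by (rule chars.isotypic_eigen(1)[OF iso _ Xh xF]) (use h in simp)
    then have "X h *\<^sub>v v = col (?\<chi> h \<cdot>\<^sub>m P ?\<chi>) j"
      unfolding v_def using col_mult2[OF Xh P(1) ij(2)] by simp
    also have "\<dots> = mono x h \<cdot>\<^sub>v v" using P(1) ij h by (intro eq_vecI) (auto simp: v_def)
    finally show ?thesis .
  qed
  ultimately show "x \<in> weight_exponents" unfolding weight_exponents_def using v by blast
next
  note FP = chars.isotypicD[OF iso, simplified]
  assume "x \<in> weight_exponents"
  then obtain v where v: "v \<in> carrier_vec d" "v \<noteq> 0\<^sub>v d" "\<And>h. h \<in> D \<Longrightarrow> X h *\<^sub>v v = mono x h \<cdot>\<^sub>v v"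
    unfolding weight_exponents_def by blast
  let ?\<omega> = "restrict (mono x) D"
  show "?\<omega> \<in> F"
  proof (rule ccontr)
    assume notF: "?\<omega> \<notin> F"
    have "v $ i = 0" if i: "i < d" for i
    proof -
      \<comment> \<open>Row \<open>i\<close> of the eigenvalue equation for \<open>v\<close>, read
        as a relation between characters; the missing character enters with the coefficient
        \<open>- (v $ i)\<close>.\<close>
      define c where "c = (\<lambda>\<chi>. if \<chi> = ?\<omega> then - (v $ i) else (\<Sum>j=0..<d. P \<chi> $$ (i,j) * v $ j))"
      have "c ?\<omega> = 0"
      proof (rule chars.characters_independent[of "insert ?\<omega> F" c "?\<omega>"])
        show "finite (insert ?\<omega> F)" using FP(1) by simp
        show "insert ?\<omega> F \<subseteq> monomials" using FP(2) unfolding monomials_def by auto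
        fix h assume "h \<in> carrier (H\<lparr>carrier := D\<rparr>)"
        then have h: "h \<in> D" by simp
        have Xh: "X h \<in> carrier_mat d d" using h D_subset X_carrier by auto
        have "(\<Sum>\<chi>\<in>F. c \<chi> * \<chi> h) = (\<Sum>\<chi>\<in>F. \<Sum>j=0..<d. \<chi> h * P \<chi> $$ (i,j) * v $ j)"
          using notF by (intro sum.cong) (auto simp: c_def sum_distrib_left mult_ac)
        also have "\<dots> = (\<Sum>j=0..<d. (\<Sum>\<chi>\<in>F. \<chi> h * P \<chi> $$ (i,j)) * v $ j)"
          unfolding sum_distrib_right by (rule sum.swap)
        also have "\<dots> = (\<Sum>j=0..<d. X h $$ (i,j) * v $ j)" using FP(6)[OF h i] by (intro sum.cong) auto
        also have "\<dots> = (X h *\<^sub>v v) $ i" using Xh v(1) i by (simp add: scalar_prod_def)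
        also have "\<dots> = mono x h * v $ i" unfolding v(3)[OF h] using v(1) i by simp
        finally show "(\<Sum>\<chi>\<in>insert ?\<omega> F. c \<chi> * \<chi> h) = 0"
          using notF FP(1) h by (simp add: c_def)
      qed simp
      then show ?thesis by (simp add: c_def)
    qed
    then show False using v(1,2) by (metis carrier_vecD eq_vecI index_zero_vec)
  qed
qed

lemma weight_exponents_nonempty:
  assumes "0 < d"
  shows "weight_exponents \<noteq> {}"
proof -
  obtain F P where iso: "chars.isotypic X d F P" using isotypic_exists by blast
  note FP = chars.isotypicD[OF iso, simplified]
  have one: "\<one>\<^bsub>H\<^esub> \<in> D" using subgroup.one_closed[OF subgroup_D] .
  have "F \<noteq> {}"
  proof
    assume "F = {}"
    then have "X \<one>\<^bsub>H\<^esub> $$ (0,0) = 0" using FP(6)[OF one assms assms] by simp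
    then show False using assms by (simp add: X_one)
  qed
  then obtain \<chi> where "\<chi> \<in> F" by blast
  moreover then obtain x where "\<chi> = restrict (mono x) D" using FP(2) unfolding monomials_def by auto
  ultimately show ?thesis using isotypic_weight_iff[OF iso] by blast
qed

lemma weight_configuration_weights:
  assumes "0 < d"
  shows "weight_configuration I n weight_exponents"
  by (rule weight_configuration.intro)
    (use finite_I n_pos weight_exponents_nonempty[OF assms] weight_shift weight_transposition lowering_weight in blast)+

lemma mono_scaled_sum:
  assumes "finite S" "s \<in> D"
  shows "mono (\<lambda>i j. \<Sum>q\<in>S. k q * x q i j) s = (\<Prod>q\<in>S. mono (x q) s powi k q)"
  using assms(1)
proof (induction S rule: finite_induct)
  case (insert q S)
  have sc: "mono (\<lambda>i j. k q * x q i j) s = mono (x q) s powi k q"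
  proof -
    have pp: "(\<Prod>j\<in>J. f j) powi m = (\<Prod>j\<in>J. f j powi m)" if "finite J" for J and f :: "'c \<Rightarrow> complex" and m
      using that by (induction J rule: finite_induct) (auto simp: power_int_mult_distrib)
    show ?thesis unfolding mono_def pp[OF finite_I] pp[OF finite_lessThan]
      by (intro prod.cong refl) (metis power_int_mult mult.commute)
  qed
  have "mono (\<lambda>i j. \<Sum>q\<in>insert q S. k q * x q i j) s = mono (\<lambda>i j. k q * x q i j + (\<Sum>q\<in>S. k q * x q i j)) s"
    using insert.hyps by simp
  also have "\<dots> = mono (x q) s powi k q * (\<Prod>q\<in>S. mono (x q) s powi k q)"
    unfolding mono_add[OF assms(2)] sc insert.IH ..
  finally show ?case using insert.hyps by simp
qed (simp add: mono_zero)

lemma alg_iso_cj: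
  assumes g: "g \<in> carrier H"
  shows "alg_iso (H\<lparr>carrier := D\<rparr>) (H\<lparr>carrier := cj g ` D\<rparr>)"
    and "cj (inv\<^bsub>H\<^esub> g) \<in> alg_hom (H\<lparr>carrier := cj g ` D\<rparr>) (H\<lparr>carrier := D\<rparr>)"
proof -
  interpret group H by (rule group_H)
  have sub: "cj g ` D \<subseteq> carrier H" using cj_inverse(1)[OF g] D_subset by blast
  have bk: "cj (inv\<^bsub>H\<^esub> g) (cj g s) = s" if "s \<in> D" for s using cj_inverse(2)[OF g] that D_subset by blast
  show 2: "cj (inv\<^bsub>H\<^esub> g) \<in> alg_hom (H\<lparr>carrier := cj g ` D\<rparr>) (H\<lparr>carrier := D\<rparr>)"
    by (rule alg_hom_restrict_codomain[OF alg_hom_restrict_domain[OF cj_alg_hom[OF inv_closed[OF g]] sub]])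
      (use bk in auto)
  have 1: "cj g \<in> alg_hom (H\<lparr>carrier := D\<rparr>) (H\<lparr>carrier := cj g ` D\<rparr>)"
    by (rule alg_hom_restrict_codomain[OF alg_hom_restrict_domain[OF cj_alg_hom[OF g] D_subset]]) simp
  show "alg_iso (H\<lparr>carrier := D\<rparr>) (H\<lparr>carrier := cj g ` D\<rparr>)"
    unfolding alg_iso_def by (intro bexI[OF _ 1] bexI[OF _ 2]) (use bk in auto)
qed

text \<open>Degeneracy lives on the given torus and in rationalised characters, the configuration in
  integer exponents on \<open>D\<close>. Conjugation by \<open>g\<close> turns exponents
  \<open>x\<close> into weights \<open>\<xi> x\<close> of the given torus. After clearing
  denominators, a combination that is constant in each factor is a product of powers equal to the
  trivial character.\<close>

theorem nondegenerate_weights: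
  assumes g: "g \<in> carrier H" and nondeg: "nondegenerate H (cj g ` D) d X"
  shows "nondegenerate_configuration I n weight_exponents"
proof -
  interpret H: group H by (rule group_H)
  have d: "0 < d" using nondeg by (simp add: nondegenerate_def)
  interpret W: weight_configuration I n weight_exponents by (rule weight_configuration_weights[OF d])
  define T where "T = cj g ` D"
  define K where "K = H\<lparr>carrier := T\<rparr>"
  have K [simp]: "carrier K = T" "regular K = regular H" "monoid.mult K = monoid.mult H" "monoid.one K = monoid.one H" by (simp_all add: K_def)
  have TH: "T \<subseteq> carrier H" using cj_inverse(1)[OF g] D_subset by (auto simp: T_def)
  have "subgroup T H"
  proof -
    have "group_hom H H (cj g)"
      using cj_alg_hom[OF g] by (intro group_hom.intro group_hom_axioms.intro group_H) (simp add: alg_hom_def)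
    from group_hom.subgroup_img_is_subgroup[OF this subgroup_D] show ?thesis by (simp add: T_def)
  qed
  then have grK: "group K" unfolding K_def by (rule subgroup.subgroup_is_group[OF _ group_H])
  have fa: "function_algebra (regular K)" by simp
  interpret C: char_localization "char_group K"
    by (rule char_localization.intro[OF comm_group_char_group[OF grK fa]])
  have rank: "torus_rank K = r"
    unfolding K_def T_def by (rule torus_rank_eq[OF alg_iso_trans[OF D_split_torus alg_iso_cj(1)[OF g]]])
  define \<iota> where "\<iota> = cj (inv\<^bsub>H\<^esub> g)"
  have \<iota>: "\<iota> \<in> alg_hom K (H\<lparr>carrier := D\<rparr>)" unfolding \<iota>_def K_def T_def by (rule alg_iso_cj(2)[OF g])
  have \<iota>D: "\<iota> t \<in> D" if "t \<in> T" for t using alg_hom_carrier[OF \<iota>] that by simp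
  define \<xi> where "\<xi> = (\<lambda>x. \<lambda>t\<in>T. mono x (\<iota> t))"
  have \<xi>_char: "\<xi> x \<in> carrier (char_group K)" for x
  proof -
    have reg: "(\<lambda>t. mono y (\<iota> t)) \<in> regular_on (regular K) (carrier K)" for y
      by (rule alg_hom_regular[OF \<iota>]) (simp add: mono_regular)
    have inv: "inverse (mono x s) = mono (\<lambda>i j. - x i j) s" if "s \<in> D" for s
    proof -
      have "mono x s * mono (\<lambda>i j. - x i j) s = 1"
        using mono_add[OF that, of x "\<lambda>i j. - x i j"] by (simp add: mono_zero)
      then show ?thesis by (rule inverse_unique)
    qed
    have nz: "mono x s \<noteq> 0" if "s \<in> D" for s
      using D_nonzero[OF that] finite_I by (auto simp: mono_def)
    have mult: "mono x (\<iota> (s \<otimes>\<^bsub>H\<^esub> t)) = mono x (\<iota> s) * mono x (\<iota> t)" if "s \<in> T" "t \<in> T" for s t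
    proof -
      have "\<iota> (s \<otimes>\<^bsub>H\<^esub> t) = \<iota> s \<otimes>\<^bsub>H\<^esub> \<iota> t" using \<iota> that unfolding alg_hom_def by (auto simp: hom_def)
      then show ?thesis using mono_mult \<iota>D that by simp
    qed
    have cl: "s \<otimes>\<^bsub>H\<^esub> t \<in> T" if "s \<in> T" "t \<in> T" for s t using \<open>subgroup T H\<close> that by (rule subgroup.m_closed)
    show ?thesis unfolding carrier_char_group[OF fa]
    proof (intro conjI)
      show "\<xi> x \<in> extensional (carrier K)" by (simp add: \<xi>_def)
      show "\<xi> x \<in> hom K Gm" by (rule homI) (use nz \<iota>D mult cl in \<open>auto simp: \<xi>_def\<close>)
      show "\<xi> x \<in> regular_on (regular K) (carrier K)" by (rule regular_on_cong[OF reg[of x]]) (simp add: \<xi>_def)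
      show "(\<lambda>t. inverse (\<xi> x t)) \<in> regular_on (regular K) (carrier K)"
        by (rule regular_on_cong[OF reg[of "\<lambda>i j. - x i j"]]) (use inv \<iota>D in \<open>simp add: \<xi>_def\<close>)
    qed
  qed
  have \<xi>_weight: "\<xi> x \<in> weights K d X" if x: "x \<in> weight_exponents" for x
  proof -
    obtain v where v: "v \<in> carrier_vec d" "v \<noteq> 0\<^sub>v d" "\<And>h. h \<in> D \<Longrightarrow> X h *\<^sub>v v = mono x h \<cdot>\<^sub>v v"
      using x unfolding weight_exponents_def by blast
    have "X t *\<^sub>v (X g *\<^sub>v v) = \<xi> x t \<cdot>\<^sub>v (X g *\<^sub>v v)" if t: "t \<in> T" for t
    proof -
      have s: "\<iota> t \<in> D" "\<iota> t \<in> carrier H" "t \<in> carrier H" using \<iota>D[OF t] t TH D_subset by auto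
      have "t = cj g (\<iota> t)" unfolding \<iota>_def using cj_inverse(3)[OF g s(3)] by simp
      then have "t \<otimes>\<^bsub>H\<^esub> g = g \<otimes>\<^bsub>H\<^esub> \<iota> t"
        unfolding cj_def using g s by (metis H.inv_solve_right' H.m_closed)
      then have "X t *\<^sub>v (X g *\<^sub>v v) = X g *\<^sub>v (X (\<iota> t) *\<^sub>v v)"
        using X_mult_vec[OF s(3) g v(1)] X_mult_vec[OF g s(2) v(1)] by simp
      also have "\<dots> = mono x (\<iota> t) \<cdot>\<^sub>v (X g *\<^sub>v v)"
        unfolding v(3)[OF s(1)] by (rule mult_mat_vec[OF X_carrier[OF g] v(1)])
      finally show ?thesis using t by (simp add: \<xi>_def)
    qed
    moreover have "X g *\<^sub>v v \<in> carrier_vec d" using X_carrier[OF g] v(1) by simp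
    moreover have "X g *\<^sub>v v \<noteq> 0\<^sub>v d" using X_injective[OF g v(1)] v(2) by blast
    ultimately show ?thesis unfolding weights_def using \<xi>_char by auto
  qed
  show ?thesis
  proof (intro nondegenerate_configuration.intro W.weight_configuration_axioms nondegenerate_configuration_axioms.intro)
    fix N x and c :: "nat \<Rightarrow> rat"
    assume N: "N \<le> W.rank" and xc: "\<forall>q<N. x q \<in> weight_exponents \<and> 0 \<le> c q" and c1: "(\<Sum>q<N. c q) = 1"
      and bal: "\<forall>i\<in>I. \<exists>\<kappa>. \<forall>j<n i. (\<Sum>q<N. c q * of_int (x q i j)) = \<kappa>"
    have N0: "0 < N" using c1 by (cases N) auto
    \<comment> \<open>Degeneracy numbers its points from \<open>1\<close> to \<open>n + 1\<close>,
      so a combination of \<open>N\<close> points bounds it by \<open>N - 1\<close>; hence the shift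
      of indices.\<close>
    define \<xi>' where "\<xi>' = (\<lambda>i. \<xi> (x (i - 1)))"
    define c' where "c' = (\<lambda>i. c (i - 1))"
    have sh: "(\<Sum>i\<in>{1..N}. f (i - 1)) = (\<Sum>q<N. f q)" for f :: "nat \<Rightarrow> rat"
      by (rule sum.reindex_bij_witness[of _ Suc "\<lambda>i. i - 1"]) auto
    obtain M where M: "M > 0" "\<forall>i\<in>{..<N}. \<exists>k::int. c i * of_nat M = of_int k"
      using common_multiple_of_denominators[of "{..<N}" c] by auto
    then obtain k where k: "\<And>q. q < N \<Longrightarrow> c q * of_nat M = of_int (k q)" by (metis lessThan_iff)
    have k0: "0 \<le> k q" if "q < N" for q
    proof -
      have "0 \<le> c q * of_nat M" using xc that by simp
      then show ?thesis unfolding k[OF that] by simp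
    qed
    have const: "(\<Sum>q<N. k q * x q i j) = (\<Sum>q<N. k q * x q i 0)" if i: "i \<in> I" and j: "j < n i" for i j
    proof -
      have e: "of_int (\<Sum>q<N. k q * x q i j) = of_nat M * (\<Sum>q<N. c q * of_int (x q i j))" for j
        unfolding of_int_sum sum_distrib_left using k by (intro sum.cong) (auto simp: mult_ac)
      obtain \<kappa> where \<kappa>: "\<forall>j<n i. (\<Sum>q<N. c q * of_int (x q i j)) = \<kappa>" using bal i by blast
      have "(of_int (\<Sum>q<N. k q * x q i j) :: rat) = of_int (\<Sum>q<N. k q * x q i 0)"
        unfolding e using \<kappa> j n_pos[OF i] by simp
      then show ?thesis by (simp only: of_int_eq_iff)
    qed
    have "(\<Oplus>\<^bsub>rat_chars K\<^esub>i\<in>{1..N}. c' i \<odot>\<^bsub>rat_chars K\<^esub> rat_embed (char_group K) (\<xi>' i)) = \<zero>\<^bsub>rat_chars K\<^esub>"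
      unfolding rat_chars_def
    proof (rule C.rational_combination_zero)
      show "\<xi>' i \<in> carrier (char_group K)" for i by (simp add: \<xi>'_def \<xi>_char)
      show "0 \<le> c' i" if "i \<in> {1..N}" for i using xc that by (auto simp: c'_def)
      show "0 < M" by fact
      show "c' i * of_nat M = of_nat (nat (k (i - 1)))" if "i \<in> {1..N}" for i
      proof -
        have "i - 1 < N" using that by auto
        from k[OF this] k0[OF this] show ?thesis by (simp add: c'_def)
      qed
      show "finprod (char_group K) (\<lambda>i. \<xi>' i [^]\<^bsub>char_group K\<^esub> nat (k (i - 1))) {1..N} = \<one>\<^bsub>char_group K\<^esub>"
        (is "?f = _")
      proof (rule extensionalityI[of _ T])
        have cc: "?f \<in> carrier (char_group K)"
          by (rule C.finprod_closed) (auto simp: \<xi>'_def \<xi>_char)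
        then show "?f \<in> extensional T" using carrier_char_group[OF fa] by simp
        show "\<one>\<^bsub>char_group K\<^esub> \<in> extensional T" by simp
        fix t assume t: "t \<in> T"
        have "?f t = (\<Prod>i\<in>{1..N}. (\<xi>' i [^]\<^bsub>char_group K\<^esub> nat (k (i - 1))) t)"
          by (rule char_group_finprod[OF grK fa]) (use t \<xi>_char in \<open>auto simp: \<xi>'_def\<close>)
        also have "\<dots> = (\<Prod>i\<in>{1..N}. mono (x (i - 1)) (\<iota> t) powi k (i - 1))"
        proof (rule prod.cong[OF refl])
          fix i assume i: "i \<in> {1..N}"
          have "(\<xi>' i [^]\<^bsub>char_group K\<^esub> nat (k (i - 1))) t = \<xi>' i t ^ nat (k (i - 1))"
            by (rule char_group_pow) (use t in simp)
          also have "\<dots> = mono (x (i - 1)) (\<iota> t) powi k (i - 1)"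
          proof -
            have "i - 1 < N" using i by auto
            from k0[OF this] show ?thesis using t by (simp add: \<xi>'_def \<xi>_def power_int_def)
          qed
          finally show "(\<xi>' i [^]\<^bsub>char_group K\<^esub> nat (k (i - 1))) t = mono (x (i - 1)) (\<iota> t) powi k (i - 1)" .
        qed
        also have "\<dots> = (\<Prod>q<N. mono (x q) (\<iota> t) powi k q)"
          by (rule prod.reindex_bij_witness[of _ Suc "\<lambda>i. i - 1"]) auto
        also have "\<dots> = mono (\<lambda>i j. \<Sum>q<N. k q * x q i j) (\<iota> t)"
          by (rule mono_scaled_sum[symmetric]) (use \<iota>D[OF t] in auto)
        also have "\<dots> = mono (\<lambda>i _. \<Sum>q<N. k q * x q i 0) (\<iota> t)" by (rule mono_cong) (rule const)
        also have "\<dots> = 1" by (rule mono_const[OF \<iota>D[OF t]])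
        finally show "?f t = \<one>\<^bsub>char_group K\<^esub> t" using t by simp
      qed
    qed simp
    moreover have "\<forall>i\<in>{1..N}. \<xi>' i \<in> weights K d X \<and> 0 \<le> c' i"
      using xc \<xi>_weight by (auto simp: \<xi>'_def c'_def)
    moreover have "(\<Sum>i\<in>{1..N}. c' i) = 1" unfolding c'_def using sh[of c] c1 by simp
    moreover have "{1..N} = {1..(N - 1) + 1}" using N0 by simp
    ultimately have "degen K d X \<le> N - 1" unfolding degen_def by (intro Least_le) (metis (no_types, lifting))
    moreover have "degen K d X = W.rank"
      using nondeg rank unfolding nondegenerate_def T_def[symmetric] K_def[symmetric] by (simp add: W.rank_def r_def)
    ultimately show False using N N0 by simp
  qed
qed

section \<open>Self-duality\<close>

definition Xd :: "('i \<Rightarrow> complex mat) \<Rightarrow> complex mat" where "Xd = dual_rep H X"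

lemma Xd_carrier: "h \<in> carrier H \<Longrightarrow> Xd h \<in> carrier_mat d d"
  using X_carrier[OF group.inv_closed[OF group_H]] by (simp add: Xd_def dual_rep_def)

lemma Xd_mult: assumes "g \<in> carrier H" "h \<in> carrier H" shows "Xd (g \<otimes>\<^bsub>H\<^esub> h) = Xd g * Xd h"
proof -
  interpret group H by (rule group_H)
  show ?thesis unfolding Xd_def dual_rep_def
    using assms X_mult transpose_mult[OF X_carrier X_carrier] by (simp add: inv_mult_group)
qed

lemma X_inv: assumes "h \<in> carrier H"
  shows "X (inv\<^bsub>H\<^esub> h) = inverse (det (X h)) \<cdot>\<^sub>m adj_mat (X h)" "det (X h) * det (X (inv\<^bsub>H\<^esub> h)) = 1"
proof -
  interpret group H by (rule group_H)
  have A: "X h \<in> carrier_mat d d" and B: "X (inv\<^bsub>H\<^esub> h) \<in> carrier_mat d d" using X_carrier assms by auto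
  have AB: "X h * X (inv\<^bsub>H\<^esub> h) = 1\<^sub>m d" using X_mult[OF assms inv_closed[OF assms]] assms X_one by simp
  show det: "det (X h) * det (X (inv\<^bsub>H\<^esub> h)) = 1" using det_mult[OF A B] unfolding AB by simp
  note adj = adj_mat[OF A]
  have "adj_mat (X h) = adj_mat (X h) * (X h * X (inv\<^bsub>H\<^esub> h))" unfolding AB using adj(1) by simp
  also have "\<dots> = (det (X h) \<cdot>\<^sub>m 1\<^sub>m d) * X (inv\<^bsub>H\<^esub> h)"
    unfolding assoc_mult_mat[OF adj(1) A B, symmetric] adj(3) ..
  also have "\<dots> = det (X h) \<cdot>\<^sub>m X (inv\<^bsub>H\<^esub> h)" using mult_smult_assoc_mat[OF one_carrier_mat B] B by simp
  finally have "adj_mat (X h) = det (X h) \<cdot>\<^sub>m X (inv\<^bsub>H\<^esub> h)" .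
  moreover have "det (X h) \<noteq> 0" using det by auto
  ultimately show "X (inv\<^bsub>H\<^esub> h) = inverse (det (X h)) \<cdot>\<^sub>m adj_mat (X h)"
    using B by (intro eq_matI) auto
qed

lemma Xd_entry_regular:
  assumes "i < d" "j < d"
  shows "(\<lambda>h. Xd h $$ (i,j)) \<in> regular_on (regular H) (carrier H)"
proof (rule regular_on_cong)
  have "(\<lambda>A. inverse (det A)) \<in> regular_on (regular (GL d)) (carrier (GL d))"
    by (rule regular_onI[of "\<lambda>A. inverse (det A)"]) (auto simp: regular_GL intro: generated_algebra.gen)
  from alg_hom_regular[OF X this]
  show "(\<lambda>h. inverse (det (X h)) * adj_mat (X h) $$ (j,i)) \<in> regular_on (regular H) (carrier H)"
    by (intro regular_on_mult regular_on_adj[where m = d] X_entry_regular X_carrier) (use assms in auto)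
  show "inverse (det (X h)) * adj_mat (X h) $$ (j,i) = Xd h $$ (i,j)" if "h \<in> carrier H" for h
    using assms adj_mat(1)[OF X_carrier[OF that]] X_inv(1)[OF that] by (simp add: Xd_def dual_rep_def)
qed

definition VV :: "int \<Rightarrow> ('i \<Rightarrow> complex mat) \<times> complex \<Rightarrow> complex mat" where
  "VV a = sum_rep d (tensor_weight X a) d (tensor_weight (dual_rep H X) (- a))"

lemma VV_eq: "VV a x = four_block_mat ((snd x powi a) \<cdot>\<^sub>m X (fst x)) (0\<^sub>m d d) (0\<^sub>m d d) ((snd x powi (- a)) \<cdot>\<^sub>m Xd (fst x))"
  by (cases x) (simp add: VV_def sum_rep_def tensor_weight_def Xd_def)

lemma VV_carrier: "x \<in> carrier G \<Longrightarrow> VV a x \<in> carrier_mat (d + d) (d + d)"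
  unfolding VV_eq using X_carrier Xd_carrier by (intro four_block_carrier_mat) auto

lemma VV_mult: assumes "x \<in> carrier G" "y \<in> carrier G" shows "VV a (x \<otimes>\<^bsub>G\<^esub> y) = VV a x * VV a y"
proof -
  have c: "X (fst x) \<in> carrier_mat d d" "X (fst y) \<in> carrier_mat d d" "Xd (fst x) \<in> carrier_mat d d" "Xd (fst y) \<in> carrier_mat d d"
    using assms X_carrier Xd_carrier by auto
  have sm: "(k \<cdot>\<^sub>m A) * (l \<cdot>\<^sub>m B) = (k * l) \<cdot>\<^sub>m (A * B)" if "A \<in> carrier_mat d d" "B \<in> carrier_mat d d" for k l :: complex and A B
    using that by (intro eq_matI) (auto simp: scalar_prod_def sum_distrib_left mult_ac)
  have "VV a x * VV a y = four_block_mat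
     (((snd x powi a) \<cdot>\<^sub>m X (fst x)) * ((snd y powi a) \<cdot>\<^sub>m X (fst y))) (0\<^sub>m d d) (0\<^sub>m d d)
     (((snd x powi (- a)) \<cdot>\<^sub>m Xd (fst x)) * ((snd y powi (- a)) \<cdot>\<^sub>m Xd (fst y)))"
    unfolding VV_eq by (subst mult_four_block_mat[of _ d d _ d _ d _ _ d _ d]) (use c in auto)
  also have "\<dots> = VV a (x \<otimes>\<^bsub>G\<^esub> y)"
    unfolding VV_eq sm[OF c(1,2)] sm[OF c(3,4)] using assms X_mult Xd_mult
    by (auto simp: power_int_mult_distrib)
  finally show ?thesis ..
qed

text \<open>The two blocks have mutually inverse determinants. Besides invertibility this shows that
  the inverse determinant, one of the generators of the coordinate ring of \<open>GL\<close>, pulls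
  back to a constant.\<close>

lemma det_VV: assumes "x \<in> carrier G" shows "det (VV a x) = 1"
proof -
  have c: "X (fst x) \<in> carrier_mat d d" "Xd (fst x) \<in> carrier_mat d d" "fst x \<in> carrier H" "snd x \<noteq> 0"
    using assms X_carrier Xd_carrier by auto
  have "det (VV a x) = det ((snd x powi a) \<cdot>\<^sub>m X (fst x)) * det ((snd x powi (- a)) \<cdot>\<^sub>m Xd (fst x))"
    unfolding VV_eq by (rule det_four_block_mat_lower_left_zero[of _ d _ d]) (use c in auto)
  also have "\<dots> = (snd x powi a * snd x powi (- a)) ^ d * (det (X (fst x)) * det (Xd (fst x)))"
    using c by (simp add: power_mult_distrib)
  also have "det (Xd (fst x)) = det (X (inv\<^bsub>H\<^esub> (fst x)))"
    unfolding Xd_def dual_rep_def by (rule det_transpose[OF X_carrier]) (use c group.inv_closed[OF group_H] in auto)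
  also have "det (X (fst x)) * det (X (inv\<^bsub>H\<^esub> (fst x))) = 1" by (rule X_inv(2)[OF c(3)])
  also have "snd x powi a * snd x powi (- a) = 1" using c(4) by (simp add: power_int_minus)
  finally show ?thesis by simp
qed

lemma rep_dims:
  assumes "h \<in> carrier H"
  shows "dim_row (X h) = d" "dim_col (X h) = d" "dim_row (Xd h) = d" "dim_col (Xd h) = d"
  using X_carrier[OF assms] Xd_carrier[OF assms] by auto

lemma rational_VV: "rational_rep G (d + d) (VV a)"
  unfolding rational_rep_def
proof (rule alg_homI[OF _ regular_GL])
  show "VV a \<in> hom G (GL (d + d))"
    by (rule homI) (use VV_carrier det_VV VV_mult in auto)
  fix s :: "complex mat \<Rightarrow> complex" assume "s \<in> insert (\<lambda>A. inverse (det A)) {\<lambda>A. A $$ (i, j) | i j. i < d + d \<and> j < d + d}"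
  then consider "s = (\<lambda>A. inverse (det A))" | i j where "s = (\<lambda>A. A $$ (i,j))" "i < d + d" "j < d + d" by blast
  then show "(\<lambda>x. s (VV a x)) \<in> regular_on (regular G) (carrier G)"
  proof cases
    case 1
    show ?thesis by (rule regular_on_cong[OF regular_on_const[of _ 1]]) (use det_VV 1 in auto)
  next
    case 2
    have f: "(\<lambda>x. \<phi> (fst x)) \<in> regular_on (regular G) (carrier G)"
      if "\<phi> \<in> regular_on (regular H) (carrier H)" for \<phi>
      unfolding G_def by (rule alg_hom_regular[OF fst_alg_hom that])
    have z: "(\<lambda>x. snd x powi m) \<in> regular_on (regular G) (carrier G)" for m
      unfolding G_def by (rule alg_hom_regular[OF snd_alg_hom Gm_powi_regular])
    consider "i < d" "j < d" | "i < d" "d \<le> j" | "d \<le> i" "j < d" | "d \<le> i" "d \<le> j" by linarith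
    then show ?thesis
    proof cases
      case 1
      have "(\<lambda>x. snd x powi a * X (fst x) $$ (i,j)) \<in> regular_on (regular G) (carrier G)"
        by (rule regular_on_mult[OF _ z f[OF X_entry_regular[OF 1]]]) simp
      then show ?thesis by (rule regular_on_cong) (use 1 2 rep_dims in \<open>auto simp: VV_eq\<close>)
    next
      case 4
      have "(\<lambda>x. snd x powi (- a) * Xd (fst x) $$ (i - d, j - d)) \<in> regular_on (regular G) (carrier G)"
        by (rule regular_on_mult[OF _ z f[OF Xd_entry_regular]]) (use 2 4 in auto)
      then show ?thesis by (rule regular_on_cong) (use 4 2 rep_dims in \<open>auto simp: VV_eq\<close>)
    next
      case 2
      then show ?thesis
        by (intro regular_on_cong[OF regular_on_const[of _ 0]])
          (use \<open>s = _\<close> \<open>j < d + d\<close> rep_dims in \<open>auto simp: VV_eq\<close>)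
    next
      case 3
      then show ?thesis
        by (intro regular_on_cong[OF regular_on_const[of _ 0]])
          (use \<open>s = _\<close> \<open>i < d + d\<close> rep_dims in \<open>auto simp: VV_eq\<close>)
    qed
  qed
qed simp

text \<open>Dualising exchanges the two summands, so the matrix \<open>Q\<close> that swaps the
  blocks is an isomorphism.\<close>

theorem self_dual_VV: "self_dual_rep G (d + d) (VV a)"
  unfolding self_dual_rep_def rep_iso_def
proof (intro conjI rational_VV)
  define Q where "Q = four_block_mat (0\<^sub>m d d) (1\<^sub>m d) (1\<^sub>m d) (0\<^sub>m d d :: complex mat)"
  have Qc: "Q \<in> carrier_mat (d + d) (d + d)" unfolding Q_def by (rule four_block_carrier_mat) auto
  have "Q * Q = 1\<^sub>m (d + d)"
    unfolding Q_def by (subst mult_four_block_mat[of _ d d _ d _ d _ _ d _ d]) auto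
  then have "det Q * det Q = 1" using det_mult[OF Qc Qc] by simp
  then have "Q \<in> carrier (GL (d + d))" using Qc by auto
  moreover have "Q * VV a x = dual_rep G (VV a) x * Q" if x: "x \<in> carrier G" for x
  proof -
    interpret H: group H by (rule group_H)
    have xH: "fst x \<in> carrier H" "snd x \<noteq> 0" using x by auto
    have c: "X (fst x) \<in> carrier_mat d d" "X (inv\<^bsub>H\<^esub> (fst x)) \<in> carrier_mat d d" "Xd (fst x) \<in> carrier_mat d d"
      "Xd (inv\<^bsub>H\<^esub> (fst x)) \<in> carrier_mat d d"
      using xH X_carrier Xd_carrier by auto
    have t: "transpose_mat (k \<cdot>\<^sub>m A) = k \<cdot>\<^sub>m transpose_mat A" for k :: complex and A by (rule eq_matI) auto
    have tX: "transpose_mat (X (inv\<^bsub>H\<^esub> (fst x))) = Xd (fst x)" by (simp add: Xd_def dual_rep_def)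
    have tXd: "transpose_mat (Xd (inv\<^bsub>H\<^esub> (fst x))) = X (fst x)" using xH by (simp add: Xd_def dual_rep_def)
    have p: "inverse (snd x) powi a = snd x powi (- a)" "inverse (snd x) powi (- a) = snd x powi a"
      by (simp_all add: power_int_minus power_int_inverse)
    have "dual_rep G (VV a) x = four_block_mat ((snd x powi (- a)) \<cdot>\<^sub>m Xd (fst x)) (0\<^sub>m d d) (0\<^sub>m d d) ((snd x powi a) \<cdot>\<^sub>m X (fst x))"
      unfolding dual_rep_def VV_eq inv_G[OF x] fst_conv snd_conv p
      by (subst transpose_four_block_mat[of _ d d _ d _ d]) (use c in \<open>auto simp: t tX tXd\<close>)
    also have "\<dots> * Q = four_block_mat (0\<^sub>m d d) ((snd x powi (- a)) \<cdot>\<^sub>m Xd (fst x)) ((snd x powi a) \<cdot>\<^sub>m X (fst x)) (0\<^sub>m d d)"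
      unfolding Q_def by (subst mult_four_block_mat[of _ d d _ d _ d _ _ d _ d]) (use c in auto)
    also have "\<dots> = Q * VV a x"
      unfolding Q_def VV_eq by (subst mult_four_block_mat[of _ d d _ d _ d _ _ d _ d]) (use c in auto)
    finally show ?thesis ..
  qed
  ultimately show "\<exists>P\<in>carrier (GL (d + d)). \<forall>g\<in>carrier G. P * VV a g = dual_rep G (VV a) g * P" by blast
qed

end

section \<open>One-parameter subgroups\<close>

text \<open>The value at \<open>2\<close> is enough, since powers of two with different exponents
  have different norms.\<close>

lemma powi_eqD:
  assumes "\<And>t::complex. t \<noteq> 0 \<Longrightarrow> t powi k = t powi l"
  shows "k = l"
proof (rule ccontr)
  assume "k \<noteq> l"
  have "norm (2 powi k :: complex) = norm (2 powi l :: complex)" using assms[of 2] by simp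
  then have e: "(2::real) powi k = 2 powi l" by (simp add: norm_power_int)
  have less: "(2::real) powi p < 2 powi q" if "p < q" for p q by (rule power_int_strict_increasing[OF that]) simp
  from \<open>k \<noteq> l\<close> have "k < l \<or> l < k" by linarith
  then show False using less e by (metis less_irrefl)
qed

lemma powi_sum:
  assumes "(t::complex) \<noteq> 0"
  shows "t powi (\<Sum>j\<in>J. f j) = (\<Prod>j\<in>J. t powi f j)"
  by (induction J rule: infinite_finite_induct) (use assms in \<open>auto simp: power_int_add\<close>)

text \<open>For negative \<open>e\<close>, multiplication by \<open>t ^ nat (- e)\<close> would
  produce the nonzero constant \<open>c\<close>, while the limit of the product is zero.\<close>

lemma powi_limit:
  assumes l: "((\<lambda>t::complex. t powi e * c) \<longlongrightarrow> l) (at 0)" and c: "c \<noteq> 0"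
  shows "0 \<le> e"
proof (rule ccontr)
  assume "\<not> 0 \<le> e"
  define m where "m = nat (- e)"
  have m: "0 < m" using \<open>\<not> 0 \<le> e\<close> by (simp add: m_def)
  have "((\<lambda>t::complex. (t powi e * c) * t ^ m) \<longlongrightarrow> l * 0 ^ m) (at 0)"
    by (intro tendsto_mult l tendsto_power tendsto_ident_at)
  moreover have "((\<lambda>t::complex. (t powi e * c) * t ^ m) \<longlongrightarrow> c) (at 0)"
  proof (rule tendsto_eventually)
    have "(t powi e * c) * t ^ m = c" if "t \<noteq> 0" for t :: complex
      using that \<open>\<not> 0 \<le> e\<close> by (simp add: m_def power_int_def field_simps)
    then show "\<forall>\<^sub>F t in at (0::complex). (t powi e * c) * t ^ m = c"
      by (rule eventually_mono[OF eventually_neq_at_within])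
  qed
  ultimately have "l * 0 ^ m = c" by (rule LIM_unique)
  then show False using c zero_power[OF m, where 'a = complex] by simp
qed

text \<open>The endomorphism is a character and, being regular, a Laurent polynomial. If it were not
  one of the powers, its expansion would contradict the independence of characters.\<close>

lemma Gm_endomorphism:
  assumes f: "f \<in> alg_hom Gm Gm"
  shows "\<exists>k. \<forall>t. t \<noteq> 0 \<longrightarrow> f t = t powi k"
proof -
  define P where "P = range (\<lambda>k. \<lambda>z\<in>-{0::complex}. z powi k)"
  have PI: "(\<lambda>z\<in>-{0::complex}. z powi k) \<in> P" for k unfolding P_def by (rule rangeI)
  let ?f = "restrict f (-{0})"
  have f_hom: "f \<in> hom Gm Gm" using f by (simp add: alg_hom_def)
  have f1: "f 1 = 1" using hom_one[OF f_hom group_Gm group_Gm] by simp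
  have fm: "f (x * y) = f x * f y" if "x \<noteq> 0" "y \<noteq> 0" for x y
    using f_hom that unfolding hom_def by auto
  interpret F: char_family Gm "insert ?f P"
  proof (rule char_family.intro)
    show "monoid Gm" using group_Gm by (rule group.is_monoid)
    show "\<chi> \<in> extensional (carrier Gm)" if "\<chi> \<in> insert ?f P" for \<chi> using that by (auto simp: P_def)
    show "\<chi> \<one>\<^bsub>Gm\<^esub> = 1" if "\<chi> \<in> insert ?f P" for \<chi> using that f1 by (auto simp: P_def)
    show "\<chi> (x \<otimes>\<^bsub>Gm\<^esub> y) = \<chi> x * \<chi> y" if "\<chi> \<in> insert ?f P" "x \<in> carrier Gm" "y \<in> carrier Gm" for \<chi> x y
      using that fm by (auto simp: P_def power_int_mult_distrib)
  qed
  have cl: "char_closed (-{0}) P"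
    unfolding char_closed_def
  proof (intro conjI ballI)
    show "\<exists>\<chi>\<in>P. \<forall>x\<in>-{0}. \<chi> x = 1" by (rule bexI[OF _ PI[of 0]]) simp
    fix \<chi> \<psi> assume "\<chi> \<in> P" "\<psi> \<in> P"
    then obtain k l where kl: "\<chi> = (\<lambda>z\<in>-{0}. z powi k)" "\<psi> = (\<lambda>z\<in>-{0}. z powi l)" unfolding P_def by auto
    show "\<exists>\<omega>\<in>P. \<forall>x\<in>-{0}. \<omega> x = \<chi> x * \<psi> x"
      by (rule bexI[OF _ PI[of "k + l"]]) (simp add: kl power_int_add)
  qed
  obtain \<psi> where \<psi>: "\<psi> \<in> regular Gm" "\<forall>z\<in>-{0}. \<psi> z = f z"
    using alg_hom_regular[OF f Gm_regular(1)] unfolding regular_on_def by auto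
  have "finite_comb (-{0}) P (\<lambda>z. \<psi> z)"
  proof (rule finite_comb_generated[OF _ cl, where f = \<psi> and h = "\<lambda>z. z"])
    show "\<psi> \<in> generated_algebra {\<lambda>z. z, inverse}" using \<psi>(1) by simp
    fix s :: "complex \<Rightarrow> complex" assume "s \<in> {\<lambda>z. z, inverse}"
    then consider "s = (\<lambda>z. z)" | "s = inverse" by blast
    then show "finite_comb (-{0}) P (\<lambda>z. s z)"
    proof cases
      case 1
      show ?thesis by (rule finite_comb_char[OF PI[of 1]]) (simp add: 1)
    next
      case 2
      show ?thesis by (rule finite_comb_char[OF PI[of "-1"]]) (simp add: 2 power_int_minus)
    qed
  qed
  then obtain F c where F: "finite F" "F \<subseteq> P" "\<forall>z\<in>-{0}. \<psi> z = (\<Sum>\<chi>\<in>F. c \<chi> * \<chi> z)"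
    unfolding finite_comb_def by blast
  have "?f \<in> P"
  proof (rule ccontr)
    assume nP: "?f \<notin> P"
    define c' where "c' = (\<lambda>\<chi>. if \<chi> = ?f then -1 else c \<chi>)"
    have "c' ?f = 0"
    proof (rule F.characters_independent[of "insert ?f F" c' "?f"])
      show "finite (insert ?f F)" "insert ?f F \<subseteq> insert ?f P" using F by auto
      fix z assume z: "z \<in> carrier Gm"
      have "(\<Sum>\<chi>\<in>F. c' \<chi> * \<chi> z) = (\<Sum>\<chi>\<in>F. c \<chi> * \<chi> z)"
        using nP F(2) by (intro sum.cong) (auto simp: c'_def)
      also have "\<dots> = f z" using F(3) \<psi>(2) z by simp
      finally have "(\<Sum>\<chi>\<in>F. c' \<chi> * \<chi> z) = f z" .
      moreover have "?f \<notin> F" using nP F(2) by blast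
      ultimately show "(\<Sum>\<chi>\<in>insert ?f F. c' \<chi> * \<chi> z) = 0" using F(1) z by (simp add: c'_def)
    qed simp
    then show False by (simp add: c'_def)
  qed
  then obtain k where k: "?f = (\<lambda>z\<in>-{0}. z powi k)" unfolding P_def by blast
  have "f t = t powi k" if "t \<noteq> 0" for t using fun_cong[OF k, of t] that by simp
  then show ?thesis by blast
qed

lemma Gm_powi_alg_hom: "(\<lambda>t. t powi k) \<in> alg_hom Gm Gm"
proof (rule alg_homI[OF _ Gm_simps(4)])
  show "(\<lambda>t. t powi k) \<in> hom Gm Gm" by (rule homI) (auto simp: power_int_mult_distrib)
  fix s :: "complex \<Rightarrow> complex" assume "s \<in> {\<lambda>z. z, inverse}"
  then consider "s = (\<lambda>z. z)" | "s = inverse" by blast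
  then show "(\<lambda>x. s (x powi k)) \<in> regular_on (regular Gm) (carrier Gm)"
  proof cases
    case 1
    then show ?thesis using Gm_powi_regular by simp
  next
    case 2
    show ?thesis by (rule regular_on_cong[OF Gm_powi_regular[of "-k"]]) (simp add: 2 power_int_minus)
  qed
qed (rule function_algebras(3))

section \<open>Finite sets have dimension zero\<close>

lemma zariski_closed_zero_set:
  assumes "f \<in> regular_on (regular K) (carrier K)"
  shows "zariski_closed K {w \<in> carrier K. f w = 0}"
proof -
  obtain \<psi> where \<psi>: "\<psi> \<in> regular K" "\<forall>w\<in>carrier K. \<psi> w = f w" using assms unfolding regular_on_def by auto
  show ?thesis unfolding zariski_closed_def by (rule exI[of _ "{\<psi>}"]) (use \<psi> in auto)
qed

text \<open>Two points of a finite irreducible closed set would be separated by a regular function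
  \<open>\<phi>\<close>. The level set of \<open>\<phi>\<close> through one of them and the zeros of
  the product of the equations for its other values would then cover the set by two closed sets
  neither of which contains it.\<close>

lemma alg_dim_finite:
  assumes R: "function_algebra (regular K)" and Z: "finite Z"
    and sep: "\<And>x y. x \<in> carrier K \<Longrightarrow> y \<in> carrier K \<Longrightarrow> x \<noteq> y \<Longrightarrow> \<exists>\<phi>\<in>regular K. \<phi> x \<noteq> \<phi> y"
  shows "alg_dim K Z = 0"
proof -
  have dim0: "m = 0" if C: "\<forall>i\<le>m. irreducible_closed K (C i) \<and> C i \<subseteq> Z" "\<forall>i<m. C i \<subset> C (Suc i)" for m and C :: "nat \<Rightarrow> 'a set"
  proof (rule ccontr)
    assume "m \<noteq> 0"
    then have irr: "irreducible_closed K (C 0)" "irreducible_closed K (C 1)" "C 1 \<subseteq> Z" "C 0 \<subset> C 1" using C by auto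
    have "C 0 \<noteq> {}" using irr(1) by (simp add: irreducible_closed_def)
    then obtain x y where xy: "x \<in> C 0" "y \<in> C 1" "x \<noteq> y" "x \<in> C 1" using irr(4) by blast
    have "zariski_closed K (C 1)" using irr(2) by (simp add: irreducible_closed_def)
    then have sub: "C 1 \<subseteq> carrier K" unfolding zariski_closed_def by auto
    obtain \<phi> where \<phi>: "\<phi> \<in> regular K" "\<phi> x \<noteq> \<phi> y" using sep[of x y] xy sub by blast
    have fin: "finite (C 1)" using finite_subset[OF irr(3) Z] .
    have reg: "(\<lambda>w. \<phi> w + c) \<in> regular_on (regular K) (carrier K)" for c
      by (rule regular_on_add[OF R regular_onI[OF \<phi>(1)] regular_on_const[OF R]]) simp
    define Z1 where "Z1 = {w \<in> carrier K. \<phi> w + (- \<phi> x) = 0}"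
    define Z2 where "Z2 = {w \<in> carrier K. (\<Prod>c\<in>\<phi> ` C 1 - {\<phi> x}. \<phi> w + (- c)) = 0}"
    have "zariski_closed K Z1" unfolding Z1_def by (rule zariski_closed_zero_set[OF reg])
    moreover have "zariski_closed K Z2"
      unfolding Z2_def by (rule zariski_closed_zero_set[OF regular_on_prod[OF R reg]])
    moreover have "C 1 \<subseteq> Z1 \<union> Z2"
    proof
      fix w assume w: "w \<in> C 1"
      show "w \<in> Z1 \<union> Z2"
      proof (cases "\<phi> w = \<phi> x")
        case False
        then have "(\<Prod>c\<in>\<phi> ` C 1 - {\<phi> x}. \<phi> w + (- c)) = 0"
          using fin w by (intro prod_zero) auto
        then show ?thesis using w sub unfolding Z2_def by blast
      qed (use w sub in \<open>auto simp: Z1_def\<close>)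
    qed
    ultimately have "C 1 \<subseteq> Z1 \<or> C 1 \<subseteq> Z2" using irr(2) by (simp add: irreducible_closed_def)
    moreover have "y \<notin> Z1" using \<phi>(2) by (auto simp: Z1_def)
    moreover have "x \<notin> Z2" using fin by (auto simp: Z2_def)
    ultimately show False using xy by blast
  qed
  have "alg_dim K Z \<le> 0"
    unfolding alg_dim_def
  proof (rule Sup_least, elim CollectE exE conjE)
    fix e m and C :: "nat \<Rightarrow> 'a set"
    assume "e = enat m" "\<forall>i\<le>m. irreducible_closed K (C i) \<and> C i \<subseteq> Z" "\<forall>i<m. C i \<subset> C (Suc i)"
    then show "e \<le> 0" using dim0[of m C] by (simp add: enat_0)
  qed
  then show ?thesis by simp
qed

context sl_product
begin

lemma G_separates_points:
  assumes "x \<in> carrier G" "y \<in> carrier G" "x \<noteq> y"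
  shows "\<exists>\<phi>\<in>regular G. \<phi> x \<noteq> \<phi> y"
proof (cases "snd x = snd y")
  case False
  have "(\<lambda>x. (\<lambda>z. z) (snd x)) \<in> regular G"
    unfolding G_def regular_alg_dirprod by (rule generated_algebra.gen) (auto intro: generated_algebra.gen)
  then show ?thesis using False by (intro bexI[of _ snd]) auto
next
  case True
  then have ne: "fst x \<noteq> fst y" using assms(3) by (simp add: prod_eq_iff)
  have c: "fst x \<in> carrier H" "fst y \<in> carrier H" using assms by auto
  have "\<exists>i\<in>I. \<exists>j<n i. \<exists>k<n i. fst x i $$ (j,k) \<noteq> fst y i $$ (j,k)"
  proof (rule ccontr)
    assume *: "\<not> ?thesis"
    have "fst x = fst y"
    proof (rule extensionalityI[of _ I])
      fix i assume i: "i \<in> I"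
      have "fst x i \<in> carrier_mat (n i) (n i)" "fst y i \<in> carrier_mat (n i) (n i)" using c i unfolding carrier_H by auto
      then show "fst x i = fst y i" using * i by (intro eq_matI) auto
    qed (use c in \<open>auto simp: carrier_H\<close>)
    then show False using ne by simp
  qed
  then obtain i j k where ijk: "i \<in> I" "j < n i" "k < n i" "fst x i $$ (j,k) \<noteq> fst y i $$ (j,k)" by blast
  have "(\<lambda>x. (\<lambda>h. h i $$ (j,k)) (fst x)) \<in> regular G"
    unfolding G_def regular_alg_dirprod by (rule generated_algebra.gen) (use H_entry_in_regular[OF ijk(1-3)] in auto)
  then show ?thesis using ijk(4) by (intro bexI) auto
qed

text \<open>With \<open>u\<close> summing to zero in each factor, these are the one-parameter
  subgroups of the product of \<open>D\<close> and \<open>Gm\<close>.\<close>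

definition psub :: "('i \<Rightarrow> nat \<Rightarrow> int) \<Rightarrow> int \<Rightarrow> complex \<Rightarrow> ('i \<Rightarrow> complex mat) \<times> complex" where
  "psub u k t = (diag (\<lambda>i j. t powi u i j), t powi k)"

lemma psub_in:
  assumes "\<forall>i\<in>I. (\<Sum>j<n i. u i j) = 0" "t \<noteq> 0"
  shows "diag (\<lambda>i j. t powi u i j) \<in> D" "psub u k t \<in> D \<times> (-{0})"
proof -
  show "diag (\<lambda>i j. t powi u i j) \<in> D"
    by (rule diag_in_D) (use assms in \<open>simp add: powi_sum[symmetric]\<close>)
  then show "psub u k t \<in> D \<times> (-{0})" using assms(2) by (simp add: psub_def)
qed

lemma mono_psub:
  assumes "t \<noteq> 0"
  shows "mono x (diag (\<lambda>i j. t powi u i j)) = t powi (\<Sum>i\<in>I. \<Sum>j<n i. u i j * x i j)"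
  unfolding mono_def powi_sum[OF assms]
  by (intro prod.cong refl) (simp add: diag_entry power_int_mult)

lemma psub_alg_hom:
  assumes u: "\<forall>i\<in>I. (\<Sum>j<n i. u i j) = 0"
  shows "psub u k \<in> alg_hom Gm G"
proof -
  have "(\<lambda>t. diag (\<lambda>i j. t powi u i j)) \<in> alg_hom Gm H"
  proof (rule hom_into_H)
    show "(\<lambda>t. diag (\<lambda>i j. t powi u i j)) \<in> hom Gm H"
      by (rule homI) (use psub_in(1)[OF u] D_subset in \<open>auto simp: diag_mult power_int_mult_distrib\<close>)
    fix i j k assume ijk: "i \<in> I" "j < n i" "k < n i"
    show "(\<lambda>t. diag (\<lambda>i j. t powi u i j) i $$ (j,k)) \<in> regular_on (regular Gm) (carrier Gm)"
    proof (cases "j = k")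
      case True
      show ?thesis by (rule regular_on_cong[OF Gm_powi_regular[of "u i j"]]) (use ijk True in \<open>simp add: diag_entry\<close>)
    next
      case False
      show ?thesis by (rule regular_on_cong[OF regular_on_const[OF function_algebras(3), of 0]]) (use ijk False in \<open>auto simp: diag_entry\<close>)
    qed
  qed (rule function_algebras(3))
  from alg_hom_pair[OF this Gm_powi_alg_hom[of k] function_algebras(3)] show ?thesis by (simp add: psub_def[abs_def] G_def)
qed

lemma D_entry_alg_hom:
  assumes "i \<in> I" "j < n i"
  shows "(\<lambda>s. s i $$ (j,j)) \<in> alg_hom (H\<lparr>carrier := D\<rparr>) Gm"
proof (rule alg_homI[OF _ Gm_simps(4)])
  show "(\<lambda>s. s i $$ (j,j)) \<in> hom (H\<lparr>carrier := D\<rparr>) Gm"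
    by (rule homI) (use assms D_nonzero D_mult_entry in auto)
  fix s :: "complex \<Rightarrow> complex" assume "s \<in> {\<lambda>z. z, inverse}"
  then show "(\<lambda>x. s (x i $$ (j,j))) \<in> regular_on (regular (H\<lparr>carrier := D\<rparr>)) (carrier (H\<lparr>carrier := D\<rparr>))"
    using H_entry_regular[OF assms assms(2) D_subset] D_inverse_entry_regular[OF assms] by auto
qed simp

lemma one_parameter_subgroup_D:
  assumes \<sigma>: "\<sigma> \<in> alg_hom Gm (H\<lparr>carrier := D\<rparr>)"
  shows "\<exists>u. (\<forall>i\<in>I. (\<Sum>j<n i. u i j) = 0) \<and> (\<forall>t. t \<noteq> 0 \<longrightarrow> \<sigma> t = diag (\<lambda>i j. t powi u i j))"
proof -
  have "\<forall>i j. \<exists>k. i \<in> I \<longrightarrow> j < n i \<longrightarrow> (\<forall>t. t \<noteq> 0 \<longrightarrow> \<sigma> t i $$ (j,j) = t powi k)"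
    using Gm_endomorphism[OF alg_hom_comp[OF \<sigma> D_entry_alg_hom]] by blast
  then obtain u where u: "\<And>i j t. i \<in> I \<Longrightarrow> j < n i \<Longrightarrow> t \<noteq> 0 \<Longrightarrow> \<sigma> t i $$ (j,j) = t powi u i j" by metis
  have \<sigma>D: "\<sigma> t \<in> D" if "t \<noteq> 0" for t using alg_hom_carrier[OF \<sigma>, of t] that by simp
  have sum0: "(\<Sum>j<n i. u i j) = 0" if i: "i \<in> I" for i
  proof (rule powi_eqD)
    fix t :: complex assume t: "t \<noteq> 0"
    have "t powi (\<Sum>j<n i. u i j) = (\<Prod>j<n i. \<sigma> t i $$ (j,j))" using u[OF i _ t] by (simp add: powi_sum[OF t])
    also have "\<dots> = 1" by (rule D_prod[OF \<sigma>D[OF t] i])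
    finally show "t powi (\<Sum>j<n i. u i j) = t powi 0" by simp
  qed
  have "\<sigma> t = diag (\<lambda>i j. t powi u i j)" if t: "t \<noteq> 0" for t
    by (rule D_ext[OF \<sigma>D[OF t] psub_in(1)[OF _ t]]) (use sum0 u t in \<open>auto simp: diag_entry\<close>)
  then show ?thesis using sum0 by blast
qed

end

section \<open>Stability of vectors\<close>

context sl_rep
begin

text \<open>The projections commute with the torus and cut out its eigenspaces; their transposes do
  so for the dual representation, with inverse characters.\<close>

lemma isotypic_apply:
  assumes iso: "chars.isotypic X d F P" and \<chi>: "\<chi> \<in> F" and s: "s \<in> D" and y: "y \<in> carrier_vec d"
  shows "P \<chi> *\<^sub>v (X s *\<^sub>v y) = \<chi> s \<cdot>\<^sub>v (P \<chi> *\<^sub>v y)"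
    and "transpose_mat (P \<chi>) *\<^sub>v (Xd s *\<^sub>v y) = inverse (\<chi> s) \<cdot>\<^sub>v (transpose_mat (P \<chi>) *\<^sub>v y)"
proof -
  note FP = chars.isotypicD[OF iso, simplified]
  have sm: "(k \<cdot>\<^sub>m A) *\<^sub>v y = k \<cdot>\<^sub>v (A *\<^sub>v y)" if "A \<in> carrier_mat d d" for k :: complex and A
    using that y by (intro eq_vecI) (auto simp: scalar_prod_def sum_distrib_left mult_ac)
  have Pc: "P \<chi> \<in> carrier_mat d d" by (rule FP(3)[OF \<chi>])
  have Xc: "X s \<in> carrier_mat d d" if "s \<in> D" for s using that D_subset X_carrier by auto
  have "P \<chi> *\<^sub>v (X s *\<^sub>v y) = (P \<chi> * X s) *\<^sub>v y" using assoc_mult_mat_vec[OF Pc Xc[OF s] y] by simp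
  also have "P \<chi> * X s = \<chi> s \<cdot>\<^sub>m P \<chi>" by (rule chars.isotypic_eigen(2)[OF iso _ Xc[OF s] \<chi>]) (use s in simp)
  finally show "P \<chi> *\<^sub>v (X s *\<^sub>v y) = \<chi> s \<cdot>\<^sub>v (P \<chi> *\<^sub>v y)" using sm[OF Pc] by simp
  have si: "inv\<^bsub>H\<^esub> s \<in> D" using subgroup.m_inv_closed[OF subgroup_D s] .
  obtain e where e: "\<chi> = restrict (mono e) D" using FP(2) \<chi> unfolding monomials_def by auto
  have "\<chi> s * \<chi> (inv\<^bsub>H\<^esub> s) = 1"
  proof -
    interpret group H by (rule group_H)
    have "s \<otimes>\<^bsub>H\<^esub> inv\<^bsub>H\<^esub> s = \<one>\<^bsub>H\<^esub>" using s D_subset by (auto intro: r_inv)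
    then show ?thesis using mono_mult[OF s si, of e] s si by (simp add: e mono_one)
  qed
  then have inv: "\<chi> (inv\<^bsub>H\<^esub> s) = inverse (\<chi> s)" by (metis inverse_unique)
  have tc: "transpose_mat (P \<chi>) \<in> carrier_mat d d" "Xd s \<in> carrier_mat d d"
    using Pc Xd_carrier s D_subset by auto
  have "transpose_mat (P \<chi>) *\<^sub>v (Xd s *\<^sub>v y) = (transpose_mat (P \<chi>) * Xd s) *\<^sub>v y"
    using assoc_mult_mat_vec[OF tc y] by simp
  also have "transpose_mat (P \<chi>) * Xd s = transpose_mat (X (inv\<^bsub>H\<^esub> s) * P \<chi>)"
    unfolding Xd_def dual_rep_def using transpose_mult[OF Xc[OF si] Pc] by simp
  also have "X (inv\<^bsub>H\<^esub> s) * P \<chi> = \<chi> (inv\<^bsub>H\<^esub> s) \<cdot>\<^sub>m P \<chi>"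
    by (rule chars.isotypic_eigen(1)[OF iso _ Xc[OF si] \<chi>]) (use si in simp)
  also have "transpose_mat (\<chi> (inv\<^bsub>H\<^esub> s) \<cdot>\<^sub>m P \<chi>) = inverse (\<chi> s) \<cdot>\<^sub>m transpose_mat (P \<chi>)"
    unfolding inv by (rule eq_matI) auto
  finally show "transpose_mat (P \<chi>) *\<^sub>v (Xd s *\<^sub>v y) = inverse (\<chi> s) \<cdot>\<^sub>v (transpose_mat (P \<chi>) *\<^sub>v y)"
    using sm[OF tc(1)] by simp
qed

lemma VV_append:
  assumes "x \<in> carrier G" "y \<in> carrier_vec d" "w \<in> carrier_vec d"
  shows "VV a x *\<^sub>v (y @\<^sub>v w) = (snd x powi a \<cdot>\<^sub>v (X (fst x) *\<^sub>v y)) @\<^sub>v (snd x powi (- a) \<cdot>\<^sub>v (Xd (fst x) *\<^sub>v w))"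
proof -
  have c: "X (fst x) \<in> carrier_mat d d" "Xd (fst x) \<in> carrier_mat d d" using assms(1) X_carrier Xd_carrier by auto
  have sm: "(k \<cdot>\<^sub>m A) *\<^sub>v y = k \<cdot>\<^sub>v (A *\<^sub>v y)" if "A \<in> carrier_mat d d" "y \<in> carrier_vec d" for k :: complex and A y
    using that by (intro eq_vecI) (auto simp: scalar_prod_def sum_distrib_left mult_ac)
  show ?thesis unfolding VV_eq
    by (subst mult_mat_vec_split) (use c assms sm in auto)
qed

text \<open>The vector has a nonzero component for every weight of \<open>X\<close> and no dual
  part. If the limit along \<open>psub u k\<close> exists, it exists in each component, so the
  pairing of \<open>u\<close> with every weight plus \<open>a * k\<close> is nonnegative;
  \<open>average_nonneg\<close> then disposes of the weights.\<close>

lemma semistable_vector_exists: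
  assumes d: "0 < d"
  shows "\<exists>x\<in>carrier_vec (d + d). \<forall>u k l. (\<forall>i\<in>I. (\<Sum>j<n i. u i j) = 0) \<longrightarrow>
    (\<forall>q<d+d. ((\<lambda>t. (VV a (psub u k t) *\<^sub>v x) $ q) \<longlongrightarrow> l q) (at 0)) \<longrightarrow> 0 \<le> a * k"
proof -
  obtain F P where iso: "chars.isotypic X d F P" using isotypic_exists by blast
  note FP = chars.isotypicD[OF iso, simplified]
  interpret W: weight_configuration I n weight_exponents by (rule weight_configuration_weights[OF d])
  have "\<forall>\<chi>\<in>F. \<exists>v\<in>carrier_vec d. \<exists>i<d. (P \<chi> *\<^sub>v v) $ i \<noteq> 0"
  proof
    fix \<chi> assume \<chi>: "\<chi> \<in> F"
    have Pc: "P \<chi> \<in> carrier_mat d d" by (rule FP(3)[OF \<chi>])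
    obtain i j where ij: "i < d" "j < d" "P \<chi> $$ (i,j) \<noteq> 0"
      using FP(4)[OF \<chi>] Pc by (metis eq_matI carrier_matD index_zero_mat)
    have "(P \<chi> *\<^sub>v unit_vec d j) $ i = P \<chi> $$ (i,j)" using Pc ij by simp
    then show "\<exists>v\<in>carrier_vec d. \<exists>i<d. (P \<chi> *\<^sub>v v) $ i \<noteq> 0" using ij by (intro bexI[of _ "unit_vec d j"]) auto
  qed
  then obtain v where v: "\<And>\<chi>. \<chi> \<in> F \<Longrightarrow> v \<chi> \<in> carrier_vec d" "\<And>\<chi>. \<chi> \<in> F \<Longrightarrow> \<exists>i<d. (P \<chi> *\<^sub>v v \<chi>) $ i \<noteq> 0" by metis
  \<comment> \<open>As the projections are orthogonal idempotents, the component of \<open>y\<close>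
    at \<open>\<psi>\<close> is that of \<open>v \<psi>\<close> alone.\<close>
  define y where "y = vec d (\<lambda>i. \<Sum>\<chi>\<in>F. (P \<chi> *\<^sub>v v \<chi>) $ i)"
  have yc: "y \<in> carrier_vec d" by (simp add: y_def)
  have Py: "P \<psi> *\<^sub>v y = P \<psi> *\<^sub>v v \<psi>" if \<psi>: "\<psi> \<in> F" for \<psi>
  proof (rule eq_vecI)
    have Pc: "P \<psi> \<in> carrier_mat d d" by (rule FP(3)[OF \<psi>])
    fix i assume "i < dim_vec (P \<psi> *\<^sub>v v \<psi>)"
    then have i: "i < d" using Pc by simp
    have "(P \<psi> *\<^sub>v y) $ i = (\<Sum>j=0..<d. P \<psi> $$ (i,j) * (\<Sum>\<chi>\<in>F. (P \<chi> *\<^sub>v v \<chi>) $ j))"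
      using Pc i by (simp add: y_def scalar_prod_def)
    also have "\<dots> = (\<Sum>\<chi>\<in>F. \<Sum>j=0..<d. P \<psi> $$ (i,j) * (P \<chi> *\<^sub>v v \<chi>) $ j)"
      unfolding sum_distrib_left by (rule sum.swap)
    also have "\<dots> = (\<Sum>\<chi>\<in>F. if \<chi> = \<psi> then (P \<psi> *\<^sub>v v \<psi>) $ i else 0)"
    proof (rule sum.cong[OF refl])
      fix \<chi> assume \<chi>: "\<chi> \<in> F"
      have Pc': "P \<chi> \<in> carrier_mat d d" by (rule FP(3)[OF \<chi>])
      have "(\<Sum>j=0..<d. P \<psi> $$ (i,j) * (P \<chi> *\<^sub>v v \<chi>) $ j) = (P \<psi> *\<^sub>v (P \<chi> *\<^sub>v v \<chi>)) $ i"
        using Pc Pc' v(1)[OF \<chi>] i by (simp add: scalar_prod_def)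
      also have "P \<psi> *\<^sub>v (P \<chi> *\<^sub>v v \<chi>) = (P \<psi> * P \<chi>) *\<^sub>v v \<chi>"
        by (rule assoc_mult_mat_vec[OF Pc Pc' v(1)[OF \<chi>], symmetric])
      also have "((P \<psi> * P \<chi>) *\<^sub>v v \<chi>) $ i = (if \<chi> = \<psi> then (P \<psi> *\<^sub>v v \<psi>) $ i else 0)"
        unfolding FP(5)[OF \<psi> \<chi>] using v(1)[OF \<chi>] i by (auto simp: scalar_prod_def)
      finally show "(\<Sum>j=0..<d. P \<psi> $$ (i,j) * (P \<chi> *\<^sub>v v \<chi>) $ j) = (if \<chi> = \<psi> then (P \<psi> *\<^sub>v v \<psi>) $ i else 0)" .
    qed
    also have "\<dots> = (P \<psi> *\<^sub>v v \<psi>) $ i" using FP(1) \<psi> by simp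
    finally show "(P \<psi> *\<^sub>v y) $ i = (P \<psi> *\<^sub>v v \<psi>) $ i" .
  qed simp
  show ?thesis
  proof (intro bexI[of _ "y @\<^sub>v 0\<^sub>v d"] allI impI)
    show "y @\<^sub>v 0\<^sub>v d \<in> carrier_vec (d + d)" using yc by simp
    fix u k l
    assume u: "\<forall>i\<in>I. (\<Sum>j<n i. u i j) = 0"
      and lim: "\<forall>q<d+d. ((\<lambda>t. (VV a (psub u k t) *\<^sub>v (y @\<^sub>v 0\<^sub>v d)) $ q) \<longlongrightarrow> l q) (at 0)"
    have nonneg: "0 \<le> (\<Sum>i\<in>I. \<Sum>j<n i. u i j * x i j) + a * k" if x: "x \<in> weight_exponents" for x
    proof -
      define \<chi> where "\<chi> = restrict (mono x) D"
      have \<chi>: "\<chi> \<in> F" using isotypic_weight_iff[OF iso] x unfolding \<chi>_def by blast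
      have Pc: "P \<chi> \<in> carrier_mat d d" by (rule FP(3)[OF \<chi>])
      obtain i where i: "i < d" "(P \<chi> *\<^sub>v v \<chi>) $ i \<noteq> 0" using v(2)[OF \<chi>] by blast
      have "((\<lambda>t. \<Sum>j=0..<d. P \<chi> $$ (i,j) * (VV a (psub u k t) *\<^sub>v (y @\<^sub>v 0\<^sub>v d)) $ j) \<longlongrightarrow> (\<Sum>j=0..<d. P \<chi> $$ (i,j) * l j)) (at 0)"
        using lim by (intro tendsto_sum tendsto_mult tendsto_const) auto
      moreover have "(\<Sum>j=0..<d. P \<chi> $$ (i,j) * (VV a (psub u k t) *\<^sub>v (y @\<^sub>v 0\<^sub>v d)) $ j) =
          t powi ((\<Sum>i\<in>I. \<Sum>j<n i. u i j * x i j) + a * k) * (P \<chi> *\<^sub>v v \<chi>) $ i" if t: "t \<noteq> 0" for t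
      proof -
        define s where "s = diag (\<lambda>i j. t powi u i j)"
        have s: "s \<in> D" "psub u k t = (s, t powi k)" "X s \<in> carrier_mat d d" "psub u k t \<in> carrier G"
          using psub_in(1)[OF u t] psub_in(2)[OF u t, of k] D_subset X_carrier by (auto simp: s_def psub_def)
        have "(\<Sum>j=0..<d. P \<chi> $$ (i,j) * (VV a (psub u k t) *\<^sub>v (y @\<^sub>v 0\<^sub>v d)) $ j) =
            (\<Sum>j=0..<d. P \<chi> $$ (i,j) * ((t powi k) powi a * (X s *\<^sub>v y) $ j))"
          unfolding VV_append[OF s(4) yc zero_carrier_vec] using s(2,3) by (intro sum.cong) auto
        also have "\<dots> = (t powi k) powi a * (P \<chi> *\<^sub>v (X s *\<^sub>v y)) $ i"
          using Pc s(3) i by (simp add: scalar_prod_def sum_distrib_left mult_ac)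
        also have "P \<chi> *\<^sub>v (X s *\<^sub>v y) = \<chi> s \<cdot>\<^sub>v (P \<chi> *\<^sub>v v \<chi>)"
          using isotypic_apply(1)[OF iso \<chi> s(1) yc] Py[OF \<chi>] by simp
        also have "(\<chi> s \<cdot>\<^sub>v (P \<chi> *\<^sub>v v \<chi>)) $ i = \<chi> s * (P \<chi> *\<^sub>v v \<chi>) $ i" using Pc i by simp
        also have "\<chi> s = t powi (\<Sum>i\<in>I. \<Sum>j<n i. u i j * x i j)"
          using s(1) mono_psub[OF t] by (simp add: \<chi>_def s_def)
        also have "(t powi k) powi a = t powi (a * k)" by (metis power_int_mult mult.commute)
        finally show ?thesis using t by (simp add: power_int_add)
      qed
      then have "\<forall>\<^sub>F t in at 0. (\<Sum>j=0..<d. P \<chi> $$ (i,j) * (VV a (psub u k t) *\<^sub>v (y @\<^sub>v 0\<^sub>v d)) $ j) =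
          t powi ((\<Sum>i\<in>I. \<Sum>j<n i. u i j * x i j) + a * k) * (P \<chi> *\<^sub>v v \<chi>) $ i"
        by (rule eventually_mono[OF eventually_neq_at_within])
      ultimately have "((\<lambda>t. t powi ((\<Sum>i\<in>I. \<Sum>j<n i. u i j * x i j) + a * k) * (P \<chi> *\<^sub>v v \<chi>) $ i) \<longlongrightarrow> (\<Sum>j=0..<d. P \<chi> $$ (i,j) * l j)) (at 0)"
        by (rule Lim_transform_eventually)
      then show ?thesis using i(2) by (rule powi_limit)
    qed
    show "0 \<le> a * k" by (rule W.average_nonneg[OF u[rule_format] nonneg])
  qed
qed

text \<open>The dual part contributes the inverse characters, and the equation
  \<open>z powi a * \<chi> s = 1\<close> is invariant under inversion. Both summands thus impose
  conditions of the same form, indexed by the weights occurring in either part.\<close>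

lemma fixed_vector_iff:
  assumes iso: "chars.isotypic X d F P" and s: "s \<in> D" and z: "z \<noteq> 0"
    and y: "y \<in> carrier_vec d" and w: "w \<in> carrier_vec d"
  shows "VV a (s, z) *\<^sub>v (y @\<^sub>v w) = y @\<^sub>v w \<longleftrightarrow>
    (\<forall>\<chi>\<in>F. P \<chi> *\<^sub>v y \<noteq> 0\<^sub>v d \<or> transpose_mat (P \<chi>) *\<^sub>v w \<noteq> 0\<^sub>v d \<longrightarrow> z powi a * \<chi> s = 1)"
proof -
  note FP = chars.isotypicD[OF iso, simplified]
  have sH: "s \<in> carrier H" using s D_subset by blast
  have si: "inv\<^bsub>H\<^esub> s \<in> D" using subgroup.m_inv_closed[OF subgroup_D s] .
  have c: "X s \<in> carrier_mat d d" "Xd s \<in> carrier_mat d d" using X_carrier Xd_carrier sH by auto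
  have nz: "\<chi> s \<noteq> 0" if "\<chi> \<in> F" for \<chi>
    using FP(2) that s D_nonzero[OF s] finite_I unfolding monomials_def by (auto simp: mono_def)
  have one: "\<one>\<^bsub>H\<^esub> \<in> D" using subgroup.one_closed[OF subgroup_D] .
  have \<chi>1: "\<chi> \<one>\<^bsub>H\<^esub> = 1" if "\<chi> \<in> F" for \<chi>
    using FP(2) that one unfolding monomials_def by (auto simp: mono_one)
  have \<chi>i: "\<chi> (inv\<^bsub>H\<^esub> s) = inverse (\<chi> s)" if \<chi>F: "\<chi> \<in> F" for \<chi>
  proof -
    interpret group H by (rule group_H)
    obtain e where e: "\<chi> = restrict (mono e) D" using FP(2) \<chi>F unfolding monomials_def by auto
    have "\<chi> s * \<chi> (inv\<^bsub>H\<^esub> s) = 1" using mono_mult[OF s si, of e] s si sH by (simp add: e mono_one)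
    then show ?thesis by (metis inverse_unique)
  qed
  have dec: "(X h *\<^sub>v y) $ i = (\<Sum>\<chi>\<in>F. \<chi> h * (P \<chi> *\<^sub>v y) $ i)" if h: "h \<in> D" and i: "i < d" for h i
  proof -
    have "X h \<in> carrier_mat d d" using h D_subset X_carrier by blast
    then have "(X h *\<^sub>v y) $ i = (\<Sum>j=0..<d. X h $$ (i,j) * y $ j)" using y i by (simp add: scalar_prod_def)
    also have "\<dots> = (\<Sum>j=0..<d. \<Sum>\<chi>\<in>F. \<chi> h * P \<chi> $$ (i,j) * y $ j)"
      using FP(6)[OF h i] by (intro sum.cong refl) (simp add: sum_distrib_right)
    also have "\<dots> = (\<Sum>\<chi>\<in>F. \<Sum>j=0..<d. \<chi> h * P \<chi> $$ (i,j) * y $ j)" by (rule sum.swap)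
    also have "\<dots> = (\<Sum>\<chi>\<in>F. \<chi> h * (P \<chi> *\<^sub>v y) $ i)"
    proof (rule sum.cong[OF refl])
      fix \<chi> assume "\<chi> \<in> F"
      then have "P \<chi> \<in> carrier_mat d d" by (rule FP(3))
      then show "(\<Sum>j=0..<d. \<chi> h * P \<chi> $$ (i,j) * y $ j) = \<chi> h * (P \<chi> *\<^sub>v y) $ i"
        using y i by (simp add: scalar_prod_def sum_distrib_left mult_ac)
    qed
    finally show ?thesis .
  qed
  have decT: "(transpose_mat (X h) *\<^sub>v w) $ i = (\<Sum>\<chi>\<in>F. \<chi> h * (transpose_mat (P \<chi>) *\<^sub>v w) $ i)" if h: "h \<in> D" and i: "i < d" for h i
  proof -
    have "X h \<in> carrier_mat d d" using h D_subset X_carrier by blast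
    then have "(transpose_mat (X h) *\<^sub>v w) $ i = (\<Sum>j=0..<d. X h $$ (j,i) * w $ j)" using w i by (simp add: scalar_prod_def)
    also have "\<dots> = (\<Sum>j=0..<d. \<Sum>\<chi>\<in>F. \<chi> h * P \<chi> $$ (j,i) * w $ j)"
      using FP(6)[OF h _ i] by (intro sum.cong refl) (simp add: sum_distrib_right)
    also have "\<dots> = (\<Sum>\<chi>\<in>F. \<Sum>j=0..<d. \<chi> h * P \<chi> $$ (j,i) * w $ j)" by (rule sum.swap)
    also have "\<dots> = (\<Sum>\<chi>\<in>F. \<chi> h * (transpose_mat (P \<chi>) *\<^sub>v w) $ i)"
    proof (rule sum.cong[OF refl])
      fix \<chi> assume "\<chi> \<in> F"
      then have "P \<chi> \<in> carrier_mat d d" by (rule FP(3))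
      then show "(\<Sum>j=0..<d. \<chi> h * P \<chi> $$ (j,i) * w $ j) = \<chi> h * (transpose_mat (P \<chi>) *\<^sub>v w) $ i"
        using w i by (simp add: scalar_prod_def sum_distrib_left mult_ac)
    qed
    finally show ?thesis .
  qed
  have "VV a (s, z) *\<^sub>v (y @\<^sub>v w) = y @\<^sub>v w \<longleftrightarrow>
      z powi a \<cdot>\<^sub>v (X s *\<^sub>v y) = y \<and> z powi (- a) \<cdot>\<^sub>v (Xd s *\<^sub>v w) = w"
    by (subst VV_append) (use sH z y w c in \<open>auto simp: append_vec_eq[of _ d]\<close>)
  also have "\<dots> \<longleftrightarrow> (\<forall>\<chi>\<in>F. P \<chi> *\<^sub>v y \<noteq> 0\<^sub>v d \<or> transpose_mat (P \<chi>) *\<^sub>v w \<noteq> 0\<^sub>v d \<longrightarrow> z powi a * \<chi> s = 1)"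
  proof (intro iffI ballI impI)
    fix \<chi> assume fix1: "z powi a \<cdot>\<^sub>v (X s *\<^sub>v y) = y \<and> z powi (- a) \<cdot>\<^sub>v (Xd s *\<^sub>v w) = w" and \<chi>: "\<chi> \<in> F"
      and ne: "P \<chi> *\<^sub>v y \<noteq> 0\<^sub>v d \<or> transpose_mat (P \<chi>) *\<^sub>v w \<noteq> 0\<^sub>v d"
    have Pc: "P \<chi> \<in> carrier_mat d d" "transpose_mat (P \<chi>) \<in> carrier_mat d d" using FP(3)[OF \<chi>] by auto
    have scal: "k = 1" if q: "k \<cdot>\<^sub>v q = q" "q \<noteq> 0\<^sub>v d" "q \<in> carrier_vec d" for k :: complex and q
    proof -
      obtain i where i: "i < d" "q $ i \<noteq> 0" using q(2,3) by (metis carrier_vecD eq_vecI index_zero_vec)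
      have "k * q $ i = q $ i" using arg_cong[OF q(1), of "\<lambda>r. r $ i"] i q(3) by simp
      then show ?thesis using i by simp
    qed
    from ne show "z powi a * \<chi> s = 1"
    proof
      assume "P \<chi> *\<^sub>v y \<noteq> 0\<^sub>v d"
      moreover have "(z powi a * \<chi> s) \<cdot>\<^sub>v (P \<chi> *\<^sub>v y) = P \<chi> *\<^sub>v y"
      proof -
        have "P \<chi> *\<^sub>v y = P \<chi> *\<^sub>v (z powi a \<cdot>\<^sub>v (X s *\<^sub>v y))" using fix1 by simp
        also have "\<dots> = z powi a \<cdot>\<^sub>v (P \<chi> *\<^sub>v (X s *\<^sub>v y))" by (rule mult_mat_vec[OF Pc(1)]) (use c y in simp)
        finally show ?thesis unfolding isotypic_apply(1)[OF iso \<chi> s y] by (simp add: smult_smult_assoc)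
      qed
      ultimately show ?thesis using scal Pc y by auto
    next
      assume "transpose_mat (P \<chi>) *\<^sub>v w \<noteq> 0\<^sub>v d"
      moreover have "(z powi (- a) * inverse (\<chi> s)) \<cdot>\<^sub>v (transpose_mat (P \<chi>) *\<^sub>v w) = transpose_mat (P \<chi>) *\<^sub>v w"
      proof -
        have "transpose_mat (P \<chi>) *\<^sub>v w = transpose_mat (P \<chi>) *\<^sub>v (z powi (- a) \<cdot>\<^sub>v (Xd s *\<^sub>v w))" using fix1 by simp
        also have "\<dots> = z powi (- a) \<cdot>\<^sub>v (transpose_mat (P \<chi>) *\<^sub>v (Xd s *\<^sub>v w))"
          by (rule mult_mat_vec[OF Pc(2)]) (use c w in simp)
        finally show ?thesis unfolding isotypic_apply(2)[OF iso \<chi> s w] by (simp add: smult_smult_assoc)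
      qed
      ultimately have "z powi (- a) * inverse (\<chi> s) = 1" using scal Pc w by auto
      then show ?thesis using z nz[OF \<chi>] by (simp add: power_int_minus field_simps)
    qed
  next
    assume all: "\<forall>\<chi>\<in>F. P \<chi> *\<^sub>v y \<noteq> 0\<^sub>v d \<or> transpose_mat (P \<chi>) *\<^sub>v w \<noteq> 0\<^sub>v d \<longrightarrow> z powi a * \<chi> s = 1"
    have "z powi a \<cdot>\<^sub>v (X s *\<^sub>v y) = y"
    proof (rule eq_vecI)
      fix i assume "i < dim_vec y"
      then have i: "i < d" using y by simp
      have "(z powi a \<cdot>\<^sub>v (X s *\<^sub>v y)) $ i = (\<Sum>\<chi>\<in>F. z powi a * \<chi> s * (P \<chi> *\<^sub>v y) $ i)"
        using c i y by (simp add: dec[OF s i] sum_distrib_left mult_ac del: index_mult_mat_vec)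
      also have "\<dots> = (\<Sum>\<chi>\<in>F. \<chi> \<one>\<^bsub>H\<^esub> * (P \<chi> *\<^sub>v y) $ i)"
      proof (rule sum.cong[OF refl])
        fix \<chi> assume \<chi>: "\<chi> \<in> F"
        show "z powi a * \<chi> s * (P \<chi> *\<^sub>v y) $ i = \<chi> \<one>\<^bsub>H\<^esub> * (P \<chi> *\<^sub>v y) $ i"
          unfolding \<chi>1[OF \<chi>] using all[rule_format, OF \<chi>] i by (cases "P \<chi> *\<^sub>v y = 0\<^sub>v d") (simp_all del: index_mult_mat_vec)
      qed
      also have "\<dots> = y $ i" unfolding dec[OF one i, symmetric] X_one using y i by simp
      finally show "(z powi a \<cdot>\<^sub>v (X s *\<^sub>v y)) $ i = y $ i" .
    qed (use c y in simp)
    moreover have "z powi (- a) \<cdot>\<^sub>v (Xd s *\<^sub>v w) = w"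
    proof (rule eq_vecI)
      fix i assume "i < dim_vec w"
      then have i: "i < d" using w by simp
      have "(Xd s *\<^sub>v w) $ i = (\<Sum>\<chi>\<in>F. \<chi> (inv\<^bsub>H\<^esub> s) * (transpose_mat (P \<chi>) *\<^sub>v w) $ i)"
        using decT[OF si i] by (simp add: Xd_def dual_rep_def del: index_mult_mat_vec)
      then have "(z powi (- a) \<cdot>\<^sub>v (Xd s *\<^sub>v w)) $ i = (\<Sum>\<chi>\<in>F. inverse (z powi a * \<chi> s) * (transpose_mat (P \<chi>) *\<^sub>v w) $ i)"
        using c i w \<chi>i by (simp add: sum_distrib_left mult_ac power_int_minus del: index_mult_mat_vec)
      also have "\<dots> = (\<Sum>\<chi>\<in>F. \<chi> \<one>\<^bsub>H\<^esub> * (transpose_mat (P \<chi>) *\<^sub>v w) $ i)"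
      proof (rule sum.cong[OF refl])
        fix \<chi> assume \<chi>: "\<chi> \<in> F"
        show "inverse (z powi a * \<chi> s) * (transpose_mat (P \<chi>) *\<^sub>v w) $ i = \<chi> \<one>\<^bsub>H\<^esub> * (transpose_mat (P \<chi>) *\<^sub>v w) $ i"
        proof (cases "transpose_mat (P \<chi>) *\<^sub>v w = 0\<^sub>v d")
          case True
          then show ?thesis using i by (simp del: index_mult_mat_vec)
        next
          case False
          then have "z powi a * \<chi> s = 1" using all[rule_format, OF \<chi>] by blast
          then show ?thesis unfolding \<chi>1[OF \<chi>] by (simp only: inverse_1)
        qed
      qed
      also have "\<dots> = w $ i" unfolding decT[OF one i, symmetric] X_one using w i by simp
      finally show "(z powi (- a) \<cdot>\<^sub>v (Xd s *\<^sub>v w)) $ i = w $ i" .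
    qed (use c w in simp)
    ultimately show "z powi a \<cdot>\<^sub>v (X s *\<^sub>v y) = y \<and> z powi (- a) \<cdot>\<^sub>v (Xd s *\<^sub>v w) = w" by blast
  qed
  finally show ?thesis .
qed

text \<open>A functional on the coordinates \<open>E\<close> that vanishes on the vectors
  \<open>v q\<close> is, up to scaling, a one-parameter subgroup fixing \<open>x\<close>:
  \<open>Inr i\<close> imposes determinant one in factor \<open>i\<close>, and
  \<open>Inl \<chi>\<close> triviality of the weight \<open>\<chi>\<close>. By \<open>stable\<close>
  the character of weight \<open>a\<close> vanishes on all of them, and by rigidity there are none
  but zero. Dually, some power of each coordinate is trivial on the stabilizer, which therefore
  embeds into a finite product of sets of roots of unity.\<close>

lemma finite_stabilizer:
  assumes a: "a \<noteq> 0" and nd: "nondegenerate_configuration I n weight_exponents" and x: "x \<in> carrier_vec (d + d)"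
    and stable: "\<And>u k. \<forall>i\<in>I. (\<Sum>j<n i. u i j) = 0 \<Longrightarrow> \<forall>t. t \<noteq> 0 \<longrightarrow> VV a (psub u k t) *\<^sub>v x = x \<Longrightarrow> 0 \<le> a * k"
  shows "finite {p \<in> D \<times> (-{0}). VV a p *\<^sub>v x = x}"
proof -
  interpret N: nondegenerate_configuration I n weight_exponents by (rule nd)
  obtain F P where iso: "chars.isotypic X d F P" using isotypic_exists by blast
  note FP = chars.isotypicD[OF iso, simplified]
  define y w where "y = vec_first x d" and "w = vec_last x d"
  have yw: "y \<in> carrier_vec d" "w \<in> carrier_vec d" "x = y @\<^sub>v w"
    using vec_first_last_append[OF x] by (simp_all add: y_def w_def)
  define S where "S = {\<chi> \<in> F. P \<chi> *\<^sub>v y \<noteq> 0\<^sub>v d \<or> transpose_mat (P \<chi>) *\<^sub>v w \<noteq> 0\<^sub>v d}"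
  have finS: "finite S" using FP(1) by (simp add: S_def)
  have fixed: "VV a (s, z) *\<^sub>v x = x \<longleftrightarrow> (\<forall>\<chi>\<in>S. z powi a * \<chi> s = 1)" if "s \<in> D" "z \<noteq> 0" for s z
    unfolding yw(3) fixed_vector_iff[OF iso that yw(1,2)] S_def by blast
  have "\<forall>\<chi>\<in>S. \<exists>e. \<chi> = restrict (mono e) D" using FP(2) unfolding S_def monomials_def by auto
  then obtain e where e: "\<And>\<chi>. \<chi> \<in> S \<Longrightarrow> \<chi> = restrict (mono (e \<chi>)) D" by metis
  have eW: "e \<chi> \<in> weight_exponents" if "\<chi> \<in> S" for \<chi>
  proof -
    have "restrict (mono (e \<chi>)) D \<in> F" using e[OF that] that by (simp add: S_def)
    then show ?thesis using isotypic_weight_iff[OF iso] by blast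
  qed
  \<comment> \<open>\<open>None\<close> is the coordinate of \<open>Gm\<close>, and
    \<open>Some (i, j)\<close> the \<open>j\<close>-th diagonal entry of factor
    \<open>i\<close>.\<close>
  define E where "E = insert None (Some ` (SIGMA i:I. {..<n i}))"
  define J where "J = S <+> I"
  have finE: "finite E" using finite_I by (simp add: E_def)
  have finJ: "finite J" using finS finite_I by (simp add: J_def)
  have memJ: "\<chi> \<in> S \<Longrightarrow> Inl \<chi> \<in> J" "i \<in> I \<Longrightarrow> Inr i \<in> J" for \<chi> i
    unfolding J_def by (erule InlI, erule InrI)
  have sumE: "(\<Sum>p\<in>E. f p) = f None + (\<Sum>i\<in>I. \<Sum>j<n i. f (Some (i,j)))" for f :: "('i \<times> nat) option \<Rightarrow> rat"
  proof -
    have "(\<Sum>p\<in>E. f p) = f None + (\<Sum>p\<in>Some ` (SIGMA i:I. {..<n i}). f p)"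
      unfolding E_def by (rule sum.insert) (use finite_I in auto)
    also have "(\<Sum>p\<in>Some ` (SIGMA i:I. {..<n i}). f p) = (\<Sum>p\<in>(SIGMA i:I. {..<n i}). f (Some p))"
      by (subst sum.reindex) auto
    also have "\<dots> = (\<Sum>i\<in>I. \<Sum>j<n i. f (Some (i,j)))"
      by (subst sum.Sigma) (use finite_I in \<open>auto intro: sum.cong\<close>)
    finally show ?thesis .
  qed
  have sumJ: "(\<Sum>q\<in>J. f q) = (\<Sum>\<chi>\<in>S. f (Inl \<chi>)) + (\<Sum>i\<in>I. f (Inr i))"
    for f :: "(('i \<Rightarrow> complex mat) \<Rightarrow> complex) + 'i \<Rightarrow> rat"
    unfolding J_def using sum.Plus[OF finS finite_I, of f] by (simp add: comp_def)
  define v :: "(('i \<Rightarrow> complex mat) \<Rightarrow> complex) + 'i \<Rightarrow> ('i \<times> nat) option \<Rightarrow> rat" where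
    "v = (\<lambda>q p. case q of
        Inl \<chi> \<Rightarrow> (case p of None \<Rightarrow> of_int a | Some (i,j) \<Rightarrow> of_int (e \<chi> i j))
      | Inr i \<Rightarrow> (case p of None \<Rightarrow> 0 | Some (i',j) \<Rightarrow> if i' = i then 1 else 0))"
  have v_simps: "v (Inl \<chi>) None = of_int a" "v (Inl \<chi>) (Some (i,j)) = of_int (e \<chi> i j)"
    "v (Inr i) None = 0" "v (Inr i) (Some (i',j)) = (if i' = i then 1 else 0)" for \<chi> i i' j
    by (simp_all add: v_def)
  have dotInl: "(\<Sum>p\<in>E. l p * v (Inl \<chi>) p) = l None * of_int a + (\<Sum>i\<in>I. \<Sum>j<n i. l (Some (i,j)) * of_int (e \<chi> i j))" for l \<chi>
    unfolding sumE v_simps ..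
  have dotInr: "(\<Sum>p\<in>E. l p * v (Inr i) p) = (\<Sum>j<n i. l (Some (i,j)))" if "i \<in> I" for l i
  proof -
    have "(\<Sum>p\<in>E. l p * v (Inr i) p) = (\<Sum>i'\<in>I. if i' = i then (\<Sum>j<n i. l (Some (i,j))) else 0)"
      unfolding sumE v_simps by (simp, intro sum.cong) auto
    then show ?thesis using finite_I that by simp
  qed
  have combInr: "(\<Sum>i\<in>I. c (Inr i) * v (Inr i) (Some (i0,j))) = c (Inr i0)" if "i0 \<in> I"
    for c :: "(('i \<Rightarrow> complex mat) \<Rightarrow> complex) + 'i \<Rightarrow> rat" and i0 j
  proof -
    have "(\<Sum>i\<in>I. c (Inr i) * v (Inr i) (Some (i0,j))) = (\<Sum>i\<in>I. if i = i0 then c (Inr i0) else 0)"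
      unfolding v_simps by (intro sum.cong) auto
    then show ?thesis using finite_I that by simp
  qed
  define b where "b = (\<lambda>p :: ('i \<times> nat) option. if p = None then of_int a else (0::rat))"
  have sum_b: "(\<Sum>p\<in>E. l p * b p) = l None * of_int a" for l unfolding sumE b_def by simp

  \<comment> \<open>Semistability says that the character of \<open>G\<close> of weight \<open>a\<close> lies in the rational span
    of the weights occurring in \<open>x\<close>: a separating functional is a one-parameter subgroup fixing \<open>x\<close>.\<close>
  have "\<exists>c. \<forall>p\<in>E. (\<Sum>q\<in>J. c q * v q p) = b p"
  proof (rule ccontr)
    assume "\<not> ?thesis"
    then obtain l where l: "\<forall>q\<in>J. (\<Sum>p\<in>E. l p * v q p) = 0" "l None * of_int a \<noteq> 0"
      using solvable_or_separating_functional[OF finJ finE, of v b] unfolding sum_b by blast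
    obtain N where N: "N > 0" "\<forall>p\<in>E. \<exists>k::int. l p * of_nat N = of_int k"
      using common_multiple_of_denominators[OF finE, of l] by blast
    then obtain L where L: "\<And>p. p \<in> E \<Longrightarrow> l p * of_nat N = of_int (L p)" by metis
    have LN: "L None * a \<noteq> 0"
    proof
      assume "L None * a = 0"
      then have "of_int (L None) * of_int a = (0::rat)" by (simp only: of_int_mult[symmetric] of_int_0)
      then show False using l(2) N(1) L[of None] by (auto simp: E_def)
    qed
    \<comment> \<open>The sign that makes the one-parameter subgroup pair negatively with the
      character, against \<open>stable\<close>.\<close>
    define \<sigma> where "\<sigma> = - sgn (L None * a)"
    define u where "u = (\<lambda>i j. \<sigma> * L (Some (i,j)))"
    define k where "k = \<sigma> * L None"
    have LE: "of_int (L (Some (i,j))) = of_nat N * l (Some (i,j))" if "i \<in> I" "j < n i" for i j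
      using L[of "Some (i,j)"] that by (simp add: E_def mult.commute)
    have LE0: "of_int (L None) = of_nat N * l None" using L[of None] by (simp add: E_def mult.commute)
    have u0: "\<forall>i\<in>I. (\<Sum>j<n i. u i j) = 0"
    proof
      fix i assume i: "i \<in> I"
      have "of_int (\<Sum>j<n i. L (Some (i,j))) = of_nat N * (\<Sum>j<n i. l (Some (i,j)))"
        unfolding of_int_sum sum_distrib_left by (intro sum.cong) (auto simp: LE[OF i])
      also have "(\<Sum>j<n i. l (Some (i,j))) = 0" using bspec[OF l(1) memJ(2)[OF i]] dotInr[OF i, of l] by simp
      finally have "(\<Sum>j<n i. L (Some (i,j))) = 0" by (simp only: mult_zero_right of_int_eq_0_iff)
      then show "(\<Sum>j<n i. u i j) = 0" by (simp add: u_def sum_distrib_left[symmetric])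
    qed
    have pair0: "(\<Sum>i\<in>I. \<Sum>j<n i. u i j * e \<chi> i j) + a * k = 0" if \<chi>: "\<chi> \<in> S" for \<chi>
    proof -
      have "of_int ((\<Sum>i\<in>I. \<Sum>j<n i. L (Some (i,j)) * e \<chi> i j) + a * L None) =
          of_nat N * (\<Sum>p\<in>E. l p * v (Inl \<chi>) p)"
        unfolding dotInl of_int_add of_int_sum of_int_mult LE0 distrib_left sum_distrib_left
        by (auto simp: LE mult_ac intro!: sum.cong)
      also have "\<dots> = 0" using bspec[OF l(1) memJ(1)[OF \<chi>]] by simp
      finally have "(\<Sum>i\<in>I. \<Sum>j<n i. L (Some (i,j)) * e \<chi> i j) + a * L None = 0" by (simp only: of_int_eq_0_iff)
      then have "\<sigma> * ((\<Sum>i\<in>I. \<Sum>j<n i. L (Some (i,j)) * e \<chi> i j) + a * L None) = 0" by simp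
      then show ?thesis unfolding u_def k_def by (simp add: distrib_left sum_distrib_left mult_ac)
    qed
    have "VV a (psub u k t) *\<^sub>v x = x" if t: "t \<noteq> 0" for t
    proof -
      have "(t powi k) powi a * \<chi> (diag (\<lambda>i j. t powi u i j)) = 1" if \<chi>: "\<chi> \<in> S" for \<chi>
      proof -
        have "\<chi> (diag (\<lambda>i j. t powi u i j)) = mono (e \<chi>) (diag (\<lambda>i j. t powi u i j))"
          using fun_cong[OF e[OF \<chi>]] psub_in(1)[OF u0 t] by simp
        also have "\<dots> = t powi (\<Sum>i\<in>I. \<Sum>j<n i. u i j * e \<chi> i j)" by (rule mono_psub[OF t])
        also have "(t powi k) powi a = t powi (a * k)" by (metis power_int_mult mult.commute)
        ultimately have "(t powi k) powi a * \<chi> (diag (\<lambda>i j. t powi u i j)) = t powi (a * k) * t powi (\<Sum>i\<in>I. \<Sum>j<n i. u i j * e \<chi> i j)"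
          by simp
        also have "\<dots> = t powi ((\<Sum>i\<in>I. \<Sum>j<n i. u i j * e \<chi> i j) + a * k)"
          using t by (simp add: power_int_add mult.commute)
        finally show ?thesis unfolding pair0[OF \<chi>] by simp
      qed
      then show ?thesis unfolding psub_def using fixed[OF psub_in(1)[OF u0 t]] t by simp
    qed
    then have "0 \<le> a * k" using stable[OF u0] by blast
    moreover have "a * k = - \<bar>L None * a\<bar>" by (simp add: k_def \<sigma>_def abs_sgn mult_ac)
    ultimately show False using LN by simp
  qed
  then obtain c where c: "\<And>p. p \<in> E \<Longrightarrow> (\<Sum>q\<in>J. c q * v q p) = b p" by blast
  \<comment> \<open>Every weight has the coordinate \<open>a\<close> at \<open>None\<close>, as does
    the character itself, and \<open>a\<close> can be cancelled.\<close>
  have c1: "(\<Sum>\<chi>\<in>S. c (Inl \<chi>)) = 1"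
  proof -
    have "(\<Sum>\<chi>\<in>S. c (Inl \<chi>)) * of_int a = of_int a"
      using c[of None] unfolding sumJ v_simps by (simp add: E_def b_def sum_distrib_right)
    then show ?thesis using a by simp
  qed
  have bal: "\<exists>\<kappa>. \<forall>j<n i. (\<Sum>\<chi>\<in>S. c (Inl \<chi>) * of_int (e \<chi> i j)) = \<kappa>" if i: "i \<in> I" for i
  proof (intro exI allI impI)
    fix j assume j: "j < n i"
    have "(\<Sum>\<chi>\<in>S. c (Inl \<chi>) * of_int (e \<chi> i j)) + c (Inr i) = 0"
      using c[of "Some (i,j)"] i j unfolding sumJ combInr[OF i] by (simp add: E_def b_def v_simps)
    then show "(\<Sum>\<chi>\<in>S. c (Inl \<chi>) * of_int (e \<chi> i j)) = - c (Inr i)" by simp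
  qed
  \<comment> \<open>The character lies in the span of the vectors \<open>v q\<close>, so
    \<open>l\<close> vanishes at \<open>None\<close>. On the remaining coordinates
    \<open>rigidity\<close> applies, with the signed coefficients just found.\<close>
  have vanish: "l p = 0" if l: "\<forall>q\<in>J. (\<Sum>p\<in>E. l p * v q p) = 0" and p: "p \<in> E" for l p
  proof -
    have "l None * of_int a = (\<Sum>p\<in>E. l p * (\<Sum>q\<in>J. c q * v q p))" using c sum_b[of l] by simp
    also have "\<dots> = (\<Sum>q\<in>J. \<Sum>p\<in>E. c q * (l p * v q p))"
      unfolding sum_distrib_left by (subst sum.swap) (simp add: mult_ac)
    also have "\<dots> = 0" using l by (simp add: sum_distrib_left[symmetric])
    finally have l0: "l None = 0" using a by simp
    have "l (Some (i,j)) = 0" if ij: "i \<in> I" "j < n i" for i j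
    proof (rule N.rigidity[where u = "\<lambda>i j. l (Some (i,j))" and K = S and x = e and c = "\<lambda>\<chi>. c (Inl \<chi>)", OF finS eW c1 bal _ _ ij])
      show "(\<Sum>j<n i. l (Some (i,j))) = 0" if "i \<in> I" for i using bspec[OF l memJ(2)[OF that]] dotInr[OF that, of l] by simp
      show "(\<Sum>i\<in>I. \<Sum>j<n i. l (Some (i,j)) * of_int (e \<chi> i j)) = 0" if "\<chi> \<in> S" for \<chi>
        using bspec[OF l memJ(1)[OF that]] dotInl[of l \<chi>] l0 by simp
    qed
    then show ?thesis using p l0 by (auto simp: E_def)
  qed
  define val :: "('i \<times> nat) option \<Rightarrow> ('i \<Rightarrow> complex mat) \<times> complex \<Rightarrow> complex" where
    "val = (\<lambda>p (s, z). case p of None \<Rightarrow> z | Some (i,j) \<Rightarrow> s i $$ (j,j))"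
  have "\<exists>N>0. \<forall>s\<in>D. \<forall>z. z \<noteq> 0 \<longrightarrow> VV a (s, z) *\<^sub>v x = x \<longrightarrow> val p (s, z) ^ N = 1" if p: "p \<in> E" for p
  proof -
    \<comment> \<open>By \<open>vanish\<close> no functional separates the coordinate vector of
      \<open>p\<close> from the span, so it is a rational combination of the \<open>v q\<close>. A
      common denominator becomes the exponent.\<close>
    let ?\<delta> = "\<lambda>p'. if p' = p then 1 else (0::rat)"
    have sum_\<delta>: "(\<Sum>p'\<in>E. l p' * ?\<delta> p') = l p" for l
    proof -
      have "(\<Sum>p'\<in>E. l p' * ?\<delta> p') = (\<Sum>p'\<in>E. if p' = p then l p' else 0)" by (intro sum.cong) auto
      then show ?thesis using finE p by simp
    qed
    have "\<exists>c. \<forall>p'\<in>E. (\<Sum>q\<in>J. c q * v q p') = ?\<delta> p'"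
      using solvable_or_separating_functional[OF finJ finE, of v ?\<delta>] vanish[OF _ p] unfolding sum_\<delta> by blast
    then obtain c where c: "\<And>p'. p' \<in> E \<Longrightarrow> (\<Sum>q\<in>J. c q * v q p') = ?\<delta> p'" by blast
    obtain N where N: "N > 0" "\<forall>q\<in>J. \<exists>k::int. c q * of_nat N = of_int k"
      using common_multiple_of_denominators[OF finJ, of c] by blast
    then obtain k where k: "\<And>q. q \<in> J \<Longrightarrow> c q * of_nat N = of_int (k q)" by metis
    have kS: "of_int (k (Inl \<chi>)) = of_nat N * c (Inl \<chi>)" if "\<chi> \<in> S" for \<chi>
      using k[OF memJ(1)[OF that]] by (simp add: mult.commute)
    have kI: "of_int (k (Inr i)) = of_nat N * c (Inr i)" if "i \<in> I" for i
      using k[OF memJ(2)[OF that]] by (simp add: mult.commute)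
    have kNone: "a * (\<Sum>\<chi>\<in>S. k (Inl \<chi>)) = (if p = None then int N else 0)"
    proof -
      have "of_int (a * (\<Sum>\<chi>\<in>S. k (Inl \<chi>))) = of_nat N * (\<Sum>q\<in>J. c q * v q None)"
        unfolding sumJ v_simps of_int_mult of_int_sum sum_distrib_left distrib_left
        by (auto simp: kS mult_ac intro!: sum.cong)
      also have "\<dots> = of_int (if p = None then int N else 0)" using c[of None] by (auto simp: E_def)
      finally show ?thesis by (simp only: of_int_eq_iff)
    qed
    have kSome: "(\<Sum>\<chi>\<in>S. k (Inl \<chi>) * e \<chi> i j) = (if p = Some (i,j) then int N else 0) + - k (Inr i)"
      if ij: "i \<in> I" "j < n i" for i j
    proof -
      have "of_int ((\<Sum>\<chi>\<in>S. k (Inl \<chi>) * e \<chi> i j) + k (Inr i)) = of_nat N * (\<Sum>q\<in>J. c q * v q (Some (i,j)))"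
        unfolding sumJ combInr[OF ij(1)] unfolding v_simps of_int_add of_int_mult of_int_sum sum_distrib_left distrib_left kI[OF ij(1)]
        by (auto simp: kS mult_ac intro!: sum.cong)
      also have "\<dots> = of_int (if p = Some (i,j) then int N else 0)" using c[of "Some (i,j)"] ij by (auto simp: E_def)
      finally have "(\<Sum>\<chi>\<in>S. k (Inl \<chi>) * e \<chi> i j) + k (Inr i) = (if p = Some (i,j) then int N else 0)"
        by (simp only: of_int_eq_iff)
      then show ?thesis by simp
    qed
    have "val p (s, z) ^ N = 1" if s: "s \<in> D" and z: "z \<noteq> 0" and fx: "VV a (s, z) *\<^sub>v x = x" for s z
    proof -
      have "1 = (\<Prod>\<chi>\<in>S. (z powi a * mono (e \<chi>) s) powi k (Inl \<chi>))"
      proof (rule prod.neutral[symmetric], rule ballI)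
        fix \<chi> assume \<chi>: "\<chi> \<in> S"
        have "mono (e \<chi>) s = \<chi> s" using fun_cong[OF e[OF \<chi>], of s] s by simp
        moreover have "z powi a * \<chi> s = 1" using fx \<chi> unfolding fixed[OF s z] by blast
        ultimately have "z powi a * mono (e \<chi>) s = 1" by (simp only:)
        then show "(z powi a * mono (e \<chi>) s) powi k (Inl \<chi>) = 1" by (simp only: power_int_1_left)
      qed
      also have "\<dots> = (\<Prod>\<chi>\<in>S. z powi (a * k (Inl \<chi>))) * (\<Prod>\<chi>\<in>S. mono (e \<chi>) s powi k (Inl \<chi>))"
        unfolding power_int_mult_distrib prod.distrib power_int_mult ..
      also have "(\<Prod>\<chi>\<in>S. z powi (a * k (Inl \<chi>))) = z powi (a * (\<Sum>\<chi>\<in>S. k (Inl \<chi>)))"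
        unfolding sum_distrib_left powi_sum[OF z] ..
      also have "(\<Prod>\<chi>\<in>S. mono (e \<chi>) s powi k (Inl \<chi>)) = mono (\<lambda>i j. \<Sum>\<chi>\<in>S. k (Inl \<chi>) * e \<chi> i j) s"
        by (rule mono_scaled_sum[OF finS s, symmetric])
      also have "\<dots> = mono (\<lambda>i j. (if p = Some (i,j) then int N else 0) + - k (Inr i)) s"
        by (rule mono_cong) (rule kSome)
      also have "\<dots> = mono (\<lambda>i j. if p = Some (i,j) then int N else 0) s"
        unfolding mono_add[OF s] mono_const[OF s] by simp
      finally have one: "1 = z powi (if p = None then int N else 0) * mono (\<lambda>i j. if p = Some (i,j) then int N else 0) s"
        unfolding kNone .
      show ?thesis
      proof (cases p)
        case None
        then show ?thesis using one by (simp add: val_def mono_zero)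
      next
        case (Some ij)
        then obtain i0 j0 where ij: "p = Some (i0, j0)" "i0 \<in> I" "j0 < n i0" using p by (auto simp: E_def)
        have "mono (\<lambda>i j. if p = Some (i,j) then int N else 0) s = mono (\<lambda>i j. if i = i0 \<and> j = j0 then int N else 0) s"
          by (rule mono_cong) (auto simp: ij(1))
        then show ?thesis using one mono_single[OF ij(2,3), of "int N" s] by (simp add: val_def ij(1))
      qed
    qed
    then show ?thesis using N(1) by blast
  qed
  then have "\<forall>p\<in>E. \<exists>N>0. \<forall>s\<in>D. \<forall>z. z \<noteq> 0 \<longrightarrow> VV a (s, z) *\<^sub>v x = x \<longrightarrow> val p (s, z) ^ N = 1" by blast
  then obtain N where N: "\<And>p. p \<in> E \<Longrightarrow> N p > 0"
      "\<And>p s z. p \<in> E \<Longrightarrow> s \<in> D \<Longrightarrow> z \<noteq> 0 \<Longrightarrow> VV a (s, z) *\<^sub>v x = x \<Longrightarrow> val p (s, z) ^ N p = 1"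
    by metis
  define V where "V = {p \<in> D \<times> (-{0}). VV a p *\<^sub>v x = x}"
  define h where "h = (\<lambda>q. \<lambda>p\<in>E. val p q)"
  have "inj_on h V"
  proof (rule inj_onI)
    fix q q' assume q: "q \<in> V" "q' \<in> V" "h q = h q'"
    have eq: "val p q = val p q'" if "p \<in> E" for p using fun_cong[OF q(3), of p] that by (simp add: h_def)
    have "fst q = fst q'"
    proof (rule D_ext)
      show "fst q \<in> D" "fst q' \<in> D" using q by (auto simp: V_def)
      show "fst q i $$ (j,j) = fst q' i $$ (j,j)" if "i \<in> I" "j < n i" for i j
        using eq[of "Some (i,j)"] that by (simp add: E_def val_def case_prod_beta)
    qed
    moreover have "snd q = snd q'" using eq[of None] by (simp add: E_def val_def case_prod_beta)
    ultimately show "q = q'" by (rule prod_eqI)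
  qed
  moreover have "h ` V \<subseteq> (\<Pi>\<^sub>E p\<in>E. {r. r ^ N p = 1})"
  proof
    fix f assume "f \<in> h ` V"
    then obtain s z where q: "s \<in> D" "z \<noteq> 0" "VV a (s, z) *\<^sub>v x = x" "f = h (s, z)" by (auto simp: V_def)
    show "f \<in> (\<Pi>\<^sub>E p\<in>E. {r. r ^ N p = 1})"
      unfolding q(4) h_def using N(2)[OF _ q(1-3)] by (auto simp: PiE_iff)
  qed
  moreover have "finite (\<Pi>\<^sub>E p\<in>E. {r::complex. r ^ N p = 1})"
    by (rule finite_PiE[OF finE]) (rule finite_nth_roots[OF N(1)])
  ultimately have "finite V" by (meson finite_imageD finite_subset)
  then show ?thesis by (simp add: V_def)
qed

section \<open>Weyl-genericity\<close>

text \<open>Instead of replacing \<open>D\<close> by a conjugate torus, the representation is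
  twisted by the conjugation and the torus stays diagonal.\<close>

lemma conjugate_rep:
  assumes g: "g \<in> carrier H"
  shows "sl_rep I n d (\<lambda>h. X (cj g h))"
  by (intro sl_rep.intro sl_product_axioms sl_rep_axioms.intro alg_hom_comp[OF cj_alg_hom[OF g] X])

lemma cj_inv:
  assumes g: "g \<in> carrier H" and h: "h \<in> carrier H"
  shows "cj g (inv\<^bsub>H\<^esub> h) = inv\<^bsub>H\<^esub> (cj g h)"
proof -
  interpret group_hom H H "cj g"
    using cj_alg_hom[OF g] by (intro group_hom.intro group_hom_axioms.intro group_H) (simp add: alg_hom_def)
  show ?thesis by (rule hom_inv[OF h])
qed

lemma conjugate_VV:
  assumes g: "g \<in> carrier H" and x: "x \<in> carrier G"
  shows "sl_rep.VV I n d (\<lambda>h. X (cj g h)) a x = VV a (cj g (fst x), snd x)"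
proof -
  interpret C: sl_rep I n d "\<lambda>h. X (cj g h)" by (rule conjugate_rep[OF g])
  have "C.Xd (fst x) = Xd (cj g (fst x))"
    unfolding C.Xd_def Xd_def dual_rep_def using cj_inv[OF g, of "fst x"] x by (cases x) simp
  then show ?thesis unfolding C.VV_eq VV_eq by simp
qed

text \<open>\<open>X (inv g)\<close> carries weight vectors of the twisted representation to weight
  vectors of \<open>X\<close> with the same exponents. This inclusion suffices because nondegeneracy
  forbids certain combinations and so passes to smaller configurations of the same rank.\<close>

lemma conjugate_nondegenerate:
  assumes g: "g \<in> carrier H" and d: "0 < d" and nd: "nondegenerate_configuration I n weight_exponents"
  shows "nondegenerate_configuration I n (sl_rep.weight_exponents I n d (\<lambda>h. X (cj g h)))"
proof -
  interpret C: sl_rep I n d "\<lambda>h. X (cj g h)" by (rule conjugate_rep[OF g])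
  interpret H: group H by (rule group_H)
  interpret N: nondegenerate_configuration I n weight_exponents by (rule nd)
  interpret W: weight_configuration I n C.weight_exponents by (rule C.weight_configuration_weights[OF d])
  have sub: "C.weight_exponents \<subseteq> weight_exponents"
  proof
    fix x assume "x \<in> C.weight_exponents"
    then obtain v where v: "v \<in> carrier_vec d" "v \<noteq> 0\<^sub>v d" "\<And>h. h \<in> D \<Longrightarrow> X (cj g h) *\<^sub>v v = mono x h \<cdot>\<^sub>v v"
      unfolding C.weight_exponents_def by blast
    have gi: "inv\<^bsub>H\<^esub> g \<in> carrier H" using g by simp
    have "X h *\<^sub>v (X (inv\<^bsub>H\<^esub> g) *\<^sub>v v) = mono x h \<cdot>\<^sub>v (X (inv\<^bsub>H\<^esub> g) *\<^sub>v v)" if h: "h \<in> D" for h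
    proof -
      have hH: "h \<in> carrier H" "cj g h \<in> carrier H" using h D_subset cj_inverse(1)[OF g] by auto
      have "inv\<^bsub>H\<^esub> g \<otimes>\<^bsub>H\<^esub> cj g h = h \<otimes>\<^bsub>H\<^esub> inv\<^bsub>H\<^esub> g"
        unfolding cj_def using g hH by (simp add: H.m_assoc[symmetric])
      then have "X h *\<^sub>v (X (inv\<^bsub>H\<^esub> g) *\<^sub>v v) = X (inv\<^bsub>H\<^esub> g) *\<^sub>v (X (cj g h) *\<^sub>v v)"
        using X_mult_vec[OF hH(1) gi v(1)] X_mult_vec[OF gi hH(2) v(1)] by simp
      also have "\<dots> = mono x h \<cdot>\<^sub>v (X (inv\<^bsub>H\<^esub> g) *\<^sub>v v)"
        unfolding v(3)[OF h] by (rule mult_mat_vec[OF X_carrier[OF gi] v(1)])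
      finally show ?thesis .
    qed
    moreover have "X (inv\<^bsub>H\<^esub> g) *\<^sub>v v \<in> carrier_vec d" using X_carrier[OF gi] v(1) by simp
    moreover have "X (inv\<^bsub>H\<^esub> g) *\<^sub>v v \<noteq> 0\<^sub>v d" using X_injective[OF gi v(1)] v(2) by blast
    ultimately show "x \<in> weight_exponents" unfolding weight_exponents_def by blast
  qed
  show ?thesis
  proof (intro nondegenerate_configuration.intro W.weight_configuration_axioms nondegenerate_configuration_axioms.intro)
    fix Q x and c :: "nat \<Rightarrow> rat"
    assume "Q \<le> W.rank" "\<forall>q<Q. x q \<in> C.weight_exponents \<and> 0 \<le> c q" "(\<Sum>q<Q. c q) = 1"
      "\<forall>i\<in>I. \<exists>\<kappa>. \<forall>j<n i. (\<Sum>q<Q. c q * of_int (x q i j)) = \<kappa>"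
    then show False using N.nondegenerate[of Q x c] sub by (auto simp: W.rank_def N.rank_def)
  qed
qed

theorem weyl_generic_VV:
  assumes a: "a \<noteq> 0" and d: "0 < d" and nd: "nondegenerate_configuration I n weight_exponents"
    and g: "g \<in> carrier H" and T: "T = (\<lambda>x. (cj g (fst x), snd x)) ` (D \<times> (-{0}))" and sT: "subgroup T G"
  shows "weyl_generic G T (d + d) (VV a)"
proof -
  interpret C: sl_rep I n d "\<lambda>h. X (cj g h)" by (rule conjugate_rep[OF g])
  interpret H: group H by (rule group_H)
  interpret G: group G by (rule group_G)
  define \<tau> where "\<tau> = (\<lambda>x :: ('i \<Rightarrow> complex mat) \<times> complex. (cj g (fst x), snd x))"
  define K where "K = G\<lparr>carrier := T\<rparr>"
  have K [simp]: "carrier K = T" "regular K = regular G" by (simp_all add: K_def)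
  have TG: "T \<subseteq> carrier G" using sT by (rule subgroup.subset)
  have D0G: "D \<times> (-{0}) \<subseteq> carrier G" using D_subset by auto
  have \<tau>T: "\<tau> p \<in> T" if "p \<in> D \<times> (-{0})" for p unfolding T \<tau>_def using that by (rule imageI)
  have \<tau>VV: "C.VV a p = VV a (\<tau> p)" if "p \<in> D \<times> (-{0})" for p
    using conjugate_VV[OF g, of p a] that D0G unfolding \<tau>_def by blast
  have \<tau>_hom: "\<tau> \<in> alg_hom G G"
    using alg_hom_pair[OF alg_hom_comp[OF fst_alg_hom cj_alg_hom[OF g]] snd_alg_hom, of Gm] G_simps(4)
    unfolding \<tau>_def G_def by simp
  have grK: "group K" unfolding K_def by (rule subgroup.subgroup_is_group[OF sT group_G])
  have fa: "function_algebra (regular K)" by simp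
  interpret L: char_localization "char_group K"
    by (rule char_localization.intro[OF comm_group_char_group[OF grK fa]])
  define \<chi>0 where "\<chi>0 = (\<lambda>x\<in>T. snd x powi a)"
  have snd_nz: "snd x \<noteq> 0" if "x \<in> T" for x using TG that by auto
  have \<chi>0: "\<chi>0 \<in> carrier (char_group K)"
    unfolding carrier_char_group[OF fa]
  proof (intro conjI)
    have reg: "(\<lambda>x. snd x powi m) \<in> regular_on (regular K) (carrier K)" for m
    proof -
      have "(\<lambda>x. snd x powi m) \<in> regular_on (regular G) (carrier G)"
        unfolding G_def by (rule alg_hom_regular[OF snd_alg_hom Gm_powi_regular])
      then show ?thesis using regular_on_subset TG by (metis K)
    qed
    show "\<chi>0 \<in> extensional (carrier K)" by (simp add: \<chi>0_def)
    show "\<chi>0 \<in> hom K Gm"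
    proof (rule homI)
      fix x y assume xy: "x \<in> carrier K" "y \<in> carrier K"
      have "x \<otimes>\<^bsub>G\<^esub> y \<in> T" using subgroup.m_closed[OF sT] xy by simp
      moreover have "x \<otimes>\<^bsub>K\<^esub> y = x \<otimes>\<^bsub>G\<^esub> y" by (simp add: K_def)
      ultimately show "\<chi>0 (x \<otimes>\<^bsub>K\<^esub> y) = \<chi>0 x \<otimes>\<^bsub>Gm\<^esub> \<chi>0 y"
        using xy by (simp add: \<chi>0_def power_int_mult_distrib)
    qed (use snd_nz in \<open>auto simp: \<chi>0_def\<close>)
    show "\<chi>0 \<in> regular_on (regular K) (carrier K)"
      by (rule regular_on_cong[OF reg[of a]]) (simp add: \<chi>0_def)
    show "(\<lambda>x. inverse (\<chi>0 x)) \<in> regular_on (regular K) (carrier K)"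
      by (rule regular_on_cong[OF reg[of "- a"]]) (simp add: \<chi>0_def power_int_minus)
  qed
  define \<theta> where "\<theta> = rat_embed (char_group K) \<chi>0"
  have \<theta>_carrier: "\<theta> \<in> carrier (rat_chars K)"
    unfolding \<theta>_def rat_embed_def rat_chars_def by (rule L.frac_closed[OF \<chi>0]) simp
  \<comment> \<open>Invariance under the Weyl group is a statement about the whole set of
    representatives, so membership in the class is made explicit.\<close>
  have \<theta>_iff: "(\<chi>, m) \<in> \<theta> \<longleftrightarrow> \<chi> \<in> carrier (char_group K) \<and> 0 < m \<and>
      (\<exists>k>0. \<forall>t\<in>T. (snd t powi a) ^ (k * m) = \<chi> t ^ k)" for \<chi> m
  proof -
    have "\<chi>0 [^]\<^bsub>char_group K\<^esub> (k * m) = \<chi> [^]\<^bsub>char_group K\<^esub> (k * 1) \<longleftrightarrow> (\<forall>t\<in>T. (snd t powi a) ^ (k * m) = \<chi> t ^ k)"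
      if \<chi>: "\<chi> \<in> carrier (char_group K)" for k
    proof -
      have pw: "(\<psi> [^]\<^bsub>char_group K\<^esub> q) t = \<psi> t ^ q" if "t \<in> T" for \<psi> t and q :: nat
        by (rule char_group_pow) (use that in simp)
      have ext: "\<psi> [^]\<^bsub>char_group K\<^esub> q \<in> extensional T" if "\<psi> \<in> carrier (char_group K)" for \<psi> and q :: nat
        using L.nat_pow_closed[OF that, of q] carrier_char_group[OF fa] by simp
      have "\<chi>0 [^]\<^bsub>char_group K\<^esub> (k * m) = \<chi> [^]\<^bsub>char_group K\<^esub> (k * 1) \<longleftrightarrow>
          (\<forall>t\<in>T. (\<chi>0 [^]\<^bsub>char_group K\<^esub> (k * m)) t = (\<chi> [^]\<^bsub>char_group K\<^esub> (k * 1)) t)"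
        using extensionalityI[OF ext[OF \<chi>0] ext[OF \<chi>]] by metis
      also have "\<dots> \<longleftrightarrow> (\<forall>t\<in>T. (snd t powi a) ^ (k * m) = \<chi> t ^ k)"
        by (intro ball_cong refl) (simp add: pw \<chi>0_def)
      finally show ?thesis .
    qed
    then show ?thesis unfolding \<theta>_def rat_embed_def L.in_frac using \<chi>0 by auto
  qed

  \<comment> \<open>Undoing the conjugation gives a one-parameter subgroup of \<open>D\<close> in
    the first component; the second component is an endomorphism of \<open>Gm\<close>.\<close>
  have one_ps: "\<exists>u k. (\<forall>i\<in>I. (\<Sum>j<n i. u i j) = 0) \<and> (\<forall>t. t \<noteq> 0 \<longrightarrow> \<gamma> t = \<tau> (psub u k t))"
    if \<gamma>: "\<gamma> \<in> alg_hom Gm K" for \<gamma>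
  proof -
    have \<gamma>G: "\<gamma> \<in> alg_hom Gm G" using \<gamma> TG unfolding K_def by (rule alg_hom_widen_codomain)
    have \<gamma>T: "\<gamma> t \<in> T" if "t \<noteq> 0" for t using alg_hom_carrier[OF \<gamma>, of t] that by simp
    have gi: "inv\<^bsub>H\<^esub> g \<in> carrier H" using g by simp
    have bk: "cj (inv\<^bsub>H\<^esub> g) (fst p) \<in> D \<and> cj g (cj (inv\<^bsub>H\<^esub> g) (fst p)) = fst p" if pT: "p \<in> T" for p
    proof -
      obtain q where q: "q \<in> D \<times> (-{0})" "p = (cj g (fst q), snd q)" using pT unfolding T by blast
      then have "fst q \<in> carrier H" "fst q \<in> D" using D_subset by auto
      then show ?thesis using cj_inverse(2)[OF g, of "fst q"] by (simp add: q(2))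
    qed
    have "(\<lambda>t. cj (inv\<^bsub>H\<^esub> g) (fst (\<gamma> t))) \<in> alg_hom Gm (H\<lparr>carrier := D\<rparr>)"
      by (rule alg_hom_restrict_codomain)
        (use alg_hom_comp[OF alg_hom_comp[OF \<gamma>G[unfolded G_def] fst_alg_hom] cj_alg_hom[OF gi]] bk \<gamma>T in auto)
    then obtain u where u: "\<forall>i\<in>I. (\<Sum>j<n i. u i j) = 0"
        "\<And>t. t \<noteq> 0 \<Longrightarrow> cj (inv\<^bsub>H\<^esub> g) (fst (\<gamma> t)) = diag (\<lambda>i j. t powi u i j)"
      using one_parameter_subgroup_D by blast
    obtain k where k: "\<And>t. t \<noteq> 0 \<Longrightarrow> snd (\<gamma> t) = t powi k"
      using Gm_endomorphism[OF alg_hom_comp[OF \<gamma>G[unfolded G_def] snd_alg_hom]] by blast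
    have "\<gamma> t = \<tau> (psub u k t)" if t: "t \<noteq> 0" for t
    proof (rule prod_eqI)
      show "fst (\<gamma> t) = fst (\<tau> (psub u k t))"
        unfolding \<tau>_def psub_def fst_conv u(2)[OF t, symmetric] using bk[OF \<gamma>T[OF t]] by simp
      show "snd (\<gamma> t) = snd (\<tau> (psub u k t))" using k[OF t] by (simp add: \<tau>_def psub_def)
    qed
    then show ?thesis using u(1) by blast
  qed
  have ps_hom: "(\<lambda>t. \<tau> (psub u k t)) \<in> alg_hom Gm K" if u: "\<forall>i\<in>I. (\<Sum>j<n i. u i j) = 0" for u k
    unfolding K_def
    by (rule alg_hom_restrict_codomain[OF alg_hom_comp[OF psub_alg_hom[OF u] \<tau>_hom]])
      (use \<tau>T psub_in(2)[OF u] in simp)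
  \<comment> \<open>The pairing is a definite description that refers to all representatives of
    \<open>\<theta>\<close>. It is evaluated at each of them, and the representative
    \<open>(\<chi>0, 1)\<close> gives uniqueness.\<close>
  have pairing: "rat_pairing \<theta> \<gamma> = of_int (a * k)"
    if \<gamma>: "\<gamma> \<in> alg_hom Gm K" and \<gamma>k: "\<And>t. t \<noteq> 0 \<Longrightarrow> snd (\<gamma> t) = t powi k" for \<gamma> k
  proof -
    have \<gamma>T: "\<gamma> t \<in> T" if "t \<noteq> 0" for t using alg_hom_carrier[OF \<gamma>, of t] that by simp
    have val: "of_int (a * k) = (of_int (char_pairing \<chi> \<gamma>) / of_nat m :: rat)" if \<chi>m: "(\<chi>, m) \<in> \<theta>" for \<chi> m
    proof -
      obtain q where q: "\<chi> \<in> carrier (char_group K)" "0 < m" "q > 0" "\<forall>t\<in>T. (snd t powi a) ^ (q * m) = \<chi> t ^ q"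
        using \<chi>m unfolding \<theta>_iff by blast
      have "\<chi> \<in> alg_hom K Gm" using q(1) by (simp add: char_group_def)
      from Gm_endomorphism[OF alg_hom_comp[OF \<gamma> this]]
      obtain c where c: "\<And>t. t \<noteq> 0 \<Longrightarrow> \<chi> (\<gamma> t) = t powi c" by blast
      have "char_pairing \<chi> \<gamma> = c"
        unfolding char_pairing_def
      proof (rule the_equality)
        show "\<forall>t. t \<noteq> 0 \<longrightarrow> \<chi> (\<gamma> t) = t powi c" using c by blast
        show "c' = c" if "\<forall>t. t \<noteq> 0 \<longrightarrow> \<chi> (\<gamma> t) = t powi c'" for c' by (rule powi_eqD) (use that c in metis)
      qed
      moreover have "a * k * int (q * m) = c * int q"
      proof (rule powi_eqD)
        fix t :: complex assume t: "t \<noteq> 0"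
        have "(snd (\<gamma> t) powi a) ^ (q * m) = \<chi> (\<gamma> t) ^ q" using q(4) \<gamma>T[OF t] by blast
        then have "((t powi k) powi a) powi int (q * m) = (t powi c) powi int q"
          unfolding \<gamma>k[OF t] c[OF t] power_int_of_nat .
        then show "t powi (a * k * int (q * m)) = t powi (c * int q)"
          by (metis power_int_mult mult.commute)
      qed
      then have "a * k * int m = c" using q(3) by (simp add: mult_ac)
      ultimately have "of_int (char_pairing \<chi> \<gamma>) = (of_int (a * k) * of_nat m :: rat)" by (metis of_int_mult of_int_of_nat_eq)
      then show ?thesis using q(2) by simp
    qed
    have self: "(\<chi>0, 1) \<in> \<theta>" unfolding \<theta>_def rat_embed_def by (rule L.frac_self[OF \<chi>0]) simp
    show ?thesis unfolding rat_pairing_def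
    proof (rule the_equality)
      show "\<forall>(\<chi>, m)\<in>\<theta>. (of_int (a * k) :: rat) = of_int (char_pairing \<chi> \<gamma>) / of_nat m" using val by blast
      fix q assume "\<forall>(\<chi>, m)\<in>\<theta>. q = of_int (char_pairing \<chi> \<gamma>) / (of_nat m :: rat)"
      then have "q = of_int (char_pairing \<chi>0 \<gamma>) / of_nat 1" using self by blast
      then show "q = of_int (a * k)" using val[OF self] by simp
    qed
  qed
  have pairing': "rat_pairing \<theta> \<gamma> = of_int (a * k)"
    if "\<gamma> \<in> alg_hom Gm K" "\<forall>t. t \<noteq> 0 \<longrightarrow> \<gamma> t = \<tau> (psub u k t)" for \<gamma> u k
    by (rule pairing[OF that(1)]) (use that(2) in \<open>simp add: \<tau>_def psub_def\<close>)

  have "semistable K (d + d) (VV a) \<theta> \<noteq> {}"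
  proof -
    obtain x where x: "x \<in> carrier_vec (d + d)" "\<And>u k l. \<forall>i\<in>I. (\<Sum>j<n i. u i j) = 0 \<Longrightarrow>
        \<forall>q<d+d. ((\<lambda>t. (C.VV a (psub u k t) *\<^sub>v x) $ q) \<longlongrightarrow> l q) (at 0) \<Longrightarrow> 0 \<le> a * k"
      using C.semistable_vector_exists[OF d, of a] by blast
    have "0 \<le> rat_pairing \<theta> \<gamma>" if \<gamma>: "\<gamma> \<in> alg_hom Gm K"
      and lim: "\<exists>l. \<forall>q<d+d. ((\<lambda>t. (VV a (\<gamma> t) *\<^sub>v x) $ q) \<longlongrightarrow> l q) (at 0)" for \<gamma>
    proof -
      obtain u k where uk: "\<forall>i\<in>I. (\<Sum>j<n i. u i j) = 0" "\<forall>t. t \<noteq> 0 \<longrightarrow> \<gamma> t = \<tau> (psub u k t)"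
        using one_ps[OF \<gamma>] by blast
      obtain l where l: "\<And>q. q < d + d \<Longrightarrow> ((\<lambda>t. (VV a (\<gamma> t) *\<^sub>v x) $ q) \<longlongrightarrow> l q) (at 0)" using lim by blast
      have "((\<lambda>t. (C.VV a (psub u k t) *\<^sub>v x) $ q) \<longlongrightarrow> l q) (at 0)" if q: "q < d + d" for q
      proof (rule Lim_transform_eventually[OF l[OF q]])
        have "(VV a (\<gamma> t) *\<^sub>v x) $ q = (C.VV a (psub u k t) *\<^sub>v x) $ q" if "t \<noteq> 0" for t
          unfolding \<tau>VV[OF psub_in(2)[OF uk(1) that]] using uk(2) that by simp
        then show "\<forall>\<^sub>F t in at 0. (VV a (\<gamma> t) *\<^sub>v x) $ q = (C.VV a (psub u k t) *\<^sub>v x) $ q"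
          by (rule eventually_mono[OF eventually_neq_at_within])
      qed
      then have "0 \<le> a * k" using x(2)[OF uk(1)] by blast
      then show ?thesis unfolding pairing'[OF \<gamma> uk(2)] by (simp only: of_int_0_le_iff)
    qed
    then have "x \<in> semistable K (d + d) (VV a) \<theta>" unfolding semistable_def using x(1) by blast
    then show ?thesis by blast
  qed
  then have ss: "\<theta> \<in> semistable_chars K (d + d) (VV a)" unfolding semistable_chars_def using \<theta>_carrier by blast

  \<comment> \<open>Conjugation leaves the component in \<open>Gm\<close> unchanged, and
    \<open>\<chi>0\<close> depends on nothing else. One inclusion uses conjugation by
    \<open>h\<close>, the other conjugation by its inverse.\<close>
  have weyl: "weyl_invariant G T \<theta>"
    unfolding weyl_invariant_def
  proof
    fix h assume "h \<in> normalizer G T"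
    then have h: "h \<in> carrier G" "h <#\<^bsub>G\<^esub> T #>\<^bsub>G\<^esub> inv\<^bsub>G\<^esub> h = T"
      using TG unfolding normalizer_def stabilizer_def by auto
    have hT: "h \<otimes>\<^bsub>G\<^esub> t \<otimes>\<^bsub>G\<^esub> inv\<^bsub>G\<^esub> h \<in> T" if "t \<in> T" for t
    proof -
      have "h \<otimes>\<^bsub>G\<^esub> t \<otimes>\<^bsub>G\<^esub> inv\<^bsub>G\<^esub> h \<in> h <#\<^bsub>G\<^esub> T #>\<^bsub>G\<^esub> inv\<^bsub>G\<^esub> h"
        unfolding l_coset_def r_coset_def using that by blast
      then show ?thesis unfolding h(2) .
    qed
    have hT': "inv\<^bsub>G\<^esub> h \<otimes>\<^bsub>G\<^esub> t \<otimes>\<^bsub>G\<^esub> inv\<^bsub>G\<^esub> (inv\<^bsub>G\<^esub> h) \<in> T" if "t \<in> T" for t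
    proof -
      have "t \<in> h <#\<^bsub>G\<^esub> T #>\<^bsub>G\<^esub> inv\<^bsub>G\<^esub> h" using that h(2) by simp
      then obtain s where s: "s \<in> T" "t = h \<otimes>\<^bsub>G\<^esub> s \<otimes>\<^bsub>G\<^esub> inv\<^bsub>G\<^esub> h" unfolding l_coset_def r_coset_def by blast
      have "s \<in> carrier G" using s(1) TG by blast
      then have "inv\<^bsub>G\<^esub> h \<otimes>\<^bsub>G\<^esub> t \<otimes>\<^bsub>G\<^esub> inv\<^bsub>G\<^esub> (inv\<^bsub>G\<^esub> h) = s"
        unfolding s(2) using h(1)
        by (metis G.inv_closed G.inv_inv G.inv_solve_left' G.inv_solve_right' G.m_assoc G.m_closed)
      then show ?thesis using s(1) by simp
    qed
    have conj_mem: "(conj_char G T k \<chi>, m) \<in> \<theta>"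
      if k: "k \<in> carrier G" and kT: "\<And>t. t \<in> T \<Longrightarrow> inv\<^bsub>G\<^esub> k \<otimes>\<^bsub>G\<^esub> t \<otimes>\<^bsub>G\<^esub> inv\<^bsub>G\<^esub> (inv\<^bsub>G\<^esub> k) \<in> T" and \<chi>m: "(\<chi>, m) \<in> \<theta>"
      for k \<chi> m
    proof -
      have \<chi>: "\<chi> \<in> carrier (char_group K)" and m: "0 < m" using \<chi>m unfolding \<theta>_iff by auto
      obtain q where q: "q > 0" "\<And>t. t \<in> T \<Longrightarrow> (snd t powi a) ^ (q * m) = \<chi> t ^ q" using \<chi>m unfolding \<theta>_iff by blast
      have ki: "inv\<^bsub>G\<^esub> k \<in> carrier G" using k by (rule G.inv_closed)
      let ?c = "\<lambda>t. inv\<^bsub>G\<^esub> k \<otimes>\<^bsub>G\<^esub> t \<otimes>\<^bsub>G\<^esub> inv\<^bsub>G\<^esub> (inv\<^bsub>G\<^esub> k)"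
      have cc: "conj_char G T k \<chi> = (\<lambda>t\<in>T. \<chi> (?c t))"
        unfolding conj_char_def G.inv_inv[OF k] ..
      have "?c \<in> alg_hom K K"
        unfolding K_def
        by (rule alg_hom_restrict_codomain[OF alg_hom_restrict_domain[OF G_conj_alg_hom[OF ki] TG]]) (use kT in simp)
      moreover have "\<chi> \<in> alg_hom K Gm" using \<chi> by (simp add: char_group_def)
      ultimately have "(\<lambda>t. \<chi> (?c t)) \<in> alg_hom K Gm" by (rule alg_hom_comp)
      then have "conj_char G T k \<chi> \<in> alg_hom K Gm"
        unfolding cc by (rule alg_hom_cong[OF _ group.is_monoid[OF grK]]) simp
      then have "conj_char G T k \<chi> \<in> carrier (char_group K)" by (simp add: char_group_def cc)
      moreover have "(snd t powi a) ^ (q * m) = conj_char G T k \<chi> t ^ q" if t: "t \<in> T" for t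
      proof -
        have tG: "t \<in> carrier G" using t TG by blast
        have "snd (?c t) = snd t" unfolding G_conj[OF ki tG] by simp
        moreover have "conj_char G T k \<chi> t = \<chi> (?c t)" unfolding cc restrict_apply'[OF t] ..
        ultimately show ?thesis using q(2)[OF kT[OF t]] by (simp only:)
      qed
      ultimately show ?thesis unfolding \<theta>_iff using m q(1) by blast
    qed
    show "(\<lambda>(\<chi>, m). (conj_char G T h \<chi>, m)) ` \<theta> = \<theta>"
    proof (intro equalityI subsetI)
      fix p assume "p \<in> (\<lambda>(\<chi>, m). (conj_char G T h \<chi>, m)) ` \<theta>"
      then show "p \<in> \<theta>" using conj_mem[OF h(1) hT'] by auto
    next
      fix p assume p: "p \<in> \<theta>"
      obtain \<chi> m where pm: "p = (\<chi>, m)" by (cases p)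
      have hi: "inv\<^bsub>G\<^esub> h \<in> carrier G" using h(1) by (rule G.inv_closed)
      have mem: "(conj_char G T (inv\<^bsub>G\<^esub> h) \<chi>, m) \<in> \<theta>"
        by (rule conj_mem[OF hi]) (use hT h(1) p pm in auto)
      have "conj_char G T h (conj_char G T (inv\<^bsub>G\<^esub> h) \<chi>) = \<chi>"
      proof (rule extensionalityI[of _ T])
        show "conj_char G T h (conj_char G T (inv\<^bsub>G\<^esub> h) \<chi>) \<in> extensional T" by (simp add: conj_char_def)
        show "\<chi> \<in> extensional T" using p pm carrier_char_group[OF fa] unfolding \<theta>_iff pm by simp
        fix t assume t: "t \<in> T"
        have tG: "t \<in> carrier G" using t TG by blast
        have cT: "inv\<^bsub>G\<^esub> h \<otimes>\<^bsub>G\<^esub> t \<otimes>\<^bsub>G\<^esub> h \<in> T" using hT'[OF t] unfolding G.inv_inv[OF h(1)] .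
        have hh: "h \<otimes>\<^bsub>G\<^esub> (inv\<^bsub>G\<^esub> h \<otimes>\<^bsub>G\<^esub> t) = t"
          by (metis G.m_assoc G.r_inv G.l_one h(1) hi tG)
        have eq: "h \<otimes>\<^bsub>G\<^esub> (inv\<^bsub>G\<^esub> h \<otimes>\<^bsub>G\<^esub> t \<otimes>\<^bsub>G\<^esub> h) \<otimes>\<^bsub>G\<^esub> inv\<^bsub>G\<^esub> h = t"
          by (simp only: G.m_assoc G.m_closed G.r_inv G.r_one h(1) hi tG hh)
        show "conj_char G T h (conj_char G T (inv\<^bsub>G\<^esub> h) \<chi>) t = \<chi> t"
          unfolding conj_char_def G.inv_inv[OF h(1)] restrict_apply'[OF t] restrict_apply'[OF cT] eq ..
      qed
      then show "p \<in> (\<lambda>(\<chi>, m). (conj_char G T h \<chi>, m)) ` \<theta>"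
        unfolding pm using mem by (intro rev_image_eqI[OF mem]) simp
    qed
  qed

  have "\<theta> \<notin> nongeneric_chars K (d + d) (VV a)"
  proof
    assume "\<theta> \<in> nongeneric_chars K (d + d) (VV a)"
    then obtain x where x: "x \<in> semistable K (d + d) (VV a) \<theta>" "0 < alg_dim K (rep_stabilizer K (VV a) x)"
      unfolding nongeneric_chars_def by blast
    have xc: "x \<in> carrier_vec (d + d)" using x(1) by (simp add: semistable_def)
    have "finite {p \<in> D \<times> (-{0}). C.VV a p *\<^sub>v x = x}"
    proof (rule C.finite_stabilizer[OF a conjugate_nondegenerate[OF g d nd] xc])
      \<comment> \<open>A one-parameter subgroup fixing \<open>x\<close> has the limit
        \<open>x\<close>, so semistability makes its pairing with \<open>\<theta>\<close>
        nonnegative.\<close>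
      fix u k assume u: "\<forall>i\<in>I. (\<Sum>j<n i. u i j) = 0" and fx: "\<forall>t. t \<noteq> 0 \<longrightarrow> C.VV a (psub u k t) *\<^sub>v x = x"
      let ?\<gamma> = "\<lambda>t. \<tau> (psub u k t)"
      have "((\<lambda>t. (VV a (?\<gamma> t) *\<^sub>v x) $ q) \<longlongrightarrow> x $ q) (at 0)" for q
      proof (rule tendsto_eventually)
        have "(VV a (?\<gamma> t) *\<^sub>v x) $ q = x $ q" if "t \<noteq> 0" for t
          unfolding \<tau>VV[OF psub_in(2)[OF u that], symmetric] using fx that by simp
        then show "\<forall>\<^sub>F t in at 0. (VV a (?\<gamma> t) *\<^sub>v x) $ q = x $ q"
          by (rule eventually_mono[OF eventually_neq_at_within])
      qed
      then have ex: "\<exists>l. \<forall>q<d+d. ((\<lambda>t. (VV a (?\<gamma> t) *\<^sub>v x) $ q) \<longlongrightarrow> l q) (at 0)"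
        by (intro exI[of _ "\<lambda>q. x $ q"]) blast
      have pos: "\<forall>\<gamma>\<in>alg_hom Gm K. (\<exists>l. \<forall>q<d+d. ((\<lambda>t. (VV a (\<gamma> t) *\<^sub>v x) $ q) \<longlongrightarrow> l q) (at 0)) \<longrightarrow>
          0 \<le> rat_pairing \<theta> \<gamma>"
        using x(1) unfolding semistable_def by blast
      have "0 \<le> rat_pairing \<theta> ?\<gamma>" by (rule mp[OF bspec[OF pos ps_hom[OF u, of k]] ex])
      moreover have "rat_pairing \<theta> ?\<gamma> = of_int (a * k)"
        by (rule pairing'[where u = u and k = k]) (use ps_hom[OF u] in auto)
      ultimately show "0 \<le> a * k" by (simp only: of_int_0_le_iff)
    qed
    moreover have "rep_stabilizer K (VV a) x \<subseteq> \<tau> ` {p \<in> D \<times> (-{0}). C.VV a p *\<^sub>v x = x}"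
    proof
      fix t assume "t \<in> rep_stabilizer K (VV a) x"
      then have t: "t \<in> T" "VV a t *\<^sub>v x = x" by (auto simp: rep_stabilizer_def)
      then obtain p where p: "p \<in> D \<times> (-{0})" "t = \<tau> p" unfolding T \<tau>_def by blast
      then show "t \<in> \<tau> ` {p \<in> D \<times> (-{0}). C.VV a p *\<^sub>v x = x}" using t(2) \<tau>VV[OF p(1)] by auto
    qed
    ultimately have "finite (rep_stabilizer K (VV a) x)" by (meson finite_imageI finite_subset)
    then have "alg_dim K (rep_stabilizer K (VV a) x) = 0"
    proof (rule alg_dim_finite[OF fa])
      fix p q assume "p \<in> carrier K" "q \<in> carrier K" "p \<noteq> q"
      then show "\<exists>\<phi>\<in>regular K. \<phi> p \<noteq> \<phi> q"
        unfolding K by (intro G_separates_points subsetD[OF TG])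
    qed
    then show False using x(2) by simp
  qed
  then show ?thesis using ss weyl unfolding weyl_generic_def K_def by blast
qed

end

theorem proposition1p3p3:
  fixes M d :: nat and n :: "nat \<Rightarrow> nat" and a :: int
    and H :: "(nat \<Rightarrow> complex mat) alg_group"
    and X :: "(nat \<Rightarrow> complex mat) \<Rightarrow> complex mat"
    and V :: "(nat \<Rightarrow> complex mat) \<times> complex \<Rightarrow> complex mat"
    and T\<^sub>H :: "(nat \<Rightarrow> complex mat) set"
    and T :: "((nat \<Rightarrow> complex mat) \<times> complex) set"
  assumes "\<And>i. i \<in> {1..M} \<Longrightarrow> 1 \<le> n i"
    and "H = alg_prod {1..M} (\<lambda>i. SL (n i))"
    and "rational_rep H d X"
    and "maximal_torus H T\<^sub>H" and "nondegenerate H T\<^sub>H d X"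
    and "a \<noteq> 0"
    and "V = sum_rep d (tensor_weight X a) d (tensor_weight (dual_rep H X) (- a))"
    and "maximal_torus (alg_dirprod H Gm) T"
  shows "self_dual_rep (alg_dirprod H Gm) (d + d) V \<and>
         weyl_generic (alg_dirprod H Gm) T (d + d) V"
proof -
  interpret P: sl_product "{1..M}" n by (rule sl_product.intro) (use assms(1) in auto)
  have H: "H = P.H" unfolding assms(2) P.H_def ..
  interpret R: sl_rep "{1..M}" n d X
    by (intro sl_rep.intro P.sl_product_axioms sl_rep_axioms.intro) (use assms(3) in \<open>simp add: H rational_rep_def\<close>)
  have V: "V = R.VV a" unfolding assms(7) R.VV_def H ..
  have G: "alg_dirprod H Gm = P.G" unfolding P.G_def H ..
  obtain g where g: "g \<in> carrier P.H" "T\<^sub>H = P.cj g ` P.D" using P.maximal_torus_H assms(4) unfolding H by blast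
  have nd: "nondegenerate_configuration {1..M} n R.weight_exponents"
    by (rule R.nondegenerate_weights[OF g(1)]) (use assms(5) in \<open>simp add: g(2) H\<close>)
  \<comment> \<open>\<open>T\<close> is not assumed to lie over \<open>T\<^sub>H\<close>, so it has
    a conjugating element of its own.\<close>
  obtain g' where g': "g' \<in> carrier P.H" "T = (\<lambda>x. (P.cj g' (fst x), snd x)) ` (P.D \<times> (-{0}))"
    using P.maximal_torus_G assms(8) unfolding G by blast
  have "subgroup T P.G" using assms(8) by (simp add: G maximal_torus_def subtorus_def)
  moreover have "0 < d" using assms(5) by (simp add: nondegenerate_def)
  ultimately have "weyl_generic P.G T (d + d) (R.VV a)"
    by (intro R.weyl_generic_VV[OF assms(6) _ nd g'])
  then show ?thesis unfolding G V using R.self_dual_VV by blast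
qed

end
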